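(* Let $\mathfrak P$ be a Laurent differentially essential and super essential system of sparse generic Laurent differential polynomials, let $l\in\{1,\dots,L\}$ with $D_l(\mathfrak P)\ne 0$, and let $\mathcal Q$ be the associated set of irreducible factors of $D_l(\mathfrak P)$. Suppose that there exists $Q\in\mathcal Q$ such that $(\mathcal S_{\tau^Q})\cap\mathbb Q[\mathcal C_{\tau^Q}]$ has codimension one. If $\Xi(Q)\neq 0$, then $\Xi(Q)=\mathfrak E\,\partial\mathrm{Res}(\mathfrak P)$ with $\mathfrak E\in\mathfrak D$.
   Context: Generic system. Let $n\ge2$, $U=\{u_1,\dots,u_{n-1}\}$ differential indeterminates with derivation $\partial$, $u_{j,k}=\partial^ku_j$, $u_{j,0}=u_j$, $0\in\mathbb N$. For each $i=1,\dots,n$ let $M_i,M_{i,1},\dots,M_{i,l_i}$ be distinct Laurent monomials in the $u_{j,k}$, let $A_i=\{\mathfrak a_i,\mathfrak a_{i,1},\dots,\mathfrak a_{i,l_i}\}$ be differential indeterminates over $\mathbb Q$, $A=\bigcup_iA_i$, $\mathfrak D=\mathbb Q\{A\}$, $\mathbb F_i=\mathfrak a_iM_i+\sum_{k=1}^{l_i}\mathfrak a_{i,k}M_{i,k}$ and $\mathfrak P=\{\mathbb F_1,\dots,\mathbb F_n\}\subset\mathfrak D\{U^{\pm}\}=\mathfrak D[u_{j,k}^{\pm1}: 1\le j\le n-1,k\in\mathbb N]$. Each $\mathbb F_i$ involves some $u_{j,k}$, and for each $j$ some $u_{j,k}$ occurs in some $\mathbb F_i$. $[\mathfrak P]$ is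 the differential ideal generated by $\mathfrak P$ in $\mathfrak D\{U^\pm\}$. Differential resultant. $\mathfrak P$ is Laurent differentially essential if for each $i$ there is $k_i\in\{1,\dots,l_i\}$ such that the set $\{M_{i,k_i}M_i^{-1}: 1\le i\le n\}$ has differential transcendence degree $n-1$ over $\mathbb Q$. Then $[\mathfrak P]\cap\mathfrak D$ is a prime differential ideal of codimension one equal to $\mathrm{sat}(R)$ for an irreducible $R=\partial\mathrm{Res}(\mathfrak P)\in\mathfrak D$, the sparse differential resultant; $\mathrm{sat}(R)$ is the set of differential polynomials in $\mathfrak D$ with zero differential remainder w.r.t. $R$ under any elimination ranking. Orders. $\mathfrak S_j(f)$ is the set of $k$ such that $u_{j,k}$ occurs in $f$; $o_{i,j}=\max\mathfrak S_j(\mathbb F_i)$ ($-\infty$ if empty). $J_i=\max_\mu\sum_{h\ne i}o_{h,\mu(h)}$ over bijections $\mu:\{1,\dots,n\}\setminus\{i\}\to\{1,\dots,n-1\}$. $\mathfrak P$ is super essential if $J_i\ge0$ for all $i$. $\gamma_j=\min\bigcup_i\mathfrak S_j(\mathbb F_i)$, $\gamma=\sum_j\gamma_j$, $M'_j=\max_i\{o_{i,j}+J_i\}-\gamma$. Put $\mathrm{ps}(\mathfrak P)=\{\partial^k\mathbb F_i: 1\le i\le n,\ 0\le k\le J_i-\gamma\}$, $L=\sum_i(J_i-\gamma+1)=|\mathrm{ps}(\mathfrak P)|$, $\mathcal V(\mathfrak P)=\{u_{j,k}:\gamma_j\le k\le M'_j\}$, of cardinality $L-1$. Algebraic generic system.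 Fix bijections $\lambda:\mathrm{ps}(\mathfrak P)\to\{1,\dots,L\}$, $\rho=\lambda^{-1}$, and $\upsilon:\mathcal Y=\{y_1,\dots,y_{L-1}\}\to\mathcal V(\mathfrak P)$ ($y_h$ algebraic indeterminates), extended to Laurent monomials. $\mathcal A(f)\subset\mathbb Z^{L-1}$ is the set of $\alpha$ such that $\upsilon(y^\alpha)$ has nonzero coefficient in $f$. With algebraic indeterminates $c^h_\alpha$ over $\mathbb Q$, put $P_h=\sum_{\alpha\in\mathcal A(\rho(h))}c^h_\alpha y^\alpha$, $\mathcal S=\mathrm{ags}(\mathfrak P)=\{P_1,\dots,P_L\}$, $\mathcal C_h=\{c_\alpha^h\}_\alpha$, $\mathcal C=\bigcup_h\mathcal C_h$. The specialization $\Xi:\mathbb Q[\mathcal C][\mathcal Y^\pm]\to\mathfrak D\{U^\pm\}$ is the ring homomorphism sending $c^h_\alpha$ to the coefficient of $\upsilon(y^\alpha)$ in $\rho(h)$ and $y_h$ to $\upsilon(y_h)$; so $\Xi(P_h)=\rho(h)$. Write $P_h=c_hT_h+\sum_sc_{h,s}T_{h,s}$ with Laurent monomials $T$, where it is assumed that the distinguished monomials are such that $\Xi(c_h)=\partial^k\mathfrak a_i$ when $\rho(h)=\partial^k\mathbb F_i$. Put $\epsilon_h=-\sum_sc_{h,s}T_{h,s}/T_h$ and $\epsilon=(\mathcal C\setminus\{c_1,\dots,c_L\};\epsilon_1,\dots,\epsilon_L)$; $G(\epsilon)$ denotes replacing each $c_h$ by $\epsilon_h$ in $G\in\mathbb Q[\mathcal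 C]$. Sylvester determinants (Canny–Emiris construction). Let $Q_h$ be the convex hull of $\mathcal A(\rho(h))$, $N=Q_1+\dots+Q_L$, and $\mathcal L$ the affine lattice generated by the Minkowski sum $\sum_h\mathcal A(\rho(h))$. Sufficiently generic linear liftings of $Q_1,\dots,Q_L$ define, by projecting the lower envelope of the Minkowski sum of the lifted polytopes, a mixed subdivision of $N$ whose maximal cells are written $F_1+\dots+F_L$, $F_h$ a face of $Q_h$, $\sum_h\dim F_h=\dim N$. Choose a small generic vector $\delta$ parallel to the affine span of $N$ with $\mathcal E=\mathcal L\cap(N+\delta)\ne\emptyset$. For $p\in\mathcal E$ let $F_1+\dots+F_L$ be the maximal cell with $p-\delta$ in its relative interior; let $h(p)$ be the largest index $h$ with $F_h=\{a(p)\}$ a vertex, for a total order of the indices in which $l$ is the smallest. $S_l(\mathfrak P)$ is the square matrix indexed by $\mathcal E\times\mathcal E$ whose row $p$ lists the coefficients of $y^{p-a(p)}P_{h(p)}$ in the monomials $y^q$, $q\in\mathcal E$; $D_l(\mathfrak P)=\det S_l(\mathfrak P)\in\mathbb Q[\mathcal C]$. $\mathcal Q$ is the set of irreducible factors $Q$ of $D_l(\mathfrak P)$ in $\mathbb Q[\mathcal C]$ with $Q(\epsilon)=0$. Subsystems. For $\tau\in(\mathbb N\cup\{-\infty\})^n$ with $\tau_i\le J_i-\gamma$, let $\mathrm{PS}(\tau)=\{\partial^k\mathbb F_i:0\le k\le\tau_i\}$ (no $k$ if $\tau_i=-\infty$), $\mathcal S_\tau=\{P_{\lambda(f)}:f\in\mathrm{PS}(\tau)\}$,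 $\mathcal C_\tau=\bigcup_{f\in\mathrm{PS}(\tau)}\mathcal C_{\lambda(f)}$, $\mathcal V(\tau)=\{u_{j,k}:\gamma_j\le k\le\kappa_j\}$ with $\kappa_j=\max_i\{o_{i,j}+\tau_i\}$, $\mathcal Y(\mathcal S_\tau)=\upsilon^{-1}(\mathcal V(\tau))$, and $(\mathcal S_\tau)$ the ideal generated by $\mathcal S_\tau$ in $\mathbb Q[\mathcal C_\tau][\mathcal Y(\mathcal S_\tau)^\pm]$. For $Q\in\mathcal Q$, $\tau^Q$ is the (unique) componentwise smallest such $\tau$ with $Q\in\mathbb Q[\mathcal C_\tau]$. Codimension refers to ideals of the polynomial ring $\mathbb Q[\mathcal C_\tau]$. *)

theory Defs
  imports
    "HOL-Analysis.Analysis"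
    "HOL-Combinatorics.Permutations"
    "HOL-Library.Poly_Mapping"
    "HOL-Library.Set_Algebras"
    "HOL-Library.Extended_Nat"
    "HOL-Computational_Algebra.Fraction_Field"
    "HOL-Algebra.Ideal"
    "HOL-Algebra.Ring_Divisibility"
    "HOL-Algebra.Subrings"
begin

section \<open>Polynomials over the rationals in arbitrary variables\<close>

text \<open>
  A polynomial ring \<open>Q[X]\<close>, and a Laurent polynomial ring, is the set of those elements of a
  large ambient ring of finitely supported functions (exponents to coefficients) that involve
  the variables in \<open>X\<close> only. Ring-theoretic notions relative to such a subset are those of
  HOL-Algebra, for the following record.
\<close>

definition subring_on :: "'a::comm_ring_1 set \<Rightarrow> 'a ring" where
  "subring_on S = \<lparr>carrier = S, monoid.mult = (*), one = 1, zero = 0, add = (+)\<rparr>"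

type_synonym 'v qpoly = "('v \<Rightarrow>\<^sub>0 nat) \<Rightarrow>\<^sub>0 rat"

definition pvars :: "(('v \<Rightarrow>\<^sub>0 'e::zero) \<Rightarrow>\<^sub>0 'c::zero) \<Rightarrow> 'v set" where
  "pvars f = (\<Union>m\<in>Poly_Mapping.keys f. Poly_Mapping.keys m)"

definition pvar :: "'v \<Rightarrow> 'v qpoly" where
  "pvar v = Poly_Mapping.single (Poly_Mapping.single v 1) 1"

definition polys_in :: "'v set \<Rightarrow> 'v qpoly set" where
  "polys_in X = {f. pvars f \<subseteq> X}"

definition lconst :: "'c \<Rightarrow> ('m::zero \<Rightarrow>\<^sub>0 'c::zero)" where
  "lconst c = Poly_Mapping.single 0 c"

text \<open>\<open>psubst e \<phi> f\<close> substitutes \<open>\<phi> v\<close> for each variable \<open>v\<close>; \<open>e\<close> is the embedding of the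
  rationals into the target ring.\<close>

definition psubst :: "(rat \<Rightarrow> 'b) \<Rightarrow> ('v \<Rightarrow> 'b) \<Rightarrow> 'v qpoly \<Rightarrow> 'b::comm_ring_1" where
  "psubst e \<phi> f = (\<Sum>m\<in>Poly_Mapping.keys f. e (Poly_Mapping.lookup f m) *
                     (\<Prod>v\<in>Poly_Mapping.keys m. \<phi> v ^ Poly_Mapping.lookup m v))"

definition pdeg :: "'v \<Rightarrow> 'v qpoly \<Rightarrow> nat" where
  "pdeg v f = Max ((\<lambda>m. Poly_Mapping.lookup m v) ` Poly_Mapping.keys f)"

text \<open>The coefficient of \<open>v ^ pdeg v f\<close> in \<open>f\<close> as a polynomial in \<open>v\<close>.\<close>

definition plcoeff :: "'v \<Rightarrow> 'v qpoly \<Rightarrow> 'v qpoly" where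
  "plcoeff v f = (\<Sum>m\<in>{m \<in> Poly_Mapping.keys f. Poly_Mapping.lookup m v = pdeg v f}.
     Poly_Mapping.single (m - Poly_Mapping.single v (pdeg v f)) (Poly_Mapping.lookup f m))"

definition pdiff :: "'v \<Rightarrow> 'v qpoly \<Rightarrow> 'v qpoly" where
  "pdiff v f = (\<Sum>m\<in>Poly_Mapping.keys f.
     Poly_Mapping.single (m - Poly_Mapping.single v 1)
       (of_nat (Poly_Mapping.lookup m v) * Poly_Mapping.lookup f m))"


section \<open>Codimension\<close>

definition prime_height :: "('a, 'b) ring_scheme \<Rightarrow> 'a set \<Rightarrow> enat" where
  "prime_height R p = Sup {enat k | k. \<exists>c :: nat \<Rightarrow> 'a set.
     (\<forall>i\<le>k. primeideal (c i) R) \<and> (\<forall>i<k. c i \<subset> c (Suc i)) \<and> c k = p}"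

definition codimension :: "('a, 'b) ring_scheme \<Rightarrow> 'a set \<Rightarrow> enat" where
  "codimension R I = Inf {prime_height R p | p. primeideal p R \<and> I \<subseteq> p}"


section \<open>Differential polynomials\<close>

text \<open>\<open>Der x k\<close> is the \<open>k\<close>-th derivative of the differential indeterminate \<open>x\<close>.\<close>

datatype 'i dvar = Der 'i nat

text \<open>The linear order on derivatives serves only to make the Laurent polynomial rings below
  integral domains for the type class system, so that they have a field of fractions.\<close>

instantiation dvar :: (linorder) linorder
begin

fun less_eq_dvar :: "'a dvar \<Rightarrow> 'a dvar \<Rightarrow> bool" where
  "Der x k \<le> Der y m \<longleftrightarrow> x < y \<or> x = y \<and> k \<le> m"

definition less_dvar :: "'a dvar \<Rightarrow> 'a dvar \<Rightarrow> bool" where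
  "less_dvar v w \<longleftrightarrow> v \<le> w \<and> \<not> w \<le> v"

instance
proof
  fix u v w :: "'a dvar"
  show "u < v \<longleftrightarrow> u \<le> v \<and> \<not> v \<le> u" by (rule less_dvar_def)
  show "u \<le> u" by (cases u) auto
  show "u \<le> w" if "u \<le> v" "v \<le> w" using that by (cases u; cases v; cases w) auto
  show "u = v" if "u \<le> v" "v \<le> u" using that by (cases u; cases v) auto
  show "u \<le> v \<or> v \<le> u" by (cases u; cases v) auto
qed

end

fun dshift :: "'i dvar \<Rightarrow> 'i dvar" where
  "dshift (Der x k) = Der x (Suc k)"

definition pderive :: "'i dvar qpoly \<Rightarrow> 'i dvar qpoly" where
  "pderive f = (\<Sum>m\<in>Poly_Mapping.keys f. \<Sum>v\<in>Poly_Mapping.keys m.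
     Poly_Mapping.single (m - Poly_Mapping.single v 1 + Poly_Mapping.single (dshift v) 1)
       (of_nat (Poly_Mapping.lookup m v) * Poly_Mapping.lookup f m))"

type_synonym umon = "nat dvar \<Rightarrow>\<^sub>0 int"

text \<open>The derivation on Laurent differential polynomials that extends the derivation \<open>d\<close> on the
  coefficients.\<close>

definition lderive :: "('c::comm_ring_1 \<Rightarrow> 'c) \<Rightarrow> (umon \<Rightarrow>\<^sub>0 'c) \<Rightarrow> (umon \<Rightarrow>\<^sub>0 'c)" where
  "lderive d f = (\<Sum>m\<in>Poly_Mapping.keys f.
     Poly_Mapping.single m (d (Poly_Mapping.lookup f m)) +
     (\<Sum>v\<in>Poly_Mapping.keys m.
        Poly_Mapping.single (m - Poly_Mapping.single v 1 + Poly_Mapping.single (dshift v) 1)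
          (of_int (Poly_Mapping.lookup m v) * Poly_Mapping.lookup f m)))"

definition diff_ideal_gen :: "('a, 'b) ring_scheme \<Rightarrow> ('a \<Rightarrow> 'a) \<Rightarrow> 'a set \<Rightarrow> 'a set" where
  "diff_ideal_gen R d S = \<Inter>{I. ideal I R \<and> d ` I \<subseteq> I \<and> S \<subseteq> I}"


section \<open>Differential transcendence degree\<close>

text \<open>The differential field \<open>Q\<langle>U\<rangle>\<close>, whose derivation is given by the quotient rule; the result
  does not depend on the representation of the fraction that is chosen.\<close>

type_synonym ufield = "(umon \<Rightarrow>\<^sub>0 rat) fract"

definition umonomial :: "umon \<Rightarrow> ufield" where
  "umonomial m = Fract (Poly_Mapping.single m 1) 1"

definition uderive :: "ufield \<Rightarrow> ufield" where
  "uderive q = (SOME r. \<exists>a b. b \<noteq> 0 \<and> q = Fract a b \<and>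
     r = Fract (lderive (\<lambda>_. 0) a * b - a * lderive (\<lambda>_. 0) b) (b * b))"

definition diff_subfield_gen :: "ufield set \<Rightarrow> ufield set" where
  "diff_subfield_gen S = \<Inter>{K. subfield K (subring_on UNIV) \<and> uderive ` K \<subseteq> K \<and> S \<subseteq> K}"

text \<open>Elements are differentially independent over the rationals if they, used as differential
  indeterminates for themselves, satisfy no nontrivial differential polynomial.\<close>

definition diff_independent :: "ufield set \<Rightarrow> bool" where
  "diff_independent T \<longleftrightarrow> (\<forall>f :: ufield dvar qpoly.
     pvars f \<subseteq> {Der s k | s k. s \<in> T} \<and>
     psubst (\<lambda>c. Fract (lconst c) 1) (\<lambda>v. case v of Der s k \<Rightarrow> (uderive ^^ k) s) f = 0
     \<longrightarrow> f = 0)"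

definition diff_trdeg :: "ufield set \<Rightarrow> enat" where
  "diff_trdeg S = Sup {enat (card T) | T. finite T \<and> T \<subseteq> diff_subfield_gen S \<and> diff_independent T}"


section \<open>Elimination rankings, differential remainders, \<open>sat\<close>\<close>

definition elimination_ranking :: "'i set \<Rightarrow> ('i dvar \<times> 'i dvar) set \<Rightarrow> bool" where
  "elimination_ranking X r \<longleftrightarrow>
     linear_order_on {Der x k | x k. x \<in> X} r \<and>
     (\<forall>x\<in>X. \<forall>k. (Der x k, Der x (Suc k)) \<in> r) \<and>
     (\<forall>v w. (v, w) \<in> r \<longrightarrow> (dshift v, dshift w) \<in> r) \<and>
     (\<forall>x\<in>X. \<forall>y\<in>X. x \<noteq> y \<and> (Der x 0, Der y 0) \<in> r \<longrightarrow> (\<forall>k m. (Der x k, Der y m) \<in> r))"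

definition leader :: "('i dvar \<times> 'i dvar) set \<Rightarrow> 'i dvar qpoly \<Rightarrow> 'i dvar" where
  "leader r f = (THE v. v \<in> pvars f \<and> (\<forall>w\<in>pvars f. (w, v) \<in> r))"

definition initial_of :: "('i dvar \<times> 'i dvar) set \<Rightarrow> 'i dvar qpoly \<Rightarrow> 'i dvar qpoly" where
  "initial_of r f = plcoeff (leader r f) f"

definition separant_of :: "('i dvar \<times> 'i dvar) set \<Rightarrow> 'i dvar qpoly \<Rightarrow> 'i dvar qpoly" where
  "separant_of r f = pdiff (leader r f) f"

definition reduced_wrt :: "('i dvar \<times> 'i dvar) set \<Rightarrow> 'i dvar qpoly \<Rightarrow> 'i dvar qpoly \<Rightarrow> bool" where
  "reduced_wrt r f g \<longleftrightarrow>
     (\<forall>k>0. (dshift ^^ k) (leader r f) \<notin> pvars g) \<and>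
     (g = 0 \<or> pdeg (leader r f) g < pdeg (leader r f) f)"

definition diff_polys :: "'i set \<Rightarrow> 'i dvar qpoly set" where
  "diff_polys X = polys_in {Der x k | x k. x \<in> X}"

text \<open>\<open>h\<close> is a differential remainder of \<open>g\<close> with respect to \<open>f\<close>.\<close>

definition diff_remainder ::
    "'i set \<Rightarrow> ('i dvar \<times> 'i dvar) set \<Rightarrow> 'i dvar qpoly \<Rightarrow> 'i dvar qpoly \<Rightarrow> 'i dvar qpoly \<Rightarrow> bool" where
  "diff_remainder X r f g h \<longleftrightarrow> h \<in> diff_polys X \<and> reduced_wrt r f h \<and>
     (\<exists>a b. initial_of r f ^ a * separant_of r f ^ b * g - h
              \<in> diff_ideal_gen (subring_on (diff_polys X)) pderive {f})"

definition sat :: "'i set \<Rightarrow> 'i dvar qpoly \<Rightarrow> 'i dvar qpoly set" where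
  "sat X f = {g \<in> diff_polys X. \<forall>r. elimination_ranking X r \<longrightarrow> diff_remainder X r f g 0}"


section \<open>The generic system and its sparse differential resultant\<close>

text \<open>\<open>Coef i 0\<close> is the distinguished coefficient \<open>a\<^sub>i\<close> and \<open>Coef i k\<close> is \<open>a\<^sub>i\<^sub>,\<^sub>k\<close>, for
  \<open>1 \<le> k \<le> l\<^sub>i\<close>. Likewise \<open>mon P i 0\<close> is \<open>M\<^sub>i\<close> and \<open>mon P i k\<close> is \<open>M\<^sub>i\<^sub>,\<^sub>k\<close>.\<close>

datatype coef = Coef nat nat

type_synonym dpoly = "coef dvar qpoly"
type_synonym dlaurent = "umon \<Rightarrow>\<^sub>0 dpoly"

record gsystem =
  size_of :: nat
  len :: "nat \<Rightarrow> nat"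
  mon :: "nat \<Rightarrow> nat \<Rightarrow> umon"

definition coefs :: "gsystem \<Rightarrow> coef set" where
  "coefs P = {Coef i k | i k. i \<in> {1..size_of P} \<and> k \<in> {0..len P i}}"

definition DD :: "gsystem \<Rightarrow> dpoly set" where
  "DD P = diff_polys (coefs P)"

definition DU :: "gsystem \<Rightarrow> dlaurent set" where
  "DU P = {f. pvars f \<subseteq> {Der j k | j k. j \<in> {1..size_of P - 1}} \<and>
              (\<forall>m. Poly_Mapping.lookup f m \<in> DD P)}"

definition dd :: "dlaurent \<Rightarrow> dlaurent" where
  "dd = lderive pderive"

definition FF :: "gsystem \<Rightarrow> nat \<Rightarrow> dlaurent" where
  "FF P i = (\<Sum>k=0..len P i. Poly_Mapping.single (mon P i k) (pvar (Der (Coef i k) 0)))"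

definition uorders :: "nat \<Rightarrow> dlaurent \<Rightarrow> nat set" where
  "uorders j f = {k. Der j k \<in> pvars f}"

definition generic_system :: "gsystem \<Rightarrow> bool" where
  "generic_system P \<longleftrightarrow> size_of P \<ge> 2 \<and>
     (\<forall>i\<in>{1..size_of P}. inj_on (mon P i) {0..len P i}) \<and>
     (\<forall>i\<in>{1..size_of P}. \<forall>k\<in>{0..len P i}.
        Poly_Mapping.keys (mon P i k) \<subseteq> {Der j m | j m. j \<in> {1..size_of P - 1}}) \<and>
     (\<forall>i\<in>{1..size_of P}. \<exists>j\<in>{1..size_of P - 1}. uorders j (FF P i) \<noteq> {}) \<and>
     (\<forall>j\<in>{1..size_of P - 1}. \<exists>i\<in>{1..size_of P}. uorders j (FF P i) \<noteq> {})"

definition laurent_diff_essential :: "gsystem \<Rightarrow> bool" where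
  "laurent_diff_essential P \<longleftrightarrow> (\<exists>\<kappa>. (\<forall>i\<in>{1..size_of P}. \<kappa> i \<in> {1..len P i}) \<and>
     diff_trdeg ((\<lambda>i. umonomial (mon P i (\<kappa> i) - mon P i 0)) ` {1..size_of P})
       = enat (size_of P - 1))"

definition sparse_diff_resultant :: "gsystem \<Rightarrow> dpoly \<Rightarrow> bool" where
  "sparse_diff_resultant P R \<longleftrightarrow> R \<in> DD P \<and>
     ring_irreducible\<^bsub>subring_on (DD P)\<^esub> R \<and>
     {g \<in> DD P. lconst g \<in> diff_ideal_gen (subring_on (DU P)) dd (FF P ` {1..size_of P})}
       = sat (coefs P) R"


section \<open>Orders\<close>

definition oord :: "gsystem \<Rightarrow> nat \<Rightarrow> nat \<Rightarrow> ereal" where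
  "oord P i j = (let S = uorders j (FF P i) in if S = {} then -\<infinity> else ereal (real (Max S)))"

definition JJ :: "gsystem \<Rightarrow> nat \<Rightarrow> ereal" where
  "JJ P i = Max {\<Sum>h\<in>{1..size_of P} - {i}. oord P h (\<mu> h) | \<mu>.
                   bij_betw \<mu> ({1..size_of P} - {i}) {1..size_of P - 1}}"

definition super_essential :: "gsystem \<Rightarrow> bool" where
  "super_essential P \<longleftrightarrow> (\<forall>i\<in>{1..size_of P}. JJ P i \<ge> 0)"

definition gam :: "gsystem \<Rightarrow> nat \<Rightarrow> nat" where
  "gam P j = Min (\<Union>i\<in>{1..size_of P}. uorders j (FF P i))"

definition gamma_sum :: "gsystem \<Rightarrow> nat" where
  "gamma_sum P = (\<Sum>j=1..size_of P - 1. gam P j)"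

definition JG :: "gsystem \<Rightarrow> nat \<Rightarrow> ereal" where
  "JG P i = JJ P i - ereal (real (gamma_sum P))"

text \<open>\<open>PS P \<tau>\<close> and \<open>VV P \<tau>\<close> for tuples \<open>\<tau>\<close> with entries in the natural numbers and \<open>-\<infinity>\<close>.
  The entries of \<open>\<tau>\<close> at indices outside \<open>{1..n}\<close> are irrelevant.\<close>

definition PS :: "gsystem \<Rightarrow> (nat \<Rightarrow> ereal) \<Rightarrow> dlaurent set" where
  "PS P \<tau> = {(dd ^^ k) (FF P i) | i k. i \<in> {1..size_of P} \<and> ereal (real k) \<le> \<tau> i}"

definition VV :: "gsystem \<Rightarrow> (nat \<Rightarrow> ereal) \<Rightarrow> nat dvar set" where
  "VV P \<tau> = {Der j k | j k. j \<in> {1..size_of P - 1} \<and> gam P j \<le> k \<and>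
               ereal (real k) \<le> Max ((\<lambda>i. oord P i j + \<tau> i) ` {1..size_of P})}"

definition ps :: "gsystem \<Rightarrow> dlaurent set" where
  "ps P = {(dd ^^ k) (FF P i) | i k. i \<in> {1..size_of P} \<and> ereal (real k) \<le> JG P i}"

definition LL :: "gsystem \<Rightarrow> nat" where
  "LL P = card (ps P)"

definition Vps :: "gsystem \<Rightarrow> nat dvar set" where
  "Vps P = {Der j k | j k. j \<in> {1..size_of P - 1} \<and> gam P j \<le> k \<and>
              ereal (real k) \<le> Max ((\<lambda>i. oord P i j + JJ P i) ` {1..size_of P})
                              - ereal (real (gamma_sum P))}"


section \<open>The algebraic generic system\<close>

text \<open>The indeterminates \<open>y\<^sub>h\<close> are indexed by a finite type \<open>'y\<close>; a bijection from \<open>'y\<close> onto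
  \<open>Vps P\<close> forces it to have \<open>L - 1\<close> elements. Laurent monomials in them are integer vectors, and
  the pair \<open>(h, \<alpha>)\<close> stands for the indeterminate \<open>c\<^sup>h\<^sub>\<alpha>\<close>.\<close>

type_synonym 'y cvar = "nat \<times> (int ^ 'y)"
type_synonym 'y cpoly = "'y cvar qpoly"
type_synonym 'y claurent = "(int ^ 'y) \<Rightarrow>\<^sub>0 'y cpoly"

definition rho :: "gsystem \<Rightarrow> (dlaurent \<Rightarrow> nat) \<Rightarrow> nat \<Rightarrow> dlaurent" where
  "rho P lam = inv_into (ps P) lam"

definition upsmon :: "('y::finite \<Rightarrow> nat dvar) \<Rightarrow> int ^ 'y \<Rightarrow> umon" where
  "upsmon ups \<alpha> = (\<Sum>h\<in>UNIV. Poly_Mapping.single (ups h) (\<alpha> $ h))"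

definition coef_at :: "('y::finite \<Rightarrow> nat dvar) \<Rightarrow> dlaurent \<Rightarrow> int ^ 'y \<Rightarrow> dpoly" where
  "coef_at ups f \<alpha> = Poly_Mapping.lookup f (upsmon ups \<alpha>)"

definition asupp :: "('y::finite \<Rightarrow> nat dvar) \<Rightarrow> dlaurent \<Rightarrow> (int ^ 'y) set" where
  "asupp ups f = {\<alpha>. coef_at ups f \<alpha> \<noteq> 0}"

definition AA :: "gsystem \<Rightarrow> (dlaurent \<Rightarrow> nat) \<Rightarrow> ('y::finite \<Rightarrow> nat dvar) \<Rightarrow> nat \<Rightarrow> (int ^ 'y) set" where
  "AA P lam ups h = asupp ups (rho P lam h)"

definition PP :: "gsystem \<Rightarrow> (dlaurent \<Rightarrow> nat) \<Rightarrow> ('y::finite \<Rightarrow> nat dvar) \<Rightarrow> nat \<Rightarrow> 'y claurent" where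
  "PP P lam ups h = (\<Sum>\<alpha>\<in>AA P lam ups h. Poly_Mapping.single \<alpha> (pvar (h, \<alpha>)))"

definition CC :: "gsystem \<Rightarrow> (dlaurent \<Rightarrow> nat) \<Rightarrow> ('y::finite \<Rightarrow> nat dvar) \<Rightarrow> 'y cvar set" where
  "CC P lam ups = {(h, \<alpha>) | h \<alpha>. h \<in> {1..LL P} \<and> \<alpha> \<in> AA P lam ups h}"

definition QC :: "gsystem \<Rightarrow> (dlaurent \<Rightarrow> nat) \<Rightarrow> ('y::finite \<Rightarrow> nat dvar) \<Rightarrow> 'y cpoly set" where
  "QC P lam ups = polys_in (CC P lam ups)"

definition Xi :: "gsystem \<Rightarrow> (dlaurent \<Rightarrow> nat) \<Rightarrow> ('y::finite \<Rightarrow> nat dvar) \<Rightarrow> 'y claurent \<Rightarrow> dlaurent" where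
  "Xi P lam ups f = (\<Sum>\<alpha>\<in>Poly_Mapping.keys f. Poly_Mapping.single (upsmon ups \<alpha>)
     (psubst lconst (\<lambda>(h, \<beta>). coef_at ups (rho P lam h) \<beta>) (Poly_Mapping.lookup f \<alpha>)))"

text \<open>\<open>T h\<close> is the exponent of the distinguished monomial of \<open>PP P lam ups h\<close>, so that \<open>c\<^sub>h\<close> is
  the indeterminate \<open>(h, T h)\<close>.\<close>

definition distinguished ::
    "gsystem \<Rightarrow> (dlaurent \<Rightarrow> nat) \<Rightarrow> ('y::finite \<Rightarrow> nat dvar) \<Rightarrow> (nat \<Rightarrow> int ^ 'y) \<Rightarrow> bool" where
  "distinguished P lam ups T \<longleftrightarrow> (\<forall>h\<in>{1..LL P}. T h \<in> AA P lam ups h \<and>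
     (\<forall>i\<in>{1..size_of P}. \<forall>k. ereal (real k) \<le> JG P i \<and> rho P lam h = (dd ^^ k) (FF P i) \<longrightarrow>
        Xi P lam ups (lconst (pvar (h, T h))) = lconst (pvar (Der (Coef i 0) k))))"

definition eps ::
    "gsystem \<Rightarrow> (dlaurent \<Rightarrow> nat) \<Rightarrow> ('y::finite \<Rightarrow> nat dvar) \<Rightarrow> (nat \<Rightarrow> int ^ 'y) \<Rightarrow> nat \<Rightarrow> 'y claurent" where
  "eps P lam ups T h = - (\<Sum>\<alpha>\<in>AA P lam ups h - {T h}. Poly_Mapping.single (\<alpha> - T h) (pvar (h, \<alpha>)))"

definition at_eps ::
    "gsystem \<Rightarrow> (dlaurent \<Rightarrow> nat) \<Rightarrow> ('y::finite \<Rightarrow> nat dvar) \<Rightarrow> (nat \<Rightarrow> int ^ 'y) \<Rightarrow> 'y cpoly \<Rightarrow> 'y claurent" where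
  "at_eps P lam ups T G = psubst (\<lambda>c. lconst (lconst c))
     (\<lambda>(h, \<alpha>). if \<alpha> = T h then eps P lam ups T h else lconst (pvar (h, \<alpha>))) G"


section \<open>Sylvester determinants\<close>

definition rvec :: "int ^ 'y \<Rightarrow> real ^ 'y" where
  "rvec \<alpha> = (\<chi> i. real_of_int (\<alpha> $ i))"

text \<open>In this section \<open>A h\<close>, for \<open>1 \<le> h \<le> L\<close>, are the supports, and \<open>\<omega> h\<close> is the vector of the
  linear form that lifts the \<open>h\<close>-th polytope.\<close>

definition newton :: "(nat \<Rightarrow> (int ^ 'y::finite) set) \<Rightarrow> nat \<Rightarrow> (real ^ 'y) set" where
  "newton A h = convex hull (rvec ` A h)"

definition newton_sum :: "nat \<Rightarrow> (nat \<Rightarrow> (int ^ 'y::finite) set) \<Rightarrow> (real ^ 'y) set" where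
  "newton_sum L A = (\<Sum>h\<in>{1..L}. newton A h)"

definition affine_lattice :: "(int ^ 'y) set \<Rightarrow> (int ^ 'y::finite) set" where
  "affine_lattice X = {\<Sum>x\<in>S. c x *s x | S c. finite S \<and> S \<subseteq> X \<and> (\<Sum>x\<in>S. c x) = 1}"

definition lifted ::
    "(nat \<Rightarrow> (int ^ 'y::finite) set) \<Rightarrow> (nat \<Rightarrow> real ^ 'y) \<Rightarrow> nat \<Rightarrow> ((real ^ 'y) \<times> real) set" where
  "lifted A \<omega> h = (\<lambda>x. (x, \<omega> h \<bullet> x)) ` newton A h"

text \<open>The faces of the lower envelope of a polytope are its faces with inner normal vectors
  \<open>(v, 1)\<close>.\<close>

definition lower_face :: "'a::real_inner \<Rightarrow> ('a \<times> real) set \<Rightarrow> ('a \<times> real) set" where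
  "lower_face v X = {z \<in> X. \<forall>w\<in>X. (v, 1) \<bullet> z \<le> (v, 1) \<bullet> w}"

text \<open>The cell of the subdivision with inner normal vector \<open>v\<close>. It is the Minkowski sum of the
  faces \<open>summand A \<omega> v h\<close> of the polytopes, which are the \<open>F\<^sub>h\<close>. A maximal cell determines
  its summands, although \<open>v\<close> is not unique if \<open>newton_sum L A\<close> is not of full dimension.\<close>

definition cell ::
    "nat \<Rightarrow> (nat \<Rightarrow> (int ^ 'y::finite) set) \<Rightarrow> (nat \<Rightarrow> real ^ 'y) \<Rightarrow> real ^ 'y \<Rightarrow> (real ^ 'y) set" where
  "cell L A \<omega> v = fst ` lower_face v (\<Sum>h\<in>{1..L}. lifted A \<omega> h)"

definition summand ::
    "(nat \<Rightarrow> (int ^ 'y::finite) set) \<Rightarrow> (nat \<Rightarrow> real ^ 'y) \<Rightarrow> real ^ 'y \<Rightarrow> nat \<Rightarrow> (real ^ 'y) set" where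
  "summand A \<omega> v h = fst ` lower_face v (lifted A \<omega> h)"

definition maximal_cell ::
    "nat \<Rightarrow> (nat \<Rightarrow> (int ^ 'y::finite) set) \<Rightarrow> (nat \<Rightarrow> real ^ 'y) \<Rightarrow> real ^ 'y \<Rightarrow> bool" where
  "maximal_cell L A \<omega> v \<longleftrightarrow> aff_dim (cell L A \<omega> v) = aff_dim (newton_sum L A)"

text \<open>The liftings are sufficiently generic if the subdivision is mixed.\<close>

definition generic_lifting ::
    "nat \<Rightarrow> (nat \<Rightarrow> (int ^ 'y::finite) set) \<Rightarrow> (nat \<Rightarrow> real ^ 'y) \<Rightarrow> bool" where
  "generic_lifting L A \<omega> \<longleftrightarrow> (\<forall>v. maximal_cell L A \<omega> v \<longrightarrow>
     (\<Sum>h\<in>{1..L}. aff_dim (summand A \<omega> v h)) = aff_dim (newton_sum L A))"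

definition EE :: "nat \<Rightarrow> (nat \<Rightarrow> (int ^ 'y::finite) set) \<Rightarrow> real ^ 'y \<Rightarrow> (int ^ 'y) set" where
  "EE L A \<delta> = {p \<in> affine_lattice (\<Sum>h\<in>{1..L}. A h). rvec p \<in> (\<lambda>x. x + \<delta>) ` newton_sum L A}"

text \<open>\<open>\<delta>\<close> is generic if each \<open>p - \<delta>\<close> is in the relative interior of a maximal cell, and small if
  scaling \<open>\<delta>\<close> down changes neither the set \<open>EE L A \<delta>\<close> of lattice points nor these cells.\<close>

definition small_generic_shift ::
    "nat \<Rightarrow> (nat \<Rightarrow> (int ^ 'y::finite) set) \<Rightarrow> (nat \<Rightarrow> real ^ 'y) \<Rightarrow> real ^ 'y \<Rightarrow> bool" where
  "small_generic_shift L A \<omega> \<delta> \<longleftrightarrow>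
     \<delta> \<in> {x - y | x y. x \<in> affine hull newton_sum L A \<and> y \<in> affine hull newton_sum L A} \<and>
     (\<forall>p\<in>EE L A \<delta>. \<exists>v. maximal_cell L A \<omega> v \<and> rvec p - \<delta> \<in> rel_interior (cell L A \<omega> v)) \<and>
     (\<forall>t. 0 < t \<and> t \<le> 1 \<longrightarrow> EE L A (t *\<^sub>R \<delta>) = EE L A \<delta> \<and>
        (\<forall>p\<in>EE L A \<delta>. \<forall>v. maximal_cell L A \<omega> v \<and> rvec p - \<delta> \<in> rel_interior (cell L A \<omega> v)
           \<longrightarrow> rvec p - t *\<^sub>R \<delta> \<in> rel_interior (cell L A \<omega> v)))"

definition cell_normal ::
    "nat \<Rightarrow> (nat \<Rightarrow> (int ^ 'y::finite) set) \<Rightarrow> (nat \<Rightarrow> real ^ 'y) \<Rightarrow> real ^ 'y \<Rightarrow> int ^ 'y \<Rightarrow> real ^ 'y" where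
  "cell_normal L A \<omega> \<delta> p =
     (SOME v. maximal_cell L A \<omega> v \<and> rvec p - \<delta> \<in> rel_interior (cell L A \<omega> v))"

text \<open>\<open>(h, h') \<in> ord\<close> means that \<open>h\<close> is smaller than or equal to \<open>h'\<close>.\<close>

definition row_index ::
    "nat \<Rightarrow> (nat \<Rightarrow> (int ^ 'y::finite) set) \<Rightarrow> (nat \<Rightarrow> real ^ 'y) \<Rightarrow> real ^ 'y \<Rightarrow> (nat \<times> nat) set
      \<Rightarrow> int ^ 'y \<Rightarrow> nat" where
  "row_index L A \<omega> \<delta> ord p =
     (let H = {h \<in> {1..L}. \<exists>a. summand A \<omega> (cell_normal L A \<omega> \<delta> p) h = {a}}
      in THE h. h \<in> H \<and> (\<forall>h'\<in>H. (h', h) \<in> ord))"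

definition row_vertex ::
    "nat \<Rightarrow> (nat \<Rightarrow> (int ^ 'y::finite) set) \<Rightarrow> (nat \<Rightarrow> real ^ 'y) \<Rightarrow> real ^ 'y \<Rightarrow> (nat \<times> nat) set
      \<Rightarrow> int ^ 'y \<Rightarrow> int ^ 'y" where
  "row_vertex L A \<omega> \<delta> ord p =
     (THE a. summand A \<omega> (cell_normal L A \<omega> \<delta> p) (row_index L A \<omega> \<delta> ord p) = {rvec a})"

definition set_det :: "'a set \<Rightarrow> ('a \<Rightarrow> 'a \<Rightarrow> 'b::comm_ring_1) \<Rightarrow> 'b" where
  "set_det E S = (\<Sum>\<pi> | \<pi> permutes E. of_int (sign \<pi>) * (\<Prod>p\<in>E. S p (\<pi> p)))"

definition sylvester_matrix ::
    "gsystem \<Rightarrow> (dlaurent \<Rightarrow> nat) \<Rightarrow> ('y::finite \<Rightarrow> nat dvar) \<Rightarrow> (nat \<Rightarrow> real ^ 'y) \<Rightarrow> real ^ 'y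
      \<Rightarrow> (nat \<times> nat) set \<Rightarrow> int ^ 'y \<Rightarrow> int ^ 'y \<Rightarrow> 'y cpoly" where
  "sylvester_matrix P lam ups \<omega> \<delta> ord p q =
     (let A = AA P lam ups;
          h = row_index (LL P) A \<omega> \<delta> ord p;
          a = row_vertex (LL P) A \<omega> \<delta> ord p
      in Poly_Mapping.lookup (Poly_Mapping.single (p - a) 1 * PP P lam ups h) q)"

definition sylvester_det ::
    "gsystem \<Rightarrow> (dlaurent \<Rightarrow> nat) \<Rightarrow> ('y::finite \<Rightarrow> nat dvar) \<Rightarrow> (nat \<Rightarrow> real ^ 'y) \<Rightarrow> real ^ 'y
      \<Rightarrow> (nat \<times> nat) set \<Rightarrow> 'y cpoly" where
  "sylvester_det P lam ups \<omega> \<delta> ord =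
     set_det (EE (LL P) (AA P lam ups) \<delta>) (sylvester_matrix P lam ups \<omega> \<delta> ord)"

definition QQ ::
    "gsystem \<Rightarrow> (dlaurent \<Rightarrow> nat) \<Rightarrow> ('y::finite \<Rightarrow> nat dvar) \<Rightarrow> (nat \<Rightarrow> int ^ 'y) \<Rightarrow> 'y cpoly
      \<Rightarrow> 'y cpoly set" where
  "QQ P lam ups T D = {Q \<in> QC P lam ups. ring_irreducible\<^bsub>subring_on (QC P lam ups)\<^esub> Q \<and>
     Q divides\<^bsub>subring_on (QC P lam ups)\<^esub> D \<and> at_eps P lam ups T Q = 0}"


section \<open>Subsystems\<close>

definition admissible :: "gsystem \<Rightarrow> (nat \<Rightarrow> ereal) \<Rightarrow> bool" where
  "admissible P \<tau> \<longleftrightarrow> (\<forall>i\<in>{1..size_of P}.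
     (\<tau> i = -\<infinity> \<or> (\<exists>k::nat. \<tau> i = ereal (real k))) \<and> \<tau> i \<le> JG P i)"

definition S_sub ::
    "gsystem \<Rightarrow> (dlaurent \<Rightarrow> nat) \<Rightarrow> ('y::finite \<Rightarrow> nat dvar) \<Rightarrow> (nat \<Rightarrow> ereal) \<Rightarrow> 'y claurent set" where
  "S_sub P lam ups \<tau> = (\<lambda>f. PP P lam ups (lam f)) ` PS P \<tau>"

definition C_sub ::
    "gsystem \<Rightarrow> (dlaurent \<Rightarrow> nat) \<Rightarrow> ('y::finite \<Rightarrow> nat dvar) \<Rightarrow> (nat \<Rightarrow> ereal) \<Rightarrow> 'y cvar set" where
  "C_sub P lam ups \<tau> = {(lam f, \<alpha>) | f \<alpha>. f \<in> PS P \<tau> \<and> \<alpha> \<in> AA P lam ups (lam f)}"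

definition laurent_sub ::
    "gsystem \<Rightarrow> (dlaurent \<Rightarrow> nat) \<Rightarrow> ('y::finite \<Rightarrow> nat dvar) \<Rightarrow> (nat \<Rightarrow> ereal) \<Rightarrow> 'y claurent set" where
  "laurent_sub P lam ups \<tau> = {f. \<forall>\<alpha>\<in>Poly_Mapping.keys f.
     Poly_Mapping.lookup f \<alpha> \<in> polys_in (C_sub P lam ups \<tau>) \<and> (\<forall>h. \<alpha> $ h \<noteq> 0 \<longrightarrow> ups h \<in> VV P \<tau>)}"

definition elim_ideal_sub ::
    "gsystem \<Rightarrow> (dlaurent \<Rightarrow> nat) \<Rightarrow> ('y::finite \<Rightarrow> nat dvar) \<Rightarrow> (nat \<Rightarrow> ereal) \<Rightarrow> 'y cpoly set" where
  "elim_ideal_sub P lam ups \<tau> = {g \<in> polys_in (C_sub P lam ups \<tau>).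
     lconst g \<in> Idl\<^bsub>subring_on (laurent_sub P lam ups \<tau>)\<^esub> (S_sub P lam ups \<tau>)}"

text \<open>\<open>\<tau>\<close> is the componentwise smallest tuple \<open>\<tau>\<^sup>Q\<close>.\<close>

definition least_tau ::
    "gsystem \<Rightarrow> (dlaurent \<Rightarrow> nat) \<Rightarrow> ('y::finite \<Rightarrow> nat dvar) \<Rightarrow> 'y cpoly \<Rightarrow> (nat \<Rightarrow> ereal) \<Rightarrow> bool" where
  "least_tau P lam ups Q \<tau> \<longleftrightarrow> admissible P \<tau> \<and> Q \<in> polys_in (C_sub P lam ups \<tau>) \<and>
     (\<forall>\<sigma>. admissible P \<sigma> \<and> Q \<in> polys_in (C_sub P lam ups \<sigma>)
        \<longrightarrow> (\<forall>i\<in>{1..size_of P}. \<tau> i \<le> \<sigma> i))"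

end

theory Submission
  imports Defs
begin

text \<open>
  Replace each distinguished coefficient \<open>a\<^sub>i\<close> by \<open>- \<Sum>\<^sub>k a\<^sub>i\<^sub>,\<^sub>k M\<^sub>i\<^sub>,\<^sub>k / M\<^sub>i\<close>. On the differential
  coefficient ring this evaluation \<open>phi\<close> has kernel \<open>sat(R)\<close>, and an element of the kernel is divisible
  by \<open>R\<close> itself as soon as, for some coefficient that occurs in \<open>R\<close>, its order is at most that of \<open>R\<close>.

  Let \<open>h\<^sub>i\<close> be the order of \<open>R\<close> in the coefficients of the \<open>i\<close>-th polynomial. As \<open>Q(\<epsilon>) = 0\<close>, the image of
  \<open>\<Xi>(Q)\<close> under \<open>phi\<close> is zero. If \<open>\<tau>\<^sub>i \<le> h\<^sub>i\<close> for some \<open>i\<close> that occurs in \<open>R\<close>, then \<open>\<Xi>(Q)\<close> has low order and \<open>R\<close>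
  divides it. Otherwise specialize in \<open>Q\<close> only the coefficients of the \<open>h\<^sub>i\<close>-th and lower derivatives, and
  keep the other ones generic, subject to \<open>c\<^sub>h = \<epsilon>\<^sub>h\<close>. The Jacobian criterion, with logarithmic gradients
  and a count of dimensions, shows that the other coefficients remain algebraically independent of the
  specialized ones; codimension one enters through the fact that every relation between the generic
  coefficients is a multiple of \<open>Q\<close>. Hence the coefficients of \<open>Q\<close>, regarded as a polynomial in the
  generic indeterminates, are specialized to zero; they have low order, and so \<open>R\<close> divides each of them.
\<close>

subsection \<open>Substitution homomorphisms and subrings\<close>

text \<open>Membership in \<open>sat\<close> only says that powers of initial and separant carry an
  element into the differential ideal of \<open>R\<close>, and the derivatives of \<open>R\<close>
  show that no more can be expected. Divisibility by \<open>R\<close> itself is thus a question of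
  order, and the obstacle is a \<open>Q\<close> that involves derivatives above the order of
  \<open>R\<close> in every block. Logarithmic derivatives suit the problem because they multiply a
  Laurent monomial by its exponent: the gradients of \<open>\<epsilon>\<^sub>h\<close> and of the
  images of the distinguished coefficients lie in spans of the same exponent vectors. The two
  families can therefore be compared, although one is generic and the other highly special. A
  dependency between them would confine too many gradients to one small space: \<open>R\<close>
  gives one relation and the supposed dependency a second, but each of \<open>R\<close> and
  \<open>Q\<close>, dividing all relations in question, leaves room for one only. The gradients are
  computed in one flat Laurent ring over the rationals, into which the nested rings are embedded, so
  that a single Jacobian criterion covers both systems.\<close>

abbreviation (input) "lookup \<equiv> Poly_Mapping.lookup"
abbreviation (input) "keys \<equiv> Poly_Mapping.keys"
abbreviation (input) "single \<equiv> Poly_Mapping.single"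

lemma pm_expand: "f = (\<Sum>m\<in>keys f. single m (lookup f m))"
  by (rule poly_mapping_eqI) (auto simp: lookup_sum lookup_single when_def in_keys_iff sum.delta)

lemma pm_induct [case_names zero single add]:
  assumes "P 0" "\<And>m c. P (single m c)" "\<And>f g. P f \<Longrightarrow> P g \<Longrightarrow> P (f + g)"
  shows "P (f :: 'a \<Rightarrow>\<^sub>0 'b::comm_monoid_add)"
proof -
  have "P (\<Sum>m\<in>A. single m (lookup f m))" if "finite A" for A
    using that by induction (auto intro: assms)
  then show ?thesis by (subst pm_expand) simp
qed

text \<open>Homomorphisms of entire types. Rings given as subsets sit inside such types and all maps
  below are defined on the ambient ones, so that no membership conditions arise in
  compositions.\<close>

definition ring_hom_on :: "('a::comm_ring_1 \<Rightarrow> 'b::comm_ring_1) \<Rightarrow> bool" where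
  "ring_hom_on h \<longleftrightarrow> h 1 = 1 \<and> (\<forall>a b. h (a + b) = h a + h b) \<and> (\<forall>a b. h (a * b) = h a * h b)"

lemma ring_hom_onI:
  "h 1 = 1 \<Longrightarrow> (\<And>a b. h (a + b) = h a + h b) \<Longrightarrow> (\<And>a b. h (a * b) = h a * h b) \<Longrightarrow> ring_hom_on h"
  by (auto simp: ring_hom_on_def)

context
  fixes h :: "'a::comm_ring_1 \<Rightarrow> 'b::comm_ring_1"
  assumes h: "ring_hom_on h"
begin

lemma rh_one: "h 1 = 1" and rh_add: "h (a + b) = h a + h b" and rh_mult: "h (a * b) = h a * h b"
  using h by (auto simp: ring_hom_on_def)

lemma rh_zero: "h 0 = 0"
  using rh_add[of 0 0] by simp

lemma rh_uminus: "h (- a) = - h a"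
  using rh_add[of a "- a"] rh_zero by (simp add: eq_neg_iff_add_eq_0 add.commute)

lemma rh_sum: "h (sum f A) = (\<Sum>x\<in>A. h (f x))"
  by (induction A rule: infinite_finite_induct) (auto simp: rh_zero rh_add)

lemma rh_prod: "h (prod f A) = (\<Prod>x\<in>A. h (f x))"
  by (induction A rule: infinite_finite_induct) (auto simp: rh_one rh_mult)

lemma rh_power: "h (a ^ k) = h a ^ k"
  by (induction k) (auto simp: rh_one rh_mult)

lemma rh_of_nat: "h (of_nat k) = of_nat k"
  by (induction k) (auto simp: rh_zero rh_add rh_one)

end

lemma ring_hom_on_comp: "ring_hom_on g \<Longrightarrow> ring_hom_on h \<Longrightarrow> ring_hom_on (\<lambda>x. h (g x))"
  by (simp add: ring_hom_on_def)

lemma ring_hom_on_id: "ring_hom_on (\<lambda>x. x)"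
  by (simp add: ring_hom_on_def)

lemma ring_hom_on_lconst:
  "ring_hom_on (lconst :: 'c::comm_ring_1 \<Rightarrow> 'm::comm_monoid_add \<Rightarrow>\<^sub>0 'c)"
  by (rule ring_hom_onI) (auto simp: lconst_def single_add mult_single)

lemmas lconst_0 = rh_zero[OF ring_hom_on_lconst]
lemmas lconst_1 = rh_one[OF ring_hom_on_lconst]
lemmas lconst_add = rh_add[OF ring_hom_on_lconst]
lemmas lconst_mult = rh_mult[OF ring_hom_on_lconst]
lemma lconst_inj [simp]: "lconst c = lconst d \<longleftrightarrow> c = d"
  unfolding lconst_def by (metis lookup_single_eq)

lemma ring_hom_on_lconst2: "ring_hom_on (\<lambda>c. lconst (lconst c))"
  by (rule ring_hom_on_comp[OF ring_hom_on_lconst ring_hom_on_lconst])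

lemma lookup_lconst_mult: "lookup (lconst a * f) m = a * lookup f m"
  by (induction f rule: pm_induct) (auto simp: lconst_def mult_single lookup_single when_def lookup_add algebra_simps)

section \<open>Evaluation of polynomials at elements of a ring\<close>

definition mev :: "('v \<Rightarrow> 'b) \<Rightarrow> ('v \<Rightarrow>\<^sub>0 nat) \<Rightarrow> 'b::comm_ring_1" where
  "mev \<phi> m = (\<Prod>v\<in>keys m. \<phi> v ^ lookup m v)"

lemma mev_superset:
  assumes "finite A" "keys m \<subseteq> A"
  shows "mev \<phi> m = (\<Prod>v\<in>A. \<phi> v ^ lookup m v)"
  unfolding mev_def using assms
  by (intro prod.mono_neutral_left) (auto simp: in_keys_iff)

lemma mev_add: "mev \<phi> (m + n) = mev \<phi> m * mev \<phi> n"
proof -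
  let ?A = "keys m \<union> keys n"
  have "keys (m + n) \<subseteq> ?A" by (rule keys_add)
  then show ?thesis
    by (simp add: mev_superset[of ?A] lookup_add power_add prod.distrib)
qed

lemma mev_0 [simp]: "mev \<phi> 0 = 1"
  by (simp add: mev_def)

lemma mev_single [simp]: "mev \<phi> (single v k) = \<phi> v ^ k"
  by (cases "k = 0") (auto simp: mev_def)

context
  fixes e :: "rat \<Rightarrow> 'b::comm_ring_1"
  assumes e: "ring_hom_on e"
begin

lemma psubst_add: "psubst e \<phi> (f + g) = psubst e \<phi> f + psubst e \<phi> g"
  unfolding psubst_def
  by (rule setsum_keys_plus_distrib) (auto simp: rh_zero[OF e] rh_add[OF e] algebra_simps)

lemma psubst_single: "psubst e \<phi> (single m c) = e c * mev \<phi> m"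
  by (auto simp: psubst_def mev_def rh_zero[OF e])

lemma psubst_0: "psubst e \<phi> 0 = 0"
  by (simp add: psubst_def)

lemma psubst_mult: "psubst e \<phi> (f * g) = psubst e \<phi> f * psubst e \<phi> g"
proof (induction f rule: pm_induct)
  case (single m c)
  show ?case
    by (induction g rule: pm_induct)
       (auto simp: psubst_0 psubst_single mult_single psubst_add algebra_simps rh_mult[OF e] mev_add)
qed (auto simp: psubst_0 psubst_add algebra_simps)

lemma ring_hom_on_psubst: "ring_hom_on (psubst e \<phi>)"
  by (rule ring_hom_onI)
     (auto simp: psubst_add psubst_mult psubst_single[of _ 0 1, simplified] rh_one[OF e])

lemma psubst_pvar: "psubst e \<phi> (pvar v) = \<phi> v"
  by (simp add: pvar_def psubst_single rh_one[OF e])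

lemma psubst_lconst: "psubst e \<phi> (lconst c) = e c"
  by (simp add: lconst_def psubst_single)

end

lemma psubst_cong:
  "(\<And>v. v \<in> pvars f \<Longrightarrow> \<phi> v = \<psi> v) \<Longrightarrow> psubst e \<phi> f = psubst e \<psi> f"
  unfolding psubst_def pvars_def
  by (intro sum.cong prod.cong arg_cong2[where f = "(*)"] arg_cong2[where f = "(^)"] refl) blast

lemma pvars_0 [simp]: "pvars 0 = {}"
  by (simp add: pvars_def)

lemma pvars_add: "pvars (f + g) \<subseteq> pvars f \<union> pvars g"
  using keys_add[of f g] by (auto simp: pvars_def)

lemma pvars_mult: "pvars (f * g) \<subseteq> pvars f \<union> pvars (g :: ('v \<Rightarrow>\<^sub>0 'e::comm_monoid_add) \<Rightarrow>\<^sub>0 'c::comm_ring_1)"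
proof
  fix v assume "v \<in> pvars (f * g)"
  then obtain m where m: "m \<in> keys (f * g)" "v \<in> keys m" by (auto simp: pvars_def)
  with keys_mult[of f g] obtain a b where "m = a + b" "a \<in> keys f" "b \<in> keys g" by auto
  with m keys_add[of a b] show "v \<in> pvars f \<union> pvars g" by (auto simp: pvars_def)
qed

lemma pvars_uminus [simp]: "pvars (- f) = pvars (f :: ('v \<Rightarrow>\<^sub>0 'e::zero) \<Rightarrow>\<^sub>0 'c::comm_ring_1)"
  by (simp add: pvars_def in_keys_iff[abs_def] set_eq_iff Poly_Mapping.in_keys_iff)

lemma pvars_single: "pvars (single m c) = (if c = 0 then {} else keys m)"
  by (simp add: pvars_def)

lemma pvars_lconst [simp]: "pvars (lconst c) = {}"
  by (simp add: lconst_def pvars_single)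

lemma pvars_1 [simp]: "pvars (1 :: ('v \<Rightarrow>\<^sub>0 'e::comm_monoid_add) \<Rightarrow>\<^sub>0 'c::comm_ring_1) = {}"
  by (simp add: pvars_def)

lemma pvars_pvar [simp]: "pvars (pvar v) = {v}"
  by (simp add: pvar_def pvars_single)

lemma finite_pvars [simp]: "finite (pvars f)"
  by (simp add: pvars_def)

lemma pvars_diff: "pvars (f - g) \<subseteq> pvars f \<union> pvars (g :: ('v \<Rightarrow>\<^sub>0 'e::zero) \<Rightarrow>\<^sub>0 'c::comm_ring_1)"
  using pvars_add[of f "- g"] by simp

section \<open>Subrings and ideals of an ambient ring\<close>

definition subring_set :: "'a::comm_ring_1 set \<Rightarrow> bool" where
  "subring_set S \<longleftrightarrow> 1 \<in> S \<and> (\<forall>a\<in>S. \<forall>b\<in>S. a - b \<in> S \<and> a * b \<in> S)"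

context
  fixes S :: "'a::comm_ring_1 set"
  assumes S: "subring_set S"
begin

lemma ss_one: "1 \<in> S" and ss_mult: "a \<in> S \<Longrightarrow> b \<in> S \<Longrightarrow> a * b \<in> S"
  and ss_diff: "a \<in> S \<Longrightarrow> b \<in> S \<Longrightarrow> a - b \<in> S"
  using S by (auto simp: subring_set_def)

lemma ss_zero: "0 \<in> S"
  using ss_diff[OF ss_one ss_one] by simp

lemma ss_uminus: "a \<in> S \<Longrightarrow> - a \<in> S"
  using ss_diff[OF ss_zero] by fastforce

lemma ss_add: "a \<in> S \<Longrightarrow> b \<in> S \<Longrightarrow> a + b \<in> S"
  using ss_diff[of a "- b"] ss_uminus by fastforce

lemma ss_sum: "(\<And>x. x \<in> A \<Longrightarrow> f x \<in> S) \<Longrightarrow> sum f A \<in> S"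
  by (induction A rule: infinite_finite_induct) (auto intro: ss_zero ss_add)

lemma ss_prod: "(\<And>x. x \<in> A \<Longrightarrow> f x \<in> S) \<Longrightarrow> prod f A \<in> S"
  by (induction A rule: infinite_finite_induct) (auto intro: ss_one ss_mult)

lemma ss_power: "a \<in> S \<Longrightarrow> a ^ k \<in> S"
  by (induction k) (auto intro: ss_one ss_mult)

lemma ss_psubst:
  assumes "\<And>c. e c \<in> S" "\<And>v. v \<in> pvars f \<Longrightarrow> \<phi> v \<in> S"
  shows "psubst e \<phi> f \<in> S"
  unfolding psubst_def using assms
  by (auto intro!: ss_sum ss_mult ss_prod ss_power simp: pvars_def)

lemma cring_subring_on: "cring (subring_on S)"
proof (rule cringI)
  show "abelian_group (subring_on S)"
  proof (rule abelian_groupI)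
    fix x assume "x \<in> carrier (subring_on S)"
    then show "\<exists>y\<in>carrier (subring_on S). y \<oplus>\<^bsub>subring_on S\<^esub> x = \<zero>\<^bsub>subring_on S\<^esub>"
      by (auto intro!: bexI[of _ "- x"] simp: subring_on_def ss_uminus)
  qed (auto simp: subring_on_def ss_add ss_zero add_ac)
  show "comm_monoid (subring_on S)"
    by (rule comm_monoidI) (auto simp: subring_on_def ss_mult ss_one mult_ac)
qed (auto simp: subring_on_def algebra_simps)

lemma ideal_subring_onD:
  assumes "ideal I (subring_on S)"
  shows "I \<subseteq> S" "0 \<in> I" "a \<in> I \<Longrightarrow> b \<in> I \<Longrightarrow> a + b \<in> I" "a \<in> I \<Longrightarrow> b \<in> I \<Longrightarrow> a - b \<in> I"
    "a \<in> I \<Longrightarrow> s \<in> S \<Longrightarrow> s * a \<in> I" "a \<in> I \<Longrightarrow> s \<in> S \<Longrightarrow> a * s \<in> I"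
proof -
  interpret ideal I "subring_on S" by fact
  show "I \<subseteq> S" using a_subset by (simp add: subring_on_def)
  show "0 \<in> I" using additive_subgroup.zero_closed[OF ideal.axioms(1)[OF assms]] by (simp add: subring_on_def)
  show add: "a \<in> I \<Longrightarrow> b \<in> I \<Longrightarrow> a + b \<in> I" for a b
    using additive_subgroup.a_closed[OF ideal.axioms(1)[OF assms], of a b] by (simp add: subring_on_def)
  show s: "a \<in> I \<Longrightarrow> s \<in> S \<Longrightarrow> s * a \<in> I" for a s
    using I_l_closed[of a s] by (simp add: subring_on_def)
  then show "a \<in> I \<Longrightarrow> s \<in> S \<Longrightarrow> a * s \<in> I" by (simp add: mult.commute)
  show "a \<in> I \<Longrightarrow> b \<in> I \<Longrightarrow> a - b \<in> I"
    using add[of a "-1 * b"] s[of b "-1"] ss_uminus[OF ss_one] by simp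
qed

lemma ideal_subring_onI:
  assumes "I \<subseteq> S" "0 \<in> I" "\<And>a b. a \<in> I \<Longrightarrow> b \<in> I \<Longrightarrow> a + b \<in> I"
    "\<And>a s. a \<in> I \<Longrightarrow> s \<in> S \<Longrightarrow> s * a \<in> I"
  shows "ideal I (subring_on S)"
proof (rule idealI)
  show "ring (subring_on S)" using cring_subring_on by (rule cring.axioms)
  interpret cring "subring_on S" by (rule cring_subring_on)
  show "subgroup I (add_monoid (subring_on S))"
  proof (rule add.subgroupI)
    fix a assume a: "a \<in> I"
    have "\<ominus>\<^bsub>subring_on S\<^esub> a = - a"
      by (rule minus_equality) (use a assms(1) in \<open>auto simp: subring_on_def ss_uminus\<close>)
    then show "\<ominus>\<^bsub>subring_on S\<^esub> a \<in> I"
      using assms(4)[OF a, of "-1"] ss_uminus[OF ss_one] by simp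
  qed (use assms in \<open>auto simp: subring_on_def\<close>)
qed (use assms in \<open>auto simp: subring_on_def mult.commute\<close>)

lemma genideal_subring_on_eq:
  "Idl\<^bsub>subring_on S\<^esub> X = \<Inter>{I. ideal I (subring_on S) \<and> X \<subseteq> I}"
  by (simp add: genideal_def)

lemma dvd_in_subring_on:
  "a divides\<^bsub>subring_on S\<^esub> b \<longleftrightarrow> (\<exists>c\<in>S. b = a * c)"
  by (auto simp: factor_def subring_on_def)

lemma Units_subring_on: "u \<in> Units (subring_on S) \<longleftrightarrow> u \<in> S \<and> (\<exists>v\<in>S. u * v = 1)"
  by (auto simp: Units_def subring_on_def mult.commute)

text \<open>Powers and products are compared factor by factor. Serves the elimination arguments:
  modulo the ideal of a system, a distinguished coefficient may be replaced by the expression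
  obtained from solving its polynomial for it.\<close>

lemma psubst_cong_ideal:
  assumes e: "ring_hom_on e" and eS: "\<And>c. e c \<in> S"
    and I: "ideal I (subring_on S)"
    and v: "\<And>v. v \<in> pvars f \<Longrightarrow> \<phi> v \<in> S \<and> \<psi> v \<in> S \<and> \<phi> v - \<psi> v \<in> I"
  shows "psubst e \<phi> f - psubst e \<psi> f \<in> I"
proof -
  note ID = ideal_subring_onD[OF I]
  have pow: "a ^ k - b ^ k \<in> I" if "a \<in> S" "b \<in> S" "a - b \<in> I" for a b k
  proof (induction k)
    case (Suc k)
    have "a ^ Suc k - b ^ Suc k = a * (a ^ k - b ^ k) + (a - b) * b ^ k" by (simp add: algebra_simps)
    then show ?case using Suc that by (simp add: ID(3) ID(5) ID(6) ss_power)
  qed (simp add: ID(2))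
  have prod: "(\<Prod>x\<in>A. p x) - (\<Prod>x\<in>A. q x) \<in> I"
    if "finite A" "\<And>x. x \<in> A \<Longrightarrow> p x \<in> S \<and> q x \<in> S \<and> p x - q x \<in> I" for A and p q :: "'x \<Rightarrow> 'a"
    using that
  proof (induction A)
    case (insert x A)
    have "(\<Prod>x\<in>insert x A. p x) - (\<Prod>x\<in>insert x A. q x)
        = p x * ((\<Prod>x\<in>A. p x) - (\<Prod>x\<in>A. q x)) + (p x - q x) * (\<Prod>x\<in>A. q x)"
      using insert by (simp add: algebra_simps)
    then show ?case using insert by (simp add: ID(3) ID(5) ID(6) ss_prod)
  qed (simp add: ID(2))
  have sum: "(\<Sum>x\<in>A. p x) \<in> I" if "\<And>x. x \<in> A \<Longrightarrow> p x \<in> I" for A and p :: "'x \<Rightarrow> 'a"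
    using that by (induction A rule: infinite_finite_induct) (auto simp: ID)
  have "psubst e \<phi> f - psubst e \<psi> f = (\<Sum>m\<in>keys f. e (lookup f m) * (mev \<phi> m - mev \<psi> m))"
    by (simp add: psubst_def mev_def sum_subtractf[symmetric] algebra_simps)
  also have "\<dots> \<in> I"
    using v by (auto intro!: sum ID(5) eS prod pow ss_power simp: mev_def pvars_def)
  finally show ?thesis .
qed

end

lemma subring_pvars: "subring_set {f :: ('v \<Rightarrow>\<^sub>0 'e::comm_monoid_add) \<Rightarrow>\<^sub>0 'c::comm_ring_1. pvars f \<subseteq> X}"
proof -
  have "pvars (a * b) \<subseteq> X" "pvars (a - b) \<subseteq> X" if "pvars a \<subseteq> X" "pvars b \<subseteq> X"
    for a b :: "('v \<Rightarrow>\<^sub>0 'e) \<Rightarrow>\<^sub>0 'c"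
    using that pvars_mult[of a b] pvars_diff[of a b] by (auto dest: subsetD)
  then show ?thesis by (simp add: subring_set_def)
qed

lemma subring_polys_in: "subring_set (polys_in X)"
  unfolding polys_in_def by (rule subring_pvars)

lemma lconst_in_polys_in [simp]: "lconst c \<in> polys_in X"
  by (simp add: polys_in_def)

lemma pvar_in_polys_in [simp]: "pvar v \<in> polys_in X \<longleftrightarrow> v \<in> X"
  by (simp add: polys_in_def)

lemma single_eq_mev: "single m c = lconst c * mev pvar m"
proof (induction m arbitrary: c rule: pm_induct)
  case (single v k)
  have "single (single v k) c = lconst c * pvar v ^ k" for c :: rat
  proof (induction k arbitrary: c)
    case (Suc k)
    have "single (single v (Suc k)) c = single (single v k) c * pvar v"
      by (simp add: pvar_def mult_single flip: single_add)
    with Suc show ?case by (simp add: mult_ac)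
  qed (simp add: lconst_def)
  then show ?case by simp
next
  case (add f g)
  have "single (f + g) c = single f 1 * single g c" by (simp add: mult_single)
  with add show ?case by (simp add: mev_add lconst_1 mult_ac)
qed (simp add: lconst_def)

text \<open>Universal property of the polynomial ring; compositions of substitutions, codings and
  specializations are identified through their values on constants and variables.\<close>

lemma hom_psubst:
  assumes "ring_hom_on H"
  shows "H f = psubst (\<lambda>c. H (lconst c)) (\<lambda>v. H (pvar v)) f"
proof -
  have e: "ring_hom_on (\<lambda>c. H (lconst c))"
    by (rule ring_hom_on_comp[OF ring_hom_on_lconst assms])
  show ?thesis
  proof (induction f rule: pm_induct)
    case (single m c)
    show ?case
      by (subst single_eq_mev)
         (simp add: psubst_single[OF e] rh_mult[OF assms] mev_def rh_prod[OF assms] rh_power[OF assms])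
  qed (simp_all add: rh_zero[OF assms] rh_add[OF assms] psubst_0[OF e] psubst_add[OF e])
qed

lemma hom_psubst_comp:
  assumes H: "ring_hom_on H" and e: "ring_hom_on e"
  shows "H (psubst e \<phi> f) = psubst (\<lambda>c. H (e c)) (\<lambda>v. H (\<phi> v)) f"
  using hom_psubst[OF ring_hom_on_comp[OF ring_hom_on_psubst[OF e] H], of \<phi> f]
  by (simp add: psubst_lconst[OF e] psubst_pvar[OF e])

lemma psubst_id: "psubst lconst pvar f = f"
  using hom_psubst[OF ring_hom_on_id, of f] by simp

text \<open>Induction over the ring operations instead of the terms, for claims whose product step
  is the essential one, such as the chain rule and the elimination of a leading variable.\<close>

lemma polys_in_induct [consumes 1, case_names const var add mult]:
  assumes f: "f \<in> polys_in X"
    and "\<And>c. P (lconst c)" "\<And>v. v \<in> X \<Longrightarrow> P (pvar v)"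
    and "\<And>f g. f \<in> polys_in X \<Longrightarrow> g \<in> polys_in X \<Longrightarrow> P f \<Longrightarrow> P g \<Longrightarrow> P (f + g)"
    and "\<And>f g. f \<in> polys_in X \<Longrightarrow> g \<in> polys_in X \<Longrightarrow> P f \<Longrightarrow> P g \<Longrightarrow> P (f * g)"
  shows "P f"
proof -
  note S = subring_polys_in[of X]
  have one: "P 1" using assms(2)[of 1] by (simp add: lconst_1)
  have zero: "P 0" using assms(2)[of 0] by (simp add: lconst_0)
  have "P (\<Sum>m\<in>A. lconst (lookup f m) * mev pvar m) \<and> (\<Sum>m\<in>A. lconst (lookup f m) * mev pvar m) \<in> polys_in X"
    if "finite A" "A \<subseteq> keys f" for A
    using that
  proof induction
    case (insert m A)
    have kX: "keys m \<subseteq> X" using insert f by (auto simp: polys_in_def pvars_def)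
    have pow: "P (pvar v ^ k) \<and> pvar v ^ k \<in> polys_in X" if "v \<in> X" for v k
      by (induction k) (use that in \<open>auto intro: one ss_one[OF S] assms ss_mult[OF S]\<close>)
    have "P (\<Prod>v\<in>B. pvar v ^ lookup m v) \<and> (\<Prod>v\<in>B. pvar v ^ lookup m v) \<in> polys_in X" if "finite B" "B \<subseteq> X" for B
      using that by induction (use pow in \<open>auto intro: one ss_one[OF S] assms ss_mult[OF S]\<close>)
    from this[of "keys m"] kX have "P (mev pvar m)" "mev pvar m \<in> polys_in X" by (auto simp: mev_def)
    then show ?case using insert by (auto intro!: assms ss_mult[OF S] ss_add[OF S])
  qed (auto intro: zero ss_zero[OF S])
  from this[of "keys f"] show ?thesis
    by (subst pm_expand) (simp add: single_eq_mev)
qed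

hide_const (open) up_ring.coeff up_ring.monom

section \<open>Partial derivatives, derivations and the chain rule\<close>

lemma pdiff_add: "pdiff v (f + g) = pdiff v f + pdiff v g"
  unfolding pdiff_def
  by (rule setsum_keys_plus_distrib) (auto simp: single_add algebra_simps)

lemma pdiff_0 [simp]: "pdiff v 0 = 0"
  by (simp add: pdiff_def)

lemma pdiff_single:
  "pdiff v (single m c) = single (m - single v 1) (of_nat (lookup m v) * c)"
  by (cases "c = 0") (auto simp: pdiff_def)

text \<open>Subtraction of natural exponents truncates at 0; a positive exponent of \<open>v\<close>
  is what lets it commute with addition.\<close>

lemma pm_minus_single_add:
  assumes "lookup m v \<noteq> (0::nat)"
  shows "m - single v 1 + n = m + n - single v 1"
  by (rule poly_mapping_eqI) (use assms in \<open>auto simp: lookup_add lookup_minus lookup_single when_def\<close>)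

lemma pdiff_mult: "pdiff v (f * g) = pdiff v f * g + f * pdiff v g"
proof (induction f rule: pm_induct)
  case (single m a)
  show ?case
  proof (induction g rule: pm_induct)
    case (single n b)
    \<comment> \<open>If \<open>v\<close> is absent from \<open>m\<close>, truncation may make the
      exponents differ, but the factor \<open>of_nat 0\<close> removes both sides.\<close>
    have 1: "single (m - single v 1 + n) (of_nat (lookup m v) * a * b)
        = single (m + n - single v 1) (of_nat (lookup m v) * a * b)"
      by (cases "lookup m v = 0") (simp_all add: pm_minus_single_add del: One_nat_def)
    have 2: "single (m + (n - single v 1)) (a * (of_nat (lookup n v) * b))
        = single (m + n - single v 1) (a * (of_nat (lookup n v) * b))"
      using pm_minus_single_add[of n v m]
      by (cases "lookup n v = 0") (simp_all add: add.commute)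
    show ?case
      by (simp only: mult_single pdiff_single 1 2 lookup_add flip: single_add)
         (simp add: algebra_simps)
  qed (simp_all add: pdiff_add algebra_simps)
qed (simp_all add: pdiff_add algebra_simps)

lemma pdiff_lconst [simp]: "pdiff v (lconst c) = 0"
  by (simp add: lconst_def pdiff_single)

lemma pdiff_pvar: "pdiff v (pvar w) = (if v = w then 1 else 0)"
  by (auto simp: pvar_def pdiff_single lookup_single)

definition derivation :: "('a::comm_ring_1 \<Rightarrow> 'a) \<Rightarrow> bool" where
  "derivation D \<longleftrightarrow> (\<forall>a b. D (a + b) = D a + D b) \<and> (\<forall>a b. D (a * b) = D a * b + a * D b)"

lemma derivationI:
  "(\<And>a b. D (a + b) = D a + D b) \<Longrightarrow> (\<And>a b. D (a * b) = D a * b + a * D b) \<Longrightarrow> derivation D"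
  by (simp add: derivation_def)

context
  fixes D :: "'a::comm_ring_1 \<Rightarrow> 'a"
  assumes D: "derivation D"
begin

lemma deriv_add: "D (a + b) = D a + D b" and deriv_mult: "D (a * b) = D a * b + a * D b"
  using D by (auto simp: derivation_def)

lemma deriv_zero: "D 0 = 0"
  using deriv_add[of 0 0] by simp

lemma deriv_one: "D 1 = 0"
  using deriv_mult[of 1 1] by simp

lemma deriv_uminus: "D (- a) = - D a"
  using deriv_add[of a "- a"] deriv_zero by (simp add: eq_neg_iff_add_eq_0 add.commute)

lemma deriv_diff: "D (a - b) = D a - D b"
  using deriv_add[of a "- b"] deriv_uminus by simp

lemma deriv_sum: "D (sum f A) = (\<Sum>x\<in>A. D (f x))"
  by (induction A rule: infinite_finite_induct) (auto simp: deriv_zero deriv_add)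

end

text \<open>Stated for an arbitrary derivation that kills the constants, since it is applied to
  \<open>theta\<close>, hence to \<open>ugrad\<close>, and to \<open>D0\<close>. The index set
  \<open>V\<close> may exceed \<open>pvars f\<close>, so that it can be a fixed set prepared in
  advance.\<close>

lemma psubst_chain:
  assumes D: "derivation D" and e: "ring_hom_on e" and De: "\<And>c. D (e c) = 0"
    and V: "finite V" "pvars f \<subseteq> V"
  shows "D (psubst e \<phi> f) = (\<Sum>v\<in>V. psubst e \<phi> (pdiff v f) * D (\<phi> v))"
proof -
  have "f \<in> polys_in V" using V by (simp add: polys_in_def)
  then show ?thesis
  proof (induction f rule: polys_in_induct)
    case (const c)
    then show ?case by (simp add: psubst_lconst[OF e] De psubst_0[OF e])
  next
    case (var v)
    have "(\<Sum>w\<in>V. psubst e \<phi> (pdiff w (pvar v)) * D (\<phi> w)) = (\<Sum>w\<in>V. if w = v then D (\<phi> w) else 0)"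
      by (intro sum.cong refl)
         (simp add: pdiff_pvar psubst_0[OF e] rh_one[OF ring_hom_on_psubst[OF e]])
    then show ?case using var V by (simp add: psubst_pvar[OF e] sum.delta)
  next
    case (add f g)
    then show ?case
      by (simp add: psubst_add[OF e] pdiff_add deriv_add[OF D] sum.distrib algebra_simps)
  next
    case (mult f g)
    then show ?case
      by (simp add: psubst_add[OF e] psubst_mult[OF e] pdiff_mult deriv_mult[OF D] sum.distrib
          sum_distrib_left sum_distrib_right algebra_simps)
  qed
qed

lemma pvars_pdiff: "pvars (pdiff v f) \<subseteq> pvars f"
proof
  fix w assume "w \<in> pvars (pdiff v f)"
  then obtain k where k: "k \<in> keys (pdiff v f)" "w \<in> keys k" by (auto simp: pvars_def)
  then obtain m where m: "m \<in> keys f" "k \<in> keys (single (m - single v 1) (of_nat (lookup m v) * lookup f m))"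
    using keys_sum unfolding pdiff_def by fastforce
  then have "k = m - single v 1" by (auto split: if_splits)
  with k have "w \<in> keys m" by (auto simp: in_keys_iff lookup_minus)
  with m show "w \<in> pvars f" by (auto simp: pvars_def)
qed

lemma lookup_pdiff: "lookup (pdiff v f) m = of_nat (Suc (lookup m v)) * lookup f (m + single v 1)"
proof (induction f rule: pm_induct)
  case (single n c)
  show ?case
  proof (cases "lookup n v = 0")
    case True
    then have "n \<noteq> m + single v 1" by (auto simp: lookup_add)
    with True show ?thesis by (simp add: pdiff_single lookup_single)
  next
    case False
    have "n - single v 1 = m \<longleftrightarrow> n = m + single v 1"
    proof
      assume "n - single v 1 = m"
      then have "m + single v 1 = n - single v 1 + single v 1" by simp
      also have "\<dots> = n" using pm_minus_single_add[OF False, of "single v 1"] by simp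
      finally show "n = m + single v 1" by simp
    qed simp
    then show ?thesis
      by (auto simp: pdiff_single lookup_single when_def lookup_add)
  qed
qed (simp_all add: pdiff_add lookup_add algebra_simps)

text \<open>Characteristic zero: a monomial that contains \<open>v\<close> keeps a coefficient that
  is a positive multiple of the old one.\<close>

lemma pdiff_nonzero: "v \<in> pvars f \<Longrightarrow> pdiff v f \<noteq> 0"
proof
  assume "v \<in> pvars f" and 0: "pdiff v f = 0"
  then obtain m where m: "m \<in> keys f" "v \<in> keys m" by (auto simp: pvars_def)
  let ?m = "m - single v 1"
  have "?m + single v 1 = m"
    using m pm_minus_single_add[of m v "single v 1"] by (simp add: in_keys_iff)
  then have "lookup (pdiff v f) ?m = of_nat (Suc (lookup ?m v)) * lookup f m"
    by (simp only: lookup_pdiff)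
  moreover have "lookup f m \<noteq> 0" using m by (simp add: in_keys_iff)
  ultimately show False using 0 by (simp del: of_nat_Suc)
qed

text \<open>Degree in the variables of \<open>A\<close> alone: \<open>A\<close> is
  \<open>UNIV\<close> for relations of least degree, a singleton for the degree in a leader, and the
  set of the variables whose coefficients are extracted in
  \<open>relative_independence\<close>.\<close>

definition deg_le :: "'v set \<Rightarrow> nat \<Rightarrow> 'v qpoly \<Rightarrow> bool" where
  "deg_le A n f \<longleftrightarrow> (\<forall>m\<in>keys f. (\<Sum>v\<in>keys m \<inter> A. lookup m v) \<le> n)"

lemma deg_le_exists: "\<exists>n. deg_le A n f"
proof -
  have "deg_le A (\<Sum>m\<in>keys f. \<Sum>v\<in>keys m \<inter> A. lookup m v) f"
    unfolding deg_le_def by (auto intro: member_le_sum)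
  then show ?thesis ..
qed

lemma deg_le_pdiff:
  assumes "deg_le A (Suc n) f" "v \<in> A"
  shows "deg_le A n (pdiff v f)"
  unfolding deg_le_def
proof
  fix m assume "m \<in> keys (pdiff v f)"
  then have "m + single v 1 \<in> keys f" by (auto simp: in_keys_iff lookup_pdiff)
  with assms have le: "(\<Sum>w\<in>keys (m + single v 1) \<inter> A. lookup (m + single v 1) w) \<le> Suc n"
    by (auto simp: deg_le_def)
  have k: "keys (m + single v 1) = insert v (keys m)"
    by (auto simp: in_keys_iff lookup_add lookup_single when_def split: if_splits)
  have "(\<Sum>w\<in>keys (m + single v 1) \<inter> A. lookup (m + single v 1) w)
      = (\<Sum>w\<in>insert v (keys m \<inter> A). lookup m w + (if w = v then 1 else 0))"
  proof -
    have "keys (m + single v 1) \<inter> A = insert v (keys m \<inter> A)" unfolding k using assms by auto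
    then show ?thesis by (simp only:) (intro sum.cong, auto simp: lookup_add lookup_single when_def)
  qed
  also have "\<dots> = (\<Sum>w\<in>insert v (keys m \<inter> A). lookup m w) + 1"
    by (subst sum.distrib) (simp add: sum.delta)
  also have "(\<Sum>w\<in>insert v (keys m \<inter> A). lookup m w) \<ge> (\<Sum>w\<in>keys m \<inter> A. lookup m w)"
    by (rule sum_mono2) auto
  ultimately show "(\<Sum>w\<in>keys m \<inter> A. lookup m w) \<le> n" using le by simp
qed

lemma deg_le_0:
  assumes "deg_le A 0 f" shows "pvars f \<inter> A = {}"
  using assms by (force simp: deg_le_def pvars_def in_keys_iff)

subsection \<open>Polynomials as univariate polynomials\<close>

text \<open>The coefficients keep the type of \<open>f\<close>, so that variables can be split off
  one after the other; evaluation at \<open>pvar x\<close> inverts the construction.\<close>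

definition uni :: "'v \<Rightarrow> 'v qpoly \<Rightarrow> 'v qpoly poly" where
  "uni x f = psubst (\<lambda>c. [:lconst c:]) (\<lambda>v. if v = x then [:0, 1:] else [:pvar v:]) f"

lemma ring_hom_on_C: "ring_hom_on (\<lambda>c. [:lconst c:])"
  by (rule ring_hom_onI) (auto simp: lconst_1 lconst_add lconst_mult)

lemma ring_hom_on_uni: "ring_hom_on (uni x)"
  unfolding uni_def by (rule ring_hom_on_psubst[OF ring_hom_on_C])

lemma uni_pvar: "uni x (pvar v) = (if v = x then [:0, 1:] else [:pvar v:])"
  by (simp add: uni_def psubst_pvar[OF ring_hom_on_C])

lemma poly_uni: "poly (uni x f) (pvar x) = f"
proof -
  have H: "ring_hom_on (\<lambda>p. poly p (pvar x))" by (rule ring_hom_onI) auto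
  have "poly (uni x f) (pvar x) = psubst lconst pvar f"
    unfolding uni_def hom_psubst_comp[OF H ring_hom_on_C]
    by (simp cong: if_cong) (rule psubst_cong, auto)
  then show ?thesis by (simp add: psubst_id)
qed

lemma uni_0 [simp]: "uni x 0 = 0"
  by (rule rh_zero[OF ring_hom_on_uni])

lemma uni_eq_0_iff: "uni x f = 0 \<longleftrightarrow> f = 0"
  by (metis uni_0 poly_uni poly_0)

definition polys_over :: "'a::comm_ring_1 set \<Rightarrow> 'a poly set" where
  "polys_over B = {p. \<forall>i. coeff p i \<in> B}"

lemma subring_polys_over:
  assumes B: "subring_set B"
  shows "subring_set (polys_over B)"
  unfolding subring_set_def polys_over_def
  by (auto simp: coeff_mult intro!: ss_sum[OF B] ss_mult[OF B] ss_diff[OF B])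
     (auto simp: coeff_pCons split: nat.split intro: ss_one[OF B] ss_zero[OF B])

lemma const_in_polys_over [simp]: "subring_set B \<Longrightarrow> [:b:] \<in> polys_over B \<longleftrightarrow> b \<in> B"
  by (auto simp: polys_over_def coeff_pCons split: nat.split intro: ss_zero dest: spec[of _ 0])

lemma X_in_polys_over: "subring_set B \<Longrightarrow> [:0, 1:] \<in> polys_over B"
  by (auto simp: polys_over_def coeff_pCons split: nat.split intro: ss_zero ss_one)

lemma uni_in_polys_over:
  assumes "f \<in> polys_in X"
  shows "uni x f \<in> polys_over (polys_in (X - {x}))"
  unfolding uni_def using assms[unfolded polys_in_def]
  by (intro ss_psubst[OF subring_polys_over[OF subring_polys_in]])
     (auto simp: X_in_polys_over[OF subring_polys_in] subring_polys_in)

lemma uni_const: "x \<notin> pvars f \<Longrightarrow> uni x f = [:f:]"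
proof -
  assume "x \<notin> pvars f"
  then have "uni x f = psubst (\<lambda>c. [:lconst c:]) (\<lambda>v. [:pvar v:]) f"
    unfolding uni_def by (intro psubst_cong) auto
  also have "\<dots> = [:f:]"
    using hom_psubst[of "\<lambda>f. [:f:]" f]
    by (simp add: ring_hom_on_def)
  finally show ?thesis .
qed

lemma uni_poly:
  assumes "p \<in> polys_over (polys_in X)" "x \<notin> X"
  shows "uni x (poly p (pvar x)) = p"
proof -
  note U = ring_hom_on_uni[of x]
  have c: "uni x (coeff p i) = [:coeff p i:]" for i
    using assms by (intro uni_const) (auto simp: polys_over_def polys_in_def)
  have "uni x (poly p (pvar x)) = (\<Sum>i\<le>degree p. [:coeff p i:] * [:0, 1:] ^ i)"
    by (simp add: poly_altdef rh_sum[OF U] rh_mult[OF U] rh_power[OF U] uni_pvar c)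
  also have "\<dots> = (\<Sum>i\<le>degree p. monom (coeff p i) i)"
    by (intro sum.cong refl) (simp add: monom_altdef)
  also have "\<dots> = p" by (simp add: poly_as_sum_of_monoms)
  finally show ?thesis .
qed

lemma poly_in_polys_in:
  assumes "p \<in> polys_over (polys_in X)" "x \<in> Y" "X \<subseteq> Y"
  shows "poly p (pvar x) \<in> polys_in Y"
  unfolding poly_altdef using assms
  by (intro ss_sum[OF subring_polys_in] ss_mult[OF subring_polys_in] ss_power[OF subring_polys_in])
     (auto simp: polys_over_def polys_in_def)

lemma degree_uni_0_iff: "degree (uni x f) = 0 \<longleftrightarrow> x \<notin> pvars f"
proof
  assume "degree (uni x f) = 0"
  then obtain b where b: "uni x f = [:b:]" by (rule degree_eq_zeroE)
  have "uni x f \<in> polys_over (polys_in (pvars f - {x}))"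
    by (rule uni_in_polys_over) (simp add: polys_in_def)
  then have "b \<in> polys_in (pvars f - {x})" by (simp add: b subring_polys_in)
  moreover have "f = b" using poly_uni[of x f] by (simp add: b)
  ultimately show "x \<notin> pvars f" by (auto simp: polys_in_def)
qed (simp add: uni_const)

lemma coeff_uni: "coeff (uni x f) k
  = (\<Sum>m\<in>{m\<in>keys f. lookup m x = k}. single (m - single x k) (lookup f m))"
proof -
  note U = ring_hom_on_uni[of x]
  have *: "uni x (single m c) = monom (single (m - single x (lookup m x)) c) (lookup m x)" for m c
  proof -
    let ?n = "m - single x (lookup m x)"
    have "m = ?n + single x (lookup m x)"
      by (rule poly_mapping_eqI) (auto simp: lookup_add lookup_minus lookup_single when_def)
    then have "single m c = single ?n c * single (single x (lookup m x)) 1"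
      by (simp add: mult_single)
    also have "single (single x (lookup m x)) 1 = pvar x ^ lookup m x"
      by (simp add: single_eq_mev lconst_1)
    finally have "uni x (single m c) = uni x (single ?n c) * [:0, 1:] ^ lookup m x"
      by (simp add: rh_mult[OF U] rh_power[OF U] uni_pvar)
    also have "uni x (single ?n c) = [:single ?n c:]"
      by (rule uni_const) (auto simp: pvars_single in_keys_iff lookup_minus)
    finally show ?thesis by (simp add: monom_altdef)
  qed
  have "uni x f = (\<Sum>m\<in>keys f. monom (single (m - single x (lookup m x)) (lookup f m)) (lookup m x))"
    by (subst (1) pm_expand) (simp add: rh_sum[OF U] *)
  then have "coeff (uni x f) k
      = (\<Sum>m\<in>keys f. if lookup m x = k then single (m - single x k) (lookup f m) else 0)"
    by (auto simp: coeff_sum intro!: sum.cong)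
  also have "\<dots> = (\<Sum>m\<in>{m\<in>keys f. lookup m x = k}. single (m - single x k) (lookup f m))"
    by (simp add: sum.inter_filter)
  finally show ?thesis .
qed

text \<open>No cancellation: monomials with the same exponent of \<open>x\<close> remain distinct
  after the power of \<open>x\<close> has been removed, so every exponent of \<open>x\<close> in
  \<open>f\<close> shows up as a nonzero coefficient.\<close>

lemma pdeg_eq: "f \<noteq> 0 \<Longrightarrow> pdeg x f = degree (uni x f)"
proof -
  assume f: "f \<noteq> 0"
  have coeff0: "coeff (uni x f) k \<noteq> 0" if "m \<in> keys f" "lookup m x = k" for m k
  proof
    assume 0: "coeff (uni x f) k = 0"
    have "lookup (coeff (uni x f) k) (m - single x k)
      = (\<Sum>m'\<in>{m\<in>keys f. lookup m x = k}. if m' = m then lookup f m else 0)"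
      unfolding coeff_uni lookup_sum
    proof (intro sum.cong refl)
      fix m' assume m': "m' \<in> {m\<in>keys f. lookup m x = k}"
      have "m' - single x k = m - single x k \<longleftrightarrow> m' = m"
      proof
        assume eq: "m' - single x k = m - single x k"
        have "lookup m' v = lookup m v" for v
          using arg_cong[OF eq, of "\<lambda>p. lookup p v"] m' that
          by (cases "v = x") (auto simp: lookup_minus lookup_single when_def)
        then show "m' = m" by (rule poly_mapping_eqI)
      qed simp
      then show "lookup (single (m' - single x k) (lookup f m')) (m - single x k) = (if m' = m then lookup f m else 0)"
        by (auto simp: lookup_single when_def)
    qed
    also have "\<dots> = lookup f m" using that by (subst sum.delta) auto
    finally show False using 0 that by (simp add: in_keys_iff)
  qed
  have le: "lookup m x \<le> degree (uni x f)" if "m \<in> keys f" for m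
    using coeff0[OF that refl] by (rule le_degree)
  have ne: "keys f \<noteq> {}" using f by simp
  have "\<exists>m\<in>keys f. lookup m x = degree (uni x f)"
  proof (rule ccontr)
    assume "\<not> ?thesis"
    then have "coeff (uni x f) (degree (uni x f)) = 0" unfolding coeff_uni by (intro sum.neutral) auto
    with f show False by (simp add: uni_eq_0_iff)
  qed
  then have "degree (uni x f) \<in> (\<lambda>m. lookup m x) ` keys f" by (metis image_eqI)
  with le show ?thesis unfolding pdeg_def by (intro Max_eqI) auto
qed

lemma plcoeff_eq: "f \<noteq> 0 \<Longrightarrow> plcoeff x f = lead_coeff (uni x f)"
  by (simp add: plcoeff_def coeff_uni pdeg_eq)

section \<open>Divisibility, primes and factoriality relative to a subring\<close>

definition dvd_in :: "'a::comm_ring_1 set \<Rightarrow> 'a \<Rightarrow> 'a \<Rightarrow> bool" where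
  "dvd_in S a b \<longleftrightarrow> (\<exists>c\<in>S. b = a * c)"

definition unit_in :: "'a::comm_ring_1 set \<Rightarrow> 'a \<Rightarrow> bool" where
  "unit_in S u \<longleftrightarrow> u \<in> S \<and> (\<exists>v\<in>S. u * v = 1)"

definition prime_in :: "'a::comm_ring_1 set \<Rightarrow> 'a \<Rightarrow> bool" where
  "prime_in S p \<longleftrightarrow> p \<in> S \<and> p \<noteq> 0 \<and> \<not> unit_in S p \<and>
     (\<forall>f\<in>S. \<forall>g\<in>S. dvd_in S p (f * g) \<longrightarrow> dvd_in S p f \<or> dvd_in S p g)"

text \<open>Factorizations into prime rather than irreducible elements, from which uniqueness
  follows.\<close>

definition ufd_in :: "'a::comm_ring_1 set \<Rightarrow> bool" where
  "ufd_in S \<longleftrightarrow> (\<forall>f\<in>S. f \<noteq> 0 \<longrightarrow>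
     (\<exists>u zs. unit_in S u \<and> (\<forall>p\<in>set zs. prime_in S p) \<and> f = u * prod_list zs))"

lemma prime_inD:
  "prime_in S p \<Longrightarrow> f \<in> S \<Longrightarrow> g \<in> S \<Longrightarrow> dvd_in S p (f * g) \<Longrightarrow> dvd_in S p f \<or> dvd_in S p g"
  by (auto simp: prime_in_def)

lemma unit_in_mult:
  assumes S: "subring_set S" and "unit_in S u" "unit_in S v"
  shows "unit_in S (u * v)"
proof -
  from assms(2,3) obtain a b where "u * a = 1" "v * b = 1" "a \<in> S" "b \<in> S" "u \<in> S" "v \<in> S"
    by (auto simp: unit_in_def)
  then have "(u * v) * (a * b) = 1" by (metis mult.assoc mult.left_commute mult_1_right)
  with \<open>a \<in> S\<close> \<open>b \<in> S\<close> \<open>u \<in> S\<close> \<open>v \<in> S\<close> show ?thesis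
    by (auto simp: unit_in_def intro!: ss_mult[OF S] bexI[of _ "a * b"])
qed

lemma unit_in_one: "subring_set S \<Longrightarrow> unit_in S 1"
  by (auto simp: unit_in_def intro: ss_one bexI[of _ 1])

lemma prod_list_in: "subring_set S \<Longrightarrow> (\<And>p. p \<in> set zs \<Longrightarrow> p \<in> S) \<Longrightarrow> prod_list zs \<in> S"
  by (induction zs) (auto intro: ss_one ss_mult)

text \<open>Irreducibility turns the cofactor of the first prime factor into a unit, so that
  \<open>f\<close> is associated to that prime.\<close>

lemma ufd_irreducible_prime:
  fixes S :: "'a::idom set"
  assumes S: "subring_set S" and "ufd_in S" and f: "f \<in> S" "f \<noteq> 0" "\<not> unit_in S f"
    and irr: "\<And>a b. a \<in> S \<Longrightarrow> b \<in> S \<Longrightarrow> f = a * b \<Longrightarrow> unit_in S a \<or> unit_in S b"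
  shows "prime_in S f"
proof -
  obtain u zs where u: "unit_in S u" and zs: "\<forall>p\<in>set zs. prime_in S p" and fu: "f = u * prod_list zs"
    using \<open>ufd_in S\<close> f by (auto simp: ufd_in_def)
  have uS: "u \<in> S" using u by (simp add: unit_in_def)
  obtain p qs where pq: "zs = p # qs"
    using f u fu by (cases zs) auto
  have p: "prime_in S p" and qS: "prod_list qs \<in> S"
    using zs by (auto simp: pq prime_in_def intro!: prod_list_in[OF S])
  have "unit_in S (u * prod_list qs)"
    using irr[of p "u * prod_list qs"] p uS qS fu
    by (auto simp: pq prime_in_def mult_ac intro: ss_mult[OF S])
  then obtain w where w: "w \<in> S" "u * prod_list qs * w = 1" by (auto simp: unit_in_def)
  have pf: "p = f * w" using w fu by (simp add: pq mult_ac)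
  have fp: "f = p * (u * prod_list qs)" by (simp add: fu pq mult_ac)
  have "dvd_in S f a \<longleftrightarrow> dvd_in S p a" for a
  proof
    assume "dvd_in S f a"
    then obtain c where "c \<in> S" "a = f * c" by (auto simp: dvd_in_def)
    then have "a = p * (u * prod_list qs * c)" "u * prod_list qs * c \<in> S"
      using fp uS qS by (auto simp: mult_ac intro!: ss_mult[OF S])
    then show "dvd_in S p a" by (auto simp: dvd_in_def)
  next
    assume "dvd_in S p a"
    then obtain c where "c \<in> S" "a = p * c" by (auto simp: dvd_in_def)
    then have "a = f * (w * c)" "w * c \<in> S"
      using pf w by (auto simp: mult_ac intro!: ss_mult[OF S])
    then show "dvd_in S f a" by (auto simp: dvd_in_def)
  qed
  with p f show ?thesis by (simp add: prime_in_def)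
qed

subsection \<open>Gauss's lemma\<close>

context
  fixes B :: "'a::idom set"
  assumes B: "subring_set B" and ufd: "ufd_in B"
begin

private lemma PB: "subring_set (polys_over B)"
  by (rule subring_polys_over[OF B])

private lemma coeff_in: "p \<in> polys_over B \<Longrightarrow> coeff p i \<in> B"
  by (simp add: polys_over_def)

private lemma dvd_in_const:
  assumes "f \<in> polys_over B"
  shows "dvd_in (polys_over B) [:b:] f \<longleftrightarrow> (\<forall>i. dvd_in B b (coeff f i))"
proof
  assume "dvd_in (polys_over B) [:b:] f"
  then show "\<forall>i. dvd_in B b (coeff f i)" by (auto simp: dvd_in_def polys_over_def)
next
  assume *: "\<forall>i. dvd_in B b (coeff f i)"
  then obtain c where c: "\<And>i. c i \<in> B" "\<And>i. coeff f i = b * c i"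
    unfolding dvd_in_def by metis
  define g where "g = (\<Sum>i\<le>degree f. monom (c i) i)"
  have "g \<in> polys_over B"
    using c ss_zero[OF B] by (auto simp: g_def polys_over_def coeff_sum intro!: ss_sum[OF B])
  moreover have "f = [:b:] * g"
  proof -
    have "f = (\<Sum>i\<le>degree f. monom (coeff f i) i)" by (simp add: poly_as_sum_of_monoms)
    also have "\<dots> = [:b:] * g" by (simp add: g_def c sum_distrib_left smult_monom)
    finally show ?thesis .
  qed
  ultimately show "dvd_in (polys_over B) [:b:] f" by (auto simp: dvd_in_def)
qed

private lemma dvd_in_diff: "dvd_in B b x \<Longrightarrow> dvd_in B b y \<Longrightarrow> dvd_in B b (x - y)"
  unfolding dvd_in_def by (metis ss_diff[OF B] right_diff_distrib)

private lemma dvd_in_sum: "(\<And>i. i \<in> A \<Longrightarrow> dvd_in B b (x i)) \<Longrightarrow> dvd_in B b (sum x A)"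
proof (induction A rule: infinite_finite_induct)
  case (insert i A)
  then have "dvd_in B b (x i)" "dvd_in B b (sum x A)" by auto
  then obtain c d where "c \<in> B" "d \<in> B" "x i = b * c" "sum x A = b * d" unfolding dvd_in_def by metis
  then show ?case using insert by (auto simp: dvd_in_def distrib_left intro!: bexI[of _ "c + d"] ss_add[OF B])
qed (auto simp: dvd_in_def intro!: bexI[of _ 0] ss_zero[OF B])

private lemma dvd_in_mult_right: "y \<in> B \<Longrightarrow> dvd_in B b x \<Longrightarrow> dvd_in B b (x * y)"
  unfolding dvd_in_def by (metis ss_mult[OF B] mult.assoc)

private lemma unit_const: "unit_in (polys_over B) [:b:] \<longleftrightarrow> unit_in B b"
proof
  assume "unit_in (polys_over B) [:b:]"
  then obtain g where "b \<in> B" "g \<in> polys_over B" "[:b:] * g = 1" by (auto simp: unit_in_def B)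
  then have "b * coeff g 0 = 1" "coeff g 0 \<in> B"
    by (auto simp: polys_over_def) (metis coeff_smult lead_coeff_1 degree_1)
  with \<open>b \<in> B\<close> show "unit_in B b" by (auto simp: unit_in_def)
next
  assume "unit_in B b"
  then obtain c where "b \<in> B" "c \<in> B" "b * c = 1" by (auto simp: unit_in_def)
  then have "[:b:] * [:c:] = 1" by (simp add: one_pCons mult.commute[of c b])
  with \<open>b \<in> B\<close> \<open>c \<in> B\<close> show "unit_in (polys_over B) [:b:]"
    unfolding unit_in_def by (intro conjI bexI[of _ "[:c:]"]) (simp_all only: const_in_polys_over[OF B])
qed

text \<open>If \<open>p\<close> divides neither factor, take the first coefficients that it does not
  divide, at \<open>i\<close> and \<open>j\<close>: in the coefficient of the product at
  \<open>i + j\<close> every term but one is divisible by \<open>p\<close>.\<close>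

lemma prime_in_const:
  assumes p: "prime_in B p"
  shows "prime_in (polys_over B) [:p:]"
  unfolding prime_in_def
proof (intro conjI ballI impI)
  show "[:p:] \<in> polys_over B" "[:p:] \<noteq> 0" "\<not> unit_in (polys_over B) [:p:]"
    using p by (auto simp: prime_in_def B unit_const)
  fix f g assume fg: "f \<in> polys_over B" "g \<in> polys_over B" and d: "dvd_in (polys_over B) [:p:] (f * g)"
  show "dvd_in (polys_over B) [:p:] f \<or> dvd_in (polys_over B) [:p:] g"
  proof (rule ccontr)
    assume "\<not> ?thesis"
    then have ex: "\<exists>i. \<not> dvd_in B p (coeff f i)" "\<exists>i. \<not> dvd_in B p (coeff g i)"
      using fg by (auto simp: dvd_in_const)
    define i where "i = (LEAST i. \<not> dvd_in B p (coeff f i))"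
    define j where "j = (LEAST i. \<not> dvd_in B p (coeff g i))"
    have i: "\<not> dvd_in B p (coeff f i)" "\<And>k. k < i \<Longrightarrow> dvd_in B p (coeff f k)"
      using LeastI_ex[OF ex(1)] not_less_Least unfolding i_def by auto
    have j: "\<not> dvd_in B p (coeff g j)" "\<And>k. k < j \<Longrightarrow> dvd_in B p (coeff g k)"
      using LeastI_ex[OF ex(2)] not_less_Least unfolding j_def by auto
    have "coeff (f * g) (i + j) = (\<Sum>k\<le>i + j. coeff f k * coeff g (i + j - k))"
      by (rule coeff_mult)
    also have "\<dots> = coeff f i * coeff g j + (\<Sum>k\<in>{..i + j} - {i}. coeff f k * coeff g (i + j - k))"
      by (subst sum.remove[of _ i]) auto
    finally have eq: "coeff f i * coeff g j = coeff (f * g) (i + j)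
        - (\<Sum>k\<in>{..i + j} - {i}. coeff f k * coeff g (i + j - k))" by simp
    have "dvd_in B p (coeff f i * coeff g j)"
      unfolding eq
    proof (intro dvd_in_diff dvd_in_sum)
      show "dvd_in B p (coeff (f * g) (i + j))"
        using d fg dvd_in_const ss_mult[OF PB] by blast
      fix k assume k: "k \<in> {..i + j} - {i}"
      show "dvd_in B p (coeff f k * coeff g (i + j - k))"
      proof (cases "k < i")
        case True
        then show ?thesis using i fg by (auto intro!: dvd_in_mult_right coeff_in)
      next
        case False
        then have "i + j - k < j" using k by auto
        then show ?thesis
          using j fg by (subst mult.commute) (auto intro!: dvd_in_mult_right coeff_in)
      qed
    qed
    with prime_inD[OF p] coeff_in[OF fg(1)] coeff_in[OF fg(2)] i j show False by blast
  qed
qed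

text \<open>Long division over a ring that is not a field: each step multiplies by the leading
  coefficient of \<open>g\<close> before the leading term is cancelled, and \<open>c\<close>
  collects these multipliers.\<close>

lemma pseudo_division:
  assumes "g \<in> polys_over B" "g \<noteq> 0" "f \<in> polys_over B"
  shows "\<exists>c q r. c \<in> B \<and> c \<noteq> 0 \<and> q \<in> polys_over B \<and> r \<in> polys_over B \<and>
    [:c:] * f = g * q + r \<and> (r = 0 \<or> degree r < degree g)"
  using assms(3)
proof (induction "degree f" arbitrary: f rule: less_induct)
  case less
  show ?case
  proof (cases "f = 0 \<or> degree f < degree g")
    case True
    then show ?thesis using less.prems
      by (intro exI[of _ 1] exI[of _ 0] exI[of _ f]) (auto simp: ss_one[OF B] ss_zero[OF PB])
  next
    case False
    define lg where "lg = lead_coeff g"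
    define m where "m = monom (lead_coeff f) (degree f - degree g)"
    define f' where "f' = [:lg:] * f - g * m"
    have lg: "lg \<noteq> 0" "lg \<in> B" using assms by (auto simp: lg_def coeff_in)
    have m: "m \<in> polys_over B"
      using less.prems ss_zero[OF B] by (auto simp: m_def polys_over_def)
    have f': "f' \<in> polys_over B"
      unfolding f'_def using less.prems m assms lg by (intro ss_diff[OF PB] ss_mult[OF PB]) (auto simp: B)
    have le: "degree f' \<le> degree f"
    proof -
      have "degree (g * m) \<le> degree f"
        using False degree_mult_le[of g m] degree_monom_le[of "lead_coeff f" "degree f - degree g"]
        unfolding m_def by linarith
      then show ?thesis unfolding f'_def by (intro degree_diff_le) auto
    qed
    have "coeff f' (degree f) = 0"
    proof -
      have "coeff (g * m) (degree f) = coeff g (degree g) * lead_coeff f"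
        using False by (simp add: m_def coeff_monom_mult mult.commute[of g] mult.commute[of "lead_coeff f"])
      then show ?thesis by (simp add: f'_def lg_def)
    qed
    then have "f' = 0 \<or> degree f' < degree f"
      using le by (metis eq_zero_or_degree_less)
    moreover have ?thesis if f'0: "f' = 0"
      by (rule exI[of _ lg], rule exI[of _ m], rule exI[of _ 0])
         (use f'0 lg m ss_zero[OF PB] in \<open>auto simp: f'_def\<close>)
    moreover have ?thesis if lt: "degree f' < degree f"
    proof -
      obtain c q r where *: "c \<in> B" "c \<noteq> 0" "q \<in> polys_over B" "r \<in> polys_over B"
        "[:c:] * f' = g * q + r" "r = 0 \<or> degree r < degree g"
        using less.hyps[OF lt f'] by blast
      have "[:c * lg:] * f = [:c:] * f' + [:c:] * (g * m)"
        by (simp add: f'_def algebra_simps)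
      also have "\<dots> = g * (q + [:c:] * m) + r" by (simp only: *) (simp add: algebra_simps)
      finally have "[:c * lg:] * f = g * (q + [:c:] * m) + r" .
      moreover have "q + [:c:] * m \<in> polys_over B"
        using * m by (intro ss_add[OF PB] ss_mult[OF PB]) (auto simp: B)
      moreover have "c * lg \<in> B" "c * lg \<noteq> 0" using * lg by (auto intro: ss_mult[OF B])
      ultimately show ?thesis using * by blast
    qed
    ultimately show ?thesis by blast
  qed
qed

private lemma unit_dvd_cancel:
  assumes "unit_in B u" "f \<in> polys_over B" "s \<in> polys_over B" "[:u:] * g = f * s"
  shows "\<exists>s'\<in>polys_over B. g = f * s'"
proof -
  obtain v where v: "v \<in> B" "u * v = 1" using assms by (auto simp: unit_in_def)
  have "g = [:v:] * ([:u:] * g)" using v by (simp add: mult.commute)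
  also have "\<dots> = f * ([:v:] * s)" by (simp only: assms) (simp add: algebra_simps)
  finally have "g = f * ([:v:] * s)" .
  moreover have "[:v:] * s \<in> polys_over B" using v assms by (intro ss_mult[OF PB]) (simp_all add: B)
  ultimately show ?thesis by blast
qed

text \<open>The prime factors of \<open>b\<close> are cancelled one at a time.\<close>

private lemma cancel_const:
  assumes f: "f \<in> polys_over B" and nd: "\<And>p. prime_in B p \<Longrightarrow> \<not> dvd_in (polys_over B) [:p:] f"
    and b: "b \<in> B" "b \<noteq> 0" and g: "g \<in> polys_over B" and s: "s \<in> polys_over B" "[:b:] * g = f * s"
  shows "dvd_in (polys_over B) f g"
proof -
  obtain u zs where u: "unit_in B u" and zs: "\<forall>p\<in>set zs. prime_in B p" and bu: "b = u * prod_list zs"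
    using ufd b by (auto simp: ufd_in_def)
  have uB: "u \<in> B" using u by (simp add: unit_in_def)
  have "\<exists>s'\<in>polys_over B. [:u:] * g = f * s'"
    using zs s unfolding bu
  proof (induction zs arbitrary: s)
    case (Cons p zs)
    have p: "prime_in B p" using Cons by simp
    have qB: "[:u * prod_list zs:] * g \<in> polys_over B"
      using Cons.prems g uB
      by (intro ss_mult[OF PB]) (auto simp: B prime_in_def intro!: ss_mult[OF B] prod_list_in[OF B])
    have eq: "f * s = [:p:] * ([:u * prod_list zs:] * g)"
      using Cons.prems(3) by (simp add: algebra_simps)
    then have "dvd_in (polys_over B) [:p:] (f * s)" using qB unfolding dvd_in_def by blast
    with prime_inD[OF prime_in_const[OF p] f Cons.prems(2)] nd[OF p]
    obtain s' where s': "s' \<in> polys_over B" "s = [:p:] * s'" by (auto simp: dvd_in_def)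
    have "[:p:] * ([:u * prod_list zs:] * g) = [:p:] * (f * s')"
      using eq by (simp only: s' mult.left_commute)
    then have "[:u * prod_list zs:] * g = f * s'"
      using p by (subst (asm) mult_left_cancel) (auto simp: prime_in_def)
    with Cons s' show ?case by auto
  qed auto
  then show ?thesis using unit_dvd_cancel[OF u f] by (auto simp: dvd_in_def)
qed

text \<open>Each prime factor of \<open>c\<close> remains prime among the polynomials and divides
  \<open>q\<close> or \<open>r\<close>; once cancelled there, it is recorded in \<open>e1\<close> or
  \<open>e2\<close>. The unit that is left over is absorbed in the first factor.\<close>

private lemma cancel_const_product:
  assumes f: "f \<in> polys_over B" and c: "c \<in> B" "c \<noteq> 0"
    and q: "q \<in> polys_over B" and r: "r \<in> polys_over B" and eq: "[:c:] * f = q * r"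
  shows "\<exists>q1\<in>polys_over B. \<exists>r1\<in>polys_over B. \<exists>e1\<in>B. \<exists>e2\<in>B. f = q1 * r1 \<and> q = [:e1:] * q1 \<and> r = [:e2:] * r1"
proof -
  obtain u zs where u: "unit_in B u" and zs: "\<forall>p\<in>set zs. prime_in B p" and cu: "c = u * prod_list zs"
    using ufd c by (auto simp: ufd_in_def)
  from u obtain v where v: "u \<in> B" "v \<in> B" "u * v = 1" by (auto simp: unit_in_def)
  show ?thesis
    using zs q r eq unfolding cu
  proof (induction zs arbitrary: q r)
    case Nil
    have "f = [:v:] * ([:u:] * f)" using v by (simp add: mult.commute)
    also have "\<dots> = [:v:] * q * r" using Nil by (simp add: mult.assoc)
    finally have "f = [:v:] * q * r" .
    moreover have "q = [:u:] * ([:v:] * q)" using v by (simp add: mult.commute)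
    moreover have "[:v:] * q \<in> polys_over B" using Nil v by (intro ss_mult[OF PB]) (auto simp: B)
    ultimately show ?case using Nil v ss_one[OF B]
      by (intro bexI[of _ "[:v:] * q"] bexI[of _ r] bexI[of _ u] bexI[of _ 1]) auto
  next
    case (Cons p zs)
    have p: "prime_in B p" "p \<in> B" "p \<noteq> 0" using Cons by (auto simp: prime_in_def)
    have fB: "[:u * prod_list zs:] * f \<in> polys_over B"
      using Cons.prems f v
      by (intro ss_mult[OF PB]) (auto simp: B prime_in_def intro!: ss_mult[OF B] prod_list_in[OF B])
    have eq: "q * r = [:p:] * ([:u * prod_list zs:] * f)"
      using Cons.prems(4) by (simp add: algebra_simps)
    then have "dvd_in (polys_over B) [:p:] (q * r)" using fB unfolding dvd_in_def by blast
    then consider "dvd_in (polys_over B) [:p:] q" | "dvd_in (polys_over B) [:p:] r"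
      using prime_inD[OF prime_in_const[OF p(1)] Cons.prems(2,3)] by blast
    then show ?case
    proof cases
      case 1
      then obtain q' where q': "q' \<in> polys_over B" "q = [:p:] * q'" by (auto simp: dvd_in_def)
      have "[:p:] * ([:u * prod_list zs:] * f) = [:p:] * (q' * r)"
        using eq by (simp only: q' mult.assoc)
      then have "[:u * prod_list zs:] * f = q' * r"
        using p by (subst (asm) mult_left_cancel) auto
      with Cons.IH[of q' r] Cons.prems q' obtain q1 r1 e1 e2
        where *: "q1 \<in> polys_over B" "r1 \<in> polys_over B" "e1 \<in> B" "e2 \<in> B"
          "f = q1 * r1" "q' = [:e1:] * q1" "r = [:e2:] * r1" by auto
      moreover have "q = [:p * e1:] * q1" using * q' by (simp add: mult.commute)
      moreover have "p * e1 \<in> B" using p * by (intro ss_mult[OF B])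
      ultimately show ?thesis by blast
    next
      case 2
      then obtain r' where r': "r' \<in> polys_over B" "r = [:p:] * r'" by (auto simp: dvd_in_def)
      have "[:p:] * ([:u * prod_list zs:] * f) = [:p:] * (q * r')"
        using eq by (simp only: r' mult.left_commute)
      then have "[:u * prod_list zs:] * f = q * r'"
        using p by (subst (asm) mult_left_cancel) auto
      with Cons.IH[of q r'] Cons.prems r' obtain q1 r1 e1 e2
        where *: "q1 \<in> polys_over B" "r1 \<in> polys_over B" "e1 \<in> B" "e2 \<in> B"
          "f = q1 * r1" "q = [:e1:] * q1" "r' = [:e2:] * r1" by auto
      moreover have "r = [:p * e2:] * r1" using * r' by (simp add: mult.commute)
      moreover have "p * e2 \<in> B" using p * by (intro ss_mult[OF B])
      ultimately show ?thesis by blast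
    qed
  qed
qed

text \<open>The proof takes an element \<open>r\<close> of least degree in the ideal generated by \<open>f\<close> and \<open>g\<close>; up to
  constants it divides both, and it is a constant unless \<open>f\<close> divides \<open>g\<close>.\<close>

private lemma primitive_prime:
  assumes f: "f \<in> polys_over B" "degree f > 0"
    and nd: "\<And>p. prime_in B p \<Longrightarrow> \<not> dvd_in (polys_over B) [:p:] f"
    and irr: "\<And>g h. g \<in> polys_over B \<Longrightarrow> h \<in> polys_over B \<Longrightarrow> f = g * h \<Longrightarrow> degree g = 0 \<or> degree h = 0"
  shows "prime_in (polys_over B) f"
  unfolding prime_in_def
proof (intro conjI ballI impI)
  show "f \<in> polys_over B" "f \<noteq> 0" using f by auto
  show "\<not> unit_in (polys_over B) f"
  proof
    assume "unit_in (polys_over B) f"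
    then obtain v where v: "f * v = 1" by (auto simp: unit_in_def)
    then have "v \<noteq> 0" "f \<noteq> 0" by auto
    then show False using f arg_cong[OF v, of degree] by (simp add: degree_mult_eq)
  qed
  fix g h assume gh: "g \<in> polys_over B" "h \<in> polys_over B" and d: "dvd_in (polys_over B) f (g * h)"
  show "dvd_in (polys_over B) f g \<or> dvd_in (polys_over B) f h"
  proof -
    define J where "J = {\<alpha> * f + \<beta> * g | \<alpha> \<beta>. \<alpha> \<in> polys_over B \<and> \<beta> \<in> polys_over B}"
    have J: "J \<subseteq> polys_over B" using f gh by (auto simp: J_def intro!: ss_add[OF PB] ss_mult[OF PB])
    have fJ: "f \<in> J" unfolding J_def
      by (rule CollectI, rule exI[of _ 1], rule exI[of _ 0]) (auto intro: ss_one[OF PB] ss_zero[OF PB])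
    have gJ: "g \<in> J" unfolding J_def
      by (rule CollectI, rule exI[of _ 0], rule exI[of _ 1]) (auto intro: ss_one[OF PB] ss_zero[OF PB])
    obtain r where r: "r \<in> J" "r \<noteq> 0" and rmin: "\<And>s. s \<in> J \<Longrightarrow> s \<noteq> 0 \<Longrightarrow> degree r \<le> degree s"
    proof -
      have "f \<in> J \<and> f \<noteq> 0" using fJ f by auto
      from arg_min_nat_lemma[of "\<lambda>r. r \<in> J \<and> r \<noteq> 0", OF this, of degree] show ?thesis
        using that by blast
    qed
    \<comment> \<open>The pseudo-remainder lies in \<open>J\<close> and has smaller degree than
      \<open>r\<close>, hence vanishes.\<close>
    have div: "\<exists>c q. c \<in> B \<and> c \<noteq> 0 \<and> q \<in> polys_over B \<and> [:c:] * s = q * r" if s: "s \<in> J" for s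
    proof -
      obtain c q t where *: "c \<in> B" "c \<noteq> 0" "q \<in> polys_over B" "t \<in> polys_over B"
        "[:c:] * s = r * q + t" "t = 0 \<or> degree t < degree r"
        using pseudo_division[OF subsetD[OF J r(1)] r(2) subsetD[OF J s]] by auto
      obtain \<alpha> \<beta> \<alpha>' \<beta>' where ab: "\<alpha> \<in> polys_over B" "\<beta> \<in> polys_over B" "\<alpha>' \<in> polys_over B" "\<beta>' \<in> polys_over B"
        "r = \<alpha> * f + \<beta> * g" "s = \<alpha>' * f + \<beta>' * g" using r s by (auto simp: J_def)
      have "t = ([:c:] * \<alpha>' - q * \<alpha>) * f + ([:c:] * \<beta>' - q * \<beta>) * g"
        using *(5) unfolding ab(5,6) by (simp add: algebra_simps)
      moreover have "[:c:] * \<alpha>' - q * \<alpha> \<in> polys_over B" "[:c:] * \<beta>' - q * \<beta> \<in> polys_over B"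
        using ab * by (auto intro!: ss_diff[OF PB] ss_mult[OF PB] simp: B simp del: mult_pCons_left)
      ultimately have "t \<in> J" by (auto simp: J_def)
      with rmin[of t] * have "t = 0" by (meson leD)
      with * show ?thesis by (auto simp: mult.commute)
    qed
    obtain c q where c: "c \<in> B" "c \<noteq> 0" "q \<in> polys_over B" "[:c:] * f = q * r" using div[OF fJ] by blast
    obtain c' q' where c': "c' \<in> B" "c' \<noteq> 0" "q' \<in> polys_over B" "[:c':] * g = q' * r" using div[OF gJ] by blast
    have rB: "r \<in> polys_over B" using r J by blast
    show ?thesis
    proof (cases "degree r = 0")
      case True
      then obtain b where b: "r = [:b:]" by (rule degree_eq_zeroE)
      have bB: "b \<in> B" "b \<noteq> 0" using rB r by (auto simp: b B)
      obtain \<alpha> \<beta> where ab: "\<alpha> \<in> polys_over B" "\<beta> \<in> polys_over B" "r = \<alpha> * f + \<beta> * g"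
        using r by (auto simp: J_def)
      obtain k where k: "k \<in> polys_over B" "g * h = f * k" using d by (auto simp: dvd_in_def)
      \<comment> \<open>The Bezout relation times \<open>h\<close>: \<open>f\<close> divides both
        terms on the right, and as no constant prime divides \<open>f\<close>, the constant
        \<open>b\<close> can be cancelled.\<close>
      have "[:b:] * h = \<alpha> * f * h + \<beta> * (g * h)" by (simp only: b[symmetric] ab) (simp add: algebra_simps)
      also have "\<dots> = f * (\<alpha> * h + \<beta> * k)" by (simp only: k) (simp add: algebra_simps)
      finally have "[:b:] * h = f * (\<alpha> * h + \<beta> * k)" .
      moreover have "\<alpha> * h + \<beta> * k \<in> polys_over B"
        using ab k gh by (intro ss_add[OF PB] ss_mult[OF PB])
      ultimately have "dvd_in (polys_over B) f h" by (intro cancel_const[OF f(1) nd bB gh(2)])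
      then show ?thesis by (rule disjI2)
    next
      case False
      \<comment> \<open>Here \<open>r\<close> is not constant and a constant multiple of
        \<open>f\<close> is a multiple of \<open>r\<close>; irreducibility makes the cofactor
        \<open>q1\<close> constant.\<close>
      obtain q1 r1 e1 e2 where *: "q1 \<in> polys_over B" "r1 \<in> polys_over B" "e1 \<in> B" "e2 \<in> B"
        "f = q1 * r1" "q = [:e1:] * q1" "r = [:e2:] * r1"
        using cancel_const_product[OF f(1) c(1,2,3) rB c(4)] by blast
      have "e2 \<noteq> 0" using * r by auto
      then have "degree r1 = degree r" using * by (simp add: degree_mult_eq_0)
      then have "degree q1 = 0" using irr[of q1 r1] * False by auto
      then obtain b where b: "q1 = [:b:]" by (rule degree_eq_zeroE)
      have bB: "b \<in> B" "b \<noteq> 0" using * f by (auto simp: b B)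
      obtain u zs where u: "unit_in B u" and zs: "\<forall>p\<in>set zs. prime_in B p" and bu: "b = u * prod_list zs"
        using ufd bB by (auto simp: ufd_in_def)
      \<comment> \<open>A prime factor of the constant \<open>q1\<close> would divide
        \<open>f\<close>; so \<open>q1\<close> is a unit and \<open>f\<close> is associated to
        \<open>r1\<close>, which divides \<open>g\<close> up to constants.\<close>
      have "zs = []"
      proof (cases zs)
        case (Cons p zs')
        have "u * prod_list zs' \<in> B"
          using zs u by (auto simp: Cons prime_in_def unit_in_def intro!: ss_mult[OF B] prod_list_in[OF B])
        then have "dvd_in (polys_over B) [:p:] f"
          unfolding dvd_in_def using *
          by (intro bexI[of _ "[:u * prod_list zs':] * r1"])
             (auto simp: b bu Cons B intro!: ss_mult[OF PB] simp del: mult_pCons_left)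
        then show ?thesis using nd[of p] zs Cons by auto
      qed auto
      then obtain v where v: "v \<in> B" "b * v = 1" using u bu by (auto simp: unit_in_def)
      have "r1 = [:v:] * f" using v by (simp add: * b mult.commute)
      have "[:c':] * g = q' * ([:e2:] * r1)" by (simp only: c'(4) *(7))
      also have "\<dots> = f * ([:v:] * [:e2:] * q')"
        by (subst \<open>r1 = [:v:] * f\<close>) (simp add: mult_ac)
      finally have "[:c':] * g = f * ([:v:] * [:e2:] * q')" .
      moreover have "[:v:] * [:e2:] * q' \<in> polys_over B" using v * c'
        by (intro ss_mult[OF PB]) (auto simp: B)
      ultimately have "dvd_in (polys_over B) f g" by (intro cancel_const[OF f(1) nd c'(1,2) gh(1)])
      then show ?thesis by (rule disjI1)
    qed
  qed
qed

text \<open>Splitting off a prime consumes exactly one entry of the list, which is the measure for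
  the termination of \<open>remove_content\<close>. If the head \<open>q\<close> divides
  \<open>p\<close>, the two are associated and the quotient is moved into the unit.\<close>

private lemma prime_factor_cancel:
  assumes "prime_in B p" "unit_in B u" "\<forall>q\<in>set zs. prime_in B q" "b \<in> B" "p * b = u * prod_list zs"
  shows "\<exists>u' zs'. unit_in B u' \<and> (\<forall>q\<in>set zs'. prime_in B q) \<and> length zs = Suc (length zs') \<and> b = u' * prod_list zs'"
  using assms(3-5)
proof (induction zs arbitrary: b)
  case Nil
  obtain v where "v \<in> B" "u * v = 1" using assms(2) by (auto simp: unit_in_def)
  then have "p * (b * v) = 1" using Nil by (simp flip: mult.assoc)
  then have "unit_in B p" using \<open>v \<in> B\<close> Nil assms(1) by (auto simp: unit_in_def prime_in_def intro!: ss_mult[OF B])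
  then show ?case using assms(1) by (simp add: prime_in_def)
next
  case (Cons q zs)
  have q: "prime_in B q" "q \<in> B" "q \<noteq> 0" and p: "p \<in> B" "p \<noteq> 0"
    using Cons assms(1) by (auto simp: prime_in_def)
  have uB: "u \<in> B" using assms(2) by (simp add: unit_in_def)
  have rB: "u * prod_list zs \<in> B"
    using Cons.prems uB by (auto simp: prime_in_def intro!: ss_mult[OF B] prod_list_in[OF B])
  have "dvd_in B q (p * b)"
    using rB Cons.prems(3) by (auto simp: dvd_in_def mult_ac intro!: bexI[of _ "u * prod_list zs"])
  then consider "dvd_in B q p" | "dvd_in B q b"
    using prime_inD[OF q(1) p(1) Cons.prems(2)] by blast
  then show ?case
  proof cases
    case 2
    then obtain b' where b': "b' \<in> B" "b = q * b'" by (auto simp: dvd_in_def)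
    have "q * (p * b') = q * (u * prod_list zs)" using Cons.prems(3) b' by (simp add: mult_ac)
    then have "p * b' = u * prod_list zs" using q by simp
    then obtain u' zs' where "unit_in B u'" "\<forall>q\<in>set zs'. prime_in B q" "length zs = Suc (length zs')" "b' = u' * prod_list zs'"
      using Cons.IH[of b'] Cons.prems b' by auto
    then show ?thesis using q b' by (intro exI[of _ u'] exI[of _ "q # zs'"]) (auto simp: mult_ac)
  next
    case 1
    then obtain w where w: "w \<in> B" "p = q * w" by (auto simp: dvd_in_def)
    have "dvd_in B p (q * w)" using w ss_one[OF B] by (auto simp: dvd_in_def)
    then consider "dvd_in B p q" | "dvd_in B p w" using prime_inD[OF assms(1) q(2) w(1)] by blast
    then have "unit_in B w"
    proof cases
      case 1
      then obtain t where "t \<in> B" "q = p * t" by (auto simp: dvd_in_def)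
      then have "q * (w * t) = q * 1" using w by (simp add: mult_ac)
      then have "w * t = 1" using q by (subst (asm) mult_left_cancel) auto
      then show ?thesis using \<open>t \<in> B\<close> w by (auto simp: unit_in_def)
    next
      case 2
      then obtain t where "t \<in> B" "w = p * t" by (auto simp: dvd_in_def)
      then have "p * (q * t) = p * 1" using w by (simp add: mult_ac)
      then have "q * t = 1" using p by (subst (asm) mult_left_cancel) auto
      then have "unit_in B q" using \<open>t \<in> B\<close> q by (auto simp: unit_in_def)
      then show ?thesis using q by (simp add: prime_in_def)
    qed
    then obtain v where v: "v \<in> B" "w * v = 1" by (auto simp: unit_in_def)
    have "q * (w * b) = q * (u * prod_list zs)" using Cons.prems(3) w by (simp add: mult_ac)
    then have "w * b = u * prod_list zs" using q by simp
    then have "b = (u * v) * prod_list zs" using v by (metis mult.assoc mult.commute mult_1_right)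
    moreover have "unit_in B v" using v w by (auto simp: unit_in_def mult.commute)
    ultimately show ?thesis using Cons.prems unit_in_mult[OF B assms(2)]
      by (intro exI[of _ "u * v"] exI[of _ zs]) auto
  qed
qed

text \<open>Constant primes are split off while there are any. Each one takes a prime factor from
  the leading coefficient, so the process ends.\<close>

private lemma remove_content:
  assumes "f \<in> polys_over B" "f \<noteq> 0"
  shows "\<exists>c f1. c \<in> B \<and> c \<noteq> 0 \<and> f1 \<in> polys_over B \<and> f = [:c:] * f1 \<and>
    (\<forall>p. prime_in B p \<longrightarrow> \<not> dvd_in (polys_over B) [:p:] f1)"
proof -
  have "lead_coeff f \<in> B" "lead_coeff f \<noteq> 0" using assms by (auto simp: polys_over_def)
  then obtain u zs where "unit_in B u" "\<forall>p\<in>set zs. prime_in B p" "lead_coeff f = u * prod_list zs"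
    using ufd unfolding ufd_in_def by blast
  then show ?thesis using assms
  proof (induction "length zs" arbitrary: f u zs)
    case (0 zs f u)
    have "\<not> dvd_in (polys_over B) [:p:] f" if p: "prime_in B p" for p
    proof
      assume "dvd_in (polys_over B) [:p:] f"
      then obtain g where "g \<in> polys_over B" "f = [:p:] * g" by (auto simp: dvd_in_def)
      then have "u = p * lead_coeff g" "lead_coeff g \<in> B" using 0 by (auto simp: polys_over_def)
      then obtain c where "c \<in> B" "u = p * c" by blast
      moreover obtain v where "v \<in> B" "u * v = 1" using 0 by (auto simp: unit_in_def)
      ultimately have "p * (c * v) = 1" "c * v \<in> B" by (auto simp: mult_ac intro: ss_mult[OF B])
      then show False using p by (auto simp: prime_in_def unit_in_def)
    qed
    then show ?case using 0 ss_one[OF B] by (intro exI[of _ 1] exI[of _ f]) auto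
  next
    case (Suc n zs f u)
    show ?case
    proof (cases "\<exists>p. prime_in B p \<and> dvd_in (polys_over B) [:p:] f")
      case False
      then show ?thesis using Suc ss_one[OF B] by (intro exI[of _ 1] exI[of _ f]) auto
    next
      case True
      then obtain p f' where p: "prime_in B p" and f': "f' \<in> polys_over B" "f = [:p:] * f'"
        by (auto simp: dvd_in_def)
      have p0: "p \<noteq> 0" "p \<in> B" using p by (auto simp: prime_in_def)
      have "p * lead_coeff f' = u * prod_list zs" using Suc f' p0 by (simp add: lead_coeff_mult)
      then obtain u' zs' where *: "unit_in B u'" "\<forall>q\<in>set zs'. prime_in B q" "length zs = Suc (length zs')"
          "lead_coeff f' = u' * prod_list zs'"
        using prime_factor_cancel[OF p Suc.prems(1,2)] coeff_in[OF f'(1)] by blast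
      obtain c f1 where **: "c \<in> B" "c \<noteq> 0" "f1 \<in> polys_over B" "f' = [:c:] * f1"
          "\<forall>p. prime_in B p \<longrightarrow> \<not> dvd_in (polys_over B) [:p:] f1"
        using Suc.hyps(1)[of zs' u' f'] * Suc.hyps(2) Suc.prems f' by auto
      have "f = [:p * c:] * f1" using f' ** by (simp add: mult.commute)
      moreover have "p * c \<in> B" "p * c \<noteq> 0" using p0 ** by (auto intro: ss_mult[OF B])
      ultimately show ?thesis using ** by blast
    qed
  qed
qed

text \<open>Induction on the degree. After removal of the content, a non-constant polynomial either
  splits into two factors of smaller positive degree or is prime by
  \<open>primitive_prime\<close>.\<close>

theorem ufd_polys_over: "ufd_in (polys_over B)"
proof -
  define fact where "fact f \<longleftrightarrow> (\<exists>u zs. unit_in (polys_over B) u \<and> (\<forall>p\<in>set zs. prime_in (polys_over B) p) \<and>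
    f = u * prod_list zs)" for f
  have fact_mult: "fact (f * g)" if fg: "fact f" "fact g" for f g
  proof -
    obtain u zs v qs where "unit_in (polys_over B) u" "\<forall>p\<in>set zs. prime_in (polys_over B) p" "f = u * prod_list zs"
      "unit_in (polys_over B) v" "\<forall>p\<in>set qs. prime_in (polys_over B) p" "g = v * prod_list qs"
      using fg by (auto simp: fact_def)
    then show ?thesis unfolding fact_def using unit_in_mult[OF PB]
      by (intro exI[of _ "u * v"] exI[of _ "zs @ qs"]) (auto simp: mult_ac)
  qed
  have fact_const: "fact [:b:]" if b: "b \<in> B" "b \<noteq> 0" for b
  proof -
    obtain u zs where u: "unit_in B u" and zs: "\<forall>p\<in>set zs. prime_in B p" and bu: "b = u * prod_list zs"
      using ufd b by (auto simp: ufd_in_def)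
    have "[:b:] = [:u:] * prod_list (map (\<lambda>p. [:p:]) zs)"
      unfolding bu
    proof (induction zs)
      case (Cons p zs)
      have "[:u * prod_list (p # zs):] = [:p:] * [:u * prod_list zs:]" by (simp add: mult_ac)
      then show ?case by (simp only: Cons) (simp add: mult.commute)
    qed (simp add: one_pCons)
    then show ?thesis unfolding fact_def using u zs prime_in_const
      by (intro exI[of _ "[:u:]"] exI[of _ "map (\<lambda>p. [:p:]) zs"]) (auto simp: unit_const)
  qed
  have "fact f" if "f \<in> polys_over B" "f \<noteq> 0" for f
    using that
  proof (induction "degree f" arbitrary: f rule: less_induct)
    case less
    obtain c f1 where *: "c \<in> B" "c \<noteq> 0" "f1 \<in> polys_over B" "f = [:c:] * f1"
      "\<And>p. prime_in B p \<Longrightarrow> \<not> dvd_in (polys_over B) [:p:] f1"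
      using remove_content[OF less.prems] by blast
    have f1: "f1 \<noteq> 0" "degree f1 = degree f" using * less.prems by auto
    have "fact f1"
    proof (cases "degree f1 = 0")
      case True
      then obtain b where b: "f1 = [:b:]" by (rule degree_eq_zeroE)
      then show ?thesis using * f1 by (auto intro!: fact_const simp: B)
    next
      case pos: False
      show ?thesis
      proof (cases "\<forall>g\<in>polys_over B. \<forall>h\<in>polys_over B. f1 = g * h \<longrightarrow> degree g = 0 \<or> degree h = 0")
        case True
        then have "prime_in (polys_over B) f1" using pos *(5) by (intro primitive_prime[OF *(3)]) auto
        then show ?thesis unfolding fact_def using unit_in_one[OF PB]
          by (intro exI[of _ 1] exI[of _ "[f1]"]) auto
      next
        case False
        then obtain g h where gh: "g \<in> polys_over B" "h \<in> polys_over B" "f1 = g * h" "degree g \<noteq> 0" "degree h \<noteq> 0"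
          by blast
        then have "degree g < degree f" "degree h < degree f" "g \<noteq> 0" "h \<noteq> 0"
          using f1 degree_mult_eq[of g h] by auto
        then show ?thesis using less.hyps gh by (auto intro: fact_mult)
      qed
    qed
    then show ?case using fact_mult[OF fact_const[of c]] * by auto
  qed
  then show ?thesis by (simp add: ufd_in_def fact_def)
qed

end

section \<open>Transport along injective homomorphisms and factoriality of polynomial rings\<close>

context
  fixes h :: "'a::comm_ring_1 \<Rightarrow> 'b::comm_ring_1" and S
  assumes h: "ring_hom_on h" and S: "subring_set S" and inj: "inj_on h S"
begin

lemma dvd_in_image:
  assumes "a \<in> S" "b \<in> S"
  shows "dvd_in (h ` S) (h a) (h b) \<longleftrightarrow> dvd_in S a b"
proof -
  have "h b = h a * h c \<longleftrightarrow> b = a * c" if "c \<in> S" for c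
    using inj_on_eq_iff[OF inj, of b "a * c"] assms that by (simp add: rh_mult[OF h] ss_mult[OF S])
  then show ?thesis by (auto simp: dvd_in_def)
qed

lemma unit_in_image:
  assumes "a \<in> S"
  shows "unit_in (h ` S) (h a) \<longleftrightarrow> unit_in S a"
proof -
  have "h a * h c = 1 \<longleftrightarrow> a * c = 1" if "c \<in> S" for c
    using inj_on_eq_iff[OF inj, of "a * c" 1] assms that
    by (simp add: rh_mult[OF h] rh_one[OF h] ss_mult[OF S] ss_one[OF S])
  then show ?thesis using assms by (auto simp: unit_in_def)
qed

lemma prime_in_image:
  assumes "prime_in S p"
  shows "prime_in (h ` S) (h p)"
proof -
  have p: "p \<in> S" "p \<noteq> 0" "\<not> unit_in S p" using assms by (auto simp: prime_in_def)
  then have "h p \<noteq> 0"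
    using inj_on_eq_iff[OF inj, of p 0] by (auto simp: rh_zero[OF h] ss_zero[OF S])
  moreover have "dvd_in (h ` S) (h p) (h f) \<or> dvd_in (h ` S) (h p) (h g)"
    if "f \<in> S" "g \<in> S" "dvd_in (h ` S) (h p) (h f * h g)" for f g
    using that p prime_inD[OF assms that(1,2)]
    by (simp add: dvd_in_image ss_mult[OF S] flip: rh_mult[OF h])
  ultimately show ?thesis using p by (auto simp: prime_in_def unit_in_image)
qed

lemma ufd_in_image:
  assumes "ufd_in S"
  shows "ufd_in (h ` S)"
  unfolding ufd_in_def
proof (intro ballI impI)
  fix f assume f: "f \<in> h ` S" "f \<noteq> 0"
  then obtain g where g: "f = h g" "g \<in> S" by auto
  with f have "g \<noteq> 0" using rh_zero[OF h] by auto
  then obtain u zs where *: "unit_in S u" "\<forall>p\<in>set zs. prime_in S p" "g = u * prod_list zs"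
    using assms g by (auto simp: ufd_in_def)
  have "h (prod_list zs) = prod_list (map h zs)"
    by (induction zs) (auto simp: rh_one[OF h] rh_mult[OF h])
  then show "\<exists>u zs. unit_in (h ` S) u \<and> (\<forall>p\<in>set zs. prime_in (h ` S) p) \<and> f = u * prod_list zs"
    using * g prime_in_image
    by (intro exI[of _ "h u"] exI[of _ "map h zs"]) (auto simp: rh_mult[OF h] unit_in_image unit_in_def[of S])
qed

end

lemma ufd_in_constants: "ufd_in (polys_in {} :: 'v::linorder qpoly set)"
  unfolding ufd_in_def
proof (intro ballI impI)
  fix f :: "'v qpoly" assume "f \<in> polys_in {}" and f0: "f \<noteq> 0"
  then have "m = 0" if "m \<in> keys f" for m using that by (auto simp: polys_in_def pvars_def)
  then have "f = lconst (lookup f 0)"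
    by (intro poly_mapping_eqI) (auto simp: lconst_def lookup_single when_def in_keys_iff)
  then obtain c where c: "f = lconst c" by blast
  then have "c \<noteq> 0" using f0 by (auto simp: lconst_0)
  then have "f * lconst (inverse c) = 1" by (simp add: c lconst_1 flip: lconst_mult)
  then have "unit_in (polys_in {}) f" unfolding unit_in_def
    by (auto simp: c intro!: bexI[of _ "lconst (inverse c)"])
  then show "\<exists>u zs. unit_in (polys_in {}) u \<and> (\<forall>p\<in>set zs. prime_in (polys_in {}) p) \<and> f = u * prod_list zs"
    by (intro exI[of _ f] exI[of _ "[]"]) auto
qed

lemma ring_hom_on_poly: "ring_hom_on (\<lambda>p. poly p a)"
  by (rule ring_hom_onI) auto

lemma polys_in_insert:
  assumes "x \<notin> X"
  shows "polys_in (insert x X) = (\<lambda>p. poly p (pvar x)) ` polys_over (polys_in X)"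
proof
  show "polys_in (insert x X) \<subseteq> (\<lambda>p. poly p (pvar x)) ` polys_over (polys_in X)"
  proof
    fix f assume "f \<in> polys_in (insert x X)"
    then have "uni x f \<in> polys_over (polys_in X)"
      using uni_in_polys_over[of f "insert x X" x] assms by simp
    then show "f \<in> (\<lambda>p. poly p (pvar x)) ` polys_over (polys_in X)"
      by (metis poly_uni image_eqI)
  qed
qed (auto intro: poly_in_polys_in)

text \<open>Variables are adjoined one at a time. The linear order on them places the ring in the
  class of integral domains; other types of variables are reached by \<open>rename\<close>.\<close>

lemma ufd_in_polys_in: "finite X \<Longrightarrow> ufd_in (polys_in X :: 'v::linorder qpoly set)"
proof (induction X rule: finite_induct)
  case (insert x X)
  have "inj_on (\<lambda>p. poly p (pvar x)) (polys_over (polys_in X))"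
    using insert by (intro inj_on_inverseI[where g = "uni x"]) (simp add: uni_poly)
  then show ?case
    unfolding polys_in_insert[OF insert(2)]
    by (rule ufd_in_image[OF ring_hom_on_poly subring_polys_over[OF subring_polys_in] _
        ufd_polys_over[OF subring_polys_in insert(3)]])
qed (simp add: ufd_in_constants)

subsection \<open>Renaming of variables\<close>

text \<open>The types \<open>'y cvar\<close> and \<open>coef dvar\<close> of coefficient variables
  carry no linear order. Facts that concern finitely many variables are proved with natural numbers
  as variables and carried over.\<close>

definition rename :: "('v \<Rightarrow> 'w) \<Rightarrow> 'v qpoly \<Rightarrow> 'w qpoly" where
  "rename r = psubst lconst (\<lambda>v. pvar (r v))"

lemma ring_hom_on_rename: "ring_hom_on (rename r)"
  unfolding rename_def by (rule ring_hom_on_psubst[OF ring_hom_on_lconst])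

lemma rename_pvar: "rename r (pvar v) = pvar (r v)"
  by (simp add: rename_def psubst_pvar[OF ring_hom_on_lconst])

lemma rename_lconst: "rename r (lconst c) = lconst c"
  by (simp add: rename_def psubst_lconst[OF ring_hom_on_lconst])

lemma rename_in: "f \<in> polys_in X \<Longrightarrow> rename r f \<in> polys_in (r ` X)"
  unfolding rename_def
  by (rule ss_psubst[OF subring_polys_in]) (auto simp: polys_in_def)

lemma rename_inv:
  assumes "\<And>v. v \<in> X \<Longrightarrow> s (r v) = v" "f \<in> polys_in X"
  shows "rename s (rename r f) = f"
proof -
  have "rename s (rename r f) = psubst lconst (\<lambda>v. pvar (s (r v))) f"
    unfolding rename_def[of r] hom_psubst_comp[OF ring_hom_on_rename ring_hom_on_lconst]
    by (simp add: rename_lconst rename_pvar)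
  also have "\<dots> = psubst lconst pvar f"
    using assms by (intro psubst_cong) (auto simp: polys_in_def)
  finally show ?thesis by (simp add: psubst_id)
qed

lemma rename_inj_on:
  assumes "inj_on r X" shows "inj_on (rename r) (polys_in X)"
  using assms by (intro inj_on_inverseI[where g = "rename (inv_into X r)"] rename_inv[of X]) auto

lemma rename_image:
  assumes "inj_on r X" shows "rename r ` polys_in X = polys_in (r ` X)"
proof
  show "polys_in (r ` X) \<subseteq> rename r ` polys_in X"
  proof
    fix g assume g: "g \<in> polys_in (r ` X)"
    let ?s = "inv_into X r"
    have "rename ?s g \<in> polys_in (?s ` r ` X)" by (rule rename_in[OF g])
    moreover have "?s ` r ` X = X" using assms by simp
    moreover have "rename r (rename ?s g) = g"
      by (rule rename_inv[OF _ g]) (auto simp: f_inv_into_f)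
    ultimately show "g \<in> rename r ` polys_in X" by (metis image_eqI)
  qed
qed (auto intro: rename_in)

lemma pvars_rename:
  assumes "inj_on r X" "f \<in> polys_in X"
  shows "pvars (rename r f) = r ` pvars f"
proof
  show "pvars (rename r f) \<subseteq> r ` pvars f"
    using rename_in[of f "pvars f" r] by (simp add: polys_in_def)
  let ?s = "inv_into X r"
  have X: "pvars f \<subseteq> X" using assms by (simp add: polys_in_def)
  have "f = rename ?s (rename r f)"
    using assms rename_inv[of X ?s r f] by simp
  then have "pvars f \<subseteq> ?s ` pvars (rename r f)"
    using rename_in[of "rename r f" "pvars (rename r f)" ?s] by (simp add: polys_in_def)
  then have "r ` pvars f \<subseteq> r ` ?s ` pvars (rename r f)" by auto
  also have "\<dots> \<subseteq> pvars (rename r f)"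
    using rename_in[of f X r] assms by (auto simp: polys_in_def f_inv_into_f)
  finally show "r ` pvars f \<subseteq> pvars (rename r f)" .
qed

lemma finite_rename: "finite X \<Longrightarrow> \<exists>r :: 'v \<Rightarrow> nat. inj_on r X"
  using finite_imp_inj_to_nat_seg[of X] by blast

lemma qpoly_no_zero_divisors:
  fixes f g :: "'v qpoly"
  assumes "f * g = 0" shows "f = 0 \<or> g = 0"
proof -
  let ?X = "pvars f \<union> pvars g"
  obtain r :: "'v \<Rightarrow> nat" where r: "inj_on r ?X" using finite_rename[of ?X] by auto
  note H = ring_hom_on_rename[of r]
  have "rename r f * rename r g = 0" using assms by (simp add: rh_zero[OF H] flip: rh_mult[OF H])
  then have "rename r f = rename r 0 \<or> rename r g = rename r 0" by (simp add: rh_zero[OF H])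
  then show ?thesis
    using rename_inj_on[OF r] by (auto simp: inj_on_def polys_in_def)
qed

lemma qpoly_cancel: "p \<noteq> 0 \<Longrightarrow> p * f = p * g \<Longrightarrow> f = (g :: 'v qpoly)"
  using qpoly_no_zero_divisors[of p "f - g"] by (simp add: algebra_simps)

text \<open>Over a domain the degree in each variable is additive, and a variable occurs exactly if
  this degree is positive.\<close>

lemma pvars_mult_eq:
  fixes f g :: "'v qpoly"
  assumes "f \<noteq> 0" "g \<noteq> 0"
  shows "pvars (f * g) = pvars f \<union> pvars g"
proof -
  have nat: "pvars (f * g) = pvars f \<union> pvars g" if "f \<noteq> 0" "g \<noteq> 0" for f g :: "nat qpoly"
  proof -
    have "x \<in> pvars (f * g) \<longleftrightarrow> x \<in> pvars f \<or> x \<in> pvars g" for x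
    proof -
      have "degree (uni x (f * g)) = degree (uni x f) + degree (uni x g)"
        using that by (simp add: rh_mult[OF ring_hom_on_uni] degree_mult_eq uni_eq_0_iff)
      then show ?thesis by (metis add_is_0 degree_uni_0_iff)
    qed
    then show ?thesis by auto
  qed
  let ?X = "pvars f \<union> pvars g"
  obtain r :: "'v \<Rightarrow> nat" where r: "inj_on r ?X" using finite_rename[of ?X] by auto
  note H = ring_hom_on_rename[of r]
  have in_X: "f \<in> polys_in ?X" "g \<in> polys_in ?X" "f * g \<in> polys_in ?X" "0 \<in> polys_in ?X"
    using pvars_mult[of f g] by (auto simp: polys_in_def)
  have "rename r f \<noteq> 0" "rename r g \<noteq> 0"
    using assms inj_on_eq_iff[OF rename_inj_on[OF r] _ in_X(4)] in_X by (auto simp: rh_zero[OF H])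
  then have "pvars (rename r (f * g)) = r ` (pvars f \<union> pvars g)"
    using nat by (simp add: rh_mult[OF H] pvars_rename[OF r] in_X image_Un)
  then have "r ` pvars (f * g) = r ` ?X" by (simp add: pvars_rename[OF r] in_X)
  then show ?thesis
    using inj_on_image_eq_iff[OF r, of "pvars (f * g)" ?X] pvars_mult[of f g] by simp
qed

text \<open>A quotient found in the ambient ring brings in no new variables. Hence divisibility can
  be proved there and read back in any polynomial ring that contains the dividend; for the dividend
  0 the quotient 0 is taken instead.\<close>

lemma dvd_in_polys_in:
  assumes "f \<in> polys_in X" "f = p * c"
  shows "dvd_in (polys_in X) p f"
proof (cases "f = 0")
  case True
  then show ?thesis unfolding dvd_in_def using ss_zero[OF subring_polys_in] by (intro bexI[of _ 0]) auto
next
  case False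
  then have "p \<noteq> 0" "c \<noteq> 0" using assms by auto
  then show ?thesis using assms pvars_mult_eq[of p c] by (auto simp: dvd_in_def polys_in_def)
qed

lemma unit_in_polys_in:
  assumes "unit_in (polys_in X) u" shows "unit_in (polys_in Y) u"
proof -
  from assms obtain v where v: "u * v = 1" by (auto simp: unit_in_def)
  then have "u \<noteq> 0" "v \<noteq> 0" by auto
  then have "pvars u = {}" "pvars v = {}" using pvars_mult_eq[of u v] v by auto
  then show ?thesis using v by (auto simp: unit_in_def polys_in_def)
qed

text \<open>The set \<open>X\<close> may be infinite. A test for primeness concerns finitely many
  variables, over which the ring is factorial; irreducibility passes to them because units are
  constants whatever the variables are.\<close>

lemma irreducible_prime_polys_in:
  fixes p :: "'v qpoly"
  assumes p: "p \<in> polys_in X" and irr: "ring_irreducible\<^bsub>subring_on (polys_in X)\<^esub> p"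
  shows "prime_in (polys_in X) p"
proof -
  note SX = subring_polys_in[of X]
  have p0: "p \<noteq> 0" and pu: "\<not> unit_in (polys_in X) p"
    using irr Units_subring_on[OF SX, of p]
    by (auto simp: ring_irreducible_def irreducible_def unit_in_def subring_on_def[of "polys_in X"])
  have pab: "unit_in (polys_in X) a \<or> unit_in (polys_in X) b"
    if ab: "a \<in> polys_in X" "b \<in> polys_in X" "p = a * b" for a b
  proof (rule ccontr)
    assume n: "\<not> ?thesis"
    then have "a \<notin> Units (subring_on (polys_in X))"
      using Units_subring_on[OF SX, of a] by (auto simp: unit_in_def)
    then have "\<not> properfactor (subring_on (polys_in X)) a p"
      using irr ab by (auto simp: ring_irreducible_def irreducible_def subring_on_def)
    then obtain c where "c \<in> polys_in X" "a = p * c"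
      using ab by (auto simp: properfactor_def dvd_in_subring_on[OF SX])
    then have "a * 1 = a * (b * c)" using ab by (simp add: mult_ac)
    moreover have "a \<noteq> 0" using ab p0 by auto
    ultimately have "b * c = 1" using qpoly_cancel[of a 1 "b * c"] by simp
    with \<open>c \<in> polys_in X\<close> n ab show False by (auto simp: unit_in_def)
  qed
  show ?thesis
    unfolding prime_in_def
  proof (intro conjI ballI impI p p0 pu)
    fix f g assume fg: "f \<in> polys_in X" "g \<in> polys_in X" "dvd_in (polys_in X) p (f * g)"
    define Y where "Y = pvars p \<union> pvars f \<union> pvars g"
    have Y: "finite Y" "Y \<subseteq> X" "p \<in> polys_in Y" "f \<in> polys_in Y" "g \<in> polys_in Y"
      using p fg by (auto simp: Y_def polys_in_def)
    obtain r :: "'v \<Rightarrow> nat" where r: "inj_on r Y" using finite_rename[OF Y(1)] by auto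
    define s where "s = inv_into Y r"
    note SY = subring_polys_in[of Y]
    have inj_s: "inj_on s (r ` Y)" unfolding s_def by (rule inj_on_inv_into) simp
    have "ufd_in (rename s ` polys_in (r ` Y))"
      by (rule ufd_in_image[OF ring_hom_on_rename subring_polys_in rename_inj_on[OF inj_s]
          ufd_in_polys_in]) (simp add: Y)
    also have "rename s ` polys_in (r ` Y) = polys_in Y"
      using rename_image[OF inj_s] r by (simp add: s_def)
    finally have ufd: "ufd_in (polys_in Y)" .
    have "prime_in (polys_in Y) p"
    proof -
      let ?R = "rename r" and ?Z = "polys_in (r ` Y)"
      have img: "?R ` polys_in Y = ?Z" by (rule rename_image[OF r])
      note I = ring_hom_on_rename[of r] SY rename_inj_on[OF r]
      have "prime_in ?Z (?R p)"
      proof (rule ufd_irreducible_prime[OF subring_polys_in])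
        show "ufd_in ?Z" using Y by (intro ufd_in_polys_in) simp
        show "?R p \<in> ?Z" using Y by (intro rename_in)
        show "?R p \<noteq> 0"
          using p0 Y inj_on_eq_iff[OF rename_inj_on[OF r], of p 0] ss_zero[OF SY]
          by (auto simp: rh_zero[OF ring_hom_on_rename])
        show "\<not> unit_in ?Z (?R p)"
          using unit_in_image[OF I Y(3)] pu unit_in_polys_in[of Y p X] by (auto simp: img)
        fix a b assume "a \<in> ?Z" "b \<in> ?Z" and ab: "?R p = a * b"
        then obtain a' b' where a': "a' \<in> polys_in Y" "a = ?R a'" "b' \<in> polys_in Y" "b = ?R b'"
          unfolding img[symmetric] by auto
        then have "?R p = ?R (a' * b')" using ab by (simp add: rh_mult[OF ring_hom_on_rename])
        then have "p = a' * b'"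
          using inj_on_eq_iff[OF rename_inj_on[OF r] Y(3), of "a' * b'"] a' ss_mult[OF SY] by blast
        moreover have "a' \<in> polys_in X" "b' \<in> polys_in X" using a' Y by (auto simp: polys_in_def)
        ultimately have "unit_in (polys_in Y) a' \<or> unit_in (polys_in Y) b'"
          using pab[of a' b'] unit_in_polys_in by blast
        then show "unit_in ?Z a \<or> unit_in ?Z b"
          using unit_in_image[OF I] a' by (auto simp: img)
      qed
      then have "prime_in (rename s ` ?Z) (rename s (?R p))"
        by (rule prime_in_image[OF ring_hom_on_rename subring_polys_in rename_inj_on[OF inj_s]])
      moreover have "rename s (?R p) = p"
        using Y r by (intro rename_inv[of Y]) (auto simp: s_def)
      moreover have "rename s ` ?Z = polys_in Y"
        using rename_image[OF inj_s] r by (simp add: s_def)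
      ultimately show ?thesis by simp
    qed
    moreover obtain c where "f * g = p * c" using fg by (auto simp: dvd_in_def)
    then have "dvd_in (polys_in Y) p (f * g)"
      using ss_mult[OF SY Y(4,5)] by (intro dvd_in_polys_in)
    ultimately have "dvd_in (polys_in Y) p f \<or> dvd_in (polys_in Y) p g"
      using Y prime_inD by blast
    then show "dvd_in (polys_in X) p f \<or> dvd_in (polys_in X) p g"
      using fg dvd_in_polys_in unfolding dvd_in_def[of "polys_in Y"] by blast
  qed
qed

subsection \<open>Linear algebra over an integral domain\<close>

text \<open>Fraction-free Gaussian elimination: with the pivot \<open>a j0 i\<close>,
  cross-multiplication removes \<open>j0\<close> from the remaining equations.\<close>

lemma homogeneous_system_solution:
  fixes a :: "'j \<Rightarrow> 'i \<Rightarrow> 'a::idom"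
  assumes "finite I" "finite J" "card I < card J"
  shows "\<exists>c. (\<exists>j\<in>J. c j \<noteq> 0) \<and> (\<forall>i\<in>I. (\<Sum>j\<in>J. c j * a j i) = 0)"
  using assms
proof (induction I arbitrary: J a rule: finite_induct)
  case empty
  then obtain j where "j \<in> J" by fastforce
  then show ?case by (intro exI[of _ "\<lambda>_. 1"]) auto
next
  case (insert i I)
  show ?case
  proof (cases "\<exists>j0\<in>J. a j0 i \<noteq> 0")
    case False
    then show ?thesis using insert.IH[of J a] insert by auto
  next
    case True
    then obtain j0 where j0: "j0 \<in> J" "a j0 i \<noteq> 0" by blast
    define J' where "J' = J - {j0}"
    have J': "finite J'" "card I < card J'" "J = insert j0 J'" "j0 \<notin> J'"
      using insert j0 by (auto simp: J'_def)
    obtain c where c: "\<exists>j\<in>J'. c j \<noteq> 0"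
      and sol: "\<And>k. k \<in> I \<Longrightarrow> (\<Sum>j\<in>J'. c j * (a j0 i * a j k - a j i * a j0 k)) = 0"
      using insert.IH[OF J'(1,2), of "\<lambda>j k. a j0 i * a j k - a j i * a j0 k"] by blast
    \<comment> \<open>The solution of the reduced system, scaled by the pivot; the entry at
      \<open>j0\<close> is what equation \<open>i\<close> then demands.\<close>
    define b where "b j = (if j = j0 then - (\<Sum>j\<in>J'. c j * a j i) else a j0 i * c j)" for j
    have b: "(\<Sum>j\<in>J. b j * a j k) = - (\<Sum>j\<in>J'. c j * a j i) * a j0 k + (\<Sum>j\<in>J'. a j0 i * c j * a j k)" for k
    proof -
      have "(\<Sum>j\<in>J'. b j * a j k) = (\<Sum>j\<in>J'. a j0 i * c j * a j k)"
        using J' by (intro sum.cong) (auto simp: b_def)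
      then show ?thesis using J' by (simp add: b_def)
    qed
    have "(\<Sum>j\<in>J. b j * a j i) = 0"
      unfolding b by (simp add: sum_distrib_left mult_ac)
    moreover have "(\<Sum>j\<in>J. b j * a j k) = 0" if "k \<in> I" for k
    proof -
      have "(\<Sum>j\<in>J. b j * a j k) = (\<Sum>j\<in>J'. c j * (a j0 i * a j k - a j i * a j0 k))"
        unfolding b by (simp add: sum_distrib_left right_diff_distrib sum_subtractf mult_ac)
      then show ?thesis using sol that by simp
    qed
    moreover have "\<exists>j\<in>J. b j \<noteq> 0" using c j0 J' by (auto simp: b_def)
    ultimately show ?thesis by (intro exI[of _ b]) auto
  qed
qed

text \<open>\<open>qspan v I\<close> is the span over the field of fractions, with cleared denominators.\<close>

definition qspan :: "('i \<Rightarrow> 'x \<Rightarrow> 'a::idom) \<Rightarrow> 'i set \<Rightarrow> ('x \<Rightarrow> 'a) set" where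
  "qspan v I = {x. \<exists>d c. d \<noteq> 0 \<and> (\<forall>t. d * x t = (\<Sum>i\<in>I. c i * v i t))}"

definition lin_indep :: "('i \<Rightarrow> 'x \<Rightarrow> 'a::idom) \<Rightarrow> 'i set \<Rightarrow> bool" where
  "lin_indep v I \<longleftrightarrow> (\<forall>c. (\<forall>t. (\<Sum>i\<in>I. c i * v i t) = 0) \<longrightarrow> (\<forall>i\<in>I. c i = 0))"

lemma qspanI: "d \<noteq> 0 \<Longrightarrow> (\<And>t. d * x t = (\<Sum>i\<in>I. c i * v i t)) \<Longrightarrow> x \<in> qspan v I"
  by (auto simp: qspan_def)

lemma qspan_base: "finite I \<Longrightarrow> i \<in> I \<Longrightarrow> v i \<in> qspan v I"
  by (intro qspanI[where d = 1 and c = "\<lambda>j. if j = i then 1 else 0"])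
     (auto simp: if_distrib[of "\<lambda>x. x * _"] cong: if_cong)

lemma qspan_zero: "(\<lambda>t. 0) \<in> qspan v I"
  by (intro qspanI[where d = 1 and c = "\<lambda>_. 0"]) auto

lemma qspan_scale: "x \<in> qspan v I \<Longrightarrow> (\<lambda>t. r * x t) \<in> qspan v I"
proof -
  assume "x \<in> qspan v I"
  then obtain d c where "d \<noteq> 0" "\<And>t. d * x t = (\<Sum>i\<in>I. c i * v i t)" by (auto simp: qspan_def)
  then show ?thesis
    by (intro qspanI[where d = d and c = "\<lambda>i. r * c i"])
       (auto simp: sum_distrib_left[symmetric] mult.assoc mult.left_commute[of d])
qed

lemma qspan_add: "x \<in> qspan v I \<Longrightarrow> y \<in> qspan v I \<Longrightarrow> (\<lambda>t. x t + y t) \<in> qspan v I"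
proof -
  assume "x \<in> qspan v I" "y \<in> qspan v I"
  then obtain d c d' c' where *: "d \<noteq> 0" "\<And>t. d * x t = (\<Sum>i\<in>I. c i * v i t)"
    "d' \<noteq> 0" "\<And>t. d' * y t = (\<Sum>i\<in>I. c' i * v i t)" by (auto simp: qspan_def)
  have "(d * d') * (x t + y t) = d' * (d * x t) + d * (d' * y t)" for t by (simp add: algebra_simps)
  then show ?thesis using *
    by (intro qspanI[where d = "d * d'" and c = "\<lambda>i. d' * c i + d * c' i"])
       (auto simp: sum_distrib_left sum.distrib algebra_simps)
qed

lemma qspan_sum: "(\<And>k. k \<in> K \<Longrightarrow> x k \<in> qspan v I) \<Longrightarrow> (\<lambda>t. \<Sum>k\<in>K. x k t) \<in> qspan v I"
  by (induction K rule: infinite_finite_induct) (auto intro: qspan_zero qspan_add)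

lemma qspan_lin_comb:
  "(\<And>k. k \<in> K \<Longrightarrow> x k \<in> qspan v I) \<Longrightarrow> (\<lambda>t. \<Sum>k\<in>K. r k * x k t) \<in> qspan v I"
  by (intro qspan_sum qspan_scale)

lemma qspan_uncancel: "d \<noteq> 0 \<Longrightarrow> (\<lambda>t. d * x t) \<in> qspan v I \<Longrightarrow> x \<in> qspan v I"
proof -
  assume d: "d \<noteq> 0" and "(\<lambda>t. d * x t) \<in> qspan v I"
  then obtain e c where "e \<noteq> 0" "\<And>t. e * (d * x t) = (\<Sum>i\<in>I. c i * v i t)" by (auto simp: qspan_def)
  then show ?thesis using d by (intro qspanI[where d = "e * d" and c = c]) (auto simp: mult.assoc)
qed

lemma qspan_trans:
  assumes "x \<in> qspan w J" "\<And>j. j \<in> J \<Longrightarrow> w j \<in> qspan v I"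
  shows "x \<in> qspan v I"
proof -
  obtain d c where d: "d \<noteq> 0" "\<And>t. d * x t = (\<Sum>j\<in>J. c j * w j t)" using assms by (auto simp: qspan_def)
  have "(\<lambda>t. d * x t) \<in> qspan v I" unfolding d(2) by (intro qspan_lin_comb assms)
  then show ?thesis by (rule qspan_uncancel[OF d(1)])
qed

text \<open>Steinitz bound. The coordinates of more than \<open>card I\<close> vectors satisfy a
  nontrivial relation; multiplication by the nonzero denominators \<open>d j\<close> makes it a
  relation between the vectors.\<close>

lemma lin_indep_card_le:
  assumes I: "finite I" and J: "finite J" and ind: "lin_indep w J" and sp: "\<And>j. j \<in> J \<Longrightarrow> w j \<in> qspan v I"
  shows "card J \<le> card I"
proof (rule ccontr)
  assume "\<not> ?thesis"
  then have less: "card I < card J" by simp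
  have "\<forall>j\<in>J. \<exists>d c. d \<noteq> 0 \<and> (\<forall>t. d * w j t = (\<Sum>i\<in>I. c i * v i t))"
    using sp by (auto simp: qspan_def)
  then obtain d a where d: "\<And>j. j \<in> J \<Longrightarrow> d j \<noteq> 0"
    and a: "\<And>j t. j \<in> J \<Longrightarrow> d j * w j t = (\<Sum>i\<in>I. a j i * v i t)"
    by metis
  obtain c where c: "\<exists>j\<in>J. c j \<noteq> 0" "\<And>i. i \<in> I \<Longrightarrow> (\<Sum>j\<in>J. c j * a j i) = 0"
    using homogeneous_system_solution[OF I J less, of a] by blast
  have "(\<Sum>j\<in>J. (c j * d j) * w j t) = 0" for t
  proof -
    have "(\<Sum>j\<in>J. (c j * d j) * w j t) = (\<Sum>j\<in>J. \<Sum>i\<in>I. c j * a j i * v i t)"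
      by (intro sum.cong refl) (simp add: mult.assoc a sum_distrib_left)
    also have "\<dots> = (\<Sum>i\<in>I. (\<Sum>j\<in>J. c j * a j i) * v i t)"
      by (subst sum.swap) (simp add: sum_distrib_right)
    also have "\<dots> = 0" using c by simp
    finally show ?thesis .
  qed
  with ind have "\<forall>j\<in>J. c j * d j = 0"
    unfolding lin_indep_def by (elim allE[of _ "\<lambda>j. c j * d j"] impE) auto
  with c d show False by auto
qed

subsection \<open>Laurent polynomials and their logarithmic derivatives\<close>

type_synonym 'w lau = "('w \<Rightarrow>\<^sub>0 int) \<Rightarrow>\<^sub>0 rat"

definition lvar :: "'w \<Rightarrow> 'w lau" where
  "lvar w = single (single w 1) 1"

lemma pvars_lvar [simp]: "pvars (lvar w) = {w}"
  by (simp add: lvar_def pvars_single)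

lemma lvar_nonzero [simp]: "lvar w \<noteq> 0"
  using pvars_lvar[of w] by (metis pvars_0 insert_not_empty)

text \<open>The operator \<open>w d/dw\<close>. It maps a Laurent monomial to an integer multiple of
  itself, so that the gradient of a monomial is the monomial times its exponent vector.\<close>

definition theta :: "'w \<Rightarrow> 'w lau \<Rightarrow> 'w lau" where
  "theta w f = (\<Sum>m\<in>keys f. single m (of_int (lookup m w) * lookup f m))"

lemma theta_add: "theta w (f + g) = theta w f + theta w g"
  unfolding theta_def
  by (rule setsum_keys_plus_distrib) (auto simp: algebra_simps simp flip: single_add)

lemma theta_0 [simp]: "theta w 0 = 0"
  by (simp add: theta_def)

lemma theta_single: "theta w (single m c) = single m (of_int (lookup m w) * c)"
  by (cases "c = 0") (auto simp: theta_def)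

lemma theta_mult: "theta w (f * g) = theta w f * g + f * theta w g"
proof (induction f rule: pm_induct)
  case (single m a)
  show ?case
    by (induction g rule: pm_induct)
       (simp_all add: theta_single mult_single theta_add lookup_add algebra_simps flip: single_add)
qed (simp_all add: theta_add algebra_simps)

lemma derivation_theta: "derivation (theta w)"
  by (rule derivationI) (auto simp: theta_add theta_mult)

lemma theta_lconst [simp]: "theta w (lconst c) = 0"
  by (simp add: lconst_def theta_single)

lemma theta_lvar: "theta w (lvar v) = (if v = w then lvar v else 0)"
  by (simp add: lvar_def theta_single lookup_single)

lemma theta_eq_0: "w \<notin> pvars f \<Longrightarrow> theta w f = 0"
  unfolding theta_def pvars_def by (intro sum.neutral) (auto simp: in_keys_iff)

subsection \<open>Algebraic independence and the Jacobian criterion\<close>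

definition alg_indep :: "('s \<Rightarrow> 'w lau) \<Rightarrow> 's set \<Rightarrow> bool" where
  "alg_indep g S \<longleftrightarrow> (\<forall>G. pvars G \<subseteq> S \<and> psubst lconst g G = 0 \<longrightarrow> G = 0)"

definition exp_bounded :: "nat \<Rightarrow> 'w lau \<Rightarrow> bool" where
  "exp_bounded C f \<longleftrightarrow> (\<forall>m\<in>keys f. \<forall>w. \<bar>lookup m w\<bar> \<le> int C)"

lemma exp_bounded_mult:
  assumes "exp_bounded C f" "exp_bounded D g"
  shows "exp_bounded (C + D) (f * g)"
  unfolding exp_bounded_def
proof (intro ballI allI)
  fix m w assume "m \<in> keys (f * g)"
  then obtain a b where "m = a + b" "a \<in> keys f" "b \<in> keys g" using keys_mult[of f g] by auto
  moreover then have "\<bar>lookup a w\<bar> \<le> int C" "\<bar>lookup b w\<bar> \<le> int D" using assms by (auto simp: exp_bounded_def)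
  ultimately show "\<bar>lookup m w\<bar> \<le> int (C + D)" by (simp add: lookup_add)
qed

lemma exp_bounded_one: "exp_bounded 0 1"
  by (simp add: exp_bounded_def)

lemma exp_bounded_power: "exp_bounded C f \<Longrightarrow> exp_bounded (k * C) (f ^ k)"
  by (induction k) (auto simp: exp_bounded_one intro: exp_bounded_mult)

lemma exp_bounded_prod:
  "finite A \<Longrightarrow> (\<And>x. x \<in> A \<Longrightarrow> exp_bounded (C x) (f x)) \<Longrightarrow> exp_bounded (sum C A) (prod f A)"
  by (induction A rule: finite_induct) (auto simp: exp_bounded_one intro: exp_bounded_mult)

lemma exp_bounded_mono: "exp_bounded C f \<Longrightarrow> C \<le> D \<Longrightarrow> exp_bounded D f"
  unfolding exp_bounded_def by (meson of_nat_mono order_trans)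

lemma exp_bounded_exists: "\<exists>C. exp_bounded C f"
proof -
  define C where "C = (\<Sum>m\<in>keys f. \<Sum>w\<in>keys m. nat \<bar>lookup m w\<bar>)"
  have "\<bar>lookup m w\<bar> \<le> int C" if m: "m \<in> keys f" for m w
  proof (cases "w \<in> keys m")
    case True
    have "nat \<bar>lookup m w\<bar> \<le> (\<Sum>w\<in>keys m. nat \<bar>lookup m w\<bar>)"
      by (rule member_le_sum[OF True]) auto
    also have "\<dots> \<le> C" unfolding C_def by (rule member_le_sum[OF m]) auto
    finally show ?thesis by linarith
  qed (auto simp: in_keys_iff)
  then show ?thesis by (auto simp: exp_bounded_def)
qed

text \<open>The powers of the members of a family of degree at most \<open>D\<close> in each member outnumber the
  Laurent monomials that can occur in them.\<close>

lemma alg_indep_card_le: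
  fixes g :: "'s \<Rightarrow> 'w lau"
  assumes I: "finite I" and W: "finite W" and gW: "\<And>i. i \<in> I \<Longrightarrow> pvars (g i) \<subseteq> W"
    and ind: "alg_indep g I"
  shows "card I \<le> card W"
proof (rule ccontr)
  assume "\<not> ?thesis"
  then have less: "Suc (card W) \<le> card I" by simp
  have "\<forall>i\<in>I. \<exists>C. exp_bounded C (g i)" using exp_bounded_exists by blast
  then obtain C where C: "\<And>i. i \<in> I \<Longrightarrow> exp_bounded (C i) (g i)" by metis
  \<comment> \<open>Products of powers up to \<open>D\<close> have exponents of size at most
    \<open>D * B\<close>. As \<open>2 * D * B + 1\<close> is at most \<open>q * (D + 1)\<close>, the
    choice \<open>D = q ^ card W\<close> bounds the number of monomials by
    \<open>D * (D + 1) ^ card W\<close>, fewer than the \<open>(D + 1) ^ card I\<close>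
    products.\<close>
  define B where "B = sum C I"
  define q where "q = 2 * B + 1"
  define D where "D = q ^ card W"
  have bd: "exp_bounded (D * B) (mev g m)" if "keys m \<subseteq> I" "\<And>i. lookup m i \<le> D" for m
  proof -
    have "exp_bounded (\<Sum>i\<in>I. lookup m i * C i) (\<Prod>i\<in>I. g i ^ lookup m i)"
      using C I by (intro exp_bounded_prod exp_bounded_power) auto
    moreover have "(\<Sum>i\<in>I. lookup m i * C i) \<le> D * B"
      unfolding B_def sum_distrib_left using that by (intro sum_mono) auto
    ultimately show ?thesis by (simp add: mev_superset[OF I that(1)] exp_bounded_mono)
  qed
  define M where "M = (\<lambda>p. Abs_poly_mapping (\<lambda>i. if i \<in> I then p i else 0)) ` (I \<rightarrow>\<^sub>E {..D})"
  define N where "N = (\<lambda>p. Abs_poly_mapping (\<lambda>i. if i \<in> W then p i else 0)) ` (W \<rightarrow>\<^sub>E {- int (D * B)..int (D * B)})"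
  have lookI: "lookup (Abs_poly_mapping (\<lambda>i. if i \<in> I then p i else 0)) = (\<lambda>i. if i \<in> I then p i else (0::nat))" for p
    using I by (intro lookup_Abs_poly_mapping) (auto intro: finite_subset)
  have lookW: "lookup (Abs_poly_mapping (\<lambda>i. if i \<in> W then p i else 0)) = (\<lambda>i. if i \<in> W then p i else (0::int))" for p
    using W by (intro lookup_Abs_poly_mapping) (auto intro: finite_subset)
  have cardM: "card M = (D + 1) ^ card I"
  proof -
    have "inj_on (\<lambda>p. Abs_poly_mapping (\<lambda>i. if i \<in> I then p i else (0::nat))) (I \<rightarrow>\<^sub>E {..D})"
    proof (rule inj_onI)
      fix p p' assume p: "p \<in> I \<rightarrow>\<^sub>E {..D}" "p' \<in> I \<rightarrow>\<^sub>E {..D}"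
        and "Abs_poly_mapping (\<lambda>i. if i \<in> I then p i else 0) = Abs_poly_mapping (\<lambda>i. if i \<in> I then p' i else 0)"
      then have "(\<lambda>i. if i \<in> I then p i else 0) = (\<lambda>i. if i \<in> I then p' i else 0)"
        using lookI by metis
      then have "p i = p' i" if "i \<in> I" for i using fun_cong[of _ _ i] that by fastforce
      then show "p = p'" by (rule PiE_ext[OF p])
    qed
    then show ?thesis unfolding M_def by (simp add: card_image card_PiE I)
  qed
  have finM: "finite M" and finN: "finite N" using I W by (auto simp: M_def N_def intro!: finite_PiE)
  have "card N \<le> card (W \<rightarrow>\<^sub>E {- int (D * B)..int (D * B)})"
    unfolding N_def by (rule card_image_le) (use W in \<open>auto intro!: finite_PiE\<close>)
  also have "\<dots> = (2 * (D * B) + 1) ^ card W"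
    by (subst card_PiE[OF W]) (simp add: nat_add_distrib nat_mult_distrib mult.commute)
  also have "\<dots> \<le> (q * (D + 1)) ^ card W"
    by (intro power_mono) (auto simp: q_def algebra_simps)
  also have "\<dots> = D * (D + 1) ^ card W" by (simp only: power_mult_distrib D_def)
  also have "\<dots> < (D + 1) ^ Suc (card W)" by simp
  also have "\<dots> \<le> (D + 1) ^ card I" by (rule power_increasing[OF less]) simp
  finally have "card N < card M" by (simp add: cardM)
  then obtain c where c: "\<exists>m\<in>M. c m \<noteq> 0" "\<And>n. n \<in> N \<Longrightarrow> (\<Sum>m\<in>M. c m * lookup (mev g m) n) = 0"
    using homogeneous_system_solution[OF finN finM, of "\<lambda>m n. lookup (mev g m) n"] by blast
  have M: "keys m \<subseteq> I" "lookup m i \<le> D" if "m \<in> M" for m i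
    using that unfolding M_def by (auto simp: lookI in_keys_iff PiE_def Pi_def split: if_splits)
  have "(\<Sum>m\<in>M. lconst (c m) * mev g m) = 0"
  proof (rule poly_mapping_eqI)
    fix n
    show "lookup (\<Sum>m\<in>M. lconst (c m) * mev g m) n = lookup 0 n"
    proof (cases "n \<in> N")
      case True
      then show ?thesis using c by (simp add: lookup_sum lookup_lconst_mult)
    next
      case False
      have "lookup (mev g m) n = 0" if m: "m \<in> M" for m
      proof (rule ccontr)
        assume "lookup (mev g m) n \<noteq> 0"
        then have n: "n \<in> keys (mev g m)" by (simp add: in_keys_iff)
        have "mev g m \<in> {f. pvars f \<subseteq> W}"
          unfolding mev_def using gW M[OF m]
          by (intro ss_prod[OF subring_pvars] ss_power[OF subring_pvars]) auto
        then have nW: "keys n \<subseteq> W" using n by (auto simp: pvars_def)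
        have nb: "\<bar>lookup n w\<bar> \<le> int (D * B)" for w
          using bd[of m] M[OF m] n by (auto simp: exp_bounded_def)
        have "n = Abs_poly_mapping (\<lambda>i. if i \<in> W then restrict (lookup n) W i else 0)"
          by (rule poly_mapping_eqI) (use nW in \<open>auto simp: lookW in_keys_iff\<close>)
        moreover have "restrict (lookup n) W \<in> W \<rightarrow>\<^sub>E {- int (D * B)..int (D * B)}"
          using nb by (auto simp: abs_le_iff minus_le_iff)
        ultimately have "n \<in> N" unfolding N_def by (rule image_eqI)
        then show False using False by contradiction
      qed
      then show ?thesis by (simp add: lookup_sum lookup_lconst_mult)
    qed
  qed
  then have "psubst lconst g (\<Sum>m\<in>M. single m (c m)) = 0"
    by (simp add: rh_sum[OF ring_hom_on_psubst[OF ring_hom_on_lconst]] psubst_single[OF ring_hom_on_lconst])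
  moreover have "pvars (\<Sum>m\<in>M. single m (c m)) \<subseteq> I"
    using ss_sum[OF subring_polys_in, of M "\<lambda>m. single m (c m)" I] M
    by (auto simp: polys_in_def pvars_single)
  ultimately have "(\<Sum>m\<in>M. single m (c m)) = 0" using ind by (auto simp: alg_indep_def)
  then have "lookup (\<Sum>m\<in>M. single m (c m)) m = 0" for m by simp
  then have *: "(if m \<in> M then c m else 0) = 0" for m
    using finM by (simp add: lookup_sum lookup_single when_def sum.delta)
  have "c m = 0" if "m \<in> M" for m using *[of m] that by simp
  then show False using c by auto
qed

text \<open>Take a relation of least total degree: its derivatives by variables that occur are
  nonzero polynomials of smaller degree and so are no relations.\<close>

lemma minimal_relation:
  fixes g :: "'s \<Rightarrow> 'w lau"
  assumes "\<not> alg_indep g S"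
  shows "\<exists>G. G \<noteq> 0 \<and> pvars G \<subseteq> S \<and> psubst lconst g G = 0 \<and>
    (\<forall>v\<in>pvars G. psubst lconst g (pdiff v G) \<noteq> 0)"
proof -
  define rel where "rel n G \<longleftrightarrow> G \<noteq> 0 \<and> pvars G \<subseteq> S \<and> psubst lconst g G = 0 \<and> deg_le UNIV n G" for n G
  from assms have "\<exists>n G. rel n G" using deg_le_exists by (fastforce simp: alg_indep_def rel_def)
  define n where "n = (LEAST n. \<exists>G. rel n G)"
  have "\<exists>G. rel n G" unfolding n_def using \<open>\<exists>n G. rel n G\<close> by (rule LeastI_ex)
  then obtain G where G: "rel n G" by blast
  have min: "\<not> rel k F" if "k < n" for k F using not_less_Least[of k "\<lambda>n. \<exists>G. rel n G"] that by (auto simp: n_def)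
  have "psubst lconst g (pdiff v G) \<noteq> 0" if v: "v \<in> pvars G" for v
  proof
    assume 0: "psubst lconst g (pdiff v G) = 0"
    have "n \<noteq> 0"
    proof
      assume "n = 0"
      then have "pvars G \<inter> UNIV = {}" using G deg_le_0[of UNIV G] by (simp add: rel_def)
      then show False using v by auto
    qed
    then obtain k where k: "n = Suc k" by (cases n) auto
    have "rel k (pdiff v G)"
      using G 0 pdiff_nonzero[OF v] pvars_pdiff[of v G] deg_le_pdiff[of UNIV k G v] by (auto simp: rel_def k)
    then show False using min[of k] k by auto
  qed
  with G show ?thesis by (auto simp: rel_def)
qed

subsection \<open>Relative algebraic independence\<close>

definition restr :: "'v set \<Rightarrow> ('v \<Rightarrow>\<^sub>0 nat) \<Rightarrow> ('v \<Rightarrow>\<^sub>0 nat)" where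
  "restr R m = Poly_Mapping.mapp (\<lambda>v k. if v \<in> R then k else 0) m"

text \<open>The coefficient of the monomial \<open>n\<close> in \<open>f\<close>, regarded as a
  polynomial in the variables \<open>R\<close> over the ring in the other variables.\<close>

definition rpart :: "'v set \<Rightarrow> ('v \<Rightarrow>\<^sub>0 nat) \<Rightarrow> 'v qpoly \<Rightarrow> 'v qpoly" where
  "rpart R n f = (\<Sum>m\<in>{m\<in>keys f. restr R m = n}. single (restr (- R) m) (lookup f m))"

lemma lookup_restr: "lookup (restr R m) v = (if v \<in> R then lookup m v else 0)"
  by (auto simp: restr_def lookup_mapp when_def in_keys_iff)

lemma restr_add: "restr R m + restr (- R) m = m"
  by (rule poly_mapping_eqI) (auto simp: lookup_add lookup_restr)

lemma keys_restr: "keys (restr R m) = keys m \<inter> R"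
  by (auto simp: in_keys_iff lookup_restr split: if_splits)

lemma rpart_expand: "f = (\<Sum>n\<in>restr R ` keys f. single n 1 * rpart R n f)"
proof -
  have "(\<Sum>n\<in>restr R ` keys f. single n 1 * rpart R n f)
      = (\<Sum>n\<in>restr R ` keys f. \<Sum>m\<in>{m\<in>keys f. restr R m = n}. single m (lookup f m))"
    unfolding rpart_def sum_distrib_left
    by (intro sum.cong refl) (auto simp: mult_single restr_add)
  also have "\<dots> = (\<Sum>m\<in>keys f. single m (lookup f m))"
    by (rule sum.image_gen[symmetric]) simp
  finally show ?thesis using pm_expand[of f] by simp
qed

lemma lookup_rpart:
  "lookup (rpart R n f) m = (if keys n \<subseteq> R \<and> keys m \<inter> R = {} then lookup f (n + m) else 0)"
proof -
  have eq: "restr R m' = n \<and> restr (- R) m' = m \<longleftrightarrow> m' = n + m \<and> keys n \<subseteq> R \<and> keys m \<inter> R = {}" for m'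
  proof
    assume "restr R m' = n \<and> restr (- R) m' = m"
    then show "m' = n + m \<and> keys n \<subseteq> R \<and> keys m \<inter> R = {}"
      using restr_add[of R m'] keys_restr[of R m'] keys_restr[of "- R" m'] by auto
  next
    assume *: "m' = n + m \<and> keys n \<subseteq> R \<and> keys m \<inter> R = {}"
    then have "lookup n v = 0" if "v \<notin> R" for v using that by (auto simp: in_keys_iff)
    moreover have "lookup m v = 0" if "v \<in> R" for v using that * by (auto simp: in_keys_iff)
    ultimately show "restr R m' = n \<and> restr (- R) m' = m"
      using * by (auto intro!: poly_mapping_eqI simp: lookup_restr lookup_add)
  qed
  have "lookup (rpart R n f) m
      = (\<Sum>m'\<in>keys f. if restr R m' = n \<and> restr (- R) m' = m then lookup f m' else 0)"
    unfolding rpart_def lookup_sum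
    by (subst sum.inter_filter) (auto intro!: sum.cong simp: lookup_single when_def)
  also have "\<dots> = (if keys n \<subseteq> R \<and> keys m \<inter> R = {} then lookup f (n + m) else 0)"
  proof (cases "keys n \<subseteq> R \<and> keys m \<inter> R = {}")
    case False
    then show ?thesis unfolding eq by (simp only: simp_thms if_False sum.neutral_const)
  qed (simp add: eq in_keys_iff)
  finally show ?thesis .
qed

lemma pvars_rpart: "pvars (rpart R n f) \<subseteq> pvars f - R"
proof
  fix v assume "v \<in> pvars (rpart R n f)"
  then obtain m where m: "lookup (rpart R n f) m \<noteq> 0" "v \<in> keys m" by (auto simp: pvars_def in_keys_iff)
  then have "keys m \<inter> R = {}" "n + m \<in> keys f" by (auto simp: lookup_rpart in_keys_iff split: if_splits)
  moreover have "v \<in> keys (n + m)" using m by (auto simp: in_keys_iff lookup_add)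
  ultimately show "v \<in> pvars f - R" using m by (auto simp: pvars_def)
qed

text \<open>Lets the coefficients of \<open>f\<close> at nonconstant monomials be read off from
  derivatives of \<open>f\<close>, which have smaller degree in \<open>R\<close>.\<close>

lemma rpart_pdiff:
  assumes v: "v \<in> keys n" "keys n \<subseteq> R"
  shows "rpart R (n - single v 1) (pdiff v f) = lconst (of_nat (lookup n v)) * rpart R n f"
proof (rule poly_mapping_eqI)
  fix m :: "'a \<Rightarrow>\<^sub>0 nat"
  have n: "n - single v 1 + single v 1 = n"
    using assms pm_minus_single_add[of n v "single v 1"] by (simp add: in_keys_iff)
  have k: "keys (n - single v 1) \<subseteq> R"
    using v by (auto simp: in_keys_iff lookup_minus subset_iff)
  show "lookup (rpart R (n - single v 1) (pdiff v f)) m = lookup (lconst (of_nat (lookup n v)) * rpart R n f) m"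
  proof (cases "keys m \<inter> R = {}")
    case True
    then have "v \<notin> keys m" using v by blast
    then have mv: "lookup m v = 0" by (simp add: in_keys_iff)
    have "n - single v 1 + m + single v 1 = n + m" using n by (metis add.assoc add.commute)
    moreover have "Suc (lookup (n - single v 1 + m) v) = lookup n v"
      using mv assms by (simp add: lookup_add lookup_minus in_keys_iff)
    ultimately show ?thesis using True k v
      by (simp add: lookup_rpart lookup_pdiff lookup_lconst_mult del: of_nat_Suc One_nat_def)
  next
    case False
    then show ?thesis by (simp add: lookup_rpart lookup_lconst_mult)
  qed
qed

text \<open>The hypothesis \<open>ind\<close> says that the gradients on \<open>R\<close> are
  independent modulo those on \<open>L\<close>. By the chain rule the derivatives of a relation
  \<open>f\<close> by variables in \<open>R\<close> are again relations, of smaller degree in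
  \<open>R\<close>; by induction their coefficients vanish, which settles every monomial
  \<open>n\<close> except 0.\<close>

theorem relative_independence:
  fixes \<psi> :: "'v \<Rightarrow> ('w::linorder) lau"
  assumes L: "finite L" and R: "finite R" "L \<inter> R = {}"
    and ind: "\<And>c. (\<And>w. (\<Sum>v\<in>L \<union> R. c v * theta w (\<psi> v)) = 0) \<Longrightarrow> \<forall>v\<in>R. c v = 0"
    and f: "pvars f \<subseteq> L \<union> R" "psubst lconst \<psi> f = 0"
  shows "psubst lconst \<psi> (rpart R n f) = 0"
proof -
  note Q = ring_hom_on_psubst[OF ring_hom_on_lconst, of \<psi>]
  have "\<forall>n. psubst lconst \<psi> (rpart R n f) = 0" if "deg_le R N f" for N
    using that f
  proof (induction N arbitrary: f)
    case 0
    then have "pvars f \<inter> R = {}" by (auto dest: deg_le_0)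
    then have "rpart R n f = (if n = 0 then f else 0)" for n
    proof (intro poly_mapping_eqI)
      fix m
      have z: "lookup f k = 0" if "v \<in> keys k" "v \<in> R" for k v
      proof (rule ccontr)
        assume "lookup f k \<noteq> 0"
        then have "v \<in> pvars f" using that by (auto simp: pvars_def in_keys_iff)
        with \<open>pvars f \<inter> R = {}\<close> that show False by blast
      qed
      show "lookup (rpart R n f) m = lookup (if n = 0 then f else 0) m"
      proof (cases "n = 0")
        case True
        then show ?thesis using z[of _ m] by (auto simp: lookup_rpart)
      next
        case False
        then obtain v where v: "v \<in> keys n" by fastforce
        then have "v \<in> keys (n + m)" by (auto simp: in_keys_iff lookup_add)
        then show ?thesis using False z[of v "n + m"] v by (auto simp: lookup_rpart)
      qed
    qed
    then show ?case using 0 by (simp add: rh_zero[OF Q])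
  next
    case (Suc N)
    have "psubst lconst \<psi> (pdiff v f) = 0" if "v \<in> R" for v
    proof -
      have "(\<Sum>v\<in>L \<union> R. psubst lconst \<psi> (pdiff v f) * theta w (\<psi> v)) = 0" for w
        using psubst_chain[OF derivation_theta ring_hom_on_lconst, of w "L \<union> R" f \<psi>] L R Suc.prems
        by simp
      from ind[OF this] that show ?thesis by blast
    qed
    note pd = this
    have IH: "psubst lconst \<psi> (rpart R n (pdiff v f)) = 0" if v: "v \<in> R" for v n
    proof -
      have "pvars (pdiff v f) \<subseteq> L \<union> R" using pvars_pdiff[of v f] Suc.prems(2) by (rule order_trans)
      from Suc.IH[OF deg_le_pdiff[OF Suc.prems(1) v] this pd[OF v]] show ?thesis by (rule spec)
    qed
    have nz: "psubst lconst \<psi> (rpart R n f) = 0" if n0: "n \<noteq> 0" for n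
    proof (cases "keys n \<subseteq> R")
      case False
      then have "rpart R n f = 0" by (intro poly_mapping_eqI) (auto simp: lookup_rpart)
      then show ?thesis by (simp add: rh_zero[OF Q])
    next
      case True
      have "keys n \<noteq> {}" using n0 by simp
      then obtain v where v: "v \<in> keys n" by blast
      have "lconst (of_nat (lookup n v)) * psubst lconst \<psi> (rpart R n f) = 0"
        using IH[of v "n - single v 1"] v True rpart_pdiff[OF v True, of f]
        by (auto simp: rh_mult[OF Q] psubst_lconst[OF ring_hom_on_lconst])
      moreover have "lconst (of_nat (lookup n v) :: rat) \<noteq> (0 :: 'w lau)"
        using v by (simp add: in_keys_iff flip: lconst_0)
      ultimately show ?thesis by simp
    qed
    \<comment> \<open>All other terms of the expansion being 0, so is the one for
      \<open>n = 0\<close>.\<close>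
    have "0 = psubst lconst \<psi> (\<Sum>n\<in>restr R ` keys f. single n 1 * rpart R n f)"
      using Suc.prems rpart_expand[of f R] by simp
    also have "\<dots> = (\<Sum>n\<in>restr R ` keys f. psubst lconst \<psi> (single n 1) * psubst lconst \<psi> (rpart R n f))"
      by (simp add: rh_sum[OF Q] rh_mult[OF Q])
    also have "\<dots> = (\<Sum>n\<in>restr R ` keys f. if n = 0 then psubst lconst \<psi> (rpart R 0 f) else 0)"
      using nz by (intro sum.cong refl) (auto simp: rh_one[OF Q])
    also have "\<dots> = (if 0 \<in> restr R ` keys f then psubst lconst \<psi> (rpart R 0 f) else 0)"
      by (simp add: sum.delta)
    finally have "0 \<in> restr R ` keys f \<Longrightarrow> psubst lconst \<psi> (rpart R 0 f) = 0" by simp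
    moreover have "rpart R 0 f = 0" if "0 \<notin> restr R ` keys f"
      unfolding rpart_def using that by (intro sum.neutral) auto
    ultimately have "psubst lconst \<psi> (rpart R 0 f) = 0"
      by (cases "0 \<in> restr R ` keys f") (simp_all add: rh_zero[OF Q])
    then show ?case using nz by (intro allI) (case_tac "n = 0", simp_all)
  qed
  then show ?thesis using deg_le_exists by blast
qed

text \<open>The Jacobian criterion in characteristic zero. A maximal set \<open>Y\<close> of
  variables is adjoined such that the family stays independent; it then has at most
  \<open>card W\<close> members. Each other variable is algebraic over it, and a differentiated
  minimal relation puts its unit vector into the span of the gradients. So the gradients span a
  space of dimension \<open>card W\<close>, and none of them can be spared.\<close>

theorem alg_indep_gradients:
  fixes f :: "'s \<Rightarrow> ('w::linorder) lau"
  assumes S: "finite S" and ind: "alg_indep f S"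
  shows "lin_indep (\<lambda>s w. theta w (f s)) S"
proof -
  define W where "W = (\<Union>s\<in>S. pvars (f s))"
  have W: "finite W" using S by (simp add: W_def)
  define g where "g = case_sum f (lvar :: 'w \<Rightarrow> 'w lau)"
  define I where "I Y = Inl ` S \<union> Inr ` Y" for Y :: "'w set"
  have finI: "finite (I Y)" if "Y \<subseteq> W" for Y using S W that by (auto simp: I_def intro: finite_subset)
  have "alg_indep g (I {})"
    unfolding alg_indep_def
  proof (intro allI impI, elim conjE)
    fix G assume G: "pvars G \<subseteq> I {}" "psubst lconst g G = 0"
    let ?r = "rename (\<lambda>v. case v of Inl s \<Rightarrow> s | Inr w \<Rightarrow> undefined) :: ('s + 'w) qpoly \<Rightarrow> 's qpoly"
    have inv: "rename Inl (?r G) = G"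
      by (rule rename_inv[of "Inl ` S"]) (use G in \<open>auto simp: polys_in_def I_def\<close>)
    have "?r G \<in> polys_in S"
      using rename_in[of G "Inl ` S" "\<lambda>v. case v of Inl s \<Rightarrow> s | Inr w \<Rightarrow> undefined"] G
      by (auto simp: polys_in_def I_def image_image)
    moreover have "psubst lconst f (?r G) = psubst lconst g (rename Inl (?r G))"
      unfolding rename_def[of Inl] hom_psubst_comp[OF ring_hom_on_psubst[OF ring_hom_on_lconst] ring_hom_on_lconst]
      by (simp add: psubst_lconst[OF ring_hom_on_lconst] psubst_pvar[OF ring_hom_on_lconst] g_def)
    ultimately have "?r G = 0" using ind G by (simp add: alg_indep_def polys_in_def inv)
    then show "G = 0" using inv by (simp add: rh_zero[OF ring_hom_on_rename])
  qed
  then have "\<exists>Y. Y \<subseteq> W \<and> alg_indep g (I Y)" by blast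
  moreover have "\<forall>Y. Y \<subseteq> W \<and> alg_indep g (I Y) \<longrightarrow> card Y < Suc (card W)"
    using W by (auto intro: card_mono simp: less_Suc_eq_le)
  ultimately obtain Y where Y: "Y \<subseteq> W" "alg_indep g (I Y)"
    and max: "\<And>Z. Z \<subseteq> W \<Longrightarrow> alg_indep g (I Z) \<Longrightarrow> card Z \<le> card Y"
    using ex_has_greatest_nat[of "\<lambda>Y. Y \<subseteq> W \<and> alg_indep g (I Y)" _ card "Suc (card W)"] by (metis le_simps(1) less_Suc_eq_le)
  let ?v = "\<lambda>s w. theta w (g s)"
  have gW: "pvars (g i) \<subseteq> W" if "i \<in> I W" for i using that by (auto simp: g_def I_def W_def)
  have card: "card (I Y) \<le> card W"
    using Y gW by (intro alg_indep_card_le[OF finI W, of Y g]) (auto simp: I_def)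
  have unit: "(\<lambda>t. if t = w then 1 else 0) \<in> qspan ?v (I Y)" if w: "w \<in> W" for w
  proof (cases "w \<in> Y")
    case True
    have "(\<lambda>t. lvar w * (if t = w then 1 else 0)) = ?v (Inr w)"
      by (auto simp: g_def theta_lvar fun_eq_iff)
    then have "(\<lambda>t. lvar w * (if t = w then 1 else 0)) \<in> qspan ?v (I Y)"
      using qspan_base[OF finI[OF Y(1)], of "Inr w" ?v] True by (simp add: I_def)
    then show ?thesis by (rule qspan_uncancel[rotated]) simp
  next
    case False
    have "\<not> alg_indep g (I (insert w Y))"
    proof
      assume "alg_indep g (I (insert w Y))"
      then have "card (insert w Y) \<le> card Y" using w Y by (intro max) auto
      then show False using False finite_subset[OF Y(1) W] by simp
    qed
    from minimal_relation[OF this] obtain G where G: "G \<noteq> 0" "pvars G \<subseteq> I (insert w Y)" "psubst lconst g G = 0"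
      "\<And>v. v \<in> pvars G \<Longrightarrow> psubst lconst g (pdiff v G) \<noteq> 0" by blast
    \<comment> \<open>Otherwise \<open>G\<close> would be a relation of the independent family
      \<open>I Y\<close>.\<close>
    have "Inr w \<in> pvars G"
      using Y(2) G by (auto simp: alg_indep_def I_def)
    then have nz: "psubst lconst g (pdiff (Inr w) G) \<noteq> 0" using G by blast
    have Iw: "I (insert w Y) = insert (Inr w) (I Y)" "Inr w \<notin> I Y" using False by (auto simp: I_def)
    have "psubst lconst g (pdiff (Inr w) G) * lvar w * (if t = w then 1 else 0)
        = (\<Sum>v\<in>I Y. - psubst lconst g (pdiff v G) * ?v v t)" for t
    proof -
      have "(\<Sum>v\<in>I (insert w Y). psubst lconst g (pdiff v G) * theta t (g v)) = theta t (psubst lconst g G)"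
        by (rule psubst_chain[OF derivation_theta ring_hom_on_lconst, symmetric])
           (use G finI[of "insert w Y"] w Y in auto)
      then have "psubst lconst g (pdiff (Inr w) G) * theta t (lvar w)
          + (\<Sum>v\<in>I Y. psubst lconst g (pdiff v G) * theta t (g v)) = 0"
        using G finI[OF Y(1)] by (simp add: Iw g_def)
      then show ?thesis
        by (cases "t = w") (simp_all add: theta_lvar sum_negf eq_neg_iff_add_eq_0 mult.assoc)
    qed
    then show ?thesis using nz
      by (intro qspanI[where d = "psubst lconst g (pdiff (Inr w) G) * lvar w"
            and c = "\<lambda>v. - psubst lconst g (pdiff v G)"]) simp_all
  qed
  show ?thesis
    unfolding lin_indep_def
  proof (intro allI impI ballI, rule ccontr)
    fix c s0 assume c: "\<forall>t. (\<Sum>s\<in>S. c s * theta t (f s)) = 0" and s0: "s0 \<in> S" "c s0 \<noteq> 0"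
    define J where "J = I Y - {Inl s0}"
    have finJ: "finite J" using finI[OF Y(1)] by (simp add: J_def)
    have s0J: "?v (Inl s0) \<in> qspan ?v J"
    proof (rule qspanI[OF s0(2)])
      fix t
      define b where "b v = (case v of Inl s \<Rightarrow> - c s | Inr _ \<Rightarrow> 0)" for v :: "'s + 'w"
      have "(\<Sum>v\<in>J. b v * ?v v t) = (\<Sum>v\<in>Inl ` (S - {s0}). b v * ?v v t)"
        using finJ by (intro sum.mono_neutral_right) (auto simp: J_def I_def b_def)
      also have "\<dots> = (\<Sum>s\<in>S - {s0}. - c s * theta t (f s))"
        by (subst sum.reindex) (auto simp: b_def g_def inj_on_def)
      also have "\<dots> = c s0 * theta t (f s0)"
        using c[rule_format, of t] S s0
        by (subst (asm) sum.remove[of _ s0]) (simp_all add: sum_negf neg_eq_iff_add_eq_0 add.commute)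
      finally show "c s0 * ?v (Inl s0) t = (\<Sum>v\<in>J. b v * ?v v t)" by (simp add: g_def)
    qed
    have "card W \<le> card J"
    proof (rule lin_indep_card_le[OF finJ W])
      show "lin_indep (\<lambda>w t. if t = w then 1 else 0 :: 'w lau) W"
        using W by (auto simp: lin_indep_def if_distrib[of "\<lambda>x. _ * x"] sum.delta cong: if_cong)
      fix w assume "w \<in> W"
      from unit[OF this] show "(\<lambda>t. if t = w then 1 else 0) \<in> qspan ?v J"
      proof (rule qspan_trans)
        fix j assume "j \<in> I Y"
        then show "?v j \<in> qspan ?v J"
          using s0J qspan_base[OF finJ, of j ?v] by (cases "j = Inl s0") (auto simp: J_def)
      qed
    qed
    also have "card J < card (I Y)"
      using finI[OF Y(1)] s0 by (intro psubset_card_mono) (auto simp: J_def I_def)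
    finally show False using card by simp
  qed
qed

subsection \<open>The derivations\<close>

lemma lderive_superset:
  assumes "finite A" "keys m \<subseteq> A"
  shows "(\<Sum>v\<in>keys m. single (m - single v 1 + single (dshift v) 1) (of_int (lookup m v) * c))
    = (\<Sum>v\<in>A. single (m - single v 1 + single (dshift v) 1) (of_int (lookup m v) * c))"
  using assms by (intro sum.mono_neutral_left) (auto simp: in_keys_iff)

lemma lderive_single:
  assumes "d 0 = 0"
  shows "lderive d (single m c) = single m (d c) +
    (\<Sum>v\<in>keys m. single (m - single v 1 + single (dshift v) 1) (of_int (lookup m v) * c))"
  using assms by (cases "c = 0") (auto simp: lderive_def)

lemma derivation_lderive:
  assumes d: "derivation d"
  shows "derivation (lderive d)"
proof (rule derivationI)
  show add: "lderive d (f + g) = lderive d f + lderive d g" for f g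
    unfolding lderive_def
    by (rule setsum_keys_plus_distrib)
       (auto simp: deriv_zero[OF d] deriv_add[OF d] single_add sum.distrib algebra_simps)
  have zero: "lderive d 0 = 0" by (simp add: lderive_def)
  show "lderive d (f * g) = lderive d f * g + f * lderive d g" for f g
  proof (induction f rule: pm_induct)
    case (single m a)
    show ?case
    proof (induction g rule: pm_induct)
      case (single n b)
      let ?A = "keys m \<union> keys n"
      let ?s = "\<lambda>m v c. single (m - single v 1 + single (dshift v) 1) (of_int (lookup m v) * c)"
      have "lderive d (single m a * single n b) = single (m + n) (d (a * b)) + (\<Sum>v\<in>?A. ?s (m + n) v (a * b))"
        using keys_add[of m n]
        by (simp add: mult_single lderive_single[where d = d, OF deriv_zero[OF d]] lderive_superset[of ?A "m + n"])
      also have "(\<Sum>v\<in>?A. ?s (m + n) v (a * b))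
          = (\<Sum>v\<in>?A. ?s m v a * single n b) + (\<Sum>v\<in>?A. single m a * ?s n v b)"
        unfolding sum.distrib[symmetric]
      proof (intro sum.cong refl)
        fix v
        have 1: "m - single v 1 + single (dshift v) 1 + n = m + n - single v 1 + single (dshift v) (1::int)" by simp
        have 2: "m + (n - single v 1 + single (dshift v) 1) = m + n - single v 1 + single (dshift v) (1::int)" by simp
        show "?s (m + n) v (a * b) = ?s m v a * single n b + single m a * ?s n v b"
          by (simp only: mult_single 1 2 flip: single_add) (simp add: lookup_add algebra_simps)
      qed
      also have "single (m + n) (d (a * b)) = single m (d a) * single n b + single m a * single n (d b)"
        by (simp add: mult_single deriv_mult[OF d] single_add)
      finally have eq: "lderive d (single m a * single n b)
        = single m (d a) * single n b + single m a * single n (d b)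
          + ((\<Sum>v\<in>?A. ?s m v a * single n b) + (\<Sum>v\<in>?A. single m a * ?s n v b))" .
      have "lderive d (single m a) = single m (d a) + (\<Sum>v\<in>?A. ?s m v a)"
        "lderive d (single n b) = single n (d b) + (\<Sum>v\<in>?A. ?s n v b)"
        by (simp_all only: lderive_single[where d = d, OF deriv_zero[OF d]])
           (simp_all add: lderive_superset[of ?A])
      then show ?case
        unfolding eq by (simp only: distrib_left distrib_right sum_distrib_left sum_distrib_right ac_simps)
    qed (simp_all add: zero add algebra_simps)
  qed (simp_all add: zero add algebra_simps)
qed

text \<open>The derivation as a vector field; additivity and the Leibniz rule are then inherited
  from \<open>pdiff\<close>.\<close>

lemma pderive_eq:
  assumes "finite V" "pvars f \<subseteq> V"
  shows "pderive f = (\<Sum>v\<in>V. pdiff v f * pvar (dshift v))"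
proof -
  have "pderive f = (\<Sum>m\<in>keys f. \<Sum>v\<in>V. single (m - single v 1) (of_nat (lookup m v) * lookup f m) * pvar (dshift v))"
    unfolding pderive_def
  proof (rule sum.cong[OF refl])
    fix m assume "m \<in> keys f"
    then have "keys m \<subseteq> V" using assms by (auto simp: pvars_def)
    then have "(\<Sum>v\<in>keys m. single (m - single v 1 + single (dshift v) 1) (of_nat (lookup m v) * lookup f m))
      = (\<Sum>v\<in>V. single (m - single v 1 + single (dshift v) 1) (of_nat (lookup m v) * lookup f m))"
      using assms by (intro sum.mono_neutral_left) (auto simp: in_keys_iff)
    then show "(\<Sum>v\<in>keys m. single (m - single v 1 + single (dshift v) 1) (of_nat (lookup m v) * lookup f m))
      = (\<Sum>v\<in>V. single (m - single v 1) (of_nat (lookup m v) * lookup f m) * pvar (dshift v))"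
      by (simp add: pvar_def mult_single)
  qed
  also have "\<dots> = (\<Sum>v\<in>V. pdiff v f * pvar (dshift v))"
    unfolding pdiff_def by (subst sum.swap) (simp add: sum_distrib_right)
  finally show ?thesis .
qed

lemma derivation_pderive: "derivation (pderive :: 'i dvar qpoly \<Rightarrow> 'i dvar qpoly)"
proof -
  have "pderive (f + g) = pderive f + pderive g" "pderive (f * g) = pderive f * g + f * pderive g"
    for f g :: "'i dvar qpoly"
  proof -
    note eq = pderive_eq[of "pvars f \<union> pvars g"]
    show "pderive (f + g) = pderive f + pderive g"
      using eq[of f] eq[of g] eq[of "f + g"] pvars_add[of f g]
      by (simp add: pdiff_add sum.distrib algebra_simps)
    show "pderive (f * g) = pderive f * g + f * pderive g"
      using eq[of f] eq[of g] eq[of "f * g"] pvars_mult[of f g]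
      by (simp add: pdiff_mult sum.distrib sum_distrib_left sum_distrib_right algebra_simps)
  qed
  then show ?thesis by (simp add: derivation_def)
qed

lemma pderive_lconst [simp]: "pderive (lconst c) = 0"
  using pderive_eq[of "{}" "lconst c"] by simp

lemma pderive_pvar [simp]: "pderive (pvar v) = pvar (dshift v)"
  using pderive_eq[of "{v}" "pvar v"] by (simp add: pdiff_pvar)

lemma pvars_pderive: "pvars (pderive f) \<subseteq> pvars f \<union> dshift ` pvars f"
proof -
  have "pderive f \<in> polys_in (pvars f \<union> dshift ` pvars f)"
    unfolding pderive_eq[OF finite_pvars order_refl]
    using pvars_pdiff[of _ f]
    by (intro ss_sum[OF subring_polys_in] ss_mult[OF subring_polys_in]) (auto simp: polys_in_def)
  then show ?thesis by (simp add: polys_in_def)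
qed

text \<open>The derivation that vanishes on rational constants. The flat ring contains codes of the
  \<open>a\<^sub>i\<^sub>,\<^sub>k\<close> as further differential indeterminates, and these are
  differentiated as well.\<close>

abbreviation D0 :: "nat dvar lau \<Rightarrow> nat dvar lau" where
  "D0 \<equiv> lderive (\<lambda>_. 0)"

lemma derivation_D0: "derivation D0"
  by (rule derivation_lderive) (simp add: derivation_def)

lemma derivation_dd: "derivation dd"
  unfolding dd_def by (rule derivation_lderive[OF derivation_pderive])

lemma D0_lconst [simp]: "D0 (lconst c) = 0"
  by (simp add: lconst_def lderive_single)

lemma D0_lvar [simp]: "D0 (lvar v) = lvar (dshift v)"
  by (simp add: lvar_def lderive_single)

lemma dd_lconst: "dd (lconst c) = lconst (pderive c)"
  by (simp add: dd_def lconst_def lderive_single[where d = pderive, OF deriv_zero[OF derivation_pderive]])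

lemma funpow_dd_lconst: "(dd ^^ k) (lconst c) = lconst ((pderive ^^ k) c)"
  by (induction k) (auto simp: dd_lconst)

lemma funpow_pderive_pvar: "(pderive ^^ k) (pvar (Der x s)) = pvar (Der x (s + k))"
  by (induction k) auto

subsection \<open>Extension of homomorphisms to Laurent polynomials\<close>

definition lext :: "('c \<Rightarrow> 'd) \<Rightarrow> ('m \<Rightarrow> 'd) \<Rightarrow> ('m \<Rightarrow>\<^sub>0 'c::comm_ring_1) \<Rightarrow> 'd::comm_ring_1" where
  "lext \<eta> \<mu> f = (\<Sum>m\<in>keys f. \<eta> (lookup f m) * \<mu> m)"

context
  fixes \<eta> :: "'c::comm_ring_1 \<Rightarrow> 'd::comm_ring_1" and \<mu> :: "'m::comm_monoid_add \<Rightarrow> 'd"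
  assumes \<eta>: "ring_hom_on \<eta>" and \<mu>0: "\<mu> 0 = 1" and \<mu>: "\<And>m n. \<mu> (m + n) = \<mu> m * \<mu> n"
begin

lemma lext_single: "lext \<eta> \<mu> (single m c) = \<eta> c * \<mu> m"
  by (cases "c = 0") (auto simp: lext_def rh_zero[OF \<eta>])

lemma lext_lconst: "lext \<eta> \<mu> (lconst c) = \<eta> c"
  by (simp add: lconst_def lext_single \<mu>0)

lemma lext_add: "lext \<eta> \<mu> (f + g) = lext \<eta> \<mu> f + lext \<eta> \<mu> g"
  unfolding lext_def by (rule setsum_keys_plus_distrib) (auto simp: rh_zero[OF \<eta>] rh_add[OF \<eta>] algebra_simps)

lemma lext_zero: "lext \<eta> \<mu> 0 = 0"
  by (simp add: lext_def)

lemma ring_hom_on_lext: "ring_hom_on (lext \<eta> \<mu>)"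
proof (rule ring_hom_onI)
  show "lext \<eta> \<mu> 1 = 1" by (simp add: lext_def rh_one[OF \<eta>] \<mu>0)
  show "lext \<eta> \<mu> (f * g) = lext \<eta> \<mu> f * lext \<eta> \<mu> g" for f g
  proof (induction f rule: pm_induct)
    case (single m a)
    show ?case
      by (induction g rule: pm_induct)
         (simp_all add: mult_single lext_single lext_zero lext_add rh_mult[OF \<eta>] \<mu> algebra_simps)
  qed (simp_all add: lext_zero lext_add algebra_simps)
qed (rule lext_add)

end

abbreviation lmon :: "('w \<Rightarrow>\<^sub>0 int) \<Rightarrow> 'w lau" where
  "lmon m \<equiv> single m 1"

lemma lmon_nonzero: "lmon m \<noteq> 0"
proof
  assume "lmon m = 0"
  then have "lookup (lmon m) m = 0" by (metis lookup_zero)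
  then show False by simp
qed

lemma D0_lmon: "D0 (lmon m) = (\<Sum>v\<in>keys m. single (m - single v 1 + single (dshift v) 1) (of_int (lookup m v)))"
  by (simp add: lderive_single)

lemma lconst_mult_single: "lconst a * single m c = single m (a * c)"
  by (simp add: lconst_def mult_single)

lemma D0_lext:
  assumes \<eta>: "ring_hom_on \<eta>" and com: "\<And>c. D0 (\<eta> c) = \<eta> (pderive c)"
  shows "D0 (lext \<eta> lmon f) = lext \<eta> lmon (dd f)"
proof -
  note L = lext_single[OF \<eta>, of lmon] lext_add[OF \<eta>] lext_zero[of \<eta> lmon]
  have hom: "ring_hom_on (lext \<eta> lmon)" by (rule ring_hom_on_lext[OF \<eta>]) (auto simp: mult_single)
  show ?thesis
  proof (induction f rule: pm_induct)
    case zero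
    then show ?case by (simp add: lext_def deriv_zero[OF derivation_D0] deriv_zero[OF derivation_dd])
  next
    case (add f g)
    then show ?case by (simp add: L rh_add[OF hom] deriv_add[OF derivation_D0] deriv_add[OF derivation_dd])
  next
    case (single m c)
    have int: "\<eta> (of_int k * c) = of_int k * \<eta> c" for k :: int
    proof (cases k)
      case (nonneg n)
      then show ?thesis by (simp add: rh_mult[OF \<eta>] rh_of_nat[OF \<eta>])
    next
      case (neg n)
      have "\<eta> (of_nat (Suc n)) = of_nat (Suc n)" by (rule rh_of_nat[OF \<eta>])
      then show ?thesis using neg
        by (simp only: of_int_minus of_int_of_nat_eq mult_minus_left rh_uminus[OF \<eta>] rh_mult[OF \<eta>])
    qed
    have c1: "single m' (of_int k) = of_int k * lmon m'" for m' :: "nat dvar \<Rightarrow>\<^sub>0 int" and k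
      by (simp add: mult_single flip: single_of_int)
    have "lext \<eta> lmon (dd (single m c)) = \<eta> (pderive c) * lmon m
      + (\<Sum>v\<in>keys m. of_int (lookup m v) * \<eta> c * lmon (m - single v 1 + single (dshift v) 1))"
      by (simp add: dd_def lderive_single[where d = pderive, OF deriv_zero[OF derivation_pderive]] rh_add[OF hom] rh_sum[OF hom] L int mult_single)
    also have "\<dots> = D0 (\<eta> c) * lmon m + \<eta> c * D0 (lmon m)"
      by (simp add: com D0_lmon sum_distrib_left c1 mult_ac)
    also have "\<dots> = D0 (lext \<eta> lmon (single m c))"
      by (simp add: L mult_single deriv_mult[OF derivation_D0])
    finally show ?case by simp
  qed
qed

lemma D0_psubst:
  assumes "\<And>v. v \<in> pvars f \<Longrightarrow> D0 (\<phi> v) = \<phi> (dshift v)"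
  shows "D0 (psubst lconst \<phi> f) = psubst lconst \<phi> (pderive f)"
proof -
  note Q = ring_hom_on_psubst[OF ring_hom_on_lconst, of \<phi>]
  have "D0 (psubst lconst \<phi> f) = (\<Sum>v\<in>pvars f. psubst lconst \<phi> (pdiff v f) * D0 (\<phi> v))"
    by (rule psubst_chain[OF derivation_D0 ring_hom_on_lconst]) auto
  also have "\<dots> = psubst lconst \<phi> (\<Sum>v\<in>pvars f. pdiff v f * pvar (dshift v))"
    using assms by (simp add: rh_sum[OF Q] rh_mult[OF Q] psubst_pvar[OF ring_hom_on_lconst])
  finally show ?thesis by (simp add: pderive_eq[of "pvars f"])
qed

subsection \<open>Encoding of exponents\<close>

definition enc :: "('v \<Rightarrow> 'w) \<Rightarrow> ('v \<Rightarrow>\<^sub>0 nat) \<Rightarrow> ('w \<Rightarrow>\<^sub>0 int)" where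
  "enc code x = (\<Sum>v\<in>keys x. single (code v) (int (lookup x v)))"

lemma lvar_power: "lvar w ^ k = single (single w (int k)) 1"
  by (induction k) (auto simp: lvar_def mult_single simp flip: single_add)

lemma mev_lvar: "mev (\<lambda>v. lvar (code v)) x = lmon (enc code x)"
proof -
  have "(\<Prod>v\<in>A. lmon (h v)) = lmon (\<Sum>v\<in>A. h v)" for A and h :: "'b \<Rightarrow> 'a \<Rightarrow>\<^sub>0 int"
    by (induction A rule: infinite_finite_induct) (auto simp: mult_single)
  then show ?thesis by (simp add: mev_def lvar_power enc_def)
qed

lemma lookup_enc:
  assumes "inj_on code (insert v (keys x))"
  shows "lookup (enc code x) (code v) = int (lookup x v)"
proof -
  have "lookup (enc code x) (code v) = (\<Sum>u\<in>keys x. if u = v then int (lookup x v) else 0)"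
    unfolding enc_def lookup_sum
    by (intro sum.cong refl) (use assms in \<open>auto simp: lookup_single when_def inj_on_def\<close>)
  then show ?thesis by (auto simp: sum.delta in_keys_iff)
qed

lemma sum_single_eq_0:
  assumes "finite A" "inj_on h A" "(\<Sum>p\<in>A. single (h p) (c p)) = 0" "p \<in> A"
  shows "c p = 0"
proof -
  have "lookup (\<Sum>p\<in>A. single (h p) (c p)) (h p) = (\<Sum>q\<in>A. if q = p then c p else 0)"
    unfolding lookup_sum
    by (intro sum.cong refl) (use assms in \<open>auto simp: lookup_single when_def inj_on_def\<close>)
  then show ?thesis using assms by (simp add: sum.delta)
qed

text \<open>The exponents at coded variables reveal the monomial \<open>x\<close> of the
  coefficient, the remaining ones reveal \<open>m\<close>; so distinct terms stay distinct.
  Vanishing in the flat ring is thereby carried back to the nested rings in which the ideals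
  live.\<close>

lemma flatten_eq_0:
  fixes f :: "'m \<Rightarrow>\<^sub>0 'v qpoly" and \<nu> :: "'m \<Rightarrow> 'w \<Rightarrow>\<^sub>0 int"
  assumes inj_\<nu>: "inj_on \<nu> (keys f)" and code: "inj_on code X" and X: "\<And>m. lookup f m \<in> polys_in X"
    and disj: "\<And>m. m \<in> keys f \<Longrightarrow> keys (\<nu> m) \<inter> code ` X = {}"
    and zero: "lext (psubst lconst (\<lambda>v. lvar (code v))) (\<lambda>m. lmon (\<nu> m)) f = 0"
  shows "f = 0"
proof -
  let ?A = "SIGMA m:keys f. keys (lookup f m)"
  have kX: "keys x \<subseteq> X" if "x \<in> keys (lookup f m)" for x m
    using X[of m] that by (auto simp: polys_in_def pvars_def)
  have "lext (psubst lconst (\<lambda>v. lvar (code v))) (\<lambda>m. lmon (\<nu> m)) f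
    = (\<Sum>m\<in>keys f. \<Sum>x\<in>keys (lookup f m). single (\<nu> m + enc code x) (lookup (lookup f m) x))"
    unfolding lext_def
  proof (intro sum.cong refl)
    fix m
    have "psubst lconst (\<lambda>v. lvar (code v)) (lookup f m)
        = (\<Sum>x\<in>keys (lookup f m). single (enc code x) (lookup (lookup f m) x))"
      unfolding psubst_def mev_def[symmetric] by (simp add: mev_lvar lconst_mult_single)
    then show "psubst lconst (\<lambda>v. lvar (code v)) (lookup f m) * lmon (\<nu> m)
        = (\<Sum>x\<in>keys (lookup f m). single (\<nu> m + enc code x) (lookup (lookup f m) x))"
      by (simp add: sum_distrib_right mult_single add.commute)
  qed
  also have "\<dots> = (\<Sum>p\<in>?A. single (\<nu> (fst p) + enc code (snd p)) (lookup (lookup f (fst p)) (snd p)))"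
    by (subst sum.Sigma) (auto simp: split_def)
  finally have eq: "(\<Sum>p\<in>?A. single (\<nu> (fst p) + enc code (snd p)) (lookup (lookup f (fst p)) (snd p))) = 0"
    using zero by simp
  have inj: "inj_on (\<lambda>p. \<nu> (fst p) + enc code (snd p)) ?A"
  proof (rule inj_onI, clarify)
    fix m x m' x' assume m: "m \<in> keys f" "m' \<in> keys f" and x: "x \<in> keys (lookup f m)" "x' \<in> keys (lookup f m')"
      and e: "\<nu> (fst (m, x)) + enc code (snd (m, x)) = \<nu> (fst (m', x')) + enc code (snd (m', x'))"
    have l: "lookup (\<nu> m) w + lookup (enc code x) w = lookup (\<nu> m') w + lookup (enc code x') w" for w
      using arg_cong[OF e, of "\<lambda>p. lookup p w"] by (simp add: lookup_add)
    have x_eq: "lookup x v = lookup x' v" for v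
    proof (cases "v \<in> X")
      case True
      have "lookup (\<nu> m) (code v) = 0" "lookup (\<nu> m') (code v) = 0"
        using disj[OF m(1)] disj[OF m(2)] True by (auto simp: in_keys_iff disjoint_iff)
      moreover have "inj_on code (insert v (keys x))" "inj_on code (insert v (keys x'))"
        by (rule inj_on_subset[OF code], use True kX[OF x(1)] kX[OF x(2)] in blast)+
      ultimately show ?thesis using l[of "code v"] by (simp add: lookup_enc)
    next
      case False
      then have "v \<notin> keys x" "v \<notin> keys x'" using kX[OF x(1)] kX[OF x(2)] by auto
      then show ?thesis by (simp add: in_keys_iff)
    qed
    then have "x = x'" by (rule poly_mapping_eqI)
    moreover from this have "\<nu> m = \<nu> m'" using e by simp
    ultimately show "m = m' \<and> x = x'" using inj_\<nu> m by (auto simp: inj_on_def)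
  qed
  show "f = 0"
  proof (rule ccontr)
    assume "f \<noteq> 0"
    then obtain m where m: "m \<in> keys f" by fastforce
    then obtain x where x: "x \<in> keys (lookup f m)"
      using keys_eq_empty by (metis all_not_in_conv in_keys_iff poly_mapping_eqI lookup_zero)
    have "lookup (lookup f (fst (m, x))) (snd (m, x)) = 0"
      by (rule sum_single_eq_0[OF _ inj eq]) (use m x in auto)
    then show False using x by (simp add: in_keys_iff)
  qed
qed

subsection \<open>Elimination by evaluation at the generic zero\<close>

text \<open>The unknown \<open>u\<^sub>j\<close> keeps its name; coefficients get indices \<open>\<ge> n\<close>, even offsets for the coefficients
  of the differential system and odd offsets (below) for those of the algebraic system.\<close>

fun cj :: "gsystem \<Rightarrow> coef \<Rightarrow> nat" where
  "cj P (Coef i l) = size_of P + 2 * prod_encode (i, l)"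

fun jcode :: "gsystem \<Rightarrow> coef dvar \<Rightarrow> nat dvar" where
  "jcode P (Der x s) = Der (cj P x) s"

definition unknowns :: "gsystem \<Rightarrow> nat dvar set" where
  "unknowns P = {Der j k | j k. j \<in> {1..size_of P - 1}}"

definition zeta :: "gsystem \<Rightarrow> nat \<Rightarrow> nat dvar lau" where
  "zeta P i = - (\<Sum>l=1..len P i. lvar (jcode P (Der (Coef i l) 0)) * lmon (mon P i l - mon P i 0))"

fun phiv :: "gsystem \<Rightarrow> coef dvar \<Rightarrow> nat dvar lau" where
  "phiv P (Der (Coef i l) s) = (if l = 0 then (D0 ^^ s) (zeta P i) else lvar (jcode P (Der (Coef i l) s)))"

definition phi :: "gsystem \<Rightarrow> dpoly \<Rightarrow> nat dvar lau" where
  "phi P = psubst lconst (phiv P)"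

text \<open>Acts by \<open>phi\<close> on the coefficients and as the identity on the unknowns. Its
  kernel is stable under the derivation and contains the system, which gives one half of
  \<open>elimination_ideal_eq_kernel\<close>.\<close>

definition Phi :: "gsystem \<Rightarrow> dlaurent \<Rightarrow> nat dvar lau" where
  "Phi P = lext (phi P) lmon"

lemma ring_hom_on_phi: "ring_hom_on (phi P)"
  unfolding phi_def by (rule ring_hom_on_psubst[OF ring_hom_on_lconst])

lemma phi_pvar: "phi P (pvar v) = phiv P v"
  by (simp add: phi_def psubst_pvar[OF ring_hom_on_lconst])

lemma D0_phiv: "D0 (phiv P v) = phiv P (dshift v)"
proof -
  obtain x s where v: "v = Der x s" by (cases v)
  obtain i l where x: "x = Coef i l" by (cases x)
  show ?thesis by (simp add: v x)
qed

lemma D0_phi: "D0 (phi P f) = phi P (pderive f)"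
  unfolding phi_def by (rule D0_psubst) (rule D0_phiv)

lemma ring_hom_on_Phi: "ring_hom_on (Phi P)"
  unfolding Phi_def by (rule ring_hom_on_lext[OF ring_hom_on_phi]) (simp_all add: mult_single)

lemma Phi_lconst: "Phi P (lconst g) = phi P g"
  unfolding Phi_def by (rule lext_lconst[OF ring_hom_on_phi]) (simp_all add: mult_single)

lemma Phi_single: "Phi P (single m g) = phi P g * lmon m"
  unfolding Phi_def by (rule lext_single[OF ring_hom_on_phi]) (simp_all add: mult_single)

lemma D0_Phi: "D0 (Phi P f) = Phi P (dd f)"
  unfolding Phi_def by (rule D0_lext[OF ring_hom_on_phi D0_phi])

lemma Phi_FF: "Phi P (FF P i) = 0"
proof -
  have s: "{0..len P i} = insert 0 {1..len P i}" by auto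
  have "Phi P (FF P i) = zeta P i * lmon (mon P i 0)
      + (\<Sum>l=1..len P i. lvar (jcode P (Der (Coef i l) 0)) * lmon (mon P i l))"
    unfolding FF_def s by (simp add: rh_add[OF ring_hom_on_Phi] rh_sum[OF ring_hom_on_Phi] Phi_single phi_pvar)
  also have "zeta P i * lmon (mon P i 0) = - (\<Sum>l=1..len P i. lvar (jcode P (Der (Coef i l) 0)) * lmon (mon P i l))"
    by (simp add: zeta_def sum_distrib_right mult.assoc mult_single)
  finally show ?thesis by simp
qed

lemma Phi_dd_FF: "Phi P ((dd ^^ k) (FF P i)) = 0"
  by (induction k) (simp_all add: Phi_FF deriv_zero[OF derivation_D0] flip: D0_Phi)

section \<open>Closure of the differential rings under the derivations\<close>

lemma subring_DD: "subring_set (DD P)"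
  unfolding DD_def diff_polys_def by (rule subring_polys_in)

lemma DD_iff: "f \<in> DD P \<longleftrightarrow> (\<forall>v\<in>pvars f. \<exists>i l s. v = Der (Coef i l) s \<and> i \<in> {1..size_of P} \<and> l \<le> len P i)"
proof -
  have "{Der x k |x k. x \<in> coefs P} = {v. \<exists>i l s. v = Der (Coef i l) s \<and> i \<in> {1..size_of P} \<and> l \<le> len P i}"
    by (auto simp: coefs_def)
  then show ?thesis unfolding DD_def diff_polys_def polys_in_def by blast
qed

lemma pderive_DD: "f \<in> DD P \<Longrightarrow> pderive f \<in> DD P"
proof -
  assume f: "f \<in> DD P"
  have "dshift ` {Der x k |x k. x \<in> coefs P} \<subseteq> {Der x k |x k. x \<in> coefs P}"
    by auto
  moreover have "pvars f \<subseteq> {Der x k |x k. x \<in> coefs P}"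
    using f by (simp add: DD_def diff_polys_def polys_in_def)
  ultimately have "pvars f \<union> dshift ` pvars f \<subseteq> {Der x k |x k. x \<in> coefs P}"
    by (meson Un_least image_mono order_trans)
  with pvars_pderive[of f] have "pvars (pderive f) \<subseteq> {Der x k |x k. x \<in> coefs P}" by (rule order_trans)
  then show "pderive f \<in> DD P" by (simp add: DD_def diff_polys_def polys_in_def)
qed

lemma subring_nested:
  assumes C: "subring_set C"
  shows "subring_set {f :: ('v \<Rightarrow>\<^sub>0 int) \<Rightarrow>\<^sub>0 'c::comm_ring_1. pvars f \<subseteq> U \<and> (\<forall>m. lookup f m \<in> C)}"
proof -
  have mult: "lookup (f * g) m \<in> C" if f: "\<forall>m. lookup f m \<in> C" and g: "\<forall>m. lookup g m \<in> C"
    for f g :: "('v \<Rightarrow>\<^sub>0 int) \<Rightarrow>\<^sub>0 'c" and m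
  proof -
    have "f * g = (\<Sum>a\<in>keys f. \<Sum>b\<in>keys g. single (a + b) (lookup f a * lookup g b))"
      by (subst (1) pm_expand[of f], subst (1) pm_expand[of g]) (simp add: sum_product mult_single)
    moreover have "lookup (single (a + b) (lookup f a * lookup g b)) m \<in> C" for a b
      using f g by (auto simp: lookup_single when_def ss_zero[OF C] ss_mult[OF C])
    ultimately show ?thesis by (auto simp: lookup_sum intro!: ss_sum[OF C])
  qed
  have "lookup 1 m \<in> C" for m :: "'v \<Rightarrow>\<^sub>0 int"
    by (auto simp: lookup_one when_def ss_one[OF C] ss_zero[OF C])
  moreover have "subring_set {f :: ('v \<Rightarrow>\<^sub>0 int) \<Rightarrow>\<^sub>0 'c. pvars f \<subseteq> U}" by (rule subring_pvars)
  ultimately show ?thesis using mult unfolding subring_set_def mem_Collect_eq lookup_minus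
    by (intro conjI ballI allI) (simp_all add: ss_diff[OF C])
qed

lemma subring_DU: "subring_set (DU P)"
  unfolding DU_def by (rule subring_nested[OF subring_DD])

lemma DU_iff: "f \<in> DU P \<longleftrightarrow> pvars f \<subseteq> unknowns P \<and> (\<forall>m. lookup f m \<in> DD P)"
  by (simp add: DU_def unknowns_def)

lemma single_in_DU: "keys m \<subseteq> unknowns P \<Longrightarrow> c \<in> DD P \<Longrightarrow> single m c \<in> DU P"
  by (auto simp: DU_iff pvars_single lookup_single when_def ss_zero[OF subring_DD])

lemma lconst_in_DU: "c \<in> DD P \<Longrightarrow> lconst c \<in> DU P"
  unfolding lconst_def by (rule single_in_DU) auto

lemma keys_in_unknowns: "f \<in> DU P \<Longrightarrow> m \<in> keys f \<Longrightarrow> keys m \<subseteq> unknowns P"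
  by (auto simp: DU_iff pvars_def)

lemma dshift_unknowns: "v \<in> unknowns P \<Longrightarrow> dshift v \<in> unknowns P"
  by (auto simp: unknowns_def)

lemma dd_DU:
  assumes "f \<in> DU P" shows "dd f \<in> DU P"
  unfolding dd_def lderive_def
proof (intro ss_sum[OF subring_DU] ss_add[OF subring_DU] single_in_DU)
  fix m v assume m: "m \<in> keys f" and v: "v \<in> keys m"
  have U: "keys m \<subseteq> unknowns P" using keys_in_unknowns[OF assms m] .
  have "keys (m - single v 1 + single (dshift v) 1) \<subseteq> insert v (insert (dshift v) (keys m))"
    by (auto simp: in_keys_iff lookup_add lookup_minus lookup_single when_def split: if_splits)
  then show "keys (m - single v 1 + single (dshift v) 1) \<subseteq> unknowns P"
    using U v dshift_unknowns by blast
  have "(of_int (lookup m v) :: dpoly) = lconst (of_int (lookup m v))"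
    by (simp add: lconst_def)
  then have "of_int (lookup m v) \<in> DD P" by (simp only: DD_def diff_polys_def lconst_in_polys_in)
  then show "of_int (lookup m v) * lookup f m \<in> DD P"
    using assms by (auto simp: DU_iff intro!: ss_mult[OF subring_DD])
next
  fix m assume m: "m \<in> keys f"
  then show "keys m \<subseteq> unknowns P" by (rule keys_in_unknowns[OF assms])
  show "pderive (lookup f m) \<in> DD P" using assms by (auto simp: DU_iff intro: pderive_DD)
qed

lemma funpow_dd_DU: "f \<in> DU P \<Longrightarrow> (dd ^^ k) f \<in> DU P"
  by (induction k) (auto intro: dd_DU)

section \<open>The elimination ideal as a kernel\<close>

context
  fixes P :: gsystem
  assumes gen: "generic_system P"
begin

lemma size_ge_2: "size_of P \<ge> 2"
  using gen by (simp add: generic_system_def)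

lemma keys_mon: "i \<in> {1..size_of P} \<Longrightarrow> l \<le> len P i \<Longrightarrow> keys (mon P i l) \<subseteq> unknowns P"
  using gen by (simp add: generic_system_def unknowns_def)

lemma jet_in_DD: "i \<in> {1..size_of P} \<Longrightarrow> l \<le> len P i \<Longrightarrow> pvar (Der (Coef i l) s) \<in> DD P"
  by (auto simp: DD_iff)

lemma FF_in_DU: "i \<in> {1..size_of P} \<Longrightarrow> FF P i \<in> DU P"
  unfolding FF_def using keys_mon jet_in_DD by (intro ss_sum[OF subring_DU] single_in_DU) auto

lemma inj_jcode: "inj (jcode P)"
proof (rule injI)
  fix v w assume "jcode P v = jcode P w"
  then show "v = w"
    by (cases v; cases w; cases "case v of Der x s \<Rightarrow> x"; cases "case w of Der x s \<Rightarrow> x") auto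
qed

lemma jcode_not_unknown: "jcode P v \<notin> unknowns P"
  using size_ge_2 by (cases v; cases "case v of Der x s \<Rightarrow> x") (auto simp: unknowns_def)

text \<open>The unflattened form of \<open>zeta\<close>: congruences modulo the ideal are statements
  in \<open>DU P\<close>, where coefficients are still separate from unknowns.\<close>

private definition zeta' :: "nat \<Rightarrow> dlaurent" where
  "zeta' i = - (\<Sum>l=1..len P i. single (mon P i l - mon P i 0) (pvar (Der (Coef i l) 0)))"

private fun psiv :: "coef dvar \<Rightarrow> dlaurent" where
  "psiv (Der (Coef i l) s) = (if l = 0 then (dd ^^ s) (zeta' i) else lconst (pvar (Der (Coef i l) s)))"

private definition emb :: "dpoly \<Rightarrow> nat dvar lau" where
  "emb = psubst lconst (\<lambda>v. lvar (jcode P v))"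

private lemma ring_hom_on_emb: "ring_hom_on emb"
  unfolding emb_def by (rule ring_hom_on_psubst[OF ring_hom_on_lconst])

private lemma D0_emb: "D0 (emb c) = emb (pderive c)"
proof -
  have "D0 (lvar (jcode P v)) = lvar (jcode P (dshift v))" for v by (cases v) auto
  then show ?thesis unfolding emb_def by (intro D0_psubst)
qed

private lemma mon_diff_keys:
  "i \<in> {1..size_of P} \<Longrightarrow> l \<le> len P i \<Longrightarrow> keys (mon P i l - mon P i 0) \<subseteq> unknowns P"
  using keys_mon[of i l] keys_mon[of i 0] keys_diff[of "mon P i l" "mon P i 0"] by auto

private lemma psiv_in_DU: "v \<in> {Der x k | x k. x \<in> coefs P} \<Longrightarrow> psiv v \<in> DU P"
proof -
  assume "v \<in> {Der x k | x k. x \<in> coefs P}"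
  then obtain i l s where v: "v = Der (Coef i l) s" and i: "i \<in> {1..size_of P}" "l \<le> len P i"
    by (auto simp: coefs_def)
  have "zeta' i \<in> DU P"
    unfolding zeta'_def
    by (intro ss_uminus[OF subring_DU] ss_sum[OF subring_DU] single_in_DU mon_diff_keys jet_in_DD i) auto
  then show ?thesis using jet_in_DD[OF i] by (simp add: v funpow_dd_DU lconst_in_DU)
qed

private lemma lext_emb_psiv: "lext emb lmon (psiv v) = phiv P v"
proof -
  have H: "ring_hom_on (lext emb lmon)"
    by (rule ring_hom_on_lext[OF ring_hom_on_emb]) (simp_all add: mult_single)
  have emb_pvar: "emb (pvar w) = lvar (jcode P w)" for w
    by (simp add: emb_def psubst_pvar[OF ring_hom_on_lconst])
  have s: "lext emb lmon (single m c) = emb c * lmon m" for m c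
    by (rule lext_single[OF ring_hom_on_emb]) (simp_all add: mult_single)
  have z: "lext emb lmon (zeta' i) = zeta P i" for i
    by (simp add: zeta'_def zeta_def rh_uminus[OF H] rh_sum[OF H] s emb_pvar)
  have d: "lext emb lmon ((dd ^^ s) f) = (D0 ^^ s) (lext emb lmon f)" for s f
    by (induction s) (simp_all flip: D0_lext[OF ring_hom_on_emb D0_emb])
  have c: "lext emb lmon (lconst (pvar w)) = lvar (jcode P w)" for w
    by (subst lext_lconst[OF ring_hom_on_emb]) (simp_all add: mult_single emb_pvar)
  obtain x s where v: "v = Der x s" by (cases v)
  obtain i l where x: "x = Coef i l" by (cases x)
  show ?thesis by (simp add: v x d z c)
qed

private lemma psi_eq_0:
  assumes g: "g \<in> DD P" and 0: "phi P g = 0"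
  shows "psubst (\<lambda>c. lconst (lconst c)) psiv g = 0"
proof (rule flatten_eq_0[where \<nu> = "\<lambda>m. m" and code = "jcode P" and X = UNIV])
  let ?f = "psubst (\<lambda>c. lconst (lconst c)) psiv g"
  have "?f \<in> DU P"
    using g psiv_in_DU
    by (intro ss_psubst[OF subring_DU] lconst_in_DU) (auto simp: DD_def diff_polys_def polys_in_def)
  then show "keys m \<inter> jcode P ` UNIV = {}" if "m \<in> keys ?f" for m
    using keys_in_unknowns[OF _ that] jcode_not_unknown by blast
  have H: "ring_hom_on (lext emb lmon)"
    by (rule ring_hom_on_lext[OF ring_hom_on_emb]) (simp_all add: mult_single)
  have "lext emb lmon (lconst (lconst c)) = lconst c" for c
    by (subst lext_lconst[OF ring_hom_on_emb]) (simp_all add: mult_single emb_def psubst_lconst[OF ring_hom_on_lconst])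
  then have "lext emb lmon ?f = phi P g"
    unfolding hom_psubst_comp[OF H ring_hom_on_lconst2] phi_def by (simp add: lext_emb_psiv)
  then show "lext (psubst lconst (\<lambda>v. lvar (jcode P v))) (\<lambda>m. lmon m) ?f = 0"
    using 0 by (simp add: emb_def)
  show "inj_on (jcode P) UNIV" by (rule inj_jcode)
qed (auto simp: polys_in_def)

text \<open>The kernel of \<open>Phi\<close> gives a differential ideal that contains the
  generators, hence one direction. Conversely, modulo the ideal each \<open>a\<^sub>i\<close> and
  its derivatives are congruent to their images, so \<open>g\<close> is congruent to its own image,
  which is 0.\<close>

theorem elimination_ideal_eq_kernel:
  assumes g: "g \<in> DD P"
  shows "lconst g \<in> diff_ideal_gen (subring_on (DU P)) dd (FF P ` {1..size_of P}) \<longleftrightarrow> phi P g = 0"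
proof
  assume *: "lconst g \<in> diff_ideal_gen (subring_on (DU P)) dd (FF P ` {1..size_of P})"
  let ?I = "{f \<in> DU P. Phi P f = 0}"
  note H = ring_hom_on_Phi[of P]
  have "ideal ?I (subring_on (DU P))"
    by (rule ideal_subring_onI[OF subring_DU])
       (auto simp: rh_zero[OF H] rh_add[OF H] rh_mult[OF H] ss_zero[OF subring_DU] ss_add[OF subring_DU] ss_mult[OF subring_DU])
  moreover have "dd ` ?I \<subseteq> ?I"
    by (auto simp: dd_DU deriv_zero[OF derivation_D0] simp flip: D0_Phi)
  moreover have "FF P ` {1..size_of P} \<subseteq> ?I"
    using FF_in_DU Phi_FF by auto
  ultimately have "lconst g \<in> ?I" using * unfolding diff_ideal_gen_def by blast
  then show "phi P g = 0" by (simp add: Phi_lconst)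
next
  assume 0: "phi P g = 0"
  show "lconst g \<in> diff_ideal_gen (subring_on (DU P)) dd (FF P ` {1..size_of P})"
    unfolding diff_ideal_gen_def
  proof (rule InterI, clarify)
    fix I assume I: "ideal I (subring_on (DU P))" and dI: "dd ` I \<subseteq> I" and FI: "FF P ` {1..size_of P} \<subseteq> I"
    note ID = ideal_subring_onD[OF subring_DU I]
    have "lconst g - psubst (\<lambda>c. lconst (lconst c)) psiv g
        = psubst (\<lambda>c. lconst (lconst c)) (\<lambda>v. lconst (pvar v)) g - psubst (\<lambda>c. lconst (lconst c)) psiv g"
      using hom_psubst[OF ring_hom_on_lconst, of g] by simp
    also have "\<dots> \<in> I"
    proof (rule psubst_cong_ideal[OF subring_DU ring_hom_on_lconst2 _ I])
      show "lconst (lconst c) \<in> DU P" for c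
        by (rule lconst_in_DU) (simp add: DD_def diff_polys_def)
      fix v assume "v \<in> pvars g"
      then obtain i l s where v: "v = Der (Coef i l) s" and i: "i \<in> {1..size_of P}" "l \<le> len P i"
        using g by (auto simp: DD_iff)
      have v': "v \<in> {Der x k | x k. x \<in> coefs P}" using v i by (auto simp: coefs_def)
      have "lconst (pvar v) - psiv v \<in> I"
      proof (cases "l = 0")
        case False
        then show ?thesis by (simp add: v ID(2))
      next
        case True
        have s: "{0..len P i} = insert 0 {1..len P i}" by auto
        \<comment> \<open>The generator divided by \<open>M\<^sub>i\<close>; the derivatives of this
          element stay in the ideal.\<close>
        have "single (- mon P i 0) 1 * FF P i = lconst (pvar (Der (Coef i 0) 0)) - zeta' i"
          unfolding FF_def s by (simp add: zeta'_def distrib_left sum_distrib_left mult_single lconst_def)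
        moreover have "single (- mon P i 0) 1 * FF P i \<in> I"
          using FI i keys_mon[of i 0] ss_one[OF subring_DD]
          by (intro ID(5) single_in_DU) auto
        ultimately have "lconst (pvar (Der (Coef i 0) 0)) - zeta' i \<in> I" by simp
        then have "(dd ^^ s) (lconst (pvar (Der (Coef i 0) 0)) - zeta' i) \<in> I"
          using dI by (induction s) auto
        also have "(dd ^^ s) (lconst (pvar (Der (Coef i 0) 0)) - zeta' i)
            = (dd ^^ s) (lconst (pvar (Der (Coef i 0) 0))) - (dd ^^ s) (zeta' i)"
          by (induction s) (simp_all add: deriv_diff[OF derivation_dd])
        finally show ?thesis using True by (simp add: v funpow_dd_lconst funpow_pderive_pvar)
      qed
      then show "lconst (pvar v) \<in> DU P \<and> psiv v \<in> DU P \<and> lconst (pvar v) - psiv v \<in> I"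
        using psiv_in_DU[OF v'] jet_in_DD[OF i] v by (auto intro: lconst_in_DU)
    qed
    finally show "lconst g \<in> I" using psi_eq_0[OF g 0] by simp
  qed
qed

end

subsection \<open>Elements of the saturation of low order\<close>

text \<open>Without an order on the variables the coefficients are not in the class of domains;
  \<open>qpoly_no_zero_divisors\<close> keeps the product of the leading coefficients from
  vanishing.\<close>

lemma degree_uni_mult:
  assumes "f \<noteq> 0" "g \<noteq> 0"
  shows "degree (uni x (f * g)) = degree (uni x f) + degree (uni x g)"
proof -
  let ?p = "uni x f" and ?q = "uni x g"
  have "coeff (?p * ?q) (degree ?p + degree ?q) = lead_coeff ?p * lead_coeff ?q"
    by (rule coeff_mult_degree_sum)
  moreover have "lead_coeff ?p * lead_coeff ?q \<noteq> 0"
    using qpoly_no_zero_divisors[of "lead_coeff ?p" "lead_coeff ?q"] assms by (auto simp: uni_eq_0_iff)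
  ultimately have "degree ?p + degree ?q \<le> degree (?p * ?q)" by (intro le_degree) simp
  then show ?thesis using degree_mult_le[of ?p ?q] by (simp add: rh_mult[OF ring_hom_on_uni])
qed

lemma degree_uni_pdiff:
  assumes x: "x \<in> pvars f"
  shows "degree (uni x (pdiff x f)) < degree (uni x f)"
proof -
  have f: "f \<noteq> 0" using x by auto
  have sum: "(\<Sum>v\<in>keys m \<inter> {x}. lookup m v) = lookup m x" for m :: "_ \<Rightarrow>\<^sub>0 nat"
    by (cases "x \<in> keys m") (auto simp: in_keys_iff)
  obtain n where n: "degree (uni x f) = Suc n" using degree_uni_0_iff[of x f] x by (cases "degree (uni x f)") auto
  have "lookup m x \<le> pdeg x f" if "m \<in> keys f" for m unfolding pdeg_def using that by (intro Max_ge) auto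
  then have "deg_le {x} (Suc n) f" unfolding deg_le_def sum using n pdeg_eq[OF f, of x] by simp
  then have "deg_le {x} n (pdiff x f)" by (rule deg_le_pdiff) simp
  then have le: "\<forall>m\<in>keys (pdiff x f). lookup m x \<le> n" unfolding deg_le_def sum .
  have S0: "pdiff x f \<noteq> 0" by (rule pdiff_nonzero[OF x])
  then have "pdeg x (pdiff x f) \<le> n" unfolding pdeg_def using le by (intro Max.boundedI) auto
  then show ?thesis using n pdeg_eq[OF S0, of x] by simp
qed

text \<open>Bounds the derivatives of \<open>x\<close> and leaves all other indeterminates free, as
  befits a ranking with \<open>x\<close> on top.\<close>

definition low :: "'i \<Rightarrow> nat \<Rightarrow> 'i dvar set" where
  "low x m = {v. \<forall>k. v = Der x k \<longrightarrow> k \<le> m}"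

lemma low_mono: "m \<le> k \<Longrightarrow> low x m \<subseteq> low x k"
  by (auto simp: low_def)

lemma polys_in_mono: "f \<in> polys_in X \<Longrightarrow> X \<subseteq> Y \<Longrightarrow> f \<in> polys_in Y"
  by (auto simp: polys_in_def)

lemma pdiff_polys_in: "f \<in> polys_in X \<Longrightarrow> pdiff v f \<in> polys_in X"
  using pvars_pdiff[of v f] by (auto simp: polys_in_def)

lemma pderive_low: "f \<in> polys_in (low x m) \<Longrightarrow> pderive f \<in> polys_in (low x (Suc m))"
proof -
  assume f: "f \<in> polys_in (low x m)"
  have "dshift ` low x m \<subseteq> low x (Suc m)"
  proof
    fix v assume "v \<in> dshift ` low x m"
    then obtain u where u: "v = dshift u" "u \<in> low x m" by blast
    then show "v \<in> low x (Suc m)" by (cases u) (auto simp: low_def)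
  qed
  moreover have "pvars f \<subseteq> low x m" using f by (simp add: polys_in_def)
  moreover have "low x m \<subseteq> low x (Suc m)" by (rule low_mono) simp
  ultimately have "pvars f \<union> dshift ` pvars f \<subseteq> low x (Suc m)"
    by (meson Un_least image_mono order_trans)
  with pvars_pderive[of f] have "pvars (pderive f) \<subseteq> low x (Suc m)" by (rule order_trans)
  then show ?thesis by (simp add: polys_in_def)
qed

lemma pdiff_eq_0: "v \<notin> pvars f \<Longrightarrow> pdiff v f = 0"
proof (rule poly_mapping_eqI)
  fix m :: "_ \<Rightarrow>\<^sub>0 nat" assume v: "v \<notin> pvars f"
  have "v \<in> keys (m + single v 1)" by (simp add: in_keys_iff lookup_add)
  with v have "lookup f (m + single v 1) = 0" unfolding pvars_def by (meson UN_I in_keys_iff)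
  then show "lookup (pdiff v f) m = lookup 0 m" unfolding lookup_pdiff by simp
qed

text \<open>Only the top derivative of \<open>x\<close> produces a new one, with the separant as its
  factor; later derivations move the top variable up and keep this factor.\<close>

lemma leading_derivative:
  assumes R: "R \<in> polys_in (low x e)"
  shows "\<exists>T\<in>polys_in (low x (e + s)). (pderive ^^ Suc s) R = pdiff (Der x e) R * pvar (Der x (e + Suc s)) + T"
proof (induction s)
  case 0
  let ?V = "pvars R - {Der x e}"
  have "pderive R = (\<Sum>v\<in>insert (Der x e) ?V. pdiff v R * pvar (dshift v))"
    by (rule pderive_eq) auto
  also have "\<dots> = pdiff (Der x e) R * pvar (Der x (Suc e)) + (\<Sum>v\<in>?V. pdiff v R * pvar (dshift v))"
    by (subst sum.insert) auto
  finally have "pderive R = pdiff (Der x e) R * pvar (Der x (Suc e)) + (\<Sum>v\<in>?V. pdiff v R * pvar (dshift v))" .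
  moreover have "(\<Sum>v\<in>?V. pdiff v R * pvar (dshift v)) \<in> polys_in (low x e)"
  proof (intro ss_sum[OF subring_polys_in] ss_mult[OF subring_polys_in] pdiff_polys_in R)
    fix v assume v: "v \<in> ?V"
    obtain y k where y: "v = Der y k" by (cases v)
    have "v \<in> low x e" using R v by (auto simp: polys_in_def)
    then have "dshift v \<in> low x e" using v by (auto simp: low_def y)
    then show "pvar (dshift v) \<in> polys_in (low x e)" by simp
  qed
  ultimately show ?case by (auto intro!: bexI[of _ "\<Sum>v\<in>?V. pdiff v R * pvar (dshift v)"])
next
  case (Suc s)
  then obtain T where T: "T \<in> polys_in (low x (e + s))"
    "(pderive ^^ Suc s) R = pdiff (Der x e) R * pvar (Der x (e + Suc s)) + T" by blast
  let ?S = "pdiff (Der x e) R"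
  have "(pderive ^^ Suc (Suc s)) R = pderive ((pderive ^^ Suc s) R)" by simp
  also have "\<dots> = ?S * pvar (Der x (e + Suc (Suc s))) + (pderive ?S * pvar (Der x (e + Suc s)) + pderive T)"
    unfolding T(2) by (simp add: deriv_add[OF derivation_pderive] deriv_mult[OF derivation_pderive])
  finally have eq: "(pderive ^^ Suc (Suc s)) R
    = ?S * pvar (Der x (e + Suc (Suc s))) + (pderive ?S * pvar (Der x (e + Suc s)) + pderive T)" .
  have "pderive ?S * pvar (Der x (e + Suc s)) + pderive T \<in> polys_in (low x (e + Suc s))"
  proof (intro ss_add[OF subring_polys_in] ss_mult[OF subring_polys_in])
    show "pderive ?S \<in> polys_in (low x (e + Suc s))"
      using pderive_low[OF pdiff_polys_in[OF R]] by (rule polys_in_mono) (rule low_mono, simp)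
    show "pvar (Der x (e + Suc s)) \<in> polys_in (low x (e + Suc s))" by (simp add: low_def)
    show "pderive T \<in> polys_in (low x (e + Suc s))" using pderive_low[OF T(1)] by simp
  qed
  with eq show ?case by blast
qed

lemma funpow_pderive_low:
  "f \<in> polys_in (low x e) \<Longrightarrow> (pderive ^^ s) f \<in> polys_in (low x (e + s))"
  by (induction s) (auto dest: pderive_low)

text \<open>To be applied to a proper derivative \<open>N\<close> of \<open>R\<close>, which is linear in its leading variable \<open>z\<close>.\<close>

lemma eliminate_leader:
  fixes c :: "'v qpoly"
  assumes "N = S * pvar z + T" "z \<notin> pvars S" "z \<notin> pvars T"
  shows "\<exists>d c' u. S ^ d * c = c' + u * N \<and> z \<notin> pvars c'"
proof -
  let ?X = "- {z}"
  have X: "z \<notin> pvars f \<longleftrightarrow> f \<in> polys_in ?X" for f :: "'v qpoly" by (auto simp: polys_in_def)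
  note SX = subring_polys_in[of ?X]
  have "c \<in> polys_in UNIV" by (simp add: polys_in_def)
  then show ?thesis
  proof (induction c rule: polys_in_induct)
    case (const c)
    show ?case by (rule exI[of _ 0], rule exI[of _ "lconst c"], rule exI[of _ 0]) simp
  next
    case (var v)
    show ?case
    proof (cases "v = z")
      case False
      then show ?thesis by (intro exI[of _ 0] exI[of _ "pvar v"]) auto
    next
      case True
      have "S ^ 1 * pvar v = - T + 1 * N" using assms(1) True by simp
      moreover have "z \<notin> pvars (- T)" using assms(3) by simp
      ultimately show ?thesis by blast
    qed
  next
    case (add f g)
    then obtain d c u d' c' u' where *: "S ^ d * f = c + u * N" "z \<notin> pvars c" "S ^ d' * g = c' + u' * N" "z \<notin> pvars c'"
      by blast
    have "S ^ (d + d') * (f + g) = S ^ d' * (S ^ d * f) + S ^ d * (S ^ d' * g)"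
      by (simp add: power_add algebra_simps)
    also have "\<dots> = (S ^ d' * c + S ^ d * c') + (S ^ d' * u + S ^ d * u') * N"
      by (simp only: *) (simp add: algebra_simps)
    finally have "S ^ (d + d') * (f + g) = (S ^ d' * c + S ^ d * c') + (S ^ d' * u + S ^ d * u') * N" .
    moreover have "z \<notin> pvars (S ^ d' * c + S ^ d * c')"
      using * assms unfolding X by (intro ss_add[OF SX] ss_mult[OF SX] ss_power[OF SX])
    ultimately show ?case by blast
  next
    case (mult f g)
    then obtain d c u d' c' u' where *: "S ^ d * f = c + u * N" "z \<notin> pvars c" "S ^ d' * g = c' + u' * N" "z \<notin> pvars c'"
      by blast
    have "S ^ (d + d') * (f * g) = (S ^ d * f) * (S ^ d' * g)"
      by (simp add: power_add algebra_simps)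
    also have "\<dots> = c * c' + (c * u' + u * c' + u * u' * N) * N"
      by (simp only: *) (simp add: algebra_simps)
    finally have "S ^ (d + d') * (f * g) = c * c' + (c * u' + u * c' + u * u' * N) * N" .
    moreover have "z \<notin> pvars (c * c')" using * unfolding X by (intro ss_mult[OF SX])
    ultimately show ?case by blast
  qed
qed

text \<open>The highest derivative \<open>N\<close> is eliminated: modulo \<open>N\<close> and up to
  powers of the separant \<open>S\<close>, the other coefficients become free of its leading
  variable \<open>z\<close>. What remains is an equation for \<open>U * N\<close> whose other terms
  do not contain \<open>z\<close>; this forces \<open>U = 0\<close>, and the number of derivatives
  drops by one.\<close>

lemma low_order_multiple:
  fixes R :: "'i dvar qpoly"
  assumes R: "R \<in> polys_in (low x e)" and e: "Der x e \<in> pvars R"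
    and w: "w = (\<Sum>s\<le>n. c s * (pderive ^^ s) R)" "w \<in> polys_in (low x e)"
  shows "\<exists>M c'. pdiff (Der x e) R ^ M * w = R * c'"
  using w
proof (induction n arbitrary: w c)
  case 0
  then show ?case by (intro exI[of _ 0] exI[of _ "c 0"]) simp
next
  case (Suc n)
  define S where "S = pdiff (Der x e) R"
  define N where "N = (pderive ^^ Suc n) R"
  define z where "z = Der x (e + Suc n)"
  have S: "S \<in> polys_in (low x e)" "S \<noteq> 0"
    unfolding S_def using pdiff_polys_in[OF R] pdiff_nonzero[OF e] by auto
  obtain T where T: "T \<in> polys_in (low x (e + n))" "N = S * pvar z + T"
    using leading_derivative[OF R] unfolding N_def S_def z_def by blast
  have zfree: "z \<notin> pvars f" if "f \<in> polys_in (low x (e + n))" for f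
    using that by (auto simp: polys_in_def low_def z_def)
  have low_e: "f \<in> polys_in (low x (e + n))" if "f \<in> polys_in (low x e)" for f
    using that by (rule polys_in_mono) (rule low_mono, simp)
  have "\<forall>s. \<exists>d c' u. S ^ d * c s = c' + u * N \<and> z \<notin> pvars c'"
    using eliminate_leader[OF T(2)] S T zfree low_e by blast
  then obtain d c' u where *: "\<And>s. S ^ d s * c s = c' s + u s * N" "\<And>s. z \<notin> pvars (c' s)" by metis
  \<comment> \<open>A common power of \<open>S\<close> for all coefficients; \<open>b\<close>
    collects the remainders free of \<open>z\<close> and \<open>U\<close> the multiples of
    \<open>N\<close>.\<close>
  define D where "D = (\<Sum>s\<le>n. d s)"
  define b where "b s = S ^ (D - d s) * c' s" for s
  define U where "U = (\<Sum>s\<le>n. S ^ (D - d s) * u s * (pderive ^^ s) R) + S ^ D * c (Suc n)"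
  have Sd: "S ^ D * c s = b s + S ^ (D - d s) * u s * N" if "s \<le> n" for s
  proof -
    have "d s \<le> D" unfolding D_def using that by (intro member_le_sum) auto
    then have "S ^ D * c s = S ^ (D - d s) * (S ^ d s * c s)" by (simp add: mult.assoc[symmetric] flip: power_add)
    then show ?thesis by (simp only: *) (simp add: b_def algebra_simps)
  qed
  have "S ^ D * w = (\<Sum>s\<le>n. S ^ D * c s * (pderive ^^ s) R) + S ^ D * c (Suc n) * N"
    unfolding Suc.prems(1) by (simp add: sum_distrib_left algebra_simps N_def)
  also have "(\<Sum>s\<le>n. S ^ D * c s * (pderive ^^ s) R)
      = (\<Sum>s\<le>n. b s * (pderive ^^ s) R) + (\<Sum>s\<le>n. S ^ (D - d s) * u s * (pderive ^^ s) R) * N"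
  proof -
    have "(\<Sum>s\<le>n. S ^ D * c s * (pderive ^^ s) R) = (\<Sum>s\<le>n. (b s + S ^ (D - d s) * u s * N) * (pderive ^^ s) R)"
      by (intro sum.cong refl) (simp only: Sd atMost_iff)
    also have "\<dots> = (\<Sum>s\<le>n. b s * (pderive ^^ s) R) + (\<Sum>s\<le>n. S ^ (D - d s) * u s * (pderive ^^ s) R) * N"
      by (simp only: distrib_right sum.distrib sum_distrib_right) (simp only: ac_simps)
    finally show ?thesis .
  qed
  finally have eq: "S ^ D * w = (\<Sum>s\<le>n. b s * (pderive ^^ s) R) + U * N"
    by (simp add: U_def algebra_simps)
  have X: "z \<notin> pvars f \<longleftrightarrow> f \<in> polys_in (- {z})" for f :: "'i dvar qpoly" by (auto simp: polys_in_def)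
  note SX = subring_polys_in[of "- {z}"]
  have Dw: "S ^ D * w \<in> polys_in (low x e)"
    using S Suc.prems by (intro ss_mult[OF subring_polys_in] ss_power[OF subring_polys_in])
  have "U = 0"
  proof (rule ccontr)
    assume U: "U \<noteq> 0"
    have "z \<in> pvars N"
    proof (rule ccontr)
      assume "z \<notin> pvars N"
      then have "pdiff z N = 0" by (rule pdiff_eq_0)
      moreover have "pdiff z N = S"
        using S T zfree low_e by (simp add: T(2) pdiff_add pdiff_mult pdiff_pvar pdiff_eq_0)
      ultimately show False using S by simp
    qed
    then have "z \<in> pvars (U * N)" using U pvars_mult_eq[of U N] by fastforce
    moreover have "z \<notin> pvars (S ^ D * w - (\<Sum>s\<le>n. b s * (pderive ^^ s) R))"
    proof -
      have "z \<notin> pvars (S ^ D * w)" using Dw zfree low_e by blast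
      moreover have "z \<notin> pvars (\<Sum>s\<le>n. b s * (pderive ^^ s) R)"
        unfolding X
      proof (intro ss_sum[OF SX] ss_mult[OF SX])
        fix s assume "s \<in> {..n}"
        then have "(pderive ^^ s) R \<in> polys_in (low x (e + n))"
          using funpow_pderive_low[OF R, of s] by (auto elim!: polys_in_mono intro!: low_mono)
        then show "(pderive ^^ s) R \<in> polys_in (- {z})" using zfree X by blast
        show "b s \<in> polys_in (- {z})"
          unfolding b_def using *(2)[of s] S zfree low_e X by (intro ss_mult[OF SX] ss_power[OF SX]) blast+
      qed
      ultimately show ?thesis using X ss_diff[OF SX] by blast
    qed
    moreover have "U * N = S ^ D * w - (\<Sum>s\<le>n. b s * (pderive ^^ s) R)" by (simp add: eq)
    ultimately show False by simp
  qed
  then have "S ^ D * w = (\<Sum>s\<le>n. b s * (pderive ^^ s) R)" using eq by simp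
  from Suc.IH[OF this Dw] obtain M c'' where "S ^ M * (S ^ D * w) = R * c''" unfolding S_def by blast
  then have "S ^ (M + D) * w = R * c''" by (simp add: power_add mult.assoc)
  then show ?case unfolding S_def by blast
qed

text \<open>The combinations of derivatives of \<open>R\<close> form a differential ideal. Their
  coefficients are taken from the ambient ring; \<open>dvd_in_polys_in\<close> brings the final
  quotient back.\<close>

lemma diff_ideal_gen_single:
  assumes D: "D = diff_polys X" and R: "R \<in> D" and w: "w \<in> diff_ideal_gen (subring_on D) pderive {R}"
  shows "\<exists>n c. w = (\<Sum>s\<le>n. c s * (pderive ^^ s) R)"
proof -
  have SD: "subring_set D" unfolding D diff_polys_def by (rule subring_polys_in)
  have pD: "pderive f \<in> D" if "f \<in> D" for f
  proof -
    have "dshift ` {Der x k |x k. x \<in> X} \<subseteq> {Der x k |x k. x \<in> X}" by auto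
    moreover have "pvars f \<subseteq> {Der x k |x k. x \<in> X}" using that by (simp add: D diff_polys_def polys_in_def)
    ultimately have "pvars f \<union> dshift ` pvars f \<subseteq> {Der x k |x k. x \<in> X}" by (meson Un_least image_mono order_trans)
    with pvars_pderive[of f] have "pvars (pderive f) \<subseteq> {Der x k |x k. x \<in> X}" by (rule order_trans)
    then show ?thesis by (simp add: D diff_polys_def polys_in_def)
  qed
  define J where "J = {w \<in> D. \<exists>n c. w = (\<Sum>s\<le>n. c s * (pderive ^^ s) R)}"
  have ext: "\<exists>c'. (\<Sum>s\<le>n. c s * (pderive ^^ s) R) = (\<Sum>s\<le>n + m. c' s * (pderive ^^ s) R)" for n m c
  proof (intro exI[of _ "\<lambda>s. if s \<le> n then c s else 0"])
    show "(\<Sum>s\<le>n. c s * (pderive ^^ s) R) = (\<Sum>s\<le>n + m. (if s \<le> n then c s else 0) * (pderive ^^ s) R)"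
      by (rule sum.mono_neutral_cong_left) auto
  qed
  have "ideal J (subring_on D)"
  proof (rule ideal_subring_onI[OF SD])
    show "J \<subseteq> D" by (auto simp: J_def)
    show "0 \<in> J" by (auto simp: J_def ss_zero[OF SD] intro!: exI[of _ 0] exI[of _ "\<lambda>_. 0"])
    fix a b assume "a \<in> J" "b \<in> J"
    then obtain n c m c' where ab: "a \<in> D" "b \<in> D" "a = (\<Sum>s\<le>n. c s * (pderive ^^ s) R)" "b = (\<Sum>s\<le>m. c' s * (pderive ^^ s) R)"
      by (auto simp: J_def)
    obtain d where "a = (\<Sum>s\<le>n + m. d s * (pderive ^^ s) R)" using ext[of c n m] ab by auto
    moreover obtain d' where "b = (\<Sum>s\<le>n + m. d' s * (pderive ^^ s) R)" using ext[of c' m n] ab by (auto simp: add.commute)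
    ultimately have "a + b = (\<Sum>s\<le>n + m. (d s + d' s) * (pderive ^^ s) R)" by (simp add: sum.distrib algebra_simps)
    moreover have "a + b \<in> D" using ab by (intro ss_add[OF SD])
    ultimately show "a + b \<in> J" unfolding J_def
      by (intro CollectI conjI exI[of _ "n + m"] exI[of _ "\<lambda>s. d s + d' s"])
  next
    fix a s assume "a \<in> J" "s \<in> D"
    then obtain n c where a: "a \<in> D" "a = (\<Sum>s\<le>n. c s * (pderive ^^ s) R)" by (auto simp: J_def)
    then have "s * a = (\<Sum>t\<le>n. (s * c t) * (pderive ^^ t) R)" by (simp add: sum_distrib_left mult.assoc)
    moreover have "s * a \<in> D" using a \<open>s \<in> D\<close> by (intro ss_mult[OF SD])
    ultimately show "s * a \<in> J" unfolding J_def
      by (intro CollectI conjI exI[of _ n] exI[of _ "\<lambda>t. s * c t"])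
  qed
  moreover have "pderive ` J \<subseteq> J"
  proof clarify
    fix a assume "a \<in> J"
    then obtain n c where a: "a \<in> D" "a = (\<Sum>s\<le>n. c s * (pderive ^^ s) R)" by (auto simp: J_def)
    have "pderive a = (\<Sum>s\<le>n. pderive (c s) * (pderive ^^ s) R) + (\<Sum>s\<le>n. c s * (pderive ^^ Suc s) R)"
      by (simp add: a(2) deriv_sum[OF derivation_pderive] deriv_mult[OF derivation_pderive] sum.distrib)
    also have "(\<Sum>s\<le>n. c s * (pderive ^^ Suc s) R) = (\<Sum>s\<le>Suc n. (case s of 0 \<Rightarrow> 0 | Suc s \<Rightarrow> c s) * (pderive ^^ s) R)"
      by (subst sum.atMost_Suc_shift) simp
    also obtain c' where "(\<Sum>s\<le>n. pderive (c s) * (pderive ^^ s) R) = (\<Sum>s\<le>Suc n. c' s * (pderive ^^ s) R)"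
      using ext[of "\<lambda>s. pderive (c s)" n 1] by auto
    finally have "pderive a = (\<Sum>s\<le>Suc n. (c' s + (case s of 0 \<Rightarrow> 0 | Suc s \<Rightarrow> c s)) * (pderive ^^ s) R)"
      by (simp add: sum.distrib algebra_simps)
    then show "pderive a \<in> J" using pD[OF a(1)] unfolding J_def
      by (intro CollectI conjI exI[of _ "Suc n"]
          exI[of _ "\<lambda>s. c' s + (case s of 0 \<Rightarrow> 0 | Suc s \<Rightarrow> c s)"])
  qed
  moreover have "R \<in> J" unfolding J_def using R by (auto intro!: exI[of _ 0] exI[of _ "\<lambda>_. 1"])
  ultimately have "w \<in> J" using w unfolding diff_ideal_gen_def by blast
  then show ?thesis by (auto simp: J_def)
qed

lemma prime_in_power:
  assumes "prime_in S p" "subring_set S" "a \<in> S" "b \<in> S" "dvd_in S p (a ^ k * b)"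
  shows "dvd_in S p a \<or> dvd_in S p b"
  using assms(5)
proof (induction k)
  case (Suc k)
  have "a ^ k * b \<in> S" using assms by (intro ss_mult[OF assms(2)] ss_power[OF assms(2)])
  then show ?case using prime_inD[OF assms(1,3), of "a ^ k * b"] Suc by (auto simp: mult.assoc)
qed simp

text \<open>The indeterminates are numbered with \<open>x\<close> receiving 0; a smaller number
  ranks higher.\<close>

lemma elimination_ranking_exists:
  fixes x :: "'i::countable"
  assumes "x \<in> X"
  shows "\<exists>r. elimination_ranking X r \<and> (\<forall>y\<in>X. \<forall>k m. y \<noteq> x \<longrightarrow> (Der y k, Der x m) \<in> r) \<and>
    (\<forall>k m. k \<le> m \<longrightarrow> (Der x k, Der x m) \<in> r)"
proof -
  define K where "K y = (if y = x then 0 else Suc (to_nat y))" for y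
  have K: "K y = K z \<longleftrightarrow> y = z" for y z by (auto simp: K_def)
  define r where "r = {(Der y k, Der z m) | y z k m. y \<in> X \<and> z \<in> X \<and> (K z < K y \<or> y = z \<and> k \<le> m)}"
  have r: "(Der y k, Der z m) \<in> r \<longleftrightarrow> y \<in> X \<and> z \<in> X \<and> (K z < K y \<or> y = z \<and> k \<le> m)" for y z k m
    by (auto simp: r_def)
  have r': "(v, w) \<in> r \<longleftrightarrow> (\<exists>y k z m. v = Der y k \<and> w = Der z m \<and> y \<in> X \<and> z \<in> X \<and> (K z < K y \<or> y = z \<and> k \<le> m))" for v w
    by (auto simp: r_def)
  have "linear_order_on {Der x k | x k. x \<in> X} r"
    unfolding order_on_defs
  proof (intro conjI)
    show "trans r" by (rule transI) (auto simp: r')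
    show "antisym r" by (rule antisymI) (auto simp: r')
    show "total_on {Der x k |x k. x \<in> X} r"
    proof (rule total_onI)
      fix v w assume "v \<in> {Der x k |x k. x \<in> X}" "w \<in> {Der x k |x k. x \<in> X}" "v \<noteq> w"
      then obtain y k z m where "v = Der y k" "w = Der z m" "y \<in> X" "z \<in> X" "Der y k \<noteq> Der z m" by blast
      then show "(v, w) \<in> r \<or> (w, v) \<in> r"
        using K[of y z] by (cases "K y" "K z" rule: linorder_cases) (auto simp: r)
    qed
  qed (auto simp: refl_on_def r')
  then have "elimination_ranking X r"
    unfolding elimination_ranking_def using K by (auto simp: r r')
  moreover have "\<forall>y\<in>X. \<forall>k m. y \<noteq> x \<longrightarrow> (Der y k, Der x m) \<in> r" using assms by (auto simp: r K_def)
  ultimately show ?thesis using assms r by blast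
qed

instance coef :: countable
  by countable_datatype

section \<open>Divisibility by the sparse differential resultant\<close>

context
  fixes P :: gsystem and R :: dpoly
  assumes gen: "generic_system P" and R: "sparse_diff_resultant P R"
begin

lemma resultant_in_DD: "R \<in> DD P"
  using R by (simp add: sparse_diff_resultant_def)

lemma resultant_prime: "prime_in (DD P) R"
  using R irreducible_prime_polys_in unfolding sparse_diff_resultant_def DD_def diff_polys_def by blast

lemma resultant_nonzero: "R \<noteq> 0"
  using resultant_prime by (simp add: prime_in_def)

lemma sat_iff: "g \<in> DD P \<Longrightarrow> g \<in> sat (coefs P) R \<longleftrightarrow> phi P g = 0"
  using R elimination_ideal_eq_kernel[OF gen, of g] unfolding sparse_diff_resultant_def by blast

lemma phi_resultant: "phi P R = 0"
proof -
  have "R \<in> sat (coefs P) R"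
    unfolding sat_def diff_remainder_def
  proof (intro CollectI conjI allI impI)
    show "R \<in> diff_polys (coefs P)" "0 \<in> diff_polys (coefs P)"
      using resultant_in_DD ss_zero[OF subring_DD] by (auto simp: DD_def)
    fix r show "reduced_wrt r R 0" by (simp add: reduced_wrt_def)
    show "\<exists>a b. initial_of r R ^ a * separant_of r R ^ b * R - 0
        \<in> diff_ideal_gen (subring_on (diff_polys (coefs P))) pderive {R}"
      by (rule exI[of _ 0], rule exI[of _ 0]) (auto simp: diff_ideal_gen_def)
  qed
  then show ?thesis using sat_iff[OF resultant_in_DD] by simp
qed

text \<open>In a ranking with \<open>x\<close> on top the leader of \<open>R\<close> is
  \<open>Der x e\<close>. By the definition of \<open>sat\<close> and by
  \<open>low_order_multiple\<close>, a product of \<open>g\<close> with powers of initial and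
  separant is a multiple of \<open>R\<close>. Both have smaller degree in the leader than
  \<open>R\<close>, which is prime and therefore divides \<open>g\<close>.\<close>

lemma low_order_divisible:
  assumes g: "g \<in> DD P" "phi P g = 0" and e: "Der x e \<in> pvars R"
    and lowR: "R \<in> polys_in (low x e)" and lowg: "g \<in> polys_in (low x e)"
  shows "dvd_in (DD P) R g"
proof -
  note SD = subring_DD[of P]
  have xX: "x \<in> coefs P"
    using e resultant_in_DD by (auto simp: DD_def diff_polys_def polys_in_def)
  obtain r where r: "elimination_ranking (coefs P) r"
    and rx: "\<And>y k m. y \<in> coefs P \<Longrightarrow> y \<noteq> x \<Longrightarrow> (Der y k, Der x m) \<in> r" "\<And>k m. k \<le> m \<Longrightarrow> (Der x k, Der x m) \<in> r"
    using elimination_ranking_exists[OF xX] by blast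
  have anti: "antisym r"
    using r by (simp add: elimination_ranking_def linear_order_on_def partial_order_on_def)
  have top: "(w, Der x e) \<in> r" if wR: "w \<in> pvars R" for w
  proof -
    obtain y k where w: "w = Der y k" "y \<in> coefs P"
      using wR resultant_in_DD unfolding DD_def diff_polys_def polys_in_def by blast
    then show ?thesis using rx lowR wR by (cases "y = x") (auto simp: polys_in_def low_def)
  qed
  have lead: "leader r R = Der x e"
    unfolding leader_def
  proof (rule the_equality)
    show "Der x e \<in> pvars R \<and> (\<forall>w\<in>pvars R. (w, Der x e) \<in> r)" using e top by blast
    fix v assume "v \<in> pvars R \<and> (\<forall>w\<in>pvars R. (w, v) \<in> r)"
    then have "(v, Der x e) \<in> r" "(Der x e, v) \<in> r" using e top by blast+
    then show "v = Der x e" by (rule antisymD[OF anti])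
  qed
  define S where "S = pdiff (Der x e) R"
  define I where "I = lead_coeff (uni (Der x e) R)"
  have "g \<in> sat (coefs P) R" using sat_iff g by blast
  then have "diff_remainder (coefs P) r R g 0" using r by (simp add: sat_def)
  then obtain a b where w: "I ^ a * S ^ b * g \<in> diff_ideal_gen (subring_on (DD P)) pderive {R}"
    by (auto simp: diff_remainder_def initial_of_def separant_of_def lead plcoeff_eq[OF resultant_nonzero] I_def S_def DD_def)
  have deg0: "degree (uni (Der x e) R) \<noteq> 0" using e by (simp add: degree_uni_0_iff)
  have vI: "I \<in> polys_in (pvars R - {Der x e})"
    using uni_in_polys_over[of R "pvars R" "Der x e"] unfolding I_def by (simp add: polys_in_def polys_over_def)
  have SR: "S \<in> polys_in (pvars R)" by (simp add: S_def polys_in_def pvars_pdiff)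
  have RD: "pvars R \<subseteq> {Der x k |x k. x \<in> coefs P}"
    using resultant_in_DD by (simp add: DD_def diff_polys_def polys_in_def)
  have ID: "I \<in> DD P" and SD': "S \<in> DD P"
    unfolding DD_def diff_polys_def
    by (rule polys_in_mono[OF vI], use RD in blast) (rule polys_in_mono[OF SR RD])
  have Rlow: "pvars R \<subseteq> low x e" using lowR by (simp add: polys_in_def)
  have lowI: "I \<in> polys_in (low x e)" and lowS: "S \<in> polys_in (low x e)"
    by (rule polys_in_mono[OF vI], use Rlow in blast) (rule polys_in_mono[OF SR Rlow])
  have I0: "I \<noteq> 0" using resultant_nonzero by (simp add: I_def uni_eq_0_iff)
  have S0: "S \<noteq> 0" unfolding S_def by (rule pdiff_nonzero[OF e])
  \<comment> \<open>A nonzero multiple of \<open>R\<close> has at least the degree of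
    \<open>R\<close> in the leader.\<close>
  have deg: "\<not> dvd_in (DD P) R f" if "f \<noteq> 0" "degree (uni (Der x e) f) < degree (uni (Der x e) R)" for f
  proof
    assume "dvd_in (DD P) R f"
    then obtain c where c: "f = R * c" by (auto simp: dvd_in_def)
    then have "c \<noteq> 0" using that by auto
    then show False using that degree_uni_mult[OF resultant_nonzero, of c "Der x e"] c by simp
  qed
  have "degree (uni (Der x e) I) = 0" using vI by (auto simp: degree_uni_0_iff polys_in_def)
  then have nI: "\<not> dvd_in (DD P) R I" using deg[OF I0] deg0 by simp
  have nS: "\<not> dvd_in (DD P) R S"
    using deg[OF S0] degree_uni_pdiff[OF e] by (simp add: S_def)
  obtain n c where "I ^ a * S ^ b * g = (\<Sum>s\<le>n. c s * (pderive ^^ s) R)"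
    using diff_ideal_gen_single[OF DD_def resultant_in_DD w] by blast
  moreover have "I ^ a * S ^ b * g \<in> polys_in (low x e)"
    using lowI lowS lowg by (intro ss_mult[OF subring_polys_in] ss_power[OF subring_polys_in])
  ultimately obtain M c' where Mc: "S ^ M * (I ^ a * S ^ b * g) = R * c'"
    using low_order_multiple[OF lowR e] unfolding S_def by blast
  have in_DD: "I ^ a * (S ^ b * g) \<in> DD P" "S ^ b * g \<in> DD P"
    using ID SD' g by (auto intro!: ss_mult[OF SD] ss_power[OF SD])
  have "dvd_in (DD P) R (S ^ M * (I ^ a * (S ^ b * g)))"
  proof -
    have "S ^ M * (I ^ a * (S ^ b * g)) \<in> DD P" using in_DD SD' ss_mult[OF SD] ss_power[OF SD] by simp
    moreover have "S ^ M * (I ^ a * (S ^ b * g)) = R * c'" using Mc by (simp add: mult.assoc)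
    ultimately show ?thesis unfolding DD_def diff_polys_def by (rule dvd_in_polys_in)
  qed
  then have "dvd_in (DD P) R (I ^ a * (S ^ b * g))"
    using prime_in_power[OF resultant_prime SD SD' in_DD(1)] nS by blast
  then have "dvd_in (DD P) R (S ^ b * g)"
    using prime_in_power[OF resultant_prime SD ID in_DD(2)] nI by blast
  then show ?thesis
    using prime_in_power[OF resultant_prime SD SD' g(1)] nS by blast
qed

end

subsection \<open>The coefficients of the derivatives of the system\<close>

lemma derivation_of_nat: "derivation D \<Longrightarrow> D (of_nat k) = 0"
  by (induction k) (simp_all add: deriv_zero deriv_add deriv_one)

lemma derivation_binomial:
  fixes D :: "'a::comm_ring_1 \<Rightarrow> 'a"
  assumes D: "derivation D"
  shows "(D ^^ k) (a * b) = (\<Sum>s\<le>k. of_nat (k choose s) * ((D ^^ s) a * (D ^^ (k - s)) b))"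
proof (induction k)
  case (Suc k)
  let ?t = "\<lambda>s r. (D ^^ s) a * (D ^^ r) b"
  have "(D ^^ Suc k) (a * b) = D (\<Sum>s\<le>k. of_nat (k choose s) * ?t s (k - s))"
    by (simp add: Suc)
  also have "\<dots> = (\<Sum>s\<le>k. of_nat (k choose s) * (?t (Suc s) (k - s) + ?t s (Suc (k - s))))"
    by (simp add: deriv_sum[OF D] deriv_mult[OF D] derivation_of_nat[OF D])
  also have "\<dots> = (\<Sum>s\<le>k. of_nat (k choose s) * ?t (Suc s) (k - s)) + (\<Sum>s\<le>k. of_nat (k choose s) * ?t s (Suc k - s))"
    by (simp add: distrib_left sum.distrib Suc_diff_le)
  also have "(\<Sum>s\<le>k. of_nat (k choose s) * ?t s (Suc k - s)) = (\<Sum>s\<le>Suc k. of_nat (k choose s) * ?t s (Suc k - s))"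
    by (simp add: binomial_eq_0)
  also have "\<dots> = ?t 0 (Suc k) + (\<Sum>s\<le>k. of_nat (k choose Suc s) * ?t (Suc s) (k - s))"
    by (subst sum.atMost_Suc_shift) simp
  also have "(\<Sum>s\<le>k. of_nat (k choose s) * ?t (Suc s) (k - s)) + (?t 0 (Suc k) + (\<Sum>s\<le>k. of_nat (k choose Suc s) * ?t (Suc s) (k - s)))
     = ?t 0 (Suc k) + (\<Sum>s\<le>k. of_nat (Suc k choose Suc s) * ?t (Suc s) (k - s))"
    by (simp add: sum.distrib[symmetric] distrib_right)
  also have "\<dots> = (\<Sum>s\<le>Suc k. of_nat (Suc k choose s) * ?t s (Suc k - s))"
    by (subst sum.atMost_Suc_shift) simp
  finally show ?case .
qed simp

text \<open>From the Leibniz rule: the coefficient of \<open>Der (Coef i l) s\<close> in the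
  coefficient of the monomial \<open>m\<close> of the \<open>k\<close>-th derivative of
  \<open>FF P i\<close>.\<close>

definition dcoef :: "gsystem \<Rightarrow> nat \<Rightarrow> nat \<Rightarrow> umon \<Rightarrow> nat \<Rightarrow> nat \<Rightarrow> rat" where
  "dcoef P i k m l s = of_nat (k choose s) * lookup ((D0 ^^ (k - s)) (lmon (mon P i l))) m"

definition linear_form :: "gsystem \<Rightarrow> nat \<Rightarrow> nat \<Rightarrow> (nat \<Rightarrow> nat \<Rightarrow> rat) \<Rightarrow> dpoly" where
  "linear_form P i k c = (\<Sum>l\<le>len P i. \<Sum>s\<le>k. lconst (c l s) * pvar (Der (Coef i l) s))"

lemma lookup_linear_form:
  assumes "l \<le> len P i" "s \<le> k"
  shows "lookup (linear_form P i k c) (single (Der (Coef i l) s) 1) = c l s"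
proof -
  have "lookup (lconst (c l' s') * pvar (Der (Coef i l') s')) (single (Der (Coef i l) s) 1)
      = (if l' = l then if s' = s then c l s else 0 else 0)" for l' s'
  proof -
    have "single (Der (Coef i l') s') (1::nat) = single (Der (Coef i l) s) 1 \<longleftrightarrow> l' = l \<and> s' = s"
    proof
      assume "single (Der (Coef i l') s') (1::nat) = single (Der (Coef i l) s) 1"
      then have "keys (single (Der (Coef i l') s') (1::nat)) = keys (single (Der (Coef i l) s) (1::nat))" by simp
      then show "l' = l \<and> s' = s" by simp
    qed simp
    then show ?thesis by (simp add: pvar_def lconst_def mult_single lookup_single when_def)
  qed
  then have "lookup (linear_form P i k c) (single (Der (Coef i l) s) 1)
      = (\<Sum>l'\<le>len P i. if l' = l then (\<Sum>s'\<le>k. if s' = s then c l s else 0) else 0)"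
    unfolding linear_form_def lookup_sum by (intro sum.cong refl) (auto intro!: sum.neutral)
  then show ?thesis using assms by (simp add: sum.delta)
qed

lemma linear_form_eq_0_iff: "linear_form P i k c = 0 \<longleftrightarrow> (\<forall>l\<le>len P i. \<forall>s\<le>k. c l s = 0)"
proof
  assume "linear_form P i k c = 0"
  then show "\<forall>l\<le>len P i. \<forall>s\<le>k. c l s = 0" using lookup_linear_form[of _ P i _ k c] by auto
qed (simp add: linear_form_def lconst_0)

lemma pvars_linear_form: "pvars (linear_form P i k c) \<subseteq> {Der (Coef i l) s | l s. l \<le> len P i \<and> s \<le> k \<and> c l s \<noteq> 0}"
proof -
  let ?X = "{Der (Coef i l) s | l s. l \<le> len P i \<and> s \<le> k \<and> c l s \<noteq> 0}"
  have "lconst (c l s) * pvar (Der (Coef i l) s) \<in> polys_in ?X" if "l \<le> len P i" "s \<le> k" for l s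
  proof (cases "c l s = 0")
    case True
    then show ?thesis by (simp add: lconst_0 ss_zero[OF subring_polys_in])
  next
    case False
    then show ?thesis using that by (intro ss_mult[OF subring_polys_in]) auto
  qed
  then have "linear_form P i k c \<in> polys_in ?X"
    unfolding linear_form_def by (intro ss_sum[OF subring_polys_in]) auto
  then show ?thesis by (simp add: polys_in_def)
qed

text \<open>Rational Laurent polynomials inside the differential ring, where the derivatives of the
  monomials of the system lie.\<close>

definition remb :: "nat dvar lau \<Rightarrow> dlaurent" where
  "remb = lext (\<lambda>c. lconst (lconst c)) (\<lambda>m. single m 1)"

lemma remb_single: "remb (single m c) = single m (lconst c)"
  by (cases "c = 0") (auto simp: remb_def lext_def lconst_def mult_single)

lemma remb_add: "remb (f + g) = remb f + remb g"
  unfolding remb_def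
  by (rule lext_add) (rule ring_hom_on_comp[OF ring_hom_on_lconst ring_hom_on_lconst] | simp add: mult_single)+

lemma remb_0: "remb 0 = 0"
  by (simp add: remb_def lext_def)

lemma remb_sum: "remb (sum f A) = (\<Sum>x\<in>A. remb (f x))"
  by (induction A rule: infinite_finite_induct) (auto simp: remb_0 remb_add)

lemma lookup_remb: "lookup (remb f) m = lconst (lookup f m)"
  by (induction f rule: pm_induct) (auto simp: remb_0 remb_single remb_add lookup_single when_def lookup_add lconst_0 lconst_add)

lemma dd_remb: "dd (remb f) = remb (D0 f)"
proof (induction f rule: pm_induct)
  case zero
  then show ?case by (simp add: remb_0 deriv_zero[OF derivation_dd] deriv_zero[OF derivation_D0])
next
  case (single m c)
  have "of_int k * lconst c = (lconst (of_int k * c) :: dpoly)" for k c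
    by (simp add: lconst_mult) (simp add: lconst_def)
  then show ?case
    by (simp add: remb_single dd_def lderive_single[where d = pderive, OF deriv_zero[OF derivation_pderive]]
        lderive_single[where d = "\<lambda>_. 0"] remb_sum)
next
  case (add f g)
  then show ?case by (simp add: remb_add deriv_add[OF derivation_dd] deriv_add[OF derivation_D0])
qed

lemma funpow_dd_single: "(dd ^^ r) (single m 1) = remb ((D0 ^^ r) (lmon m))"
proof (induction r)
  case 0
  show ?case by (simp add: remb_single lconst_1)
qed (simp add: dd_remb)

lemma funpow_deriv_sum: "derivation D \<Longrightarrow> (D ^^ k) (sum f A) = (\<Sum>x\<in>A. (D ^^ k) (f x))"
  by (induction k) (simp_all add: deriv_sum)

theorem lookup_dd_FF: "lookup ((dd ^^ k) (FF P i)) m = linear_form P i k (dcoef P i k m)"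
proof -
  have "FF P i = (\<Sum>l\<le>len P i. lconst (pvar (Der (Coef i l) 0)) * single (mon P i l) 1)"
    by (simp add: FF_def lconst_def mult_single atLeast0AtMost)
  then have "(dd ^^ k) (FF P i) = (\<Sum>l\<le>len P i. \<Sum>s\<le>k. of_nat (k choose s) *
      (lconst (pvar (Der (Coef i l) s)) * remb ((D0 ^^ (k - s)) (lmon (mon P i l)))))"
    by (simp add: funpow_deriv_sum[OF derivation_dd] derivation_binomial[OF derivation_dd] funpow_dd_single
        funpow_dd_lconst funpow_pderive_pvar)
  then have "lookup ((dd ^^ k) (FF P i)) m = (\<Sum>l\<le>len P i. \<Sum>s\<le>k. lookup (lconst (of_nat (k choose s)) *
      (lconst (pvar (Der (Coef i l) s)) * remb ((D0 ^^ (k - s)) (lmon (mon P i l))))) m)"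
    by (simp only: lookup_sum rh_of_nat[OF ring_hom_on_lconst])
  also have "\<dots> = (\<Sum>l\<le>len P i. \<Sum>s\<le>k. lconst (dcoef P i k m l s) * pvar (Der (Coef i l) s))"
    by (intro sum.cong refl)
       (simp add: lookup_lconst_mult lookup_remb dcoef_def lconst_mult mult_ac del: lconst_inj
        flip: rh_of_nat[OF ring_hom_on_lconst])
  finally show ?thesis by (simp add: linear_form_def)
qed

text \<open>Raising both \<open>k\<close> and \<open>s\<close> by one leaves the order
  \<open>k - s\<close> of the derivative of the monomial unchanged, and the binomial coefficients
  are positive. That supports grow along a row is what lets gradients of different orders be
  compared.\<close>

lemma keys_dd_FF_Suc: "keys ((dd ^^ k) (FF P i)) \<subseteq> keys ((dd ^^ Suc k) (FF P i))"
proof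
  fix m assume "m \<in> keys ((dd ^^ k) (FF P i))"
  then obtain l s where ls: "l \<le> len P i" "s \<le> k" "dcoef P i k m l s \<noteq> 0"
    by (auto simp: in_keys_iff lookup_dd_FF linear_form_eq_0_iff simp del: funpow.simps)
  have "dcoef P i (Suc k) m l (Suc s) \<noteq> 0" using ls by (simp add: dcoef_def del: binomial_Suc_Suc)
  then have "linear_form P i (Suc k) (dcoef P i (Suc k) m) \<noteq> 0"
    using ls unfolding linear_form_eq_0_iff by (meson Suc_le_mono)
  then show "m \<in> keys ((dd ^^ Suc k) (FF P i))" by (simp only: in_keys_iff lookup_dd_FF not_False_eq_True)
qed

lemma keys_dd_FF_mono: "k \<le> k' \<Longrightarrow> keys ((dd ^^ k) (FF P i)) \<subseteq> keys ((dd ^^ k') (FF P i))"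
  by (induction k' rule: nat_induct_at_least) (use keys_dd_FF_Suc in blast)+

lemma dcoef_top: "l \<le> len P i \<Longrightarrow> dcoef P i k m l k = (if m = mon P i l then 1 else 0)"
  by (simp add: dcoef_def lookup_single when_def)

text \<open>The derivative of order \<open>k\<close> of a coefficient arises only if no derivation
  falls on the monomial; this pins down the distinguished monomial of every derivative as
  \<open>mon P i 0\<close>.\<close>

lemma coefficient_top_jet:
  assumes "lookup ((dd ^^ k) (FF P i)) m = pvar (Der (Coef i 0) k)"
  shows "m = mon P i 0"
proof (rule ccontr)
  assume m: "m \<noteq> mon P i 0"
  have "lookup (linear_form P i k (dcoef P i k m)) (single (Der (Coef i 0) k) 1) = dcoef P i k m 0 k"
    by (rule lookup_linear_form) auto
  then show False using assms m by (simp add: lookup_dd_FF dcoef_top pvar_def)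
qed

lemma coefficient_lower_jets:
  assumes "m \<noteq> mon P i 0"
  shows "Der (Coef i 0) k \<notin> pvars (lookup ((dd ^^ k) (FF P i)) m)"
  using pvars_linear_form[of P i k "dcoef P i k m"] assms dcoef_top[of 0 P i k m]
  by (auto simp: lookup_dd_FF)

lemma pvars_lookup_dd_FF: "pvars (lookup ((dd ^^ k) (FF P i)) m) \<subseteq> {Der (Coef i l) s | l s. l \<le> len P i \<and> s \<le> k}"
  using pvars_linear_form[of P i k "dcoef P i k m"] by (auto simp: lookup_dd_FF)

lemma pvars_lderive: "pvars (lderive d f) \<subseteq> pvars f \<union> dshift ` pvars f"
proof -
  let ?U = "pvars f \<union> dshift ` pvars f"
  note SU = subring_pvars[of ?U]
  have "lderive d f \<in> {g. pvars g \<subseteq> ?U}"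
    unfolding lderive_def
  proof (intro ss_sum[OF SU] ss_add[OF SU])
    fix m v assume m: "m \<in> keys f" and v: "v \<in> keys m"
    have U: "keys m \<subseteq> pvars f" using m by (auto simp: pvars_def)
    have "keys (m - single v 1 + single (dshift v) 1) \<subseteq> insert v (insert (dshift v) (keys m))"
      by (auto simp: in_keys_iff lookup_add lookup_minus lookup_single when_def split: if_splits)
    also have "\<dots> \<subseteq> ?U" using U v by blast
    finally show "single (m - single v 1 + single (dshift v) 1) (of_int (lookup m v) * lookup f m) \<in> {g. pvars g \<subseteq> ?U}"
      by (auto simp: pvars_single)
  next
    fix m assume "m \<in> keys f"
    then show "single m (d (lookup f m)) \<in> {g. pvars g \<subseteq> ?U}" by (auto simp: pvars_single pvars_def)
  qed
  then show ?thesis by simp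
qed

lemma pvars_funpow_dd:
  assumes "Der j m \<in> pvars ((dd ^^ k) f)"
  shows "\<exists>m0. Der j m0 \<in> pvars f \<and> m0 \<le> m \<and> m \<le> m0 + k"
  using assms
proof (induction k arbitrary: m)
  case (Suc k)
  then consider "Der j m \<in> pvars ((dd ^^ k) f)" | "Der j m \<in> dshift ` pvars ((dd ^^ k) f)"
    using pvars_lderive[of pderive "(dd ^^ k) f"] by (auto simp: dd_def)
  then show ?case
  proof cases
    case 1
    then show ?thesis using Suc.IH[of m] by fastforce
  next
    case 2
    then obtain u where u: "Der j m = dshift u" "u \<in> pvars ((dd ^^ k) f)" by blast
    then obtain m' where "u = Der j m'" "m = Suc m'" by (cases u) auto
    then show ?thesis using Suc.IH[of m'] u by fastforce
  qed
qed auto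

subsection \<open>The algebraic generic system\<close>

text \<open>Order 0 throughout: generic coefficients are algebraic indeterminates, to which the
  derivation is never applied.\<close>

definition gcode :: "gsystem \<Rightarrow> 'y::finite cvar \<Rightarrow> nat dvar" where
  "gcode P c = Der (size_of P + 2 * to_nat c + 1) 0"

lemma inj_gcode: "inj (gcode P)"
  by (rule injI) (simp add: gcode_def)

lemma gcode_ne_jcode: "gcode P c \<noteq> jcode P v"
proof -
  obtain x s where v: "v = Der x s" by (cases v)
  obtain i l where x: "x = Coef i l" by (cases x)
  show ?thesis unfolding v x gcode_def by simp presburger
qed

lemma finite_uorders: "finite (uorders j f)"
proof -
  have "Der j ` uorders j f \<subseteq> pvars f" by (auto simp: uorders_def)
  then have "finite (Der j ` uorders j f)" by (rule finite_subset) simp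
  then show ?thesis by (rule finite_imageD) (simp add: inj_on_def)
qed

lemma ereal_le_add_shift: "m \<le> M + k \<Longrightarrow> ereal (real k) \<le> t \<Longrightarrow> ereal (real m) \<le> ereal (real M) + t"
proof -
  assume a: "m \<le> M + k" "ereal (real k) \<le> t"
  then have "ereal (real m) \<le> ereal (real M) + ereal (real k)" by simp
  also have "\<dots> \<le> ereal (real M) + t" using a by (intro add_left_mono)
  finally show ?thesis .
qed

context
  fixes P :: gsystem
  assumes gen: "generic_system P"
begin

lemma not_unknown: "size_of P \<le> j \<Longrightarrow> Der j k \<notin> unknowns P"
  using size_ge_2[OF gen] by (auto simp: unknowns_def)

lemma gcode_not_unknown: "gcode P c \<notin> unknowns P"
  unfolding gcode_def by (rule not_unknown) simp

lemma dd_FF_in_DU: "i \<in> {1..size_of P} \<Longrightarrow> (dd ^^ k) (FF P i) \<in> DU P"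
  by (intro funpow_dd_DU FF_in_DU[OF gen])

text \<open>The highest derivative of the distinguished coefficient that occurs betrays both the row
  and the order.\<close>

lemma dd_FF_inject:
  assumes "i \<in> {1..size_of P}" "i' \<in> {1..size_of P}" "(dd ^^ k) (FF P i) = (dd ^^ k') (FF P i')"
  shows "i = i' \<and> k = k'"
proof -
  have top: "Der (Coef i 0) k \<in> pvars (lookup ((dd ^^ k) (FF P i)) (mon P i 0))" for i k
  proof -
    have "lookup (lookup ((dd ^^ k) (FF P i)) (mon P i 0)) (single (Der (Coef i 0) k) 1) = 1"
      unfolding lookup_dd_FF by (subst lookup_linear_form) (simp_all add: dcoef_top)
    then have "single (Der (Coef i 0) k) 1 \<in> keys (lookup ((dd ^^ k) (FF P i)) (mon P i 0))"
      by (simp add: in_keys_iff)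
    then show ?thesis unfolding pvars_def by force
  qed
  have "Der (Coef i 0) k \<in> {Der (Coef i' l) s | l s. l \<le> len P i' \<and> s \<le> k'}"
    using top[of i k] pvars_lookup_dd_FF[of k' P i' "mon P i 0"] assms(3) by auto
  moreover have "Der (Coef i' 0) k' \<in> {Der (Coef i l) s | l s. l \<le> len P i \<and> s \<le> k}"
    using top[of i' k'] pvars_lookup_dd_FF[of k P i "mon P i' 0"] assms(3) by auto
  ultimately show ?thesis by auto
qed

text \<open>Each derivation raises the order of an unknown by at most one. The bounds match those in
  \<open>VV\<close> and \<open>Vps\<close>, so that the monomials of the system can be written in
  the \<open>y\<^sub>h\<close>.\<close>

lemma variable_range:
  assumes i: "i \<in> {1..size_of P}" and v: "v \<in> pvars ((dd ^^ k) (FF P i))"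
  shows "\<exists>j m M. v = Der j m \<and> j \<in> {1..size_of P - 1} \<and> gam P j \<le> m \<and> oord P i j = ereal (real M) \<and> m \<le> M + k"
proof -
  have "v \<in> unknowns P" using v dd_FF_in_DU[OF i, of k] by (auto simp: DU_iff)
  then obtain j m where jm: "v = Der j m" "j \<in> {1..size_of P - 1}" by (auto simp: unknowns_def)
  obtain m0 where m0: "Der j m0 \<in> pvars (FF P i)" "m0 \<le> m" "m \<le> m0 + k"
    using pvars_funpow_dd v jm by blast
  then have u: "m0 \<in> uorders j (FF P i)" by (simp add: uorders_def)
  have "gam P j \<le> m0" unfolding gam_def using u i finite_uorders by (intro Min_le) auto
  moreover have "oord P i j = ereal (real (Max (uorders j (FF P i))))"
    using u by (auto simp: oord_def Let_def)
  moreover have "m0 \<le> Max (uorders j (FF P i))" using u finite_uorders by (intro Max_ge) auto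
  ultimately show ?thesis using jm m0 by (intro exI[of _ j] exI[of _ m] exI[of _ "Max (uorders j (FF P i))"]) auto
qed

lemma pvars_dd_FF_VV:
  assumes i: "i \<in> {1..size_of P}" and k: "ereal (real k) \<le> \<tau> i"
  shows "pvars ((dd ^^ k) (FF P i)) \<subseteq> VV P \<tau>"
proof
  fix v assume "v \<in> pvars ((dd ^^ k) (FF P i))"
  then obtain j m M where *: "v = Der j m" "j \<in> {1..size_of P - 1}" "gam P j \<le> m" "oord P i j = ereal (real M)" "m \<le> M + k"
    using variable_range[OF i] by blast
  have "ereal (real m) \<le> oord P i j + \<tau> i" unfolding *(4) using *(5) k by (rule ereal_le_add_shift)
  also have "\<dots> \<le> Max ((\<lambda>i. oord P i j + \<tau> i) ` {1..size_of P})" using i by (intro Max_ge) auto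
  finally show "v \<in> VV P \<tau>" using * by (auto simp: VV_def)
qed

lemma pvars_dd_FF_Vps:
  assumes i: "i \<in> {1..size_of P}" and k: "ereal (real k) \<le> JG P i"
  shows "pvars ((dd ^^ k) (FF P i)) \<subseteq> Vps P"
proof
  fix v assume "v \<in> pvars ((dd ^^ k) (FF P i))"
  then obtain j m M where *: "v = Der j m" "j \<in> {1..size_of P - 1}" "gam P j \<le> m" "oord P i j = ereal (real M)" "m \<le> M + k"
    using variable_range[OF i] by blast
  have "ereal (real m) \<le> oord P i j + JG P i" unfolding *(4) using *(5) k by (rule ereal_le_add_shift)
  also have "\<dots> = (oord P i j + JJ P i) - ereal (real (gamma_sum P))"
    unfolding JG_def *(4) by (cases "JJ P i") auto
  also have "\<dots> \<le> Max ((\<lambda>i. oord P i j + JJ P i) ` {1..size_of P}) - ereal (real (gamma_sum P))"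
    using i by (intro ereal_minus_mono Max_ge) auto
  finally show "v \<in> Vps P" using * by (auto simp: Vps_def)
qed

end

lemma lookup_upsmon: "inj ups \<Longrightarrow> lookup (upsmon ups \<alpha>) (ups j) = \<alpha> $ j"
  by (simp add: upsmon_def lookup_sum lookup_single when_def inj_eq sum.delta)

lemma keys_upsmon: "inj ups \<Longrightarrow> keys (upsmon ups \<alpha>) = ups ` {j. \<alpha> $ j \<noteq> 0}"
proof -
  assume inj: "inj ups"
  have "keys (upsmon ups \<alpha>) \<subseteq> range ups"
    unfolding upsmon_def using keys_sum[of "\<lambda>h. single (ups h) (\<alpha> $ h)" UNIV] by (auto split: if_splits)
  moreover have "ups j \<in> keys (upsmon ups \<alpha>) \<longleftrightarrow> \<alpha> $ j \<noteq> 0" for j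
    by (simp add: in_keys_iff lookup_upsmon[OF inj])
  ultimately show ?thesis by blast
qed

lemma upsmon_0: "upsmon ups 0 = 0"
  by (simp add: upsmon_def)

lemma upsmon_add: "upsmon ups (\<alpha> + \<beta>) = upsmon ups \<alpha> + upsmon ups \<beta>"
  by (simp add: upsmon_def single_add sum.distrib)

lemma upsmon_diff: "upsmon ups (\<alpha> - \<beta>) = upsmon ups \<alpha> - upsmon ups \<beta>"
  using upsmon_add[of ups "\<alpha> - \<beta>" \<beta>] by simp

lemma upsmon_inj: "inj ups \<Longrightarrow> inj (upsmon ups)"
  by (rule injI) (metis lookup_upsmon vec_eq_iff)

lemma upsmon_surj:
  assumes "inj ups" "keys m \<subseteq> range ups"
  shows "m \<in> range (upsmon ups)"
proof -
  have "m = upsmon ups (\<chi> j. lookup m (ups j))"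
  proof (rule poly_mapping_eqI)
    fix v
    show "lookup m v = lookup (upsmon ups (\<chi> j. lookup m (ups j))) v"
    proof (cases "v \<in> range ups")
      case True
      then show ?thesis using lookup_upsmon[OF assms(1)] by auto
    next
      case False
      then have "v \<notin> keys m" "v \<notin> keys (upsmon ups (\<chi> j. lookup m (ups j)))"
        using assms keys_upsmon[OF assms(1)] by auto
      then show ?thesis by (simp add: in_keys_iff)
    qed
  qed
  then show ?thesis by blast
qed

section \<open>The generic system in flat form and the elimination ideals of its subsystems\<close>

locale generic_algebraic_system =
  fixes P :: gsystem and lam :: "dlaurent \<Rightarrow> nat" and ups :: "'y::finite \<Rightarrow> nat dvar" and T :: "nat \<Rightarrow> int ^ 'y"
  assumes gen: "generic_system P"
    and lam: "bij_betw lam (ps P) {1..LL P}"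
    and ups: "bij_betw ups UNIV (Vps P)"
    and dist: "distinguished P lam ups T"
begin

lemma inj_ups: "inj ups" and range_ups: "range ups = Vps P"
  using ups by (auto simp: bij_betw_def)

lemma Vps_unknowns: "Vps P \<subseteq> unknowns P"
  by (auto simp: Vps_def unknowns_def)

lemma keys_upsmon_unknowns: "keys (upsmon ups \<alpha>) \<subseteq> unknowns P"
  using keys_upsmon[OF inj_ups] range_ups Vps_unknowns by blast

text \<open>Row and order replace the arbitrary numbering \<open>lam\<close>, since supports are
  compared within a row.\<close>

definition ix :: "(nat \<times> nat) set" where
  "ix = {(i, k). i \<in> {1..size_of P} \<and> ereal (real k) \<le> JG P i}"

definition dF :: "nat \<times> nat \<Rightarrow> dlaurent" where
  "dF s = (dd ^^ snd s) (FF P (fst s))"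

definition hh :: "nat \<times> nat \<Rightarrow> nat" where
  "hh s = lam (dF s)"

lemma dF_ps: "s \<in> ix \<Longrightarrow> dF s \<in> ps P"
  unfolding ix_def dF_def ps_def by (cases s) (clarsimp, blast)

lemma hh_range: "s \<in> ix \<Longrightarrow> hh s \<in> {1..LL P}"
  using dF_ps lam unfolding hh_def bij_betw_def by blast

lemma rho_hh: "s \<in> ix \<Longrightarrow> rho P lam (hh s) = dF s"
  using dF_ps lam by (simp add: rho_def hh_def bij_betw_def)

lemma hh_inj: "s \<in> ix \<Longrightarrow> t \<in> ix \<Longrightarrow> hh s = hh t \<Longrightarrow> s = t"
proof -
  assume s: "s \<in> ix" and t: "t \<in> ix" and e: "hh s = hh t"
  have "dF s = dF t" using rho_hh[OF s] rho_hh[OF t] e by simp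
  then show "s = t" using dd_FF_inject[OF gen, of "fst s" "fst t" "snd s" "snd t"] s t
    by (auto simp: dF_def ix_def prod_eq_iff)
qed

lemma AA_iff: "s \<in> ix \<Longrightarrow> \<alpha> \<in> AA P lam ups (hh s) \<longleftrightarrow> upsmon ups \<alpha> \<in> keys (dF s)"
  by (simp add: AA_def asupp_def coef_at_def rho_hh in_keys_iff)

lemma upsmon_AA: "s \<in> ix \<Longrightarrow> upsmon ups ` AA P lam ups (hh s) = keys (dF s)"
proof -
  assume s: "s \<in> ix"
  have "keys (dF s) \<subseteq> range (upsmon ups)"
  proof
    fix m assume m: "m \<in> keys (dF s)"
    then have "keys m \<subseteq> pvars (dF s)" by (auto simp: pvars_def)
    also have "\<dots> \<subseteq> Vps P" unfolding dF_def using s by (intro pvars_dd_FF_Vps[OF gen]) (auto simp: ix_def)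
    finally show "m \<in> range (upsmon ups)" using upsmon_surj[OF inj_ups] range_ups by simp
  qed
  then show ?thesis using AA_iff[OF s] by auto
qed

lemma finite_AA: "s \<in> ix \<Longrightarrow> finite (AA P lam ups (hh s))"
  using upsmon_AA finite_keys by (intro finite_imageD[of "upsmon ups"]) (auto intro: inj_on_subset[OF upsmon_inj[OF inj_ups]])

lemma Xi_eq: "Xi P lam ups f = lext (\<lambda>g. lconst (psubst lconst (\<lambda>(h, \<beta>). coef_at ups (rho P lam h) \<beta>) g))
    (\<lambda>\<alpha>. single (upsmon ups \<alpha>) 1) f"
  unfolding Xi_def lext_def by (intro sum.cong refl) (simp add: lconst_def mult_single)

definition Xi0 :: "'y cpoly \<Rightarrow> dpoly" where
  "Xi0 = psubst lconst (\<lambda>(h, \<beta>). coef_at ups (rho P lam h) \<beta>)"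

lemma ring_hom_on_Xi0: "ring_hom_on Xi0"
  unfolding Xi0_def by (rule ring_hom_on_psubst[OF ring_hom_on_lconst])

lemma Xi_lconst: "Xi P lam ups (lconst g) = lconst (Xi0 g)"
proof -
  have h: "ring_hom_on (\<lambda>g. lconst (Xi0 g) :: dlaurent)"
    by (rule ring_hom_on_comp[OF ring_hom_on_Xi0 ring_hom_on_lconst])
  show ?thesis unfolding Xi_eq Xi0_def[symmetric]
    by (rule lext_lconst[OF h]) (simp_all add: upsmon_0 upsmon_add mult_single)
qed

lemma Xi0_pvar: "Xi0 (pvar (h, \<beta>)) = coef_at ups (rho P lam h) \<beta>"
  by (simp add: Xi0_def psubst_pvar[OF ring_hom_on_lconst])

lemma T_AA: "s \<in> ix \<Longrightarrow> T (hh s) \<in> AA P lam ups (hh s)"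
  using dist hh_range by (auto simp: distinguished_def)

lemma coef_T: "s \<in> ix \<Longrightarrow> lookup (dF s) (upsmon ups (T (hh s))) = pvar (Der (Coef (fst s) 0) (snd s))"
proof -
  assume s: "s \<in> ix"
  then have "Xi P lam ups (lconst (pvar (hh s, T (hh s)))) = lconst (pvar (Der (Coef (fst s) 0) (snd s)))"
    using dist hh_range[OF s] rho_hh[OF s] by (auto simp: distinguished_def dF_def ix_def)
  then show ?thesis by (simp add: Xi_lconst Xi0_pvar coef_at_def rho_hh[OF s])
qed

lemma upsmon_T: "s \<in> ix \<Longrightarrow> upsmon ups (T (hh s)) = mon P (fst s) 0"
  using coef_T[of s] coefficient_top_jet[of "snd s" P "fst s"] by (simp add: dF_def)

definition geps :: "nat \<Rightarrow> nat dvar lau" where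
  "geps h = - (\<Sum>\<alpha>\<in>AA P lam ups h - {T h}. lvar (gcode P (h, \<alpha>)) * lmon (upsmon ups (\<alpha> - T h)))"

fun epsv :: "'y cvar \<Rightarrow> nat dvar lau" where
  "epsv (h, \<alpha>) = (if \<alpha> = T h then geps h else lvar (gcode P (h, \<alpha>)))"

definition cflat :: "'y claurent \<Rightarrow> nat dvar lau" where
  "cflat = lext (psubst lconst (\<lambda>c. lvar (gcode P c))) (\<lambda>\<alpha>. lmon (upsmon ups \<alpha>))"

lemma ring_hom_on_cflat: "ring_hom_on cflat"
  unfolding cflat_def
  by (rule ring_hom_on_lext[OF ring_hom_on_psubst[OF ring_hom_on_lconst]])
     (simp_all add: upsmon_0 upsmon_add mult_single)

lemma cflat_single: "cflat (single \<alpha> g) = psubst lconst (\<lambda>c. lvar (gcode P c)) g * lmon (upsmon ups \<alpha>)"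
  unfolding cflat_def
  by (rule lext_single[OF ring_hom_on_psubst[OF ring_hom_on_lconst]])
     (simp_all add: upsmon_0 upsmon_add mult_single)

lemma cflat_lconst: "cflat (lconst g) = psubst lconst (\<lambda>c. lvar (gcode P c)) g"
  using cflat_single[of 0 g] by (simp add: lconst_def upsmon_0)

lemma cflat_at_eps: "cflat (at_eps P lam ups T G) = psubst lconst epsv G"
proof -
  have "cflat (if \<alpha> = T h then eps P lam ups T h else lconst (pvar (h, \<alpha>))) = epsv (h, \<alpha>)" for h \<alpha>
    by (simp add: cflat_lconst psubst_pvar[OF ring_hom_on_lconst] eps_def geps_def rh_uminus[OF ring_hom_on_cflat]
        rh_sum[OF ring_hom_on_cflat] cflat_single)
  then have "(\<lambda>v. cflat (case v of (h, \<alpha>) \<Rightarrow> if \<alpha> = T h then eps P lam ups T h else lconst (pvar (h, \<alpha>)))) = epsv"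
    by (intro ext) (auto split: prod.splits simp del: epsv.simps)
  then show ?thesis
    unfolding at_eps_def hom_psubst_comp[OF ring_hom_on_cflat ring_hom_on_lconst2]
    by (simp add: cflat_lconst psubst_lconst[OF ring_hom_on_lconst])
qed

definition idx :: "(nat \<Rightarrow> ereal) \<Rightarrow> (nat \<times> nat) set" where
  "idx \<tau> = {(i, k). i \<in> {1..size_of P} \<and> ereal (real k) \<le> \<tau> i}"

lemma PS_eq: "PS P \<tau> = dF ` idx \<tau>"
  unfolding PS_def idx_def dF_def by force

lemma C_sub_eq: "C_sub P lam ups \<tau> = {(hh s, \<alpha>) | s \<alpha>. s \<in> idx \<tau> \<and> \<alpha> \<in> AA P lam ups (hh s)}"
  unfolding C_sub_def PS_eq hh_def by blast

lemma S_sub_eq: "S_sub P lam ups \<tau> = (\<lambda>s. PP P lam ups (hh s)) ` idx \<tau>"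
  unfolding S_sub_def PS_eq hh_def by blast

lemma idx_ix: "admissible P \<tau> \<Longrightarrow> idx \<tau> \<subseteq> ix"
  unfolding idx_def ix_def admissible_def using order_trans by blast

lemma subring_laurent_sub: "subring_set (laurent_sub P lam ups \<tau>)"
proof -
  let ?S = "laurent_sub P lam ups \<tau>" and ?C = "polys_in (C_sub P lam ups \<tau>)"
  note SC = subring_polys_in[of "C_sub P lam ups \<tau>"]
  have single: "single \<alpha> c \<in> ?S" if "c \<in> ?C" "\<forall>h. \<alpha> $ h \<noteq> 0 \<longrightarrow> ups h \<in> VV P \<tau>" for \<alpha> c
    using that by (auto simp: laurent_sub_def)
  have diff: "f - g \<in> ?S" if "f \<in> ?S" "g \<in> ?S" for f g
  proof -
    have look: "lookup f \<alpha> \<in> ?C" if "f \<in> ?S" for f \<alpha>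
      using that ss_zero[OF SC] by (cases "\<alpha> \<in> keys f") (auto simp: laurent_sub_def in_keys_iff)
    have "\<alpha> \<in> keys f \<or> \<alpha> \<in> keys g" if "\<alpha> \<in> keys (f - g)" for \<alpha>
      using that by (auto simp: in_keys_iff lookup_minus)
    then show ?thesis using look[OF that(1)] look[OF that(2)] that
      by (fastforce simp: laurent_sub_def lookup_minus intro!: ss_diff[OF SC])
  qed
  have zero: "0 \<in> ?S" by (simp add: laurent_sub_def)
  have sum: "(\<Sum>x\<in>A. f x) \<in> ?S" if "\<And>x. x \<in> A \<Longrightarrow> f x \<in> ?S" for A and f :: "'b \<Rightarrow> 'y claurent"
    using that
  proof (induction A rule: infinite_finite_induct)
    case (insert x A)
    have "f x - (0 - sum f A) \<in> ?S" using insert by (intro diff zero) auto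
    then show ?case using insert by simp
  qed (simp_all add: zero)
  have mult: "f * g \<in> ?S" if "f \<in> ?S" "g \<in> ?S" for f g
  proof -
    have "f * g = (\<Sum>a\<in>keys f. \<Sum>b\<in>keys g. single (a + b) (lookup f a * lookup g b))"
      by (subst (1) pm_expand[of f], subst (1) pm_expand[of g]) (simp add: sum_product mult_single)
    moreover have "single (a + b) (lookup f a * lookup g b) \<in> ?S" if "a \<in> keys f" "b \<in> keys g" for a b
    proof (rule single)
      show "lookup f a * lookup g b \<in> ?C"
        using that \<open>f \<in> ?S\<close> \<open>g \<in> ?S\<close> by (intro ss_mult[OF SC]) (auto simp: laurent_sub_def)
      show "\<forall>h. (a + b) $ h \<noteq> 0 \<longrightarrow> ups h \<in> VV P \<tau>"
      proof (intro allI impI)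
        fix h assume "(a + b) $ h \<noteq> 0"
        then have "a $ h \<noteq> 0 \<or> b $ h \<noteq> 0" by auto
        then show "ups h \<in> VV P \<tau>"
          using that \<open>f \<in> ?S\<close> \<open>g \<in> ?S\<close> unfolding laurent_sub_def by blast
      qed
    qed
    ultimately show ?thesis by (simp add: sum)
  qed
  have "1 \<in> ?S" by (auto simp: laurent_sub_def lookup_one ss_one[OF SC])
  then show ?thesis using diff mult by (simp add: subring_set_def)
qed

lemma cflat_eq_0: "cflat f = 0 \<Longrightarrow> f = 0"
proof (rule flatten_eq_0[where \<nu> = "upsmon ups" and code = "gcode P" and X = UNIV])
  show "inj_on (upsmon ups) (keys f)" using upsmon_inj[OF inj_ups] by (rule inj_on_subset) simp
  show "inj_on (gcode P) UNIV" by (rule inj_gcode)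
  show "lookup f m \<in> polys_in UNIV" for m by (simp add: polys_in_def)
  show "keys (upsmon ups m) \<inter> range (gcode P) = {}" for m
    using keys_upsmon_unknowns gcode_not_unknown[OF gen] by blast
qed (simp add: cflat_def)

lemma support_VV:
  assumes s: "s \<in> idx \<tau>" "admissible P \<tau>" and \<alpha>: "\<alpha> \<in> AA P lam ups (hh s)" "\<alpha> $ h \<noteq> 0"
  shows "ups h \<in> VV P \<tau>"
proof -
  have "s \<in> ix" using s idx_ix by blast
  then have "upsmon ups \<alpha> \<in> keys (dF s)" using \<alpha> AA_iff by blast
  moreover have "ups h \<in> keys (upsmon ups \<alpha>)" using \<alpha> keys_upsmon[OF inj_ups] by auto
  ultimately have "ups h \<in> pvars (dF s)" by (auto simp: pvars_def)
  moreover have "pvars (dF s) \<subseteq> VV P \<tau>"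
    unfolding dF_def using s by (intro pvars_dd_FF_VV[OF gen]) (auto simp: idx_def)
  ultimately show ?thesis by blast
qed

text \<open>Modulo the ideal, \<open>c\<^sub>h\<close> is congruent to
  \<open>\<epsilon>\<^sub>h\<close>, so \<open>G\<close> is congruent to a vanishing element. By
  \<open>support_VV\<close> all monomials involved use unknowns of the subsystem only.\<close>

lemma elim_ideal_subI:
  assumes adm: "admissible P \<tau>" and G: "G \<in> polys_in (C_sub P lam ups \<tau>)" and 0: "psubst lconst epsv G = 0"
  shows "G \<in> elim_ideal_sub P lam ups \<tau>"
proof -
  let ?S = "laurent_sub P lam ups \<tau>"
  note SS = subring_laurent_sub[of \<tau>]
  have at: "at_eps P lam ups T G = 0" using 0 cflat_at_eps cflat_eq_0 by simp
  have single: "single \<alpha> c \<in> ?S" if "c \<in> polys_in (C_sub P lam ups \<tau>)" "\<And>h. \<alpha> $ h \<noteq> 0 \<Longrightarrow> ups h \<in> VV P \<tau>" for \<alpha> c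
    using that by (auto simp: laurent_sub_def)
  have lc: "lconst c \<in> ?S" if "c \<in> polys_in (C_sub P lam ups \<tau>)" for c
    unfolding lconst_def using that by (intro single) auto
  have "lconst G \<in> I" if I: "ideal I (subring_on ?S)" and SI: "S_sub P lam ups \<tau> \<subseteq> I" for I
  proof -
    note ID = ideal_subring_onD[OF SS I]
    let ?e = "\<lambda>(h, \<alpha>). if \<alpha> = T h then eps P lam ups T h else lconst (pvar (h, \<alpha>))"
    have "psubst (\<lambda>c. lconst (lconst c)) (\<lambda>v. lconst (pvar v)) G - psubst (\<lambda>c. lconst (lconst c)) ?e G \<in> I"
    proof (rule psubst_cong_ideal[OF SS ring_hom_on_lconst2 _ I])
      show "lconst (lconst c) \<in> ?S" for c by (rule lc) simp
      fix v assume "v \<in> pvars G"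
      then obtain s \<alpha> where s: "s \<in> idx \<tau>" and \<alpha>: "\<alpha> \<in> AA P lam ups (hh s)" and v: "v = (hh s, \<alpha>)"
        using G unfolding C_sub_eq polys_in_def by blast
      let ?h = "hh s"
      have six: "s \<in> ix" using s adm idx_ix by blast
      have C: "(?h, \<beta>) \<in> C_sub P lam ups \<tau>" if "\<beta> \<in> AA P lam ups ?h" for \<beta>
        using that s unfolding C_sub_eq by blast
      have Tn: "ups h \<in> VV P \<tau>" if "(\<beta> - T ?h) $ h \<noteq> 0" "\<beta> \<in> AA P lam ups ?h" for \<beta> h
      proof -
        have "\<beta> $ h \<noteq> 0 \<or> T ?h $ h \<noteq> 0" using that by auto
        then show ?thesis using support_VV[OF s adm] that T_AA[OF six] by blast
      qed
      have epsS: "eps P lam ups T ?h \<in> ?S"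
        unfolding eps_def using C Tn by (intro ss_uminus[OF SS] ss_sum[OF SS] single) auto
      \<comment> \<open>The polynomial divided by its distinguished monomial.\<close>
      have "lconst (pvar (?h, T ?h)) - eps P lam ups T ?h = single (- T ?h) 1 * PP P lam ups ?h"
      proof -
        have "PP P lam ups ?h = (\<Sum>\<alpha>\<in>insert (T ?h) (AA P lam ups ?h - {T ?h}). single \<alpha> (pvar (?h, \<alpha>)))"
          using T_AA[OF six] by (simp add: PP_def insert_absorb)
        also have "\<dots> = single (T ?h) (pvar (?h, T ?h)) + (\<Sum>\<alpha>\<in>AA P lam ups ?h - {T ?h}. single \<alpha> (pvar (?h, \<alpha>)))"
          using finite_AA[OF six] by (subst sum.insert) auto
        finally show ?thesis
          by (simp add: distrib_left sum_distrib_left mult_single eps_def lconst_def)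
      qed
      moreover have "single (- T ?h) 1 \<in> ?S"
        using support_VV[OF s adm T_AA[OF six]] ss_one[OF subring_polys_in] by (intro single) auto
      moreover have "PP P lam ups ?h \<in> I" using SI s unfolding S_sub_eq by blast
      ultimately have "lconst (pvar (?h, T ?h)) - eps P lam ups T ?h \<in> I" using ID(5) by simp
      then show "lconst (pvar v) \<in> ?S \<and> ?e v \<in> ?S \<and> lconst (pvar v) - ?e v \<in> I"
        using C[OF \<alpha>] epsS lc by (auto simp: v ID(2))
    qed
    moreover have "(lconst G :: 'y claurent) = psubst (\<lambda>c. lconst (lconst c)) (\<lambda>v. lconst (pvar v)) G"
      by (rule hom_psubst[OF ring_hom_on_lconst])
    ultimately show ?thesis using at by (simp add: at_eps_def)
  qed
  then show ?thesis
    using G unfolding elim_ideal_sub_def genideal_subring_on_eq[OF SS] by blast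
qed

end

subsection \<open>Ideals of codimension one\<close>

lemma prime_in_mono:
  fixes p :: "'v qpoly"
  assumes "prime_in (polys_in X) p" "Y \<subseteq> X" "p \<in> polys_in Y"
  shows "prime_in (polys_in Y) p"
  unfolding prime_in_def
proof (intro conjI ballI impI)
  show "p \<in> polys_in Y" "p \<noteq> 0" using assms by (auto simp: prime_in_def)
  show "\<not> unit_in (polys_in Y) p" using assms unit_in_polys_in[of Y p X] by (auto simp: prime_in_def)
  fix f g assume fg: "f \<in> polys_in Y" "g \<in> polys_in Y" "dvd_in (polys_in Y) p (f * g)"
  then have X: "f \<in> polys_in X" "g \<in> polys_in X" using assms polys_in_mono by blast+
  moreover have "dvd_in (polys_in X) p (f * g)"
    using fg polys_in_mono[OF _ assms(2)] unfolding dvd_in_def by blast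
  ultimately have "dvd_in (polys_in X) p f \<or> dvd_in (polys_in X) p g"
    using assms(1) prime_inD by blast
  then show "dvd_in (polys_in Y) p f \<or> dvd_in (polys_in Y) p g"
    using fg dvd_in_polys_in unfolding dvd_in_def[of "polys_in X"] by blast
qed

text \<open>The infimum is attained by a prime \<open>p\<close> of height one. Were the principal
  prime ideal of \<open>Q\<close> smaller than \<open>p\<close>, it would fit between 0 and
  \<open>p\<close> in a chain of length two.\<close>

lemma codimension_one_principal:
  fixes Q :: "'v qpoly"
  assumes Q: "prime_in (polys_in X) Q" and cod: "codimension (subring_on (polys_in X)) I = 1"
    and QI: "Q \<in> I" and G: "G \<in> I"
  shows "dvd_in (polys_in X) Q G"
proof -
  let ?A = "polys_in X" and ?R = "subring_on (polys_in X)"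
  note SA = subring_polys_in[of X]
  interpret cring ?R by (rule cring_subring_on[OF SA])
  let ?H = "{prime_height ?R p | p. primeideal p ?R \<and> I \<subseteq> p}"
  have "Inf ?H = 1" using cod by (simp add: codimension_def)
  \<comment> \<open>The infimum of the empty set would be infinite.\<close>
  then have "?H \<noteq> {}" by (auto simp: Inf_enat_def split: if_splits)
  then have "Inf ?H \<in> ?H" unfolding Inf_enat_def by (auto intro: LeastI)
  then obtain p where p: "primeideal p ?R" "I \<subseteq> p" "prime_height ?R p = 1" using \<open>Inf ?H = 1\<close> by auto
  interpret p: primeideal p ?R by (rule p(1))
  note pD = ideal_subring_onD[OF SA p.is_ideal]
  have QA: "Q \<in> ?A" "Q \<noteq> 0" and Qu: "\<not> unit_in ?A Q" using Q by (auto simp: prime_in_def)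
  have primeI: "primeideal J ?R" if J: "ideal J ?R" "1 \<notin> J" and pr: "\<And>a b. a \<in> ?A \<Longrightarrow> b \<in> ?A \<Longrightarrow> a * b \<in> J \<Longrightarrow> a \<in> J \<or> b \<in> J" for J
  proof (rule primeidealI[OF J(1) is_cring])
    show "carrier ?R \<noteq> J" using J(2) ss_one[OF SA] by (auto simp: subring_on_def)
  qed (use pr in \<open>auto simp: subring_on_def\<close>)
  define Z where "Z = {0 :: 'v qpoly}"
  define J where "J = {f. dvd_in ?A Q f}"
  have Z: "primeideal Z ?R"
    unfolding Z_def
    by (rule primeI) (auto intro!: ideal_subring_onI[OF SA] simp: ss_zero[OF SA] dest: qpoly_no_zero_divisors)
  have JA: "J \<subseteq> ?A" using QA by (auto simp: J_def dvd_in_def intro: ss_mult[OF SA])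
  have J: "primeideal J ?R"
  proof (rule primeI)
    show "ideal J ?R"
    proof (rule ideal_subring_onI[OF SA JA])
      show "0 \<in> J" using ss_zero[OF SA] by (auto simp: J_def dvd_in_def intro!: bexI[of _ 0])
      show "a + b \<in> J" if "a \<in> J" "b \<in> J" for a b
        using that ss_add[OF SA] unfolding J_def dvd_in_def by (auto simp: distrib_left[symmetric])
      show "s * a \<in> J" if "a \<in> J" "s \<in> ?A" for a s
        using that ss_mult[OF SA] unfolding J_def dvd_in_def by (auto simp: mult.left_commute)
    qed
    show "1 \<notin> J" using Qu QA by (auto simp: J_def dvd_in_def unit_in_def)
    show "a \<in> J \<or> b \<in> J" if "a \<in> ?A" "b \<in> ?A" "a * b \<in> J" for a b
      using that prime_inD[OF Q] by (auto simp: J_def)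
  qed
  have Jp: "J \<subseteq> p" using p(2) QI pD(6) by (auto simp: J_def dvd_in_def)
  have ZJ: "Z \<subset> J"
  proof -
    have "Q \<in> J" using ss_one[OF SA] by (auto simp: J_def dvd_in_def intro!: bexI[of _ 1])
    moreover have "0 \<in> J" using ss_zero[OF SA] by (auto simp: J_def dvd_in_def intro!: bexI[of _ 0])
    ultimately show ?thesis using QA by (auto simp: Z_def)
  qed
  have "J = p"
  proof (rule ccontr)
    assume "J \<noteq> p"
    define c where "c i = (if i = 0 then Z else if i = 1 then J else p)" for i :: nat
    have "(\<forall>i\<le>2. primeideal (c i) ?R) \<and> (\<forall>i<2. c i \<subset> c (Suc i)) \<and> c 2 = p"
      using Z J p(1) ZJ Jp \<open>J \<noteq> p\<close> by (auto simp: c_def less_2_cases_iff)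
    then have "enat 2 \<in> {enat k | k. \<exists>c :: nat \<Rightarrow> 'v qpoly set.
        (\<forall>i\<le>k. primeideal (c i) ?R) \<and> (\<forall>i<k. c i \<subset> c (Suc i)) \<and> c k = p}"
      by blast
    then have "enat 2 \<le> prime_height ?R p" unfolding prime_height_def by (rule Sup_upper)
    then show False using p(3) by (simp add: one_enat_def)
  qed
  then show ?thesis using G p(2) by (auto simp: J_def)
qed

subsection \<open>Gradients with respect to the unknowns\<close>

text \<open>Logarithmic gradient restricted to \<open>U\<close> and padded by 0. In use
  \<open>U\<close> consists of the unknowns, so that the codes of coefficients count as
  constants.\<close>

definition ugrad :: "nat dvar set \<Rightarrow> nat dvar lau \<Rightarrow> nat dvar \<Rightarrow> nat dvar lau" where
  "ugrad U f u = (if u \<in> U then theta u f else 0)"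

lemma ugrad_sum: "ugrad U (sum f A) u = (\<Sum>x\<in>A. ugrad U (f x) u)"
  by (simp add: ugrad_def deriv_sum[OF derivation_theta])

lemma ugrad_mult: "ugrad U (f * g) u = ugrad U f u * g + f * ugrad U g u"
  by (simp add: ugrad_def theta_mult)

lemma ugrad_uminus: "ugrad U (- f) u = - ugrad U f u"
  by (simp add: ugrad_def deriv_uminus[OF derivation_theta])

lemma ugrad_lvar: "v \<notin> U \<Longrightarrow> ugrad U (lvar v) u = 0"
  by (auto simp: ugrad_def theta_lvar)

lemma ugrad_lmon: "keys m \<subseteq> U \<Longrightarrow> ugrad U (lmon m) u = lconst (of_int (lookup m u)) * lmon m"
  by (cases "lookup m u = 0") (auto simp: ugrad_def theta_single lconst_mult_single in_keys_iff subset_iff)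

lemma ugrad_psubst:
  assumes "finite V" "pvars f \<subseteq> V"
  shows "ugrad U (psubst lconst \<phi> f) u = (\<Sum>v\<in>V. psubst lconst \<phi> (pdiff v f) * ugrad U (\<phi> v) u)"
  using psubst_chain[OF derivation_theta ring_hom_on_lconst _ assms, of u \<phi>] by (simp add: ugrad_def)

text \<open>A relation between the gradients with respect to \<open>U\<close> extends to a relation between all
  logarithmic gradients, since \<open>theta (code v)\<close> multiplies the unit \<open>lvar (code v)\<close> by one and
  annihilates the other variables.\<close>

lemma alg_indep_ugrad:
  fixes f :: "'s \<Rightarrow> nat dvar lau"
  assumes fin: "finite A" "finite S" and disj: "A \<inter> S = {}" and ind: "alg_indep f (A \<union> S)"
    and S: "\<And>v. v \<in> S \<Longrightarrow> f v = lvar (code v)" "inj_on code S" "code ` S \<inter> U = {}"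
    and A: "\<And>s. s \<in> A \<Longrightarrow> pvars (f s) \<subseteq> U \<union> code ` S"
  shows "lin_indep (\<lambda>s. ugrad U (f s)) A"
  unfolding lin_indep_def
proof (intro allI impI)
  fix c assume c: "\<forall>t. (\<Sum>s\<in>A. c s * ugrad U (f s) t) = 0"
  \<comment> \<open>The entries on \<open>S\<close> are chosen to cancel the components at the coded
    variables, which are units and can be divided by.\<close>
  define b where "b v = (if v \<in> A then c v else
    - (lmon (- single (code v) 1) * (\<Sum>s\<in>A. c s * theta (code v) (f s))))" for v
  have A_sum: "(\<Sum>v\<in>A. b v * theta w (f v)) = (\<Sum>s\<in>A. c s * theta w (f s))" for w
    by (intro sum.cong) (auto simp: b_def)
  have "(\<Sum>v\<in>A \<union> S. b v * theta w (f v)) = 0" for w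
  proof -
    have split: "(\<Sum>v\<in>A \<union> S. b v * theta w (f v)) = (\<Sum>s\<in>A. c s * theta w (f s)) + (\<Sum>v\<in>S. b v * theta w (f v))"
      using fin disj by (simp add: sum.union_disjoint A_sum)
    have S_sum: "(\<Sum>v\<in>S. b v * theta w (f v)) = (\<Sum>v\<in>S. if code v = w then b v * lvar w else 0)"
      by (intro sum.cong) (auto simp: S theta_lvar)
    show ?thesis
    proof (cases "w \<in> code ` S")
      case True
      then obtain v where v: "v \<in> S" "w = code v" by blast
      have "(\<Sum>v\<in>S. if code v = w then b v * lvar w else 0) = (\<Sum>v'\<in>S. if v' = v then b v * lvar w else 0)"
        using S(2) v by (intro sum.cong) (auto simp: inj_on_def)
      also have "\<dots> = b v * lvar w" using fin v by simp
      also have "\<dots> = - ((lmon (- single w 1) * lvar w) * (\<Sum>s\<in>A. c s * theta w (f s)))"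
        using v disj by (auto simp: b_def)
      also have "lmon (- single w 1) * lvar w = 1" by (simp add: lvar_def mult_single)
      finally show ?thesis unfolding split S_sum by simp
    next
      case False
      then have "(\<Sum>v\<in>S. if code v = w then b v * lvar w else 0) = 0" by (intro sum.neutral) auto
      moreover have "(\<Sum>s\<in>A. c s * theta w (f s)) = 0"
      proof (cases "w \<in> U")
        case True
        then show ?thesis using c[rule_format, of w] by (simp add: ugrad_def)
      next
        case wU: False
        have "theta w (f s) = 0" if "s \<in> A" for s
          by (rule theta_eq_0) (use wU False A[OF that] in blast)
        then show ?thesis by simp
      qed
      ultimately show ?thesis unfolding split S_sum by simp
    qed
  qed
  then have "\<forall>v\<in>A \<union> S. b v = 0"
    using alg_indep_gradients[OF _ ind] fin unfolding lin_indep_def by blast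
  then show "\<forall>s\<in>A. c s = 0" unfolding b_def by (auto dest: bspec)
qed

lemma alg_indep_lvar:
  assumes "inj code" "psubst lconst (\<lambda>v. lvar (code v)) f = 0"
  shows "f = 0"
proof -
  have "(lconst f :: nat \<Rightarrow>\<^sub>0 _) = 0"
  proof (rule flatten_eq_0[where \<nu> = "\<lambda>_. 0" and code = code and X = UNIV])
    show "inj_on (\<lambda>_. 0) (keys (lconst f :: nat \<Rightarrow>\<^sub>0 _))" by (auto simp: lconst_def inj_on_def)
    show "lookup (lconst f :: nat \<Rightarrow>\<^sub>0 _) m \<in> polys_in UNIV" for m by (simp add: polys_in_def)
    show "lext (psubst lconst (\<lambda>v. lvar (code v))) (\<lambda>m. lmon 0) (lconst f :: nat \<Rightarrow>\<^sub>0 _) = 0"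
      by (subst lext_lconst[OF ring_hom_on_psubst[OF ring_hom_on_lconst]])
         (simp_all add: assms mult_single)
  qed (use assms in auto)
  then show ?thesis by (simp flip: lconst_0)
qed

lemma pdiff_not_multiple:
  assumes "v \<in> pvars R"
  shows "pdiff v R \<noteq> R * c"
proof
  assume eq: "pdiff v R = R * c"
  have nz: "pdiff v R \<noteq> 0" using assms by (rule pdiff_nonzero)
  then have "R \<noteq> 0" "c \<noteq> 0" using eq by auto
  then have "degree (uni v (pdiff v R)) = degree (uni v R) + degree (uni v c)"
    unfolding eq by (rule degree_uni_mult)
  then show False using degree_uni_pdiff[OF assms] by simp
qed

section \<open>Partial specialization of the generic coefficients\<close>

context generic_algebraic_system
begin

lemma finite_idx:
  assumes "admissible P \<tau>"
  shows "finite (idx \<tau>)"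
proof -
  have "finite {k. ereal (real k) \<le> \<tau> i}" if "i \<in> {1..size_of P}" for i
  proof -
    have "\<tau> i = -\<infinity> \<or> (\<exists>k::nat. \<tau> i = ereal (real k))" using assms that by (auto simp: admissible_def)
    then show ?thesis
    proof
      assume "\<exists>k::nat. \<tau> i = ereal (real k)"
      then obtain k where "\<tau> i = ereal (real k)" by blast
      then have "{k. ereal (real k) \<le> \<tau> i} = {..k}" by auto
      then show ?thesis by simp
    qed simp
  qed
  then have "finite (SIGMA i:{1..size_of P}. {k. ereal (real k) \<le> \<tau> i})" by (intro finite_SigmaI) auto
  moreover have "idx \<tau> = (SIGMA i:{1..size_of P}. {k. ereal (real k) \<le> \<tau> i})" by (auto simp: idx_def)
  ultimately show ?thesis by simp
qed

lemma ix_row: "(i, k) \<in> ix \<Longrightarrow> k' \<le> k \<Longrightarrow> (i, k') \<in> ix"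
  unfolding ix_def by (auto intro: order_trans[of "ereal (real k')" "ereal (real k)"])

lemma phi_coef_T: "s \<in> ix \<Longrightarrow> phi P (lookup (dF s) (upsmon ups (T (hh s)))) = phiv P (Der (Coef (fst s) 0) (snd s))"
  using coef_T[of s] by (simp add: phi_pvar del: phiv.simps)

lemma dF_in_DU: "s \<in> ix \<Longrightarrow> dF s \<in> DU P"
  unfolding dF_def ix_def using dd_FF_in_DU[OF gen] by auto

lemma coef_at_rho: "s \<in> ix \<Longrightarrow> coef_at ups (rho P lam (hh s)) \<alpha> = lookup (dF s) (upsmon ups \<alpha>)"
  by (simp add: coef_at_def rho_hh)

text \<open>\<open>mixed X\<close> specializes the generic coefficients of the polynomials with indices in \<open>X\<close> to
  those of the differential system, and keeps the others generic.\<close>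

definition mixed :: "(nat \<times> nat) set \<Rightarrow> 'y cvar \<Rightarrow> nat dvar lau" where
  "mixed X c = (if fst c \<in> hh ` X then phi P (Xi0 (pvar c)) else epsv c)"

lemma mixed_X: "s \<in> X \<Longrightarrow> s \<in> ix \<Longrightarrow> mixed X (hh s, \<alpha>) = phi P (lookup (dF s) (upsmon ups \<alpha>))"
  by (auto simp: mixed_def Xi0_pvar coef_at_rho)

lemma mixed_not_X: "X \<subseteq> ix \<Longrightarrow> s \<in> ix \<Longrightarrow> s \<notin> X \<Longrightarrow> mixed X (hh s, \<alpha>) = epsv (hh s, \<alpha>)"
  using hh_inj by (fastforce simp: mixed_def simp del: epsv.simps)

text \<open>As \<open>Phi\<close> kills the derivatives of the system, one can solve for the term of
  the distinguished monomial. The result has the shape of the formula for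
  \<open>\<epsilon>\<^sub>h\<close>.\<close>

lemma phi_coef_T_expand:
  assumes s: "s \<in> ix"
  shows "phiv P (Der (Coef (fst s) 0) (snd s)) =
    - (\<Sum>m\<in>keys (dF s) - {mon P (fst s) 0}. phi P (lookup (dF s) m) * lmon (m - mon P (fst s) 0))"
proof -
  let ?m0 = "mon P (fst s) 0"
  have m0: "?m0 \<in> keys (dF s)" using AA_iff[OF s] T_AA[OF s] upsmon_T[OF s] by simp
  have "Phi P (dF s) = (\<Sum>m\<in>keys (dF s). phi P (lookup (dF s) m) * lmon m)"
    by (simp add: Phi_def lext_def)
  then have "0 = lmon (- ?m0) * (\<Sum>m\<in>keys (dF s). phi P (lookup (dF s) m) * lmon m)"
    by (simp add: dF_def Phi_dd_FF)
  also have "\<dots> = (\<Sum>m\<in>keys (dF s). phi P (lookup (dF s) m) * (lmon (- ?m0) * lmon m))"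
    by (simp add: sum_distrib_left mult_ac)
  also have "\<dots> = (\<Sum>m\<in>keys (dF s). phi P (lookup (dF s) m) * lmon (m - ?m0))"
    by (simp add: mult_single)
  also have "\<dots> = phi P (lookup (dF s) ?m0) * lmon (?m0 - ?m0)
      + (\<Sum>m\<in>keys (dF s) - {?m0}. phi P (lookup (dF s) m) * lmon (m - ?m0))"
    using m0 by (subst sum.remove[OF finite_keys m0]) simp
  also have "phi P (lookup (dF s) ?m0) * lmon (?m0 - ?m0) = phiv P (Der (Coef (fst s) 0) (snd s))"
    using phi_coef_T[OF s] upsmon_T[OF s] by (simp del: phiv.simps)
  finally show ?thesis by (simp only: eq_neg_iff_add_eq_0)
qed

text \<open>Specialized and generic values obey one and the same equation: the former by
  \<open>phi_coef_T_expand\<close>, the latter by the definition of \<open>geps\<close>.\<close>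

lemma mixed_T:
  assumes X: "X \<subseteq> ix" and s: "s \<in> ix"
  shows "mixed X (hh s, T (hh s)) =
    - (\<Sum>\<alpha>\<in>AA P lam ups (hh s) - {T (hh s)}. mixed X (hh s, \<alpha>) * lmon (upsmon ups (\<alpha> - T (hh s))))"
proof (cases "s \<in> X")
  case True
  have inj: "inj_on (upsmon ups) A" for A using upsmon_inj[OF inj_ups] by (rule inj_on_subset) simp
  have "keys (dF s) - {mon P (fst s) 0} = upsmon ups ` (AA P lam ups (hh s) - {T (hh s)})"
    using upsmon_AA[OF s] inj_onD[OF upsmon_inj[OF inj_ups]] unfolding upsmon_T[OF s, symmetric] by auto
  then show ?thesis
    using phi_coef_T[OF s] phi_coef_T_expand[OF s]
    by (simp add: mixed_X[OF True s] sum.reindex[OF inj] upsmon_diff upsmon_T[OF s] del: phiv.simps)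
next
  case False
  then show ?thesis by (simp add: mixed_not_X[OF X s False] geps_def)
qed

text \<open>By \<open>mixed_T\<close> the substitution \<open>mixed X\<close> factors through
  \<open>at_eps\<close>.\<close>

lemma psubst_mixed_eq_0:
  assumes X: "X \<subseteq> ix" and adm: "admissible P \<tau>" and G: "G \<in> polys_in (C_sub P lam ups \<tau>)"
    and 0: "at_eps P lam ups T G = 0"
  shows "psubst lconst (mixed X) G = 0"
proof -
  define H where "H = lext (psubst lconst (mixed X)) (\<lambda>\<alpha>. lmon (upsmon ups \<alpha>))"
  have hyp: "lmon (upsmon ups 0) = 1" "lmon (upsmon ups (m + n)) = lmon (upsmon ups m) * lmon (upsmon ups n)" for m n
    by (simp_all add: upsmon_0 upsmon_add mult_single)
  note L = ring_hom_on_psubst[OF ring_hom_on_lconst, of "mixed X"]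
  have H: "ring_hom_on H" unfolding H_def by (rule ring_hom_on_lext[OF L hyp])
  have H_single: "H (single \<alpha> g) = psubst lconst (mixed X) g * lmon (upsmon ups \<alpha>)" for \<alpha> g
    unfolding H_def by (rule lext_single[OF L hyp])
  have H_lconst: "H (lconst g) = psubst lconst (mixed X) g" for g
    unfolding H_def by (rule lext_lconst[OF L hyp])
  have "0 = H (at_eps P lam ups T G)" using 0 by (simp add: rh_zero[OF H])
  also have "\<dots> = psubst lconst (\<lambda>v. H (case v of (h, \<alpha>) \<Rightarrow> if \<alpha> = T h then eps P lam ups T h else lconst (pvar (h, \<alpha>)))) G"
    unfolding at_eps_def hom_psubst_comp[OF H ring_hom_on_lconst2]
    by (simp add: H_lconst psubst_lconst[OF ring_hom_on_lconst])
  also have "\<dots> = psubst lconst (mixed X) G"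
  proof (rule psubst_cong)
    fix v assume "v \<in> pvars G"
    then obtain s \<alpha> where s: "s \<in> idx \<tau>" and v: "v = (hh s, \<alpha>)"
      using G unfolding C_sub_eq polys_in_def by blast
    have "s \<in> ix" using s idx_ix[OF adm] by blast
    then have "H (eps P lam ups T (hh s)) = mixed X (hh s, T (hh s))"
      by (simp add: mixed_T[OF X] eps_def rh_uminus[OF H] rh_sum[OF H] H_single psubst_pvar[OF ring_hom_on_lconst])
    then show "H (case v of (h, \<alpha>) \<Rightarrow> if \<alpha> = T h then eps P lam ups T h else lconst (pvar (h, \<alpha>))) = mixed X v"
      by (simp add: v H_lconst psubst_pvar[OF ring_hom_on_lconst])
  qed
  finally show ?thesis by simp
qed

lemma phi_Xi0:
  assumes G: "G \<in> polys_in (C_sub P lam ups \<tau>)" and X: "\<And>s \<alpha>. s \<in> idx \<tau> \<Longrightarrow> (hh s, \<alpha>) \<in> pvars G \<Longrightarrow> s \<in> X"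
  shows "phi P (Xi0 G) = psubst lconst (mixed X) G"
proof -
  have "phi P (Xi0 G) = psubst lconst (\<lambda>v. phi P (Xi0 (pvar v))) G"
    using hom_psubst[OF ring_hom_on_comp[OF ring_hom_on_Xi0 ring_hom_on_phi[of P]], of G]
    by (simp add: Xi0_def phi_def psubst_lconst[OF ring_hom_on_lconst])
  also have "\<dots> = psubst lconst (mixed X) G"
  proof (rule psubst_cong)
    fix v assume v: "v \<in> pvars G"
    then obtain s \<alpha> where s: "s \<in> idx \<tau>" "v = (hh s, \<alpha>)"
      using G unfolding C_sub_eq polys_in_def by blast
    then have "fst v \<in> hh ` X" using X[OF s(1)] v by auto
    then show "phi P (Xi0 (pvar v)) = mixed X v" by (simp add: mixed_def)
  qed
  finally show ?thesis .
qed

lemma pvars_Xi0: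
  assumes adm: "admissible P \<tau>" and G: "G \<in> polys_in (C_sub P lam ups \<tau>)" and w: "w \<in> pvars (Xi0 G)"
  shows "\<exists>s\<in>idx \<tau>. \<exists>\<alpha>. (hh s, \<alpha>) \<in> pvars G \<and> w \<in> pvars (lookup (dF s) (upsmon ups \<alpha>))"
proof -
  let ?A = "\<Union>v\<in>pvars G. pvars (Xi0 (pvar v))"
  have "Xi0 G \<in> polys_in ?A"
    unfolding Xi0_def by (rule ss_psubst[OF subring_polys_in]) (auto simp: polys_in_def Xi0_def psubst_pvar[OF ring_hom_on_lconst])
  then obtain v where v: "v \<in> pvars G" "w \<in> pvars (Xi0 (pvar v))" using w by (auto simp: polys_in_def)
  then obtain s \<alpha> where s: "s \<in> idx \<tau>" "v = (hh s, \<alpha>)"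
    using G unfolding C_sub_eq polys_in_def by blast
  then have "s \<in> ix" using idx_ix[OF adm] by blast
  then show ?thesis using s v by (auto simp: Xi0_pvar coef_at_rho)
qed

lemma Xi0_in_DD:
  assumes "admissible P \<tau>" "G \<in> polys_in (C_sub P lam ups \<tau>)"
  shows "Xi0 G \<in> DD P"
proof -
  have "\<exists>i l s. w = Der (Coef i l) s \<and> i \<in> {1..size_of P} \<and> l \<le> len P i" if "w \<in> pvars (Xi0 G)" for w
  proof -
    obtain s \<alpha> where "s \<in> idx \<tau>" "w \<in> pvars (lookup (dF s) (upsmon ups \<alpha>))"
      using pvars_Xi0[OF assms \<open>w \<in> pvars (Xi0 G)\<close>] by blast
    moreover have "lookup (dF s) (upsmon ups \<alpha>) \<in> DD P"
      using dF_in_DU[of s] idx_ix[OF assms(1)] \<open>s \<in> idx \<tau>\<close> by (auto simp: DU_iff)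
    ultimately show ?thesis by (auto simp: DD_iff)
  qed
  then show ?thesis by (simp add: DD_iff)
qed

lemma Xi0_low:
  assumes adm: "admissible P \<tau>" and G: "G \<in> polys_in (C_sub P lam ups \<tau>)"
    and "\<And>k \<alpha>. (i, k) \<in> idx \<tau> \<Longrightarrow> (hh (i, k), \<alpha>) \<in> pvars G \<Longrightarrow> k \<le> e"
  shows "Xi0 G \<in> polys_in (low (Coef i l) e)"
  unfolding polys_in_def low_def
proof (intro CollectI subsetI allI impI)
  fix w k assume "w \<in> pvars (Xi0 G)" and w: "w = Der (Coef i l) k"
  then obtain s \<alpha> where s: "s \<in> idx \<tau>" "(hh s, \<alpha>) \<in> pvars G" "w \<in> pvars (lookup (dF s) (upsmon ups \<alpha>))"
    using pvars_Xi0[OF adm G] by blast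
  then have "fst s = i" "k \<le> snd s"
    using pvars_lookup_dd_FF[of "snd s" P "fst s" "upsmon ups \<alpha>"] w by (auto simp: dF_def)
  moreover have "snd s \<le> e" using assms(3)[of "snd s" \<alpha>] s \<open>fst s = i\<close> by (cases s) auto
  ultimately show "k \<le> e" by simp
qed

end

lemma pvars_theta: "pvars (theta w f) \<subseteq> pvars f"
proof -
  have "theta w f \<in> {g. pvars g \<subseteq> pvars f}"
    unfolding theta_def
    by (intro ss_sum[OF subring_pvars]) (auto simp: pvars_single pvars_def)
  then show ?thesis by simp
qed

lemma lin_indep_reindex:
  assumes "inj_on r A" "lin_indep v (r ` A)"
  shows "lin_indep (\<lambda>s. v (r s)) A"
  unfolding lin_indep_def
proof (intro allI impI)
  fix c assume c: "\<forall>t. (\<Sum>s\<in>A. c s * v (r s) t) = 0"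
  have "(\<Sum>x\<in>r ` A. c (the_inv_into A r x) * v x t) = (\<Sum>s\<in>A. c s * v (r s) t)" for t
    using assms(1) by (simp add: sum.reindex the_inv_into_f_f)
  then have "\<forall>x\<in>r ` A. c (the_inv_into A r x) = 0"
    using assms(2)[unfolded lin_indep_def, rule_format, of "\<lambda>x. c (the_inv_into A r x)"] c by simp
  then show "\<forall>s\<in>A. c s = 0" using assms(1) by (simp add: the_inv_into_f_f)
qed

section \<open>Gradients of the specialized and of the generic values\<close>

context generic_algebraic_system
begin

abbreviation U :: "nat dvar set" where "U \<equiv> unknowns P"

definition grad_zeta :: "nat \<times> nat \<Rightarrow> nat dvar \<Rightarrow> nat dvar lau" where
  "grad_zeta s = ugrad U (phiv P (Der (Coef (fst s) 0) (snd s)))"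

definition grad_eps :: "nat \<times> nat \<Rightarrow> nat dvar \<Rightarrow> nat dvar lau" where
  "grad_eps s = ugrad U (geps (hh s))"

text \<open>Exponent vector of \<open>m\<close> relative to the distinguished monomial, its integer
  entries taken as constants of the flat ring.\<close>

definition expo :: "nat \<Rightarrow> umon \<Rightarrow> nat dvar \<Rightarrow> nat dvar lau" where
  "expo i m u = lconst (of_int (lookup (m - mon P i 0) u))"

lemma fst_ix: "(i, k) \<in> ix \<Longrightarrow> i \<in> {1..size_of P}"
  by (simp add: ix_def)

lemma keys_dF_diff: "s \<in> ix \<Longrightarrow> m \<in> keys (dF s) \<Longrightarrow> keys (m - mon P (fst s) 0) \<subseteq> U"
proof -
  assume s: "s \<in> ix" and m: "m \<in> keys (dF s)"
  have "keys m \<subseteq> U" "keys (mon P (fst s) 0) \<subseteq> U"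
    using keys_in_unknowns[OF dF_in_DU[OF s] m] keys_mon[OF gen, of "fst s" 0] s by (auto simp: ix_def)
  then show ?thesis using keys_diff[of m "mon P (fst s) 0"] by blast
qed

lemma expo_T: "expo i (mon P i 0) = (\<lambda>_. 0)"
  by (simp add: expo_def fun_eq_iff lconst_0)

lemma ugrad_phiv: "l \<noteq> 0 \<Longrightarrow> ugrad U (phiv P (Der (Coef i l) k)) = (\<lambda>_. 0)"
  using jcode_not_unknown[OF gen] by (simp add: ugrad_lvar fun_eq_iff del: jcode.simps)

lemma ugrad_phi_coef:
  assumes "\<And>k'. Der (Coef i 0) k' \<in> pvars (lookup (dF (i, k)) m) \<Longrightarrow> k' \<le> k \<Longrightarrow> grad_zeta (i, k') \<in> qspan v I"
  shows "ugrad U (phi P (lookup (dF (i, k)) m)) \<in> qspan v I"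
proof -
  let ?c = "lookup (dF (i, k)) m"
  have "ugrad U (phi P ?c) = (\<lambda>u. \<Sum>x\<in>pvars ?c. phi P (pdiff x ?c) * ugrad U (phiv P x) u)"
    unfolding phi_def by (rule ext, rule ugrad_psubst) auto
  also have "\<dots> \<in> qspan v I"
  proof (rule qspan_lin_comb)
    fix x assume x: "x \<in> pvars ?c"
    then obtain l k' where x': "x = Der (Coef i l) k'" "k' \<le> k"
      using pvars_lookup_dd_FF[of k P i m] by (auto simp: dF_def)
    show "ugrad U (phiv P x) \<in> qspan v I"
    proof (cases "l = 0")
      case True
      then show ?thesis using assms[of k'] x x' by (simp add: grad_zeta_def del: phiv.simps)
    next
      case False
      then show ?thesis using ugrad_phiv[OF False] qspan_zero by (simp add: x' del: phiv.simps)
    qed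
  qed
  finally show ?thesis .
qed

text \<open>Differentiate \<open>phi_coef_T_expand\<close>: the monomials contribute exponent
  vectors, the coefficients contribute gradients of lower order in the same row. The induction
  applies to these because supports grow with the order.\<close>

lemma grad_zeta_in_span:
  assumes "(i, k) \<in> ix" "\<And>m. m \<in> keys (dF (i, k)) \<Longrightarrow> expo i m \<in> qspan v I"
  shows "grad_zeta (i, k) \<in> qspan v I"
  using assms
proof (induction k rule: less_induct)
  case (less k)
  let ?m0 = "mon P i 0"
  let ?A = "keys (dF (i, k)) - {?m0}"
  have IH: "grad_zeta (i, k') \<in> qspan v I" if "k' < k" for k'
  proof (rule less.IH[OF that])
    show "(i, k') \<in> ix" using ix_row[OF less.prems(1)] that by simp
    fix m assume "m \<in> keys (dF (i, k'))"
    then show "expo i m \<in> qspan v I"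
      using keys_dd_FF_mono[of k' k P i] that by (intro less.prems(2)) (auto simp: dF_def)
  qed
  have "grad_zeta (i, k) = (\<lambda>u. \<Sum>m\<in>?A. - lmon (m - ?m0) * ugrad U (phi P (lookup (dF (i, k)) m)) u
      + - (phi P (lookup (dF (i, k)) m) * lmon (m - ?m0)) * expo i m u)"
  proof
    fix u
    have "grad_zeta (i, k) u = - (\<Sum>m\<in>?A. ugrad U (phi P (lookup (dF (i, k)) m) * lmon (m - ?m0)) u)"
      unfolding grad_zeta_def phi_coef_T_expand[OF less.prems(1)] by (simp add: ugrad_uminus ugrad_sum)
    also have "\<dots> = (\<Sum>m\<in>?A. - lmon (m - ?m0) * ugrad U (phi P (lookup (dF (i, k)) m)) u
      + - (phi P (lookup (dF (i, k)) m) * lmon (m - ?m0)) * expo i m u)"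
      unfolding sum_negf[symmetric]
    proof (rule sum.cong[OF refl])
      fix m assume "m \<in> ?A"
      then have "keys (m - ?m0) \<subseteq> U" using keys_dF_diff[OF less.prems(1), of m] by simp
      then show "- ugrad U (phi P (lookup (dF (i, k)) m) * lmon (m - ?m0)) u
        = - lmon (m - ?m0) * ugrad U (phi P (lookup (dF (i, k)) m)) u
          + - (phi P (lookup (dF (i, k)) m) * lmon (m - ?m0)) * expo i m u"
        unfolding ugrad_mult by (simp add: ugrad_lmon expo_def algebra_simps)
    qed
    finally show "grad_zeta (i, k) u = \<dots>" .
  qed
  also have "\<dots> \<in> qspan v I"
  proof (intro qspan_sum qspan_add qspan_scale)
    fix m assume m: "m \<in> ?A"
    then show "expo i m \<in> qspan v I" using less.prems(2) by blast
    show "ugrad U (phi P (lookup (dF (i, k)) m)) \<in> qspan v I"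
    proof (rule ugrad_phi_coef)
      fix k' assume k': "Der (Coef i 0) k' \<in> pvars (lookup (dF (i, k)) m)" "k' \<le> k"
      \<comment> \<open>The derivative of order \<open>k\<close> itself occurs only at the
        distinguished monomial, which is excluded.\<close>
      then have "k' \<noteq> k" using coefficient_lower_jets[of m P i k] m by (auto simp: dF_def)
      then show "grad_zeta (i, k') \<in> qspan v I" using IH k' by simp
    qed
  qed
  finally show ?case .
qed

lemma grad_eps_expand:
  assumes s: "s \<in> ix"
  shows "grad_eps s u = (\<Sum>\<alpha>\<in>AA P lam ups (hh s) - {T (hh s)}.
    - (lvar (gcode P (hh s, \<alpha>)) * lmon (upsmon ups (\<alpha> - T (hh s)))) * expo (fst s) (upsmon ups \<alpha>) u)"
proof -
  have "grad_eps s u = (\<Sum>\<alpha>\<in>AA P lam ups (hh s) - {T (hh s)}.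
      - ugrad U (lvar (gcode P (hh s, \<alpha>)) * lmon (upsmon ups (\<alpha> - T (hh s)))) u)"
    unfolding grad_eps_def geps_def by (simp add: ugrad_uminus ugrad_sum sum_negf)
  also have "\<dots> = (\<Sum>\<alpha>\<in>AA P lam ups (hh s) - {T (hh s)}.
    - (lvar (gcode P (hh s, \<alpha>)) * lmon (upsmon ups (\<alpha> - T (hh s)))) * expo (fst s) (upsmon ups \<alpha>) u)"
  proof (rule sum.cong[OF refl])
    fix \<alpha> assume "\<alpha> \<in> AA P lam ups (hh s) - {T (hh s)}"
    have "ugrad U (lmon (upsmon ups (\<alpha> - T (hh s)))) u
        = expo (fst s) (upsmon ups \<alpha>) u * lmon (upsmon ups (\<alpha> - T (hh s)))"
      using ugrad_lmon[OF keys_upsmon_unknowns, of "\<alpha> - T (hh s)" u]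
      by (simp add: expo_def upsmon_diff upsmon_T[OF s])
    then show "- ugrad U (lvar (gcode P (hh s, \<alpha>)) * lmon (upsmon ups (\<alpha> - T (hh s)))) u
      = - (lvar (gcode P (hh s, \<alpha>)) * lmon (upsmon ups (\<alpha> - T (hh s)))) * expo (fst s) (upsmon ups \<alpha>) u"
      unfolding ugrad_mult ugrad_lvar[OF gcode_not_unknown[OF gen]] by (simp add: mult_ac)
  qed
  finally show ?thesis .
qed

lemma grad_eps_in_span:
  assumes s: "s \<in> ix" and span: "\<And>m. m \<in> keys (dF s) \<Longrightarrow> expo (fst s) m \<in> qspan v I"
  shows "grad_eps s \<in> qspan v I"
proof -
  have "(\<lambda>u. \<Sum>\<alpha>\<in>AA P lam ups (hh s) - {T (hh s)}.
    - (lvar (gcode P (hh s, \<alpha>)) * lmon (upsmon ups (\<alpha> - T (hh s)))) * expo (fst s) (upsmon ups \<alpha>) u) \<in> qspan v I"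
    by (rule qspan_lin_comb) (use AA_iff[OF s] span in auto)
  moreover have "(\<lambda>u. grad_eps s u) = grad_eps s" by simp
  ultimately show ?thesis unfolding grad_eps_expand[OF s, symmetric] by simp
qed

text \<open>Differentiation with respect to a generic coefficient isolates an exponent vector.\<close>

lemma theta_grad_eps:
  assumes s: "s \<in> ix" "s' \<in> ix" and \<alpha>: "\<alpha> \<in> AA P lam ups (hh s)" "\<alpha> \<noteq> T (hh s)"
  shows "theta (gcode P (hh s, \<alpha>)) (grad_eps s' u) = (if s' = s then
    - (lvar (gcode P (hh s, \<alpha>)) * lmon (upsmon ups (\<alpha> - T (hh s)))) * expo (fst s) (upsmon ups \<alpha>) u else 0)"
proof -
  let ?w = "gcode P (hh s, \<alpha>)"
  have lm: "theta ?w (lmon (upsmon ups \<beta>)) = 0" for \<beta>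
  proof (rule theta_eq_0)
    show "?w \<notin> pvars (lmon (upsmon ups \<beta>))"
      using gcode_not_unknown[OF gen, of "(hh s, \<alpha>)"] keys_upsmon_unknowns[of \<beta>] by (auto simp: pvars_single)
  qed
  have theta_expo: "theta ?w (expo i m u) = 0" for i m by (simp add: expo_def)
  have lv: "theta ?w (lvar (gcode P (hh s', \<beta>))) = (if s' = s \<and> \<beta> = \<alpha> then lvar ?w else 0)" for \<beta>
    using hh_inj[OF s] by (auto simp: theta_lvar dest: injD[OF inj_gcode])
  have "theta ?w (grad_eps s' u) = (\<Sum>\<beta>\<in>AA P lam ups (hh s') - {T (hh s')}. if s' = s \<and> \<beta> = \<alpha> then
      - (lvar ?w * lmon (upsmon ups (\<alpha> - T (hh s)))) * expo (fst s) (upsmon ups \<alpha>) u else 0)"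
    unfolding grad_eps_expand[OF s(2)] deriv_sum[OF derivation_theta]
    by (intro sum.cong refl) (auto simp: deriv_uminus[OF derivation_theta] theta_mult lm lv theta_expo)
  also have "\<dots> = (if s' = s then
    - (lvar ?w * lmon (upsmon ups (\<alpha> - T (hh s)))) * expo (fst s) (upsmon ups \<alpha>) u else 0)"
    using \<alpha> finite_AA[OF s(1)] by (cases "s' = s") (simp_all add: sum.delta)
  finally show ?thesis .
qed

lemma pvars_phiv_distinguished:
  assumes i: "i \<in> {1..size_of P}"
  shows "pvars (phiv P (Der (Coef i 0) k)) \<subseteq> U \<union> {jcode P (Der (Coef i l) k') | l k'. l \<in> {1..len P i} \<and> k' \<le> k}"
proof (induction k)
  case 0
  let ?B = "U \<union> {jcode P (Der (Coef i l) k') | l k'. l \<in> {1..len P i} \<and> k' \<le> 0}"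
  have "zeta P i \<in> {f. pvars f \<subseteq> ?B}"
    unfolding zeta_def
  proof (intro ss_uminus[OF subring_pvars] ss_sum[OF subring_pvars] ss_mult[OF subring_pvars])
    fix l assume l: "l \<in> {1..len P i}"
    show "lvar (jcode P (Der (Coef i l) 0)) \<in> {f. pvars f \<subseteq> ?B}"
      using l unfolding mem_Collect_eq pvars_lvar by blast
    have "keys (mon P i l - mon P i 0) \<subseteq> U"
      using keys_mon[OF gen i, of l] keys_mon[OF gen i, of 0] l keys_diff[of "mon P i l" "mon P i 0"] by auto
    then show "lmon (mon P i l - mon P i 0) \<in> {f. pvars f \<subseteq> ?B}" by (simp add: pvars_single le_supI1)
  qed
  then show ?case by simp
next
  case (Suc k)
  let ?J = "\<lambda>k. {jcode P (Der (Coef i l) k') | l k'. l \<in> {1..len P i} \<and> k' \<le> k}"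
  have "dshift v \<in> U \<union> ?J (Suc k)" if "v \<in> U \<union> ?J k" for v
    using that
  proof
    assume "v \<in> ?J k"
    then obtain l k' where "v = jcode P (Der (Coef i l) k')" "l \<in> {1..len P i}" "k' \<le> k" by blast
    then have "dshift v = jcode P (Der (Coef i l) (Suc k')) \<and> l \<in> {1..len P i} \<and> Suc k' \<le> Suc k" by simp
    then show ?thesis by blast
  qed (use dshift_unknowns in blast)
  then have shift: "dshift ` pvars (phiv P (Der (Coef i 0) k)) \<subseteq> U \<union> ?J (Suc k)"
    using Suc.IH by (meson image_subsetI subsetD)
  have "?J k \<subseteq> ?J (Suc k)"
    using le_SucI by blast
  then have "pvars (phiv P (Der (Coef i 0) k)) \<subseteq> U \<union> ?J (Suc k)"
    using Suc.IH by (meson Un_mono order_refl order_trans)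
  then have "pvars (phiv P (Der (Coef i 0) k)) \<union> dshift ` pvars (phiv P (Der (Coef i 0) k)) \<subseteq> U \<union> ?J (Suc k)"
    using shift by (rule Un_least)
  moreover have "pvars (phiv P (Der (Coef i 0) (Suc k))) \<subseteq>
      pvars (phiv P (Der (Coef i 0) k)) \<union> dshift ` pvars (phiv P (Der (Coef i 0) k))"
    using pvars_lderive[of "\<lambda>_. 0" "phiv P (Der (Coef i 0) k)"] by simp
  ultimately show ?case by (rule order_trans[rotated])
qed

lemma pvars_geps: "pvars (geps h) \<subseteq> U \<union> gcode P ` {(h, \<alpha>) | \<alpha>. \<alpha> \<in> AA P lam ups h - {T h}}"
proof -
  have "geps h \<in> {f. pvars f \<subseteq> U \<union> gcode P ` {(h, \<alpha>) | \<alpha>. \<alpha> \<in> AA P lam ups h - {T h}}}"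
    unfolding geps_def using keys_upsmon_unknowns
    by (intro ss_uminus[OF subring_pvars] ss_sum[OF subring_pvars] ss_mult[OF subring_pvars])
       (auto simp: pvars_single)
  then show ?thesis by simp
qed

lemma theta_grad_zeta: "s \<in> ix \<Longrightarrow> theta (gcode P c) (grad_zeta s u) = 0"
proof (rule theta_eq_0)
  assume s: "s \<in> ix"
  have "pvars (grad_zeta s u) \<subseteq> pvars (phiv P (Der (Coef (fst s) 0) (snd s)))"
    using pvars_theta[of u "phiv P (Der (Coef (fst s) 0) (snd s))"] unfolding grad_zeta_def ugrad_def by (simp del: phiv.simps)
  moreover have "gcode P c \<notin> U" "gcode P c \<noteq> jcode P v" for v
    using gcode_not_unknown[OF gen] gcode_ne_jcode by blast+
  moreover have "fst s \<in> {1..size_of P}" using s by (auto simp: ix_def)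
  ultimately show "gcode P c \<notin> pvars (grad_zeta s u)"
    using pvars_phiv_distinguished[of "fst s" "snd s"] by blast
qed

text \<open>The absence of relations makes the distinguished values, together with the other
  coefficients as plain variables, algebraically independent; \<open>alg_indep_ugrad\<close> strips
  off the latter.\<close>

lemma lin_indep_grad_eps:
  assumes fin: "finite S0" and S0: "S0 \<subseteq> ix"
    and zero: "\<And>G. pvars G \<subseteq> {(hh s, \<alpha>) | s \<alpha>. s \<in> S0 \<and> \<alpha> \<in> AA P lam ups (hh s)} \<Longrightarrow>
      psubst lconst epsv G = 0 \<Longrightarrow> G = 0"
  shows "lin_indep grad_eps S0"
proof -
  define r where "r s = (hh s, T (hh s))" for s
  define S where "S = (\<Union>s\<in>S0. (\<lambda>\<alpha>. (hh s, \<alpha>)) ` (AA P lam ups (hh s) - {T (hh s)}))"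
  have inj: "inj_on r S0" proof (rule inj_onI)
    fix x y assume "x \<in> S0" "y \<in> S0" "r x = r y"
    then show "x = y" using hh_inj[of x y] S0 by (auto simp: r_def)
  qed
  have "lin_indep (\<lambda>v. ugrad U (epsv v)) (r ` S0)"
  proof (rule alg_indep_ugrad[where S = S and code = "gcode P"])
    show "finite S" unfolding S_def using fin S0 finite_AA by (intro finite_UN_I finite_imageI finite_Diff) auto
    show "r ` S0 \<inter> S = {}" by (auto simp: r_def S_def)
    have "r ` S0 \<union> S \<subseteq> {(hh s, \<alpha>) | s \<alpha>. s \<in> S0 \<and> \<alpha> \<in> AA P lam ups (hh s)}"
      using T_AA S0 unfolding r_def S_def by blast
    then show "alg_indep epsv (r ` S0 \<union> S)"
      unfolding alg_indep_def using zero by (meson order_trans)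
    show "epsv v = lvar (gcode P v)" if "v \<in> S" for v using that by (auto simp: S_def split: if_splits)
    show "inj_on (gcode P) S" using inj_gcode by (rule inj_on_subset) simp
    show "gcode P ` S \<inter> U = {}" using gcode_not_unknown[OF gen] by blast
    show "pvars (epsv v) \<subseteq> U \<union> gcode P ` S" if "v \<in> r ` S0" for v
    proof -
      from that obtain s where s: "s \<in> S0" "v = (hh s, T (hh s))" by (auto simp: r_def)
      have "{(hh s, \<alpha>) | \<alpha>. \<alpha> \<in> AA P lam ups (hh s) - {T (hh s)}} \<subseteq> S" using s by (auto simp: S_def)
      then show ?thesis using pvars_geps[of "hh s"] by (simp add: s) blast
    qed
  qed (use fin in simp)
  then have "lin_indep (\<lambda>s. ugrad U (epsv (r s))) S0" by (rule lin_indep_reindex[OF inj])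
  then show ?thesis by (simp add: r_def grad_eps_def[abs_def])
qed

lemma lin_indep_grad_zeta:
  assumes fin: "finite S0" and S0: "S0 \<subseteq> ix"
    and zero: "\<And>G. pvars G \<subseteq> {Der (Coef i l) k' | i l k' k. (i, k) \<in> S0 \<and> l \<le> len P i \<and> k' \<le> k} \<Longrightarrow>
      phi P G = 0 \<Longrightarrow> G = 0"
  shows "lin_indep grad_zeta S0"
proof -
  define r where "r s = Der (Coef (fst s) 0) (snd s)" for s :: "nat \<times> nat"
  define S where "S = (\<Union>s\<in>S0. (\<lambda>(l, k'). Der (Coef (fst s) l) k') ` ({1..len P (fst s)} \<times> {..snd s}))"
  have inj: "inj_on r S0" by (auto simp: inj_on_def r_def)
  have "lin_indep (\<lambda>v. ugrad U (phiv P v)) (r ` S0)"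
  proof (rule alg_indep_ugrad[where S = S and code = "jcode P"])
    show "finite S" unfolding S_def using fin by (intro finite_UN_I finite_imageI) auto
    show "r ` S0 \<inter> S = {}" by (auto simp: r_def S_def)
    have "r ` S0 \<union> S \<subseteq> {Der (Coef i l) k' | i l k' k. (i, k) \<in> S0 \<and> l \<le> len P i \<and> k' \<le> k}"
      by (force simp: r_def S_def)
    then show "alg_indep (phiv P) (r ` S0 \<union> S)"
      unfolding alg_indep_def using zero unfolding phi_def by (meson order_trans)
    show "phiv P v = lvar (jcode P v)" if "v \<in> S" for v using that by (auto simp: S_def)
    show "inj_on (jcode P) S" using inj_jcode[OF gen] by (rule inj_on_subset) simp
    show "jcode P ` S \<inter> U = {}" using jcode_not_unknown[OF gen] by blast
    show "pvars (phiv P v) \<subseteq> U \<union> jcode P ` S" if "v \<in> r ` S0" for v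
    proof -
      from that obtain s where s: "s \<in> S0" "v = r s" by blast
      have "Der (Coef (fst s) l) k' \<in> S" if "l \<in> {1..len P (fst s)}" "k' \<le> snd s" for l k'
        unfolding S_def using that by (intro UN_I[OF s(1)] image_eqI[of _ _ "(l, k')"]) auto
      then have "{jcode P (Der (Coef (fst s) l) k') | l k'. l \<in> {1..len P (fst s)} \<and> k' \<le> snd s} \<subseteq> jcode P ` S"
        by blast
      moreover have "fst s \<in> {1..size_of P}" using s S0 by (auto simp: ix_def)
      ultimately show ?thesis using pvars_phiv_distinguished[of "fst s" "snd s"] unfolding s r_def by blast
    qed
  qed (use fin in simp)
  then have "lin_indep (\<lambda>s. ugrad U (phiv P (r s))) S0" by (rule lin_indep_reindex[OF inj])
  then show ?thesis by (simp add: r_def grad_zeta_def[abs_def])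
qed

end

context generic_algebraic_system
begin

lemma theta_phi:
  assumes g: "g \<in> DD P"
  shows "theta (gcode P c) (phi P g) = 0"
proof (rule theta_eq_0)
  have v: "pvars (phiv P v) \<subseteq> U \<union> range (jcode P)" if "v \<in> pvars g" for v
  proof -
    from g that obtain i l s where "v = Der (Coef i l) s" "i \<in> {1..size_of P}" unfolding DD_iff by blast
    then show ?thesis
    proof (cases "l = 0")
      case True
      have "{jcode P (Der (Coef i l) k') | l k'. l \<in> {1..len P i} \<and> k' \<le> s} \<subseteq> range (jcode P)" by blast
      then show ?thesis
        using pvars_phiv_distinguished[of i s] \<open>i \<in> _\<close> unfolding \<open>v = _\<close> True by blast
    qed (simp del: jcode.simps)
  qed
  have "phi P g \<in> {f. pvars f \<subseteq> U \<union> range (jcode P)}"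
    unfolding phi_def by (rule ss_psubst[OF subring_pvars]) (use v in auto)
  then show "gcode P c \<notin> pvars (phi P g)"
    using gcode_not_unknown[OF gen, of c] gcode_ne_jcode[of P c] by auto
qed

section \<open>Comparison of the relations given by \<open>R\<close> and by \<open>Q\<close>\<close>

context
  fixes \<tau> :: "nat \<Rightarrow> ereal" and Q :: "'y cpoly" and R :: dpoly
  assumes adm: "admissible P \<tau>" and R: "sparse_diff_resultant P R"
    and Q: "Q \<in> polys_in (C_sub P lam ups \<tau>)" "Q \<noteq> 0" "at_eps P lam ups T Q = 0"
    and principal: "\<And>G. G \<in> elim_ideal_sub P lam ups \<tau> \<Longrightarrow> dvd_in (polys_in (C_sub P lam ups \<tau>)) Q G"
begin

definition blocks :: "nat set" where
  "blocks = {i. \<exists>l k. Der (Coef i l) k \<in> pvars R}"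

text \<open>The order \<open>h\<^sub>i\<close>; meaningful on \<open>blocks\<close>, where the set
  is finite and nonempty.\<close>

definition bord :: "nat \<Rightarrow> nat" where
  "bord i = Max {k. \<exists>l. Der (Coef i l) k \<in> pvars R}"

text \<open>All orders up to that of \<open>R\<close> are included, whether or not \<open>R\<close>
  involves them, so that the rows are closed downwards.\<close>

definition X :: "(nat \<times> nat) set" where
  "X = {(i, k). i \<in> blocks \<and> k \<le> bord i}"

lemma finite_orders: "finite {k. \<exists>l. Der (Coef i l) k \<in> pvars R}"
proof -
  have "{k. \<exists>l. Der (Coef i l) k \<in> pvars R} \<subseteq> (\<lambda>v. case v of Der x k \<Rightarrow> k) ` pvars R" by force
  then show ?thesis by (rule finite_subset) simp
qed

lemma bord_attained: "i \<in> blocks \<Longrightarrow> \<exists>l. Der (Coef i l) (bord i) \<in> pvars R"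
  using Max_in[OF finite_orders[of i]] unfolding bord_def blocks_def by blast

lemma jet_X: "Der (Coef i l) k \<in> pvars R \<Longrightarrow> (i, k) \<in> X"
  unfolding X_def blocks_def bord_def using Max_ge[OF finite_orders[of i], of k] by blast

lemma finite_X: "finite X"
proof -
  have "blocks \<subseteq> (\<lambda>v. case v of Der (Coef i l) k \<Rightarrow> i) ` pvars R" by (force simp: blocks_def)
  then have "finite blocks" by (rule finite_subset) simp
  then have "finite (SIGMA i:blocks. {..bord i})" by blast
  moreover have "X = (SIGMA i:blocks. {..bord i})" by (auto simp: X_def)
  ultimately show ?thesis by simp
qed

lemma resultant_low: "R \<in> polys_in (low (Coef i l) (bord i))"
  using jet_X[of i l] by (auto simp: polys_in_def low_def X_def)

lemma blocks_divisible:
  assumes i: "i \<in> blocks" and g: "g \<in> DD P" "phi P g = 0"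
    and low: "\<And>l. g \<in> polys_in (low (Coef i l) (bord i))"
  shows "dvd_in (DD P) R g"
proof -
  obtain l where l: "Der (Coef i l) (bord i) \<in> pvars R" using bord_attained[OF i] by blast
  show ?thesis by (rule low_order_divisible[OF gen R g l resultant_low low])
qed

text \<open>Otherwise \<open>phi\<close> would merely rename the variables of \<open>R\<close>, and
  the image of \<open>R\<close> could not vanish.\<close>

lemma distinguished_jet: "\<exists>i k. Der (Coef i 0) k \<in> pvars R"
proof (rule ccontr)
  assume no: "\<not> ?thesis"
  have "phi P R = psubst lconst (\<lambda>v. lvar (jcode P v)) R"
    unfolding phi_def
  proof (rule psubst_cong)
    fix v assume v: "v \<in> pvars R"
    obtain x k where "v = Der x k" by (cases v)
    moreover obtain i l where "x = Coef i l" by (cases x)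
    ultimately show "phiv P v = lvar (jcode P v)" using v no by (cases "l = 0") auto
  qed
  then have "psubst lconst (\<lambda>v. lvar (jcode P v)) R = 0" using phi_resultant[OF gen R] by simp
  then show False using alg_indep_lvar[OF inj_jcode[OF gen]] resultant_nonzero[OF gen R] by blast
qed

text \<open>A vanishing image would make the derivative, whose orders do not exceed those of
  \<open>R\<close>, a multiple of \<open>R\<close>.\<close>

lemma phi_separant:
  assumes v: "v \<in> pvars R"
  shows "phi P (pdiff v R) \<noteq> 0"
proof
  assume 0: "phi P (pdiff v R) = 0"
  obtain x k where "v = Der x k" by (cases v)
  moreover obtain i l where "x = Coef i l" by (cases x)
  ultimately have i: "i \<in> blocks" using v by (auto simp: blocks_def)
  have "dvd_in (DD P) R (pdiff v R)"
  proof (rule blocks_divisible[OF i _ 0])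
    show "pdiff v R \<in> DD P"
      using resultant_in_DD[OF gen R] unfolding DD_def diff_polys_def by (rule pdiff_polys_in)
    show "pdiff v R \<in> polys_in (low (Coef i l) (bord i))" for l
      using resultant_low by (rule pdiff_polys_in)
  qed
  then obtain c where "pdiff v R = R * c" unfolding dvd_in_def by blast
  then show False using pdiff_not_multiple[OF v] by blast
qed

text \<open>Differentiate the relation that \<open>R\<close> gives under \<open>phi\<close>. Only
  distinguished coefficients have gradients, and \<open>phi_separant\<close> supplies a nonzero
  factor.\<close>

lemma grad_zeta_dependent: "\<exists>s\<in>X. grad_zeta s \<in> qspan grad_zeta (X - {s})"
proof -
  obtain i0 k0 where v0: "Der (Coef i0 0) k0 \<in> pvars R" using distinguished_jet by blast
  define d where "d s = phi P (pdiff (Der (Coef (fst s) 0) (snd s)) R)" for s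
  define s0 where "s0 = (i0, k0)"
  have s0: "s0 \<in> X" "d s0 \<noteq> 0" using jet_X[OF v0] phi_separant[OF v0] by (auto simp: s0_def d_def)
  define r where "r s = Der (Coef (fst s) 0) (snd s)" for s :: "nat \<times> nat"
  have inj: "inj_on r X" by (auto simp: inj_on_def r_def)
  have sum: "(\<Sum>s\<in>X. d s * grad_zeta s u) = 0" for u
  proof -
    have "0 = ugrad U (psubst lconst (phiv P) R) u"
      using phi_resultant[OF gen R] by (simp add: phi_def ugrad_def)
    also have "\<dots> = (\<Sum>v\<in>pvars R \<union> r ` X. phi P (pdiff v R) * ugrad U (phiv P v) u)"
      unfolding phi_def using finite_X by (intro ugrad_psubst) auto
    also have "\<dots> = (\<Sum>v\<in>r ` X. phi P (pdiff v R) * ugrad U (phiv P v) u)"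
    proof (rule sum.mono_neutral_right)
      show "\<forall>v\<in>pvars R \<union> r ` X - r ` X. phi P (pdiff v R) * ugrad U (phiv P v) u = 0"
      proof
        fix v assume v: "v \<in> pvars R \<union> r ` X - r ` X"
        obtain x k where x: "v = Der x k" by (cases v)
        obtain i l where i: "x = Coef i l" by (cases x)
        have "(i, k) \<in> X" using v jet_X by (auto simp: x i)
        then have "r (i, k) \<noteq> v" using v by blast
        then have "l \<noteq> 0" by (auto simp: r_def x i)
        then show "phi P (pdiff v R) * ugrad U (phiv P v) u = 0" by (simp add: x i ugrad_phiv del: phiv.simps)
      qed
    qed (use finite_X in auto)
    also have "\<dots> = (\<Sum>s\<in>X. d s * grad_zeta s u)"
      unfolding sum.reindex[OF inj] o_def by (simp only: r_def d_def grad_zeta_def)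
    finally show ?thesis by simp
  qed
  have "grad_zeta s0 \<in> qspan grad_zeta (X - {s0})"
  proof (rule qspanI[OF s0(2)])
    fix u
    have "d s0 * grad_zeta s0 u + (\<Sum>s\<in>X - {s0}. d s * grad_zeta s u) = 0"
      using sum[of u] finite_X s0 by (simp add: sum.remove)
    then show "d s0 * grad_zeta s0 u = (\<Sum>s\<in>X - {s0}. - d s * grad_zeta s u)"
      by (simp add: sum_negf eq_neg_iff_add_eq_0)
  qed
  then show ?thesis using s0 by blast
qed

lemma generic_distinguished: "\<exists>s\<in>idx \<tau>. (hh s, T (hh s)) \<in> pvars Q"
proof (rule ccontr)
  assume no: "\<not> ?thesis"
  have "psubst lconst epsv Q = psubst lconst (\<lambda>v. lvar (gcode P v)) Q"
  proof (rule psubst_cong)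
    fix v assume v: "v \<in> pvars Q"
    then obtain s \<alpha> where s: "s \<in> idx \<tau>" "v = (hh s, \<alpha>)"
      using Q(1) unfolding C_sub_eq polys_in_def by blast
    then have "\<alpha> \<noteq> T (hh s)" using no v by blast
    then show "epsv v = lvar (gcode P v)" by (simp add: s)
  qed
  moreover have "psubst lconst epsv Q = 0" unfolding cflat_at_eps[symmetric] Q(3) by (rule rh_zero[OF ring_hom_on_cflat])
  ultimately show False using alg_indep_lvar[OF inj_gcode] Q(2) by metis
qed

text \<open>The index \<open>g\<close> is one for which \<open>Q\<close> involves the distinguished coefficient of \<open>P\<^sub>g\<close>: any
  relation between the other polynomials is a multiple of \<open>Q\<close>, hence trivial.\<close>

lemma grad_eps_independent: "\<exists>g. \<forall>S. S \<subseteq> idx \<tau> - {g} \<longrightarrow> lin_indep grad_eps S"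
proof -
  obtain g where g: "g \<in> idx \<tau>" "(hh g, T (hh g)) \<in> pvars Q" using generic_distinguished by blast
  have "lin_indep grad_eps S" if S: "S \<subseteq> idx \<tau> - {g}" for S
  proof (rule lin_indep_grad_eps)
    show "finite S" using finite_idx[OF adm] S by (auto intro: finite_subset)
    show "S \<subseteq> ix" using S idx_ix[OF adm] by blast
    fix G assume G: "pvars G \<subseteq> {(hh s, \<alpha>) | s \<alpha>. s \<in> S \<and> \<alpha> \<in> AA P lam ups (hh s)}" "psubst lconst epsv G = 0"
    show "G = 0"
    proof (rule ccontr)
      assume G0: "G \<noteq> 0"
      have "{(hh s, \<alpha>) | s \<alpha>. s \<in> S \<and> \<alpha> \<in> AA P lam ups (hh s)} \<subseteq> C_sub P lam ups \<tau>"
        unfolding C_sub_eq using S by blast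
      then have "G \<in> polys_in (C_sub P lam ups \<tau>)" using G(1) by (simp add: polys_in_def)
      then have "G \<in> elim_ideal_sub P lam ups \<tau>" using G(2) by (rule elim_ideal_subI[OF adm])
      then have "dvd_in (polys_in (C_sub P lam ups \<tau>)) Q G" by (rule principal)
      then obtain c where c: "G = Q * c" unfolding dvd_in_def by blast
      then have "c \<noteq> 0" using G0 by auto
      then have "(hh g, T (hh g)) \<in> pvars G" using pvars_mult_eq[OF Q(2), of c] g c by simp
      then obtain s where "s \<in> S" "hh s = hh g" using G(1) by auto
      then show False using hh_inj[of s g] S g idx_ix[OF adm] by blast
    qed
  qed
  then show ?thesis by blast
qed

text \<open>A relation with orders below \<open>bord i0\<close> in the block \<open>i0\<close> would
  be a multiple of \<open>R\<close>, but it lacks the top derivative of that block, which occurs in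
  \<open>R\<close>.\<close>

lemma grad_zeta_independent:
  assumes i0: "i0 \<in> blocks" and S: "S \<subseteq> idx \<tau>" and less: "\<And>k. (i0, k) \<in> S \<Longrightarrow> k < bord i0"
  shows "lin_indep grad_zeta S"
proof (rule lin_indep_grad_zeta)
  show "finite S" using finite_idx[OF adm] S by (auto intro: finite_subset)
  show Six: "S \<subseteq> ix" using S idx_ix[OF adm] by blast
  fix G assume G: "pvars G \<subseteq> {Der (Coef i l) k' | i l k' k. (i, k) \<in> S \<and> l \<le> len P i \<and> k' \<le> k}" "phi P G = 0"
  show "G = 0"
  proof (rule ccontr)
    assume G0: "G \<noteq> 0"
    have low: "k' < bord i0" if "Der (Coef i0 l) k' \<in> pvars G" for l k'
      using G(1) that less by fastforce
    have "G \<in> DD P" unfolding DD_iff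
    proof
      fix v assume "v \<in> pvars G"
      then obtain i l k' k where "v = Der (Coef i l) k'" "(i, k) \<in> S" "l \<le> len P i" using G(1) by blast
      moreover then have "i \<in> {1..size_of P}" using Six fst_ix[of i k] by blast
      ultimately show "\<exists>i l s. v = Der (Coef i l) s \<and> i \<in> {1..size_of P} \<and> l \<le> len P i" by blast
    qed
    then have "dvd_in (DD P) R G"
      using low by (intro blocks_divisible[OF i0 _ G(2)]) (auto simp: polys_in_def low_def less_imp_le)
    then obtain c where c: "G = R * c" by (auto simp: dvd_in_def)
    then have "c \<noteq> 0" using G0 by auto
    then have "pvars R \<subseteq> pvars G" using pvars_mult_eq[OF resultant_nonzero[OF gen R], of c] c by simp
    then show False using bord_attained[OF i0] low by blast
  qed
qed

lemma idx_row: "(i, k) \<in> idx \<tau> \<Longrightarrow> k' \<le> k \<Longrightarrow> (i, k') \<in> idx \<tau>"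
  unfolding idx_def by (auto intro: order_trans[of "ereal (real k')" "ereal (real k)"])

context
  assumes high: "\<And>i. i \<in> blocks \<Longrightarrow> (i, Suc (bord i)) \<in> idx \<tau>"
begin

lemma X_idx: "X \<subseteq> idx \<tau>"
  unfolding X_def using high idx_row le_SucI by blast

text \<open>A relation with support \<open>K\<close> would put all exponent vectors of the polynomials in \<open>K\<close> into a
  space of dimension at most \<open>card (X \<union> K) - 2\<close>. This space would contain the gradients of
  \<open>card (X \<union> K) - 1\<close> independent elements: by the minimality of \<open>R\<close> if a block of \<open>R\<close> is
  missing from \<open>K\<close>, and by the minimality of \<open>Q\<close> otherwise.\<close>

lemma grad_eps_independent_mod_grad_zeta:
  assumes rel: "(\<lambda>u. \<Sum>s\<in>idx \<tau> - X. c s * grad_eps s u) \<in> qspan grad_zeta X"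
  shows "\<forall>s\<in>idx \<tau> - X. c s = 0"
proof (rule ccontr)
  define K where "K = {s \<in> idx \<tau> - X. c s \<noteq> 0}"
  assume "\<not> ?thesis"
  then obtain k0 where k0: "k0 \<in> K" by (auto simp: K_def)
  have K: "K \<subseteq> idx \<tau>" "K \<inter> X = {}" "finite K" using finite_idx[OF adm] by (auto simp: K_def)
  have Kix: "K \<subseteq> ix" and Xix: "X \<subseteq> ix" using K X_idx idx_ix[OF adm] by blast+
  obtain d \<mu> where d: "d \<noteq> 0" and "\<And>u. d * (\<Sum>s\<in>idx \<tau> - X. c s * grad_eps s u) = (\<Sum>s\<in>X. \<mu> s * grad_zeta s u)"
    using rel by (auto simp: qspan_def)
  moreover have "(\<Sum>s\<in>idx \<tau> - X. c s * grad_eps s u) = (\<Sum>s\<in>K. c s * grad_eps s u)" for u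
    using finite_idx[OF adm] by (intro sum.mono_neutral_right) (auto simp: K_def)
  ultimately have eq: "(\<Sum>s\<in>K. (d * c s) * grad_eps s u) = (\<Sum>s\<in>X. \<mu> s * grad_zeta s u)" for u
    by (simp add: sum_distrib_left mult.assoc)
  obtain s0 where s0: "s0 \<in> X" "grad_zeta s0 \<in> qspan grad_zeta (X - {s0})" using grad_zeta_dependent by blast
  define f where "f s = (if s \<in> X then grad_zeta s else grad_eps s)" for s
  \<comment> \<open>Two elements are dropped without loss of span: \<open>s0\<close> by the relation
    from \<open>R\<close>, \<open>k0\<close> by the supposed one.\<close>
  define I where "I = (X \<union> K) - {s0, k0}"
  have I: "finite I" using finite_X K by (simp add: I_def)
  have cardI: "card I + 2 = card (X \<union> K)"
  proof -
    have "s0 \<noteq> k0" using s0(1) k0 K(2) by blast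
    then have "card {s0, k0} = 2" by simp
    moreover have "{s0, k0} \<subseteq> X \<union> K" using s0 k0 by blast
    ultimately show ?thesis using card_mono[of "X \<union> K" "{s0, k0}"] finite_X K
      by (simp add: I_def card_Diff_subset)
  qed
  have z: "grad_zeta s \<in> qspan f I" if "s \<in> X" for s
  proof -
    have base: "grad_zeta s \<in> qspan f I" if "s \<in> X - {s0}" for s
      using qspan_base[OF I, of s f] that k0 K by (auto simp: I_def f_def)
    show ?thesis
    proof (cases "s = s0")
      case True
      then show ?thesis using qspan_trans[OF s0(2) base] by simp
    qed (use base that in blast)
  qed
  have w: "grad_eps k \<in> qspan f I" if k: "k \<in> K" for k
  proof -
    have base: "grad_eps k \<in> qspan f I" if "k \<in> K - {k0}" for k
    proof -
      have "k \<notin> X" "k \<in> I" using that s0 K by (auto simp: I_def)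
      then show ?thesis using qspan_base[OF I, of k f] by (simp add: f_def)
    qed
    show ?thesis
    proof (cases "k = k0")
      case True
      have "(d * c k0) * grad_eps k0 u = (\<Sum>s\<in>X. \<mu> s * grad_zeta s u) + (\<Sum>s\<in>K - {k0}. - (d * c s) * grad_eps s u)" for u
      proof -
        have "(d * c k0) * grad_eps k0 u + (\<Sum>s\<in>K - {k0}. (d * c s) * grad_eps s u) = (\<Sum>s\<in>X. \<mu> s * grad_zeta s u)"
          using eq[of u] K(3) k0 by (simp add: sum.remove)
        then show ?thesis by (simp add: sum_negf eq_diff_eq)
      qed
      moreover have "(\<lambda>u. (\<Sum>s\<in>X. \<mu> s * grad_zeta s u) + (\<Sum>s\<in>K - {k0}. - (d * c s) * grad_eps s u)) \<in> qspan f I"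
        by (intro qspan_add qspan_lin_comb z base)
      ultimately have "(\<lambda>u. (d * c k0) * grad_eps k0 u) \<in> qspan f I" by (simp only:)
      moreover have "d * c k0 \<noteq> 0" using d k0 by (auto simp: K_def)
      ultimately have "grad_eps k0 \<in> qspan f I" by (rule qspan_uncancel[rotated])
      then show ?thesis using True by simp
    qed (use base k in blast)
  qed
  have e: "expo (fst k) m \<in> qspan f I" if k: "k \<in> K" and m: "m \<in> keys (dF k)" for k m
  proof -
    have kix: "k \<in> ix" using k Kix by blast
    obtain \<alpha> where \<alpha>: "\<alpha> \<in> AA P lam ups (hh k)" "m = upsmon ups \<alpha>" using upsmon_AA[OF kix] m by blast
    show ?thesis
    proof (cases "\<alpha> = T (hh k)")
      case True
      then show ?thesis using qspan_zero by (simp add: \<alpha> upsmon_T[OF kix] expo_T)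
    next
      case False
      let ?w = "gcode P (hh k, \<alpha>)"
      define b where "b = d * c k * - (lvar ?w * lmon (upsmon ups (\<alpha> - T (hh k))))"
      \<comment> \<open>Apply \<open>theta\<close> for the generic coefficient to the relation
        \<open>eq\<close>. Among the gradients only that of \<open>k\<close> is affected, and it
        yields the exponent vector; all other terms are the old gradients with new
        coefficients.\<close>
      have "b * expo (fst k) m u = (\<Sum>s\<in>X. theta ?w (\<mu> s) * grad_zeta s u) + (\<Sum>s\<in>K. - theta ?w (d * c s) * grad_eps s u)" for u
      proof -
        have "theta ?w (\<Sum>s\<in>K. (d * c s) * grad_eps s u) = (\<Sum>s\<in>K. theta ?w (d * c s) * grad_eps s u) + (\<Sum>s\<in>K. if s = k then b * expo (fst k) m u else 0)"
          unfolding deriv_sum[OF derivation_theta] sum.distrib[symmetric]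
        proof (rule sum.cong[OF refl])
          fix s assume "s \<in> K"
          then have "s \<in> ix" using Kix by blast
          from theta_grad_eps[OF kix this \<alpha>(1) False, of u]
          show "theta ?w ((d * c s) * grad_eps s u) = theta ?w (d * c s) * grad_eps s u + (if s = k then b * expo (fst k) m u else 0)"
            unfolding theta_mult[of ?w "d * c s" "grad_eps s u"] by (simp add: b_def \<alpha> mult.assoc)
        qed
        also have "(\<Sum>s\<in>K. if s = k then b * expo (fst k) m u else 0) = b * expo (fst k) m u"
          using K k by simp
        finally have "(\<Sum>s\<in>K. theta ?w (d * c s) * grad_eps s u) + b * expo (fst k) m u = theta ?w (\<Sum>s\<in>X. \<mu> s * grad_zeta s u)"
          unfolding eq by simp
        also have "\<dots> = (\<Sum>s\<in>X. theta ?w (\<mu> s) * grad_zeta s u)"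
          unfolding deriv_sum[OF derivation_theta]
        proof (rule sum.cong[OF refl])
          fix s assume "s \<in> X"
          then have "theta ?w (grad_zeta s u) = 0" using theta_grad_zeta Xix by blast
          then show "theta ?w (\<mu> s * grad_zeta s u) = theta ?w (\<mu> s) * grad_zeta s u"
            unfolding theta_mult[of ?w "\<mu> s" "grad_zeta s u"] by simp
        qed
        finally show ?thesis by (simp add: sum_negf algebra_simps)
      qed
      moreover have "(\<lambda>u. (\<Sum>s\<in>X. theta ?w (\<mu> s) * grad_zeta s u) + (\<Sum>s\<in>K. - theta ?w (d * c s) * grad_eps s u)) \<in> qspan f I"
        by (intro qspan_add qspan_lin_comb z w)
      ultimately have "(\<lambda>u. b * expo (fst k) m u) \<in> qspan f I" by (simp only:)
      moreover have "b \<noteq> 0" using d k lmon_nonzero[of "upsmon ups (\<alpha> - T (hh k))"] by (auto simp: b_def K_def)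
      ultimately show ?thesis by (rule qspan_uncancel[rotated])
    qed
  qed
  have card: "card S \<le> card I" if "S \<subseteq> X \<union> K" "lin_indep v S" "\<And>s. s \<in> S \<Longrightarrow> v s \<in> qspan f I" for S v
    using that finite_X K by (intro lin_indep_card_le[OF I]) (auto intro: finite_subset)
  have minus: "card (X \<union> K) \<le> card (X \<union> K - {g}) + 1" for g
    using finite_X K by (cases "g \<in> X \<union> K") (auto simp: card_Diff_singleton)
  show False
  proof (cases "blocks \<subseteq> fst ` K")
    case False
    then obtain i0 where i0: "i0 \<in> blocks" "i0 \<notin> fst ` K" by blast
    \<comment> \<open>As \<open>K\<close> has nothing in the row \<open>i0\<close>, removing the top
      of that row from \<open>X\<close> leaves only orders below \<open>bord i0\<close>
      there.\<close>
    let ?S = "X \<union> K - {(i0, bord i0)}"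
    have "k < bord i0" if "(i0, k) \<in> ?S" for k
      using that i0 by (force simp: X_def)
    then have "lin_indep grad_zeta ?S" using X_idx K by (intro grad_zeta_independent[OF i0(1)]) auto
    moreover have "grad_zeta s \<in> qspan f I" if "s \<in> ?S" for s
    proof (cases "s \<in> X")
      case False
      then have "s \<in> K" using that by blast
      then show ?thesis using grad_zeta_in_span[of "fst s" "snd s" f I] e[of s] Kix by auto
    qed (rule z)
    ultimately have "card ?S \<le> card I" by (intro card[of ?S grad_zeta]) auto
    then show False using minus[of "(i0, bord i0)"] cardI by linarith
  next
    case True
    obtain g where g: "\<And>S. S \<subseteq> idx \<tau> - {g} \<Longrightarrow> lin_indep grad_eps S" using grad_eps_independent by blast
    let ?S = "X \<union> K - {g}"
    have "lin_indep grad_eps ?S" using X_idx K by (intro g) blast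
    moreover have "grad_eps s \<in> qspan f I" if "s \<in> ?S" for s
    proof (cases "s \<in> X")
      case True
      then have "fst s \<in> blocks" "snd s \<le> bord (fst s)" by (auto simp: X_def)
      \<comment> \<open>This \<open>k\<close> lies in the same row but outside \<open>X\<close>,
        hence above the order of \<open>R\<close>; its support contains that of
        \<open>s\<close>.\<close>
      moreover then obtain k where k: "k \<in> K" "fst k = fst s" using \<open>blocks \<subseteq> fst ` K\<close> by force
      moreover have "k \<notin> X" using k K by blast
      ultimately have "snd s \<le> snd k" by (cases k) (auto simp: X_def)
      then have "keys (dF s) \<subseteq> keys (dF k)" unfolding dF_def k(2) by (rule keys_dd_FF_mono)
      then show ?thesis using grad_eps_in_span[of s f I] e[OF k(1)] k(2) Xix True by auto
    qed (use that w in blast)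
    ultimately have "card ?S \<le> card I" by (intro card[of ?S grad_eps]) auto
    then show False using minus[of g] cardI by linarith
  qed
qed

text \<open>Supplies the hypothesis of \<open>relative_independence\<close>, with \<open>L\<close>
  the specialized and \<open>N\<close> the generic coefficients. Gradients in the unknowns settle
  the distinguished members of \<open>N\<close>; each other member is a variable of its own, whose
  \<open>theta\<close> then isolates its factor.\<close>

lemma mixed_relation_trivial:
  fixes c :: "'y cvar \<Rightarrow> nat dvar lau"
  defines "L \<equiv> {(hh s, \<alpha>) | s \<alpha>. s \<in> X \<and> \<alpha> \<in> AA P lam ups (hh s)}"
    and "N \<equiv> {(hh s, \<alpha>) | s \<alpha>. s \<in> idx \<tau> - X \<and> \<alpha> \<in> AA P lam ups (hh s)}"
  assumes fin: "finite L" "finite N" and disj: "L \<inter> N = {}"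
    and c: "\<And>w. (\<Sum>v\<in>L \<union> N. c v * theta w (mixed X v)) = 0"
  shows "\<forall>v\<in>N. c v = 0"
proof -
  define O' where "O' = idx \<tau> - X"
  have Xix: "X \<subseteq> ix" and Oix: "O' \<subseteq> ix" using X_idx idx_ix[OF adm] by (auto simp: O'_def)
  have mixN: "mixed X (hh s, \<alpha>) = epsv (hh s, \<alpha>)" if "s \<in> O'" for s \<alpha>
    using mixed_not_X[OF Xix, of s \<alpha>] that Oix by (auto simp: O'_def simp del: epsv.simps)
  define r where "r s = (hh s, T (hh s))" for s
  have inj: "inj_on r O'"
  proof (rule inj_onI)
    fix x y assume "x \<in> O'" "y \<in> O'" "r x = r y"
    then show "x = y" using hh_inj[of x y] Oix by (auto simp: r_def)
  qed
  have rN: "r ` O' \<subseteq> N"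
  proof
    fix v assume "v \<in> r ` O'"
    then obtain s where s: "s \<in> O'" "v = (hh s, T (hh s))" by (auto simp: r_def)
    then show "v \<in> N" using T_AA Oix unfolding N_def O'_def by blast
  qed
  have nondist: "mixed X v = lvar (gcode P v)" if v: "v \<in> N - r ` O'" for v
  proof -
    from v obtain s \<alpha> where s: "s \<in> O'" "v = (hh s, \<alpha>)" unfolding N_def O'_def by blast
    then have "\<alpha> \<noteq> T (hh s)" using v by (auto simp: r_def)
    then show ?thesis using mixN[OF s(1), of \<alpha>] s(2) by simp
  qed
  have dist: "\<forall>s\<in>O'. c (r s) = 0"
    unfolding O'_def
  proof (rule grad_eps_independent_mod_grad_zeta)
    have "(\<Sum>s\<in>O'. c (r s) * grad_eps s u) = (\<Sum>v\<in>L. - c v * ugrad U (mixed X v) u)" for u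
    proof -
      have "0 = (\<Sum>v\<in>L. c v * ugrad U (mixed X v) u) + (\<Sum>v\<in>N. c v * ugrad U (mixed X v) u)"
        using c[of u] fin disj by (cases "u \<in> U") (simp_all add: ugrad_def sum.union_disjoint)
      also have "(\<Sum>v\<in>N. c v * ugrad U (mixed X v) u) = (\<Sum>v\<in>r ` O'. c v * ugrad U (mixed X v) u)"
        by (intro sum.mono_neutral_right fin rN)
           (simp add: nondist ugrad_lvar gcode_not_unknown[OF gen])
      also have "\<dots> = (\<Sum>s\<in>O'. c (r s) * grad_eps s u)"
        unfolding sum.reindex[OF inj] by (intro sum.cong refl) (simp add: r_def mixN grad_eps_def)
      finally show ?thesis by (simp add: sum_negf eq_neg_iff_add_eq_0 add.commute)
    qed
    \<comment> \<open>Coefficients of a derivative of order \<open>k\<close> involve orders up to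
      \<open>k\<close> only, and the rows of \<open>X\<close> are closed downwards.\<close>
    moreover have "(\<lambda>u. \<Sum>v\<in>L. - c v * ugrad U (mixed X v) u) \<in> qspan grad_zeta X"
    proof (rule qspan_lin_comb)
      fix v assume "v \<in> L"
      then obtain i k \<alpha> where v: "(i, k) \<in> X" "v = (hh (i, k), \<alpha>)" unfolding L_def by auto
      then have "mixed X v = phi P (lookup (dF (i, k)) (upsmon ups \<alpha>))" using mixed_X Xix by auto
      moreover have "grad_zeta (i, k') \<in> qspan grad_zeta X" if "k' \<le> k" for k'
        using v that by (intro qspan_base[OF finite_X]) (auto simp: X_def)
      ultimately show "ugrad U (mixed X v) \<in> qspan grad_zeta X" by (simp add: ugrad_phi_coef)
    qed
    ultimately show "(\<lambda>u. \<Sum>s\<in>idx \<tau> - X. c (r s) * grad_eps s u) \<in> qspan grad_zeta X"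
      unfolding O'_def[symmetric] by (simp only:)
  qed
  show ?thesis
  proof
    fix v assume v: "v \<in> N"
    show "c v = 0"
    proof (cases "v \<in> r ` O'")
      case False
      let ?w = "gcode P v"
      have L0: "(\<Sum>x\<in>L. c x * theta ?w (mixed X x)) = 0"
      proof (intro sum.neutral ballI)
        fix x assume "x \<in> L"
        then obtain s \<alpha> where s: "s \<in> X" "x = (hh s, \<alpha>)" unfolding L_def by blast
        then have six: "s \<in> ix" using Xix by blast
        then have "lookup (dF s) (upsmon ups \<alpha>) \<in> DD P" using dF_in_DU by (simp add: DU_iff)
        then have "theta ?w (mixed X x) = 0"
          using theta_phi[of _ v] by (simp add: s mixed_X[OF s(1) six])
        then show "c x * theta ?w (mixed X x) = 0" by simp
      qed
      have "0 = (\<Sum>x\<in>N. c x * theta ?w (mixed X x))"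
        using c[of ?w] fin disj L0 by (simp add: sum.union_disjoint)
      also have "\<dots> = (\<Sum>x\<in>N. if x = v then c v * lvar ?w else 0)"
      proof (rule sum.cong[OF refl])
        fix x assume x: "x \<in> N"
        show "c x * theta ?w (mixed X x) = (if x = v then c v * lvar ?w else 0)"
        proof (cases "x \<in> r ` O'")
          case True
          then show ?thesis using dist \<open>v \<notin> r ` O'\<close> by auto
        next
          case False
          then show ?thesis using x by (auto simp: nondist theta_lvar dest: injD[OF inj_gcode])
        qed
      qed
      also have "\<dots> = c v * lvar ?w" using fin v by simp
      finally show ?thesis by simp
    qed (use dist in auto)
  qed
qed

lemma high_order_divisible: "dvd_in (DD P) R (Xi0 Q)"
proof -
  define L where "L = {(hh s, \<alpha>) | s \<alpha>. s \<in> X \<and> \<alpha> \<in> AA P lam ups (hh s)}"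
  define N where "N = {(hh s, \<alpha>) | s \<alpha>. s \<in> idx \<tau> - X \<and> \<alpha> \<in> AA P lam ups (hh s)}"
  have Xix: "X \<subseteq> ix" using X_idx idx_ix[OF adm] by blast
  have finite: "finite {(hh s, \<alpha>) | s \<alpha>. s \<in> S \<and> \<alpha> \<in> AA P lam ups (hh s)}" if "S \<subseteq> idx \<tau>" for S
  proof -
    have "{(hh s, \<alpha>) | s \<alpha>. s \<in> S \<and> \<alpha> \<in> AA P lam ups (hh s)} = (\<Union>s\<in>S. Pair (hh s) ` AA P lam ups (hh s))"
      by blast
    moreover have "finite S" using finite_idx[OF adm] that by (rule finite_subset[rotated])
    ultimately show ?thesis using that idx_ix[OF adm] finite_AA by auto
  qed
  have fin: "finite L" "finite N" unfolding L_def N_def using X_idx by (rule finite, intro finite Diff_subset)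
  have disj: "L \<inter> N = {}"
  proof -
    have False if v: "v \<in> L" "v \<in> N" for v
    proof -
      obtain s where s: "s \<in> X" "fst v = hh s" using v(1) by (auto simp: L_def)
      obtain s' where s': "s' \<in> idx \<tau> - X" "fst v = hh s'" using v(2) by (auto simp: N_def)
      then show False using s hh_inj[of s s'] Xix idx_ix[OF adm] by auto
    qed
    then show ?thesis by blast
  qed
  have LN: "C_sub P lam ups \<tau> = L \<union> N" using X_idx unfolding C_sub_eq L_def N_def by blast
  obtain i0 where i0: "i0 \<in> blocks" using distinguished_jet by (auto simp: blocks_def)
  \<comment> \<open>These coefficients involve members of \<open>X\<close> only: on them
    \<open>mixed X\<close> is the specialization followed by \<open>phi\<close>, and their orders in
    the block \<open>i0\<close> are at most \<open>bord i0\<close>.\<close>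
  have "dvd_in (DD P) R (Xi0 (rpart N n Q))" for n
  proof -
    let ?q = "rpart N n Q"
    have sub: "pvars ?q \<subseteq> L" using pvars_rpart[of N n Q] Q(1) LN by (auto simp: polys_in_def)
    then have qC: "?q \<in> polys_in (C_sub P lam ups \<tau>)" unfolding polys_in_def LN by blast
    have qX: "s \<in> X" if "s \<in> idx \<tau>" "(hh s, \<alpha>) \<in> pvars ?q" for s \<alpha>
    proof -
      from sub that(2) obtain s' where s': "s' \<in> X" "hh s = hh s'" unfolding L_def by blast
      then have "s = s'" using that(1) hh_inj[of s s'] Xix idx_ix[OF adm] by blast
      then show ?thesis using s' by simp
    qed
    have "psubst lconst (mixed X) ?q = 0"
    proof (rule relative_independence[OF fin disj])
      show "\<forall>v\<in>N. c v = 0" if "\<And>w. (\<Sum>v\<in>L \<union> N. c v * theta w (mixed X v)) = 0" for c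
        using mixed_relation_trivial[of c] fin disj that unfolding L_def N_def by blast
      show "pvars Q \<subseteq> L \<union> N" using Q(1) LN by (simp add: polys_in_def)
      show "psubst lconst (mixed X) Q = 0" by (rule psubst_mixed_eq_0[OF Xix adm Q(1,3)])
    qed
    then have "phi P (Xi0 ?q) = 0" using phi_Xi0[OF qC qX] by simp
    then show ?thesis
    proof (rule blocks_divisible[OF i0 Xi0_in_DD[OF adm qC]])
      show "Xi0 ?q \<in> polys_in (low (Coef i0 l) (bord i0))" for l
        using qX by (intro Xi0_low[OF adm qC]) (auto simp: X_def)
    qed
  qed
  then have "\<forall>n. \<exists>e. Xi0 (rpart N n Q) = R * e" unfolding dvd_in_def by blast
  then obtain e where e: "\<And>n. Xi0 (rpart N n Q) = R * e n" by metis
  have "Xi0 Q = (\<Sum>n\<in>restr N ` keys Q. Xi0 (single n 1) * Xi0 (rpart N n Q))"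
    by (subst (1) rpart_expand[of Q N]) (simp add: rh_sum[OF ring_hom_on_Xi0] rh_mult[OF ring_hom_on_Xi0])
  also have "\<dots> = R * (\<Sum>n\<in>restr N ` keys Q. Xi0 (single n 1) * e n)"
    unfolding e sum_distrib_left by (simp add: mult.left_commute)
  finally show ?thesis
    using Xi0_in_DD[OF adm Q(1)] unfolding DD_def diff_polys_def by (intro dvd_in_polys_in)
qed

end

lemma resultant_divides: "dvd_in (DD P) R (Xi0 Q)"
proof (cases "\<forall>i\<in>blocks. (i, Suc (bord i)) \<in> idx \<tau>")
  case True
  then show ?thesis using high_order_divisible by blast
next
  case False
  then obtain i0 where i0: "i0 \<in> blocks" "(i0, Suc (bord i0)) \<notin> idx \<tau>" by blast
  \<comment> \<open>With the whole subsystem in place of \<open>X\<close> nothing stays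
    generic.\<close>
  have "phi P (Xi0 Q) = psubst lconst (mixed (idx \<tau>)) Q" by (rule phi_Xi0[OF Q(1)])
  also have "\<dots> = 0" by (rule psubst_mixed_eq_0[OF idx_ix[OF adm] adm Q(1,3)])
  finally show ?thesis
  proof (rule blocks_divisible[OF i0(1) Xi0_in_DD[OF adm Q(1)]])
    show "Xi0 Q \<in> polys_in (low (Coef i0 l) (bord i0))" for l
    proof (rule Xi0_low[OF adm Q(1)])
      show "k \<le> bord i0" if "(i0, k) \<in> idx \<tau>" for k
        using idx_row[OF that, of "Suc (bord i0)"] i0(2) by (meson not_less_eq_eq)
    qed
  qed
qed

end

end

theorem theorem6p11:
  fixes P :: gsystem
    and lam :: "dlaurent \<Rightarrow> nat"
    and ups :: "'y::finite \<Rightarrow> nat dvar"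
    and T :: "nat \<Rightarrow> int ^ 'y"
    and \<omega> :: "nat \<Rightarrow> real ^ 'y"
    and \<delta> :: "real ^ 'y"
    and l :: nat
    and ord :: "(nat \<times> nat) set"
    and Q :: "'y cpoly"
    and \<tau> :: "nat \<Rightarrow> ereal"
    and R :: dpoly
  assumes "generic_system P"
    and "laurent_diff_essential P"
    and "super_essential P"
    and "bij_betw lam (ps P) {1..LL P}"
    and "bij_betw ups UNIV (Vps P)"
    and "distinguished P lam ups T"
    and "generic_lifting (LL P) (AA P lam ups) \<omega>"
    and "small_generic_shift (LL P) (AA P lam ups) \<omega> \<delta>"
    and "EE (LL P) (AA P lam ups) \<delta> \<noteq> {}"
    and "l \<in> {1..LL P}"
    and "linear_order_on {1..LL P} ord"
    and "\<forall>h\<in>{1..LL P}. (l, h) \<in> ord"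
    and "sylvester_det P lam ups \<omega> \<delta> ord \<noteq> 0"
    and "sparse_diff_resultant P R"
    and "Q \<in> QQ P lam ups T (sylvester_det P lam ups \<omega> \<delta> ord)"
    and "least_tau P lam ups Q \<tau>"
    and "codimension (subring_on (polys_in (C_sub P lam ups \<tau>))) (elim_ideal_sub P lam ups \<tau>) = 1"
    and "Xi P lam ups (lconst Q) \<noteq> 0"
  shows "\<exists>E\<in>DD P. Xi P lam ups (lconst Q) = lconst (E * R)"
proof -
  interpret generic_algebraic_system P lam ups T
    using assms by unfold_locales
  have adm: "admissible P \<tau>" and Q: "Q \<in> polys_in (C_sub P lam ups \<tau>)"
    using assms(16) by (auto simp: least_tau_def)
  have irr: "Q \<in> polys_in (CC P lam ups)" "ring_irreducible\<^bsub>subring_on (polys_in (CC P lam ups))\<^esub> Q"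
    and 0: "at_eps P lam ups T Q = 0"
    using assms(15) by (auto simp: QQ_def QC_def)
  \<comment> \<open>\<open>Q\<close> is irreducible, hence prime, in the ring of all coefficients;
    primeness descends to the smaller polynomial ring that contains \<open>Q\<close>.\<close>
  have "C_sub P lam ups \<tau> \<subseteq> CC P lam ups"
    unfolding C_sub_eq CC_def using hh_range idx_ix[OF adm] by blast
  then have prime: "prime_in (polys_in (C_sub P lam ups \<tau>)) Q"
    using prime_in_mono[OF irreducible_prime_polys_in[OF irr] _ Q] by blast
  have "psubst lconst epsv Q = 0"
    unfolding cflat_at_eps[symmetric] 0 by (rule rh_zero[OF ring_hom_on_cflat])
  then have "Q \<in> elim_ideal_sub P lam ups \<tau>" by (rule elim_ideal_subI[OF adm Q])
  then have principal: "dvd_in (polys_in (C_sub P lam ups \<tau>)) Q G" if "G \<in> elim_ideal_sub P lam ups \<tau>" for G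
    using codimension_one_principal[OF prime assms(17)] that by blast
  have "Q \<noteq> 0" using prime by (simp add: prime_in_def)
  from resultant_divides[OF adm assms(14) Q this 0 principal]
  obtain E where "E \<in> DD P" "Xi0 Q = R * E" by (auto simp: dvd_in_def)
  then show ?thesis by (intro bexI[of _ E]) (simp_all add: Xi_lconst mult.commute)
qed

end
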